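(* Let $V$ be a finite-dimensional complex vector space, $Z\in\mathfrak{gl}(V)$ diagonalisable with distinct eigenvalues $z_1,\ldots,z_m$ and corresponding eigenprojections $P_1,\ldots,P_m$ (so $V=\bigoplus_i V_i$, $V_i=P_iV$), and let $F\in\mathfrak{gl}(V)$ satisfy $P_iFP_i=0$ for all $i$. Let $\ell$ be a Stokes ray of the connection $\nabla^V=d-\left(\frac Z{t^2}+\frac Ft\right)dt$ and $S^V_\ell\in GL(V)$ the corresponding Stokes factor. Write $z_j>_\ell z_i$ if $z_j\in z_i+\ell$. Then $$P_j\circ S^V_\ell\circ P_i=\begin{cases}0&\text{if }z_j\ngeq_\ell z_i\\ P_i&\text{if }z_j=z_i\\ 2\pi i\cdot P_jF\circ\mathrm{PT}^{\mathrm{reg}}_{C_{ji}}\circ P_i&\text{if }z_j>_\ell z_i\end{cases}$$ where $C_{ji}$ is a small perturbation of the oriented line segment from $z_i$ to $z_j$ which avoids the points $z_k\in(z_i,z_j)$ by using anticlockwise arcs of circle around them. Thus, for $z_j>_\ell z_i$, $$P_j\circ S^V_\ell\circ P_i=2\pi i\cdot P_jF\left(1+\sum_{n\ge1}\ \sum_{\substack{k_1,\ldots,k_n\in\{1,\ldots,m\}\\k_1\ne j,\ k_n\ne i}}\left(\int^*_{C_{ji}}\frac{dz}{z-z_{k_1}}\circ\cdots\circ\frac{dz}{z-z_{k_n}}\right)P_{k_1}F\cdots P_{k_n}F\right)P_i.$$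
   Context: A ray is a subset $\mathbb R_{>0}e^{i\varphi}\subset\mathbb C^*$. The Stokes rays of $\nabla^V$ are $\mathbb R_{>0}(z_i-z_j)$, $i\ne j$; other rays are admissible. For a ray $r$, $\mathbb H_r=\{uv:u\in r,\mathrm{Re}(v)>0\}$. For $r$ admissible, $Y^V_r:\mathbb H_r\to GL(V)$ is the unique holomorphic function with $\frac{dY^V_r}{dt}=\left(\frac Z{t^2}+\frac Ft\right)Y^V_r$ and $Y^V_re^{Z/t}\to1$ as $t\to0$ in $\mathbb H_r$. The Stokes factor $S^V_\ell$ is defined by $Y^V_{r_-}=Y^V_{r_+}\cdot S^V_\ell$ on $\mathbb H_{r_-}\cap\mathbb H_{r_+}$, where $r_+$ (resp. $r_-$) is a sufficiently small anticlockwise (resp. clockwise) perturbation of $\ell$ (so that the closed sector they bound contains no Stokes ray other than $\ell$). Fourier–Laplace transform: $\widehat\nabla^V=d-\sum_{i=1}^m\frac{P_iF}{z-z_i}dz$, a Fuchsian connection on the trivial bundle with fibre $V$. Its residues satisfy $(P_iF)^2=0$. For a path $\gamma$ avoiding the poles, $\mathrm{PT}_\gamma\in GL(V)$ is parallel transport of flat sections of $\widehat\nabla^V$ along $\gamma$. For a path $\gamma:[0,1]\to\mathbb C$ from a pole $p$ to a pole $q$ otherwise avoiding the poles, the regularised parallel transport is $$\mathrm{PT}^{\mathrm{reg}}_\gamma=\lim_{s\to0,\,t\to1}(\gamma(t)-q)^{-A_q}\cdot\mathrm{PT}_{\gamma|_{[s,t]}}\cdot(\gamma(s)-p)^{A_p},$$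 where $A_{z_i}=P_iF$ and $(z-p)^{A}=\exp(A\log(z-p))$ for chosen determinations of the logarithms (the expression $P_jF\circ\mathrm{PT}^{\mathrm{reg}}_{C_{ji}}\circ P_i$ does not depend on these choices). Iterated integrals: for 1-forms with $\gamma^*\omega_i=g_i(t)dt$, $\int^*_\gamma\omega_1\circ\cdots\circ\omega_n=\int_{1\ge t_1\ge\cdots\ge t_n\ge0}g_1(t_1)\cdots g_n(t_n)\,dt_1\cdots dt_n$ (here convergent as a limit over $\gamma|_{[s,t]}$, $s\to0,t\to1$). *)

theory Defs
  imports "HOL-Complex_Analysis.Complex_Analysis"
begin

text \<open>
  A finite-dimensional complex vector space is represented by \<open>complex ^ 'n\<close> with an arbitrary
  finite index type \<open>'n\<close>, and its endomorphisms by square matrices; composition is \<open>**\<close>.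
\<close>

subsection \<open>Matrices\<close>

definition msmult :: "complex \<Rightarrow> complex^'n^'n \<Rightarrow> complex^'n^'n" (infixr "*\<^sub>m" 75) where
  "c *\<^sub>m A = (\<chi> i j. c * A $ i $ j)"

(* The multiplication on type complex^'n^'n is componentwise, so the library functions (^) and
   exp do not give powers and exponentials of matrices. *)
definition mpow :: "complex^'n^'n \<Rightarrow> nat \<Rightarrow> complex^'n^'n" where
  "mpow A k = (((**) A) ^^ k) (mat 1)"

definition mexp :: "complex^'n^'n \<Rightarrow> complex^'n^'n" where
  "mexp A = (\<Sum>k. (1 / fact k) *\<^sub>m mpow A k)"

definition diagonalisable :: "complex^'n^'n \<Rightarrow> bool" where
  "diagonalisable A \<longleftrightarrow>
     (\<exists>(Q :: complex^'n^'n) (D :: complex^'n^'n). invertible Q \<and> (\<forall>i j. i \<noteq> j \<longrightarrow> D $ i $ j = 0) \<and>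
        A = Q ** D ** matrix_inv Q)"

definition eigenspace :: "complex^'n^'n \<Rightarrow> complex \<Rightarrow> (complex^'n) set" where
  "eigenspace A c = {v. A *v v = c *s v}"

definition eigenvalues :: "complex^'n^'n \<Rightarrow> complex set" where
  "eigenvalues A = {c. \<exists>v \<in> eigenspace A c. v \<noteq> 0}"

(* The projection onto one eigenspace along all the others; for diagonalisable A these eigenspaces
   span, so A and c determine it. *)
definition is_eigenprojection :: "complex^'n^'n \<Rightarrow> complex \<Rightarrow> complex^'n^'n \<Rightarrow> bool" where
  "is_eigenprojection A c P \<longleftrightarrow>
     (\<forall>v \<in> eigenspace A c. P *v v = v) \<and>
     (\<forall>c'. c' \<noteq> c \<longrightarrow> (\<forall>v \<in> eigenspace A c'. P *v v = 0))"

subsection \<open>Rays, canonical solutions and Stokes factors\<close>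

definition ray_through :: "complex \<Rightarrow> complex set" where
  "ray_through w = {of_real x * w | x. 0 < (x::real)}"

definition rotate_ray :: "real \<Rightarrow> complex set \<Rightarrow> complex set" where
  "rotate_ray \<theta> r = (\<lambda>u. cis \<theta> * u) ` r"

definition half_plane :: "complex set \<Rightarrow> complex set" where
  "half_plane r = {u * v | u v. u \<in> r \<and> 0 < Re v}"

definition stokes_rays :: "complex^'n^'n \<Rightarrow> complex set set" where
  "stokes_rays Z =
     {ray_through (a - b) | a b. a \<in> eigenvalues Z \<and> b \<in> eigenvalues Z \<and> a \<noteq> b}"

definition is_canonical_solution ::
    "complex^'n^'n \<Rightarrow> complex^'n^'n \<Rightarrow> complex set \<Rightarrow> (complex \<Rightarrow> complex^'n^'n) \<Rightarrow> bool" where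
  "is_canonical_solution Z F r Y \<longleftrightarrow>
     (\<forall>i j. (\<lambda>t. Y t $ i $ j) holomorphic_on half_plane r) \<and>
     (\<forall>t \<in> half_plane r. invertible (Y t)) \<and>
     (\<forall>t \<in> half_plane r. \<forall>i j.
        ((\<lambda>u. Y u $ i $ j) has_field_derivative
           ((((1 / t\<^sup>2) *\<^sub>m Z + (1 / t) *\<^sub>m F) ** Y t) $ i $ j)) (at t)) \<and>
     ((\<lambda>t. Y t ** mexp ((1 / t) *\<^sub>m Z)) \<longlongrightarrow> mat 1) (at 0 within half_plane r)"

(* The perturbed rays are obtained from l by rotating anticlockwise by a and clockwise by b. The
   bound pi/2 excludes perturbations for which the two half planes would meet around -l instead
   of l: the closed sector may contain no Stokes ray other than l even then. *)
definition is_stokes_factor ::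
    "complex^'n^'n \<Rightarrow> complex^'n^'n \<Rightarrow> complex set \<Rightarrow> complex^'n^'n \<Rightarrow> bool" where
  "is_stokes_factor Z F l S \<longleftrightarrow> invertible S \<and>
     (\<exists>a b Yplus Yminus.
        0 < a \<and> a < pi / 2 \<and> 0 < b \<and> b < pi / 2 \<and>
        (\<forall>\<theta> \<in> {-b..a}. \<theta> \<noteq> 0 \<longrightarrow> rotate_ray \<theta> l \<notin> stokes_rays Z) \<and>
        is_canonical_solution Z F (rotate_ray a l) Yplus \<and>
        is_canonical_solution Z F (rotate_ray (-b) l) Yminus \<and>
        (\<forall>t \<in> half_plane (rotate_ray (-b) l) \<inter> half_plane (rotate_ray a l).
           Yminus t = Yplus t ** S))"

definition ray_less :: "complex set \<Rightarrow> complex \<Rightarrow> complex \<Rightarrow> bool" where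
  "ray_less l a b \<longleftrightarrow> b \<in> (\<lambda>u. a + u) ` l"

subsection \<open>The Fourier--Laplace transform and parallel transport\<close>

(* The coefficient A of the connection d - A dz. *)
definition fl_connection ::
    "nat \<Rightarrow> (nat \<Rightarrow> complex) \<Rightarrow> (nat \<Rightarrow> complex^'n^'n) \<Rightarrow> complex^'n^'n \<Rightarrow> complex \<Rightarrow> complex^'n^'n" where
  "fl_connection m z P F w = (\<Sum>k = 1..m. (1 / (w - z k)) *\<^sub>m (P k ** F))"

(* Fundamental solution of the equation for flat sections pulled back to a piecewise smooth path;
   K is the set of corners. *)
definition parallel_transport ::
    "(complex \<Rightarrow> complex^'n^'n) \<Rightarrow> (real \<Rightarrow> complex) \<Rightarrow> real \<Rightarrow> real \<Rightarrow> complex^'n^'n" where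
  "parallel_transport A \<gamma> s t = (THE M. \<exists>\<Phi> K.
     continuous_on {s..t} \<Phi> \<and> \<Phi> s = mat 1 \<and> \<Phi> t = M \<and> finite K \<and>
     (\<forall>u \<in> {s<..<t} - K.
        (\<Phi> has_vector_derivative
           (vector_derivative \<gamma> (at u) *\<^sub>m (A (\<gamma> u) ** \<Phi> u))) (at u)))"

definition log_along :: "(real \<Rightarrow> complex) \<Rightarrow> complex \<Rightarrow> (real \<Rightarrow> complex) \<Rightarrow> bool" where
  "log_along \<gamma> p L \<longleftrightarrow>
     continuous_on {0<..<1} L \<and> (\<forall>s \<in> {0<..<1}. exp (L s) = \<gamma> s - p)"

(* Ap, Aq are the residues at the initial and final pole p, q of the path, and Lp, Lq are
   determinations of log (z - p), log (z - q) along it. *)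
definition has_reg_transport ::
    "(complex \<Rightarrow> complex^'n^'n) \<Rightarrow> (real \<Rightarrow> complex) \<Rightarrow> complex^'n^'n \<Rightarrow> complex^'n^'n \<Rightarrow>
     (real \<Rightarrow> complex) \<Rightarrow> (real \<Rightarrow> complex) \<Rightarrow> complex^'n^'n \<Rightarrow> bool" where
  "has_reg_transport A \<gamma> Ap Aq Lp Lq T \<longleftrightarrow>
     ((\<lambda>(s, t). mexp (- (Lq t *\<^sub>m Aq)) ** parallel_transport A \<gamma> s t ** mexp (Lp s *\<^sub>m Ap))
        \<longlongrightarrow> T) (at_right 0 \<times>\<^sub>F at_left 1)"

subsection \<open>The perturbed segment\<close>

(* Straight from a in direction d, passing each of the listed centres on a half circle of radius e.
   An anticlockwise half circle about c leads from c - e d/|d| to c + e d/|d| on the right-hand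
   side of the direction of travel. *)
fun detour_path ::
    "real \<Rightarrow> complex \<Rightarrow> complex \<Rightarrow> complex list \<Rightarrow> complex \<Rightarrow> real \<Rightarrow> complex" where
  "detour_path e d a [] b = linepath a b"
| "detour_path e d a (c # cs) b =
     linepath a (c - of_real e * sgn d) +++
     part_circlepath c e (Arg d + pi) (Arg d + 2 * pi) +++
     detour_path e d (c + of_real e * sgn d) cs b"

definition perturbed_segment ::
    "nat \<Rightarrow> (nat \<Rightarrow> complex) \<Rightarrow> real \<Rightarrow> nat \<Rightarrow> nat \<Rightarrow> real \<Rightarrow> complex" where
  "perturbed_segment m z e j i =
     detour_path e (z j - z i) (z i)
       (sort_key (dist (z i))
          (map z (filter (\<lambda>k. z k \<in> open_segment (z i) (z j)) [1..<Suc m])))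
       (z j)"

definition small_radius :: "nat \<Rightarrow> (nat \<Rightarrow> complex) \<Rightarrow> real \<Rightarrow> bool" where
  "small_radius m z e \<longleftrightarrow>
     0 < e \<and> (\<forall>k \<in> {1..m}. \<forall>l \<in> {1..m}. k \<noteq> l \<longrightarrow> 2 * e < dist (z k) (z l))"

subsection \<open>Iterated integrals\<close>

(* A 1-form f dz is represented by its coefficient f. Coordinate u k stands for the variable
   t_{k+1}, so the domain of integration is t \<ge> t_1 \<ge> ... \<ge> t_n \<ge> s. *)
definition iterated_integral ::
    "(real \<Rightarrow> complex) \<Rightarrow> (complex \<Rightarrow> complex) list \<Rightarrow> real \<Rightarrow> real \<Rightarrow> complex" where
  "iterated_integral \<gamma> fs s t =
     set_lebesgue_integral (\<Pi>\<^sub>M k\<in>{..<length fs}. (lborel :: real measure))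
       {u. (\<forall>k < length fs. s \<le> u k \<and> u k \<le> t) \<and>
           (\<forall>k. Suc k < length fs \<longrightarrow> u (Suc k) \<le> u k)}
       (\<lambda>u. \<Prod>k<length fs. (fs ! k) (\<gamma> (u k)) * vector_derivative \<gamma> (at (u k)))"

definition has_improper_iterated_integral ::
    "(real \<Rightarrow> complex) \<Rightarrow> (complex \<Rightarrow> complex) list \<Rightarrow> complex \<Rightarrow> bool" where
  "has_improper_iterated_integral \<gamma> fs v \<longleftrightarrow>
     ((\<lambda>(s, t). iterated_integral \<gamma> fs s t) \<longlongrightarrow> v) (at_right 0 \<times>\<^sub>F at_left 1)"

definition improper_iterated_integral ::
    "(real \<Rightarrow> complex) \<Rightarrow> (complex \<Rightarrow> complex) list \<Rightarrow> complex" where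
  "improper_iterated_integral \<gamma> fs = (THE v. has_improper_iterated_integral \<gamma> fs v)"

definition log_forms :: "(nat \<Rightarrow> complex) \<Rightarrow> nat list \<Rightarrow> (complex \<Rightarrow> complex) list" where
  "log_forms z ks = map (\<lambda>k w. 1 / (w - z k)) ks"

definition index_words :: "nat \<Rightarrow> nat \<Rightarrow> nat \<Rightarrow> nat \<Rightarrow> nat list set" where
  "index_words m j i n = {ks. length ks = n \<and> set ks \<subseteq> {1..m} \<and> hd ks \<noteq> j \<and> last ks \<noteq> i}"

(* The product P k1 F ... P kn F. *)
definition word_product ::
    "(nat \<Rightarrow> complex^'n^'n) \<Rightarrow> complex^'n^'n \<Rightarrow> nat list \<Rightarrow> complex^'n^'n" where
  "word_product P F ks = foldr (\<lambda>k M. P k ** F ** M) ks (mat 1)"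

end

theory Submission
  imports Defs
begin

text \<open>The coefficients in \<open>t\<close> of \<open>\<nabla>\<^sup>V\<close> and those of its Fourier--Laplace transform are exchanged by the
  Laplace transform: if \<open>\<phi>\<close> solves \<open>(z - Z) \<phi>' = F \<phi>\<close>, the Laplace integral of \<open>\<phi>\<close> along the ray from
  the pole \<open>z\<^sub>i\<close> in a direction near \<open>\<ell>\<close> is a solution of \<open>\<nabla>\<^sup>V\<close> on the corresponding half plane.
  Rotating the direction of integration across \<open>\<ell>\<close> leaves the jumps of \<open>\<phi>\<close> across the cuts starting at the
  poles \<open>z\<^sub>j\<close> on \<open>z\<^sub>i + \<ell>\<close>. Since the residues square to zero, the local monodromy at \<open>z\<^sub>j\<close> is
  \<open>1 + 2 \<pi> \<i> P\<^sub>j F\<close>, and the jump at \<open>z\<^sub>j\<close> is the connection matrix from \<open>z\<^sub>i\<close> to \<open>z\<^sub>j\<close>, i.e. the regularised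
  parallel transport. The series is the Dyson expansion of the latter; its terms are dominated uniformly in
  the end points because only words without repeated letters contribute, so that the singular weights
  \<open>1/t\<close> and \<open>1/(1 - t)\<close> at the two ends are never integrated twice in a row.\<close>

text \<open>A canonical solution is known only through its equation and its asymptotics at 0, so a
  Laplace integral is not matched with it by construction. The integral is cut off at
  \<open>R\<close>; its quotient by the canonical solution then has an exponentially small
  derivative, and each spectral component of the limiting constant is read off along a direction of
  the half plane in which the comparing exponential stays bounded. Such directions exist because the
  perturbed rays enclose no Stokes ray but l.

  The poles on z_i + l obstruct moving the contours onto that ray, since phi has logarithms there.
  The integrals are therefore formed with (z - Z) phi, which is continuous up to the poles. This
  costs a factor 1 + F, removed at the end by showing that its kernel contains no nonzero solution.

  For the series, each word is integrable up to the ends, but exchanging the sum with the end point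
  limit requires a bound that beats the number of words. Majorants that depend on the letter and on
  a free constant K give (c/K)^n for a word of length n, up to a factor independent of n.\<close>

no_notation fps_nth (infixl "$" 75)

section \<open>Matrices as a normed algebra and complex differentiability of matrix
  functions\<close>

lemma msmult_nth [simp]: "(c *\<^sub>m A) $ i $ j = c * A $ i $ j"
 by (simp add: msmult_def)

lemma mat_eq_iff: "A = B \<longleftrightarrow> (\<forall>i j. A $ i $ j = B $ i $ j)"
 by (simp add: vec_eq_iff)

text \<open>Each row of the product is a combination of the rows of \<open>B\<close>, to which
  Cauchy-Schwarz applies. The norm of the type is the Frobenius norm, so the identity does not have
  norm 1 in general, and later estimates carry \<open>norm (mat 1)\<close> as a constant.\<close>

lemma norm_matrix_mult_le: "norm (A ** B) <= norm A * norm (B :: complex^'n^'n)"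
proof -
 have row: "norm ((A ** B) $ i) <= norm (A $ i) * norm B" for i
 proof -
  have "(A ** B) $ i = (\<Sum>k\<in>UNIV. A $ i $ k *s B $ k)"
   by (simp add: vec_eq_iff matrix_matrix_mult_def)
  also have "norm \<dots> <= (\<Sum>k\<in>UNIV. norm (A $ i $ k *s B $ k))"
   by (rule norm_sum)
  also have "\<dots> = (\<Sum>k\<in>UNIV. \<bar>norm (A $ i $ k)\<bar> * \<bar>norm (B $ k)\<bar>)"
  proof (rule sum.cong[OF refl])
   fix k
   have "norm (c *s v) = norm c * norm v" for c :: complex and v :: "complex^'n"
    unfolding norm_vec_def by (simp add: norm_mult L2_set_right_distrib)
   then show "norm (A $ i $ k *s B $ k) = \<bar>norm (A $ i $ k)\<bar> * \<bar>norm (B $ k)\<bar>" by simp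
  qed
  also have "\<dots> <= norm (A $ i) * norm B"
   unfolding norm_vec_def[of "A $ i"] norm_vec_def[of B] by (rule L2_set_mult_ineq)
  finally show ?thesis .
 qed
 have "norm (A ** B) = L2_set (%i. norm ((A ** B) $ i)) UNIV" by (simp add: norm_vec_def)
 also have "\<dots> <= L2_set (%i. norm (A $ i) * norm B) UNIV"
  by (rule L2_set_mono) (auto simp: row)
 also have "\<dots> = norm A * norm B"
  by (subst L2_set_left_distrib[symmetric]) (simp_all add: norm_vec_def[of A])
 finally show ?thesis .
qed

lemma norm_msmult [simp]: "norm (c *\<^sub>m A) = norm c * norm A"
proof -
 have "norm ((c *\<^sub>m A) $ i) = norm c * norm (A $ i)" for i
  unfolding norm_vec_def by (simp add: norm_mult L2_set_right_distrib)
 then show ?thesis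
  unfolding norm_vec_def[of "c *\<^sub>m A"] norm_vec_def[of A] by (simp add: L2_set_right_distrib)
qed

text \<open>The product \<open>**\<close> becomes an instance of the theory of bounded bilinear
  maps, which supplies limits, derivatives, integrals and sums of matrix products.\<close>

interpretation mm: bounded_bilinear "(**) :: complex^'n^'n => complex^'n^'n => complex^'n^'n"
proof
 fix a a' b b' :: "complex^'n^'n" and r :: real
 show "(a + a') ** b = a ** b + a' ** b"
  by (simp add: mat_eq_iff matrix_matrix_mult_def algebra_simps sum.distrib)
 show "a ** (b + b') = a ** b + a ** b'"
  by (simp add: mat_eq_iff matrix_matrix_mult_def algebra_simps sum.distrib)
 show "(r *\<^sub>R a) ** b = r *\<^sub>R (a ** b)"
  by (simp add: mat_eq_iff matrix_matrix_mult_def scaleR_sum_right)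
 show "a ** (r *\<^sub>R b) = r *\<^sub>R (a ** b)"
  by (simp add: mat_eq_iff matrix_matrix_mult_def scaleR_sum_right)
 show "\<exists>K. \<forall>(a::complex^'n^'n) (b::complex^'n^'n). norm (a ** b) <= norm a * norm b * K"
  by (rule exI[of _ 1]) (simp add: norm_matrix_mult_le)
qed

interpretation ms: bounded_bilinear "msmult"
proof
 fix c c' :: complex and b b' :: "complex^'n^'n" and r :: real
 show "(c + c') *\<^sub>m b = c *\<^sub>m b + c' *\<^sub>m b" by (simp add: mat_eq_iff algebra_simps)
 show "c *\<^sub>m (b + b') = c *\<^sub>m b + c *\<^sub>m b'" by (simp add: mat_eq_iff algebra_simps)
 show "(r *\<^sub>R c) *\<^sub>m b = r *\<^sub>R (c *\<^sub>m b)" by (simp add: mat_eq_iff)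
 show "c *\<^sub>m (r *\<^sub>R b) = r *\<^sub>R (c *\<^sub>m b)" by (simp add: mat_eq_iff)
 show "\<exists>K. \<forall>c (b::complex^'n^'n). norm (c *\<^sub>m b) <= norm c * norm b * K"
  by (rule exI[of _ 1]) simp
qed

lemma msmult_mult_left [simp]: "(c *\<^sub>m A) ** B = c *\<^sub>m (A ** B)"
 by (simp add: mat_eq_iff matrix_matrix_mult_def sum_distrib_left mult.assoc)

lemma msmult_mult_right [simp]: "A ** (c *\<^sub>m B) = c *\<^sub>m (A ** B)"
 by (simp add: mat_eq_iff matrix_matrix_mult_def sum_distrib_left mult_ac)

lemma msmult_msmult [simp]: "c *\<^sub>m (d *\<^sub>m A) = (c * d) *\<^sub>m A"
 by (simp add: mat_eq_iff)

lemma msmult_one [simp]: "1 *\<^sub>m A = A"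
 by (simp add: mat_eq_iff)

lemma msmult_eq_0_iff [simp]: "c *\<^sub>m A = 0 \<longleftrightarrow> c = 0 \<or> A = 0"
 by (metis mult_eq_0_iff norm_eq_zero norm_msmult)

lemmas mat_distrib = mm.add_left mm.add_right mm.diff_left mm.diff_right
 mm.minus_left mm.minus_right ms.add_left ms.add_right ms.diff_left ms.diff_right
 ms.minus_left ms.minus_right

lemmas mat_assoc = matrix_mul_assoc[symmetric]

lemma norm_entry_le: "norm (A $ i $ j) <= norm (A :: complex^'n^'n)"
 using Finite_Cartesian_Product.norm_nth_le[of A i] Finite_Cartesian_Product.norm_nth_le[of "A $ i" j] by linarith

lemma left_inverse_imp_right: "A ** B = mat 1 \<longleftrightarrow> B ** A = mat (1::complex)" for A B :: "complex^'n^'n"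
 by (rule matrix_left_right_inverse)

lemma tendsto_matrix_iff:
 "(f \<longlongrightarrow> L) G \<longleftrightarrow> (\<forall>i j. ((%x. f x $ i $ j) \<longlongrightarrow> (L :: complex^'n^'n) $ i $ j) G)"
proof
 assume "(f \<longlongrightarrow> L) G"
 then show "\<forall>i j. ((%x. f x $ i $ j) \<longlongrightarrow> L $ i $ j) G"
  by (intro allI tendsto_vec_nth)
next
 assume *: "\<forall>i j. ((%x. f x $ i $ j) \<longlongrightarrow> L $ i $ j) G"
 show "(f \<longlongrightarrow> L) G" by (rule vec_tendstoI, rule vec_tendstoI) (use * in blast)
qed

lemma has_derivative_vecI:
 fixes f :: "'a::real_normed_vector => ('b::real_normed_vector)^'n"
 assumes "\<And>i. ((%x. f x $ i) has_derivative (%h. f' h $ i)) (at a within S)"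
 shows "(f has_derivative f') (at a within S)"
proof -
 have bl: "bounded_linear (%h. f' h $ i)" for i using assms has_derivative_bounded_linear by blast
 have "bounded_linear f'"
 proof (rule bounded_linear_intro[where K = "\<Sum>i\<in>UNIV. (SOME K. \<forall>x. norm (f' x $ i) <= norm x * K)"])
  fix x y r
  show "f' (x + y) = f' x + f' y"
   using linear_add[OF bounded_linear.linear[OF bl]] by (simp add: vec_eq_iff)
  show "f' (r *\<^sub>R x) = r *\<^sub>R f' x"
   using linear_scale[OF bounded_linear.linear[OF bl]] by (simp add: vec_eq_iff)
  have "norm (f' x) <= (\<Sum>i\<in>UNIV. norm (f' x $ i))"
   unfolding norm_vec_def by (rule L2_set_le_sum) auto
  also have "\<dots> <= (\<Sum>i\<in>UNIV. norm x * (SOME K. \<forall>x. norm (f' x $ i) <= norm x * K))"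
  proof (rule sum_mono)
   fix i
   have "\<exists>K. \<forall>x. norm (f' x $ i) <= norm x * K" using bounded_linear.bounded[OF bl] .
   from someI_ex[OF this] show "norm (f' x $ i) <= norm x * (SOME K. \<forall>x. norm (f' x $ i) <= norm x * K)"
    by blast
  qed
  finally show "norm (f' x) <= norm x * (\<Sum>i\<in>UNIV. SOME K. \<forall>x. norm (f' x $ i) <= norm x * K)"
   by (simp add: sum_distrib_left)
 qed
 moreover have "((%y. (f y - f a - f' (y - a)) /\<^sub>R norm (y - a)) \<longlongrightarrow> 0) (at a within S)"
 proof (rule vec_tendstoI)
  fix i
  have "((%y. (f y $ i - f a $ i - f' (y - a) $ i) /\<^sub>R norm (y - a)) \<longlongrightarrow> 0) (at a within S)"
   using assms[of i] by (simp add: has_derivative_at_within)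
  then show "((%y. ((f y - f a - f' (y - a)) /\<^sub>R norm (y - a)) $ i) \<longlongrightarrow> 0 $ i) (at a within S)"
   by simp
 qed
 ultimately show ?thesis by (simp add: has_derivative_at_within)
qed

text \<open>Complex differentiability as a Frechet derivative that is multiplication by
  \<open>D\<close>: in this form the product rules of bounded bilinear maps apply, while
  \<open>has_mder_iff\<close> leads back to the entries and hence to holomorphic functions.\<close>

definition has_mder :: "(complex => complex^'n^'n) => complex^'n^'n => complex filter => bool" where
 "has_mder f D G \<longleftrightarrow> (f has_derivative (%h. h *\<^sub>m D)) G"

lemma has_mder_iff:
 "has_mder f D (at z within S) \<longleftrightarrow>
   (\<forall>i j. ((%u. f u $ i $ j) has_field_derivative D $ i $ j) (at z within S))"
proof
 assume "has_mder f D (at z within S)"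
 then have "(f has_derivative (%h. h *\<^sub>m D)) (at z within S)" by (simp add: has_mder_def)
 then have "((%u. f u $ i $ j) has_derivative (%h. (h *\<^sub>m D) $ i $ j)) (at z within S)" for i j
  by (intro bounded_linear.has_derivative[OF bounded_linear_vec_nth])
 then show "\<forall>i j. ((%u. f u $ i $ j) has_field_derivative D $ i $ j) (at z within S)"
  unfolding has_field_derivative_def by (simp add: mult_commute_abs)
next
 assume *: "\<forall>i j. ((%u. f u $ i $ j) has_field_derivative D $ i $ j) (at z within S)"
 show "has_mder f D (at z within S)" unfolding has_mder_def
  by (rule has_derivative_vecI, rule has_derivative_vecI)
   (use * in \<open>simp add: has_field_derivative_def mult_commute_abs\<close>)
qed

lemma has_mder_mult:
 assumes "has_mder f D (at z within S)" "has_mder g E (at z within S)"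
 shows "has_mder (%u. f u ** g u) (D ** g z + f z ** E) (at z within S)"
 using mm.FDERIV[OF assms[unfolded has_mder_def]] unfolding has_mder_def
 by (simp add: mat_distrib add.commute)

lemma has_mder_msmult:
 assumes "(f has_field_derivative D) (at z within S)" "has_mder g E (at z within S)"
 shows "has_mder (%u. f u *\<^sub>m g u) (D *\<^sub>m g z + f z *\<^sub>m E) (at z within S)"
 using ms.FDERIV[OF assms[unfolded has_mder_def has_field_derivative_def]] unfolding has_mder_def
 by (simp add: mat_distrib add.commute mult.commute)

lemma has_mder_const [simp]: "has_mder (%u. C) 0 (at z within S)"
 unfolding has_mder_def by (simp add: ms.zero_right)

lemma has_mder_multc_right: "has_mder f D (at z within S) ==> has_mder (%u. f u ** C) (D ** C) (at z within S)"
 using has_mder_mult[of f D z S "%u. C" 0] by simp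

lemma has_mder_multc_left: "has_mder f D (at z within S) ==> has_mder (%u. C ** f u) (C ** D) (at z within S)"
 using has_mder_mult[of "%u. C" 0 z S f D] by simp

lemma has_mder_add: "has_mder f D G ==> has_mder g E G ==> has_mder (%u. f u + g u) (D + E) G"
 unfolding has_mder_def ms.add_right by (rule has_derivative_add)

lemma has_mder_diff: "has_mder f D G ==> has_mder g E G ==> has_mder (%u. f u - g u) (D - E) G"
 unfolding has_mder_def ms.diff_right by (rule has_derivative_diff)

lemma has_mder_transpose:
 "has_mder f D (at z within S) ==> has_mder (%u. transpose (f u)) (transpose D) (at z within S)"
 by (auto simp: has_mder_iff transpose_def)

lemma has_mder_chain:
 assumes "has_mder f D (at (g z))" "(g has_field_derivative E) (at z within S)"
 shows "has_mder (%u. f (g u)) (E *\<^sub>m D) (at z within S)"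
 using DERIV_chain2[of "%u. f u $ _ $ _" "D $ _ $ _" g z E S] assms
 unfolding has_mder_iff by (simp add: mult.commute)

lemma has_mder_path:
 assumes "has_mder f D (at (g u))" "(g has_vector_derivative E) (at u within S)"
 shows "((%u. f (g u)) has_vector_derivative (E *\<^sub>m D)) (at u within S)"
proof -
 have "((%u. f (g u)) has_derivative (%h. (h *\<^sub>R E) *\<^sub>m D)) (at u within S)"
  using has_derivative_compose[OF assms(2)[unfolded has_vector_derivative_def] assms(1)[unfolded has_mder_def]]
  by simp
 then show ?thesis unfolding has_vector_derivative_def by (simp add: ms.scaleR_left)
qed

lemma has_mder_imp_continuous: "has_mder f D (at z within S) ==> continuous (at z within S) f"
 unfolding has_mder_def by (rule has_derivative_continuous)

lemma has_mder_transform: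
 assumes "has_mder f D (at z)" "open S" "z \<in> S" "\<And>u. u \<in> S ==> f u = g u"
 shows "has_mder g D (at z)"
 using assms unfolding has_mder_def by (rule has_derivative_transform_within_open)

lemma has_mder_within: "has_mder f D (at z) ==> has_mder f D (at z within S)"
 unfolding has_mder_def by (rule has_derivative_at_withinI)

lemma mder_zero_const:
 assumes "open S" "connected S" "\<And>z. z \<in> S ==> has_mder f 0 (at z)" "a \<in> S" "b \<in> S"
 shows "f a = f b"
 by (rule has_derivative_zero_unique_connected[OF assms(1,2) _ assms(4,5)])
  (use assms(3) in \<open>simp add: has_mder_def ms.zero_right\<close>)

definition mhol :: "(complex => complex^'n^'n) => complex set => bool" where
 "mhol f S \<longleftrightarrow> (\<forall>i j. (%z. f z $ i $ j) holomorphic_on S)"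

lemma mhol_subset: "mhol f S ==> T \<subseteq> S ==> mhol f T"
 by (auto simp: mhol_def intro: holomorphic_on_subset)

lemma mhol_mult: "mhol f S ==> mhol g S ==> mhol (%z. f z ** g z) S"
 unfolding mhol_def matrix_matrix_mult_def by (auto intro!: holomorphic_intros)

lemma mhol_const [simp]: "mhol (%z. C) S"
 by (simp add: mhol_def)

lemma mhol_msmult: "f holomorphic_on S ==> mhol g S ==> mhol (%z. f z *\<^sub>m g z) S"
 unfolding mhol_def by (auto intro!: holomorphic_intros)

lemma mhol_sum: "(\<And>k. k \<in> I ==> mhol (f k) S) ==> mhol (%z. \<Sum>k\<in>I. f k z) S"
 unfolding mhol_def by (auto intro!: holomorphic_intros)

lemma mhol_add: "mhol f S ==> mhol g S ==> mhol (%z. f z + g z) S"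
 unfolding mhol_def by (auto intro!: holomorphic_intros)

lemma mhol_transpose: "mhol f S ==> mhol (%z. transpose (f z)) S"
 unfolding mhol_def transpose_def by auto

lemma mhol_continuous: "mhol f S ==> continuous_on S f"
 unfolding mhol_def continuous_on_def tendsto_matrix_iff
 by (meson continuous_on_def holomorphic_on_imp_continuous_on)

lemma has_mder_imp_mhol: "(\<And>z. z \<in> S ==> \<exists>D. has_mder f D (at z)) ==> mhol f S"
 unfolding mhol_def has_mder_iff holomorphic_on_def field_differentiable_def
 by (meson has_field_derivative_at_within)

section \<open>Linear differential equations: Picard iteration and fundamental solutions\<close>

lemma mhol_primitive:
 assumes "open S" "convex S" "mhol f S" "z0 \<in> S"
 shows "\<exists>g. g z0 = 0 \<and> (\<forall>z\<in>S. has_mder g (f z) (at z))"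
proof -
 have "\<exists>g. \<forall>z\<in>S. (g has_field_derivative f z $ i $ j) (at z)" for i j
  using holomorphic_convex_primitive'[OF assms(2,1), of "%z. f z $ i $ j"] assms(3)
  unfolding mhol_def by (metis assms(1) at_within_open)
 then obtain G where G: "\<And>i j z. z \<in> S ==> (G i j has_field_derivative f z $ i $ j) (at z)"
  by metis
 show ?thesis
  by (rule exI[of _ "%z. \<chi> i j. G i j z - G i j z0"])
   (auto simp: mat_eq_iff has_mder_iff intro!: derivative_eq_intros G)
qed

text \<open>Picard iteration with complex primitives: on a convex set every iterate has a primitive
  vanishing at \<open>z0\<close>, and along segments from \<open>z0\<close> the iterates are bounded
  by c (M r)^n / n!. The series and its termwise derivative thus converge locally uniformly.\<close>

lemma picard_exists:
 fixes A :: "complex => complex^'n^'n"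
 assumes S: "open S" "convex S" "z0 \<in> S" and A: "mhol A S"
 shows "\<exists>X. X z0 = mat 1 \<and> (\<forall>z\<in>S. has_mder X (A z ** X z) (at z))"
proof -
 define next_term where "next_term Y = (SOME g. g z0 = 0 \<and> (\<forall>z\<in>S. has_mder g (A z ** Y z) (at z)))"
  for Y :: "complex => complex^'n^'n"
 have next_term: "next_term Y z0 = 0 \<and> (\<forall>z\<in>S. has_mder (next_term Y) (A z ** Y z) (at z))"
  if "mhol Y S" for Y
  unfolding next_term_def using someI_ex[OF mhol_primitive[OF S(1,2) mhol_mult[OF A that] S(3)]] .
 define X where "X n = (next_term ^^ n) (%z. mat 1)" for n
 have hol: "mhol (X n) S" for n
 proof (induction n)
  case (Suc n)
  then show ?case using next_term[of "X n"] has_mder_imp_mhol[of S "X (Suc n)"] by (auto simp: X_def)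
 qed (simp add: X_def)
 have X0: "X 0 z = mat 1" for z by (simp add: X_def)
 have XS: "X (Suc n) z0 = 0" "z \<in> S ==> has_mder (X (Suc n)) (A z ** X n z) (at z)" for n z
  using next_term[OF hol[of n]] by (auto simp: X_def)
 define c where "c = norm (mat 1 :: complex^'n^'n)"
 \<comment> \<open>Convexity keeps the segment from \<open>z0\<close> to \<open>z\<close> inside
   \<open>K\<close>; on it the derivative of the next iterate is compared with the derivative of the
   claimed bound as a function of the segment parameter.\<close>
 have bound: "norm (X n z) <= c * (M * norm (z - z0)) ^ n / fact n"
  if K: "K \<subseteq> S" "convex K" "z0 \<in> K" and M: "\<And>z. z \<in> K ==> norm (A z) <= M" "0 <= M" and z: "z \<in> K" for K M n z
  using z
 proof (induction n arbitrary: z)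
  case 0 show ?case by (simp add: X0 c_def)
 next
  case (Suc n)
  define r where "r = norm (z - z0)"
  define p where "p u = z0 + of_real u * (z - z0)" for u :: real
  have pK: "p u \<in> K" if "0 <= u" "u <= 1" for u
  proof -
   have "(1 - u) *\<^sub>R z0 + u *\<^sub>R z \<in> K" using K Suc.prems that convexD_alt by blast
   then show ?thesis by (simp add: p_def scaleR_conv_of_real algebra_simps)
  qed
  have dp: "(p has_vector_derivative (z - z0)) (at u)" for u
   unfolding p_def by (auto intro!: derivative_eq_intros)
  have der: "((%u. X (Suc n) (p u)) has_vector_derivative ((z - z0) *\<^sub>m (A (p u) ** X n (p u)))) (at u)"
   if "0 <= u" "u <= 1" for u
   using XS(2)[of "p u" n] pK[OF that] K dp by (intro has_mder_path) auto
  have "norm (X (Suc n) (p 1) - X (Suc n) (p 0)) <=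
    c * (M * r * 1) ^ Suc n / fact (Suc n) - c * (M * r * 0) ^ Suc n / fact (Suc n)"
  proof (rule differentiable_bound_general[where a = 0 and b = "1::real" and
    \<phi> = "%u. c * (M * r * u) ^ Suc n / fact (Suc n)" and f = "%u. X (Suc n) (p u)"
    and f' = "%u. (z - z0) *\<^sub>m (A (p u) ** X n (p u))"
    and \<phi>' = "%u. M * r * (c * (M * r * u) ^ n / fact n)"])
   show "continuous_on {0..1} (%u. X (Suc n) (p u))"
    by (intro continuous_at_imp_continuous_on ballI has_vector_derivative_continuous[OF der]) auto
   show "((%u. c * (M * r * u) ^ Suc n / fact (Suc n)) has_vector_derivative
      M * r * (c * (M * r * x) ^ n / fact n)) (at x)" for x
    unfolding has_real_derivative_iff_has_vector_derivative[symmetric]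
    by (rule derivative_eq_intros refl | simp)+
   fix u :: real assume u: "0 < u" "u < 1"
   have pz: "norm (p u - z0) = r * u" using u by (simp add: p_def r_def norm_mult)
   have "norm ((z - z0) *\<^sub>m (A (p u) ** X n (p u))) <= r * (norm (A (p u)) * norm (X n (p u)))"
    by (simp add: r_def norm_matrix_mult_le mult_left_mono)
   also have "\<dots> <= r * (M * (c * (M * (r * u)) ^ n / fact n))"
    using M(1)[OF pK[of u]] M(2) Suc.IH[OF pK[of u]] u pz
    by (intro mult_left_mono mult_mono) (auto simp: r_def c_def)
   finally show "norm ((z - z0) *\<^sub>m (A (p u) ** X n (p u))) <= M * r * (c * (M * r * u) ^ n / fact n)"
    by (simp add: mult_ac)
  qed (use der in \<open>auto intro!: continuous_intros\<close>)
  then show ?case by (simp add: p_def XS r_def)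
 qed
 define Xs where "Xs z = (\<Sum>n. X n z)" for z
 have main: "has_mder Xs (A z ** Xs z) (at z)" if z: "z \<in> S" for z
 proof -
  obtain r where r: "0 < r" "cball z r \<subseteq> S" using S z open_contains_cball by blast
  \<comment> \<open>A compact convex neighbourhood of \<open>z\<close> that also contains
    \<open>z0\<close>, as the estimate along segments requires.\<close>
  define K where "K = convex hull (insert z0 (cball z r))"
  have K: "K \<subseteq> S" "convex K" "z0 \<in> K" "compact K" "cball z r \<subseteq> K" "z \<in> K"
  proof -
   show "K \<subseteq> S" unfolding K_def using r S by (intro hull_minimal) auto
  qed (use r in \<open>auto simp: K_def intro!: compact_convex_hull hull_inc\<close>)
  have "compact (A ` K)"
   using A K by (intro compact_continuous_image) (auto intro: mhol_continuous mhol_subset)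
  then obtain M where M: "\<And>z. z \<in> K ==> norm (A z) <= M" "0 <= M"
   by (metis bounded_pos compact_imp_bounded image_eqI less_imp_le)
  obtain R where R: "\<And>u. u \<in> K ==> norm (u - z0) <= R" "0 <= R"
   using compact_imp_bounded[OF \<open>compact K\<close>] bounded_any_center[of K z0]
   by (metis dist_norm norm_minus_commute norm_ge_zero order_trans K(3))
  have b: "norm (X n u) <= c * (M * R) ^ n / fact n" if "u \<in> K" for n u
  proof -
   have "norm (X n u) <= c * (M * norm (u - z0)) ^ n / fact n" using bound[OF K(1-3) M that] .
   also have "\<dots> <= c * (M * R) ^ n / fact n"
    using M R(1)[OF that] R(2) by (intro divide_right_mono mult_left_mono power_mono) (auto simp: c_def)
   finally show ?thesis .
  qed
  have sm: "summable (%n. c * (M * R) ^ n / fact n)"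
   using summable_mult[OF summable_exp[of "M * R"], of c] by (simp add: field_simps)
  have sX: "summable (%n. X n u)" if "u \<in> K" for u
   by (rule summable_comparison_test'[OF sm, of 0]) (rule b[OF that])
  have sumsX: "(%n. X n u $ i $ j) sums (Xs u $ i $ j)" if "u \<in> K" for u i j
  proof -
   have "(%n. X n u) sums Xs u" using sX[OF that] by (simp add: Xs_def summable_sums)
   then show ?thesis
    by (intro bounded_linear.sums[OF bounded_linear_vec_nth])
  qed
  have sumsAX: "(%n. (A u ** X n u) $ i $ j) sums ((A u ** Xs u) $ i $ j)" if "u \<in> K" for u i j
  proof -
   have "(%n. A u ** X n u) sums (A u ** Xs u)"
    using sX[OF that] by (simp add: Xs_def summable_sums bounded_linear.sums[OF mm.bounded_linear_right])
   then show ?thesis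
    by (intro bounded_linear.sums[OF bounded_linear_vec_nth])
  qed
  show ?thesis unfolding has_mder_iff
  proof (intro allI)
   fix i j
   \<comment> \<open>Termwise derivatives: the constant zeroth iterate contributes 0, which shifts
     the index by one.\<close>
   define d where "d n u = (case n of 0 => 0 | Suc n => (A u ** X n u) $ i $ j)" for n u
   define B where "B n = (case n of 0 => 0 | Suc n => M * (c * (M * R) ^ n / fact n))" for n
   have "uniform_limit K (%n u. \<Sum>k<n. d k u) (%u. \<Sum>k. d k u) sequentially"
   proof (rule Weierstrass_m_test)
    show "summable B"
     unfolding summable_Suc_iff[symmetric, of B] using summable_mult[OF sm, of M] by (simp add: B_def)
    fix n u assume u: "u \<in> K"
    show "norm (d n u) <= B n"
    proof (cases n)
     case (Suc k)
     have "norm ((A u ** X k u) $ i $ j) <= norm (A u) * norm (X k u)"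
      by (meson norm_entry_le norm_matrix_mult_le order_trans)
     also have "\<dots> <= M * (c * (M * R) ^ k / fact k)"
      using M(1)[OF u] b[OF u, of k] M(2) by (intro mult_mono) auto
     finally show ?thesis by (simp add: Suc d_def B_def)
    qed (simp add: d_def B_def)
   qed
   moreover have "(\<Sum>k. d k u) = (A u ** Xs u) $ i $ j" if "u \<in> K" for u
   proof -
    have "(%k. d (Suc k) u) sums ((A u ** Xs u) $ i $ j)" using sumsAX[OF that] by (simp add: d_def)
    then have "(%k. d k u) sums ((A u ** Xs u) $ i $ j + d 0 u)" by (rule sums_Suc)
    then show ?thesis by (simp add: d_def sums_iff)
   qed
   ultimately have ul: "uniform_limit K (%n u. \<Sum>k<n. d k u) (%u. (A u ** Xs u) $ i $ j) sequentially"
    by (metis (no_types, lifting) uniform_limit_cong')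
   have "\<exists>g. \<forall>u\<in>K. (%n. X n u $ i $ j) sums g u \<and>
      (g has_field_derivative (A u ** Xs u) $ i $ j) (at u within K)"
   proof (rule has_field_derivative_series[OF K(2) _ ul \<open>z \<in> K\<close>])
    show "summable (%n. X n z $ i $ j)" using sumsX[OF \<open>z \<in> K\<close>] sums_summable by blast
    fix n u assume u: "u \<in> K"
    show "((%u. X n u $ i $ j) has_field_derivative d n u) (at u within K)"
    proof (cases n)
     case 0 then show ?thesis by (simp add: X0 d_def)
    next
     case (Suc k)
     then show ?thesis using XS(2)[of u k] u K
      by (auto simp: d_def has_mder_iff intro: has_field_derivative_at_within)
    qed
   qed
   then obtain g where g: "\<And>u. u \<in> K ==> (%n. X n u $ i $ j) sums g u"
    "\<And>u. u \<in> K ==> (g has_field_derivative (A u ** Xs u) $ i $ j) (at u within K)" by blast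
   have "g u = Xs u $ i $ j" if "u \<in> K" for u using g(1)[OF that] sumsX[OF that] sums_unique2 by blast
   moreover have "z \<in> interior K" using K r by (meson centre_in_ball ball_subset_cball interior_maximal open_ball subset_iff order_trans)
   moreover from this have "(g has_field_derivative (A z ** Xs z) $ i $ j) (at z)"
    using g(2)[OF \<open>z \<in> K\<close>] at_within_interior[of z K] by simp
   ultimately show "((%u. Xs u $ i $ j) has_field_derivative (A z ** Xs z) $ i $ j) (at z)"
    using has_field_derivative_transform_within_open[of g _ z "interior K" "%u. Xs u $ i $ j"]
     interior_subset[of K] by blast
  qed
 qed
 have "Xs z0 = mat 1"
 proof -
  have "(%n. X (Suc n) z0) sums 0" by (simp add: XS)
  then have "(%n. X n z0) sums (0 + X 0 z0)" by (rule sums_Suc)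
  then show ?thesis by (simp add: Xs_def sums_iff X0)
 qed
 then show ?thesis using main by blast
qed


text \<open>The inverse is carried along with its own equation Y' = - Y A, so that no derivative of
  a matrix inverse has to be computed.\<close>

definition fund :: "(complex => complex^'n^'n) => complex set => (complex => complex^'n^'n) =>
  (complex => complex^'n^'n) => bool" where
 "fund A S X Y \<longleftrightarrow> (\<forall>z\<in>S. has_mder X (A z ** X z) (at z) \<and> has_mder Y (- (Y z ** A z)) (at z) \<and>
   X z ** Y z = mat 1 \<and> Y z ** X z = mat 1)"

lemma fundD:
 assumes "fund A S X Y" "z \<in> S"
 shows "has_mder X (A z ** X z) (at z)" "has_mder Y (- (Y z ** A z)) (at z)"
  "X z ** Y z = mat 1" "Y z ** X z = mat 1"
 using assms by (auto simp: fund_def)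

lemma transpose_uminus: "transpose (- A) = - transpose A"
 by (simp add: transpose_def vec_eq_iff)

lemma matrix_cancel: "Y ** X = mat 1 ==> Y ** (X ** C) = C" for X Y C :: "complex^'n^'n"
 by (simp add: matrix_mul_assoc)

text \<open>The derivative of \<open>Y ** f\<close> vanishes, so this product is constant on the
  connected set.\<close>

lemma fund_solution:
 assumes "fund A S X Y" "T \<subseteq> S" "open T" "connected T"
  and f: "\<And>z. z \<in> T ==> has_mder f (A z ** f z) (at z)"
 shows "\<exists>C. \<forall>z\<in>T. f z = X z ** C"
proof (cases "T = {}")
 case False
 then obtain z0 where z0: "z0 \<in> T" by blast
 have "has_mder (%z. Y z ** f z) 0 (at z)" if "z \<in> T" for z
 proof -
  have "z \<in> S" using that assms by blast
  from has_mder_mult[OF fundD(2)[OF assms(1) this] f[OF that]] show ?thesis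
   by (simp add: mat_distrib mat_assoc)
 qed
 then have c: "Y z ** f z = Y z0 ** f z0" if "z \<in> T" for z
  using mder_zero_const[OF assms(3,4), of "%z. Y z ** f z"] that z0 by blast
 have "f z = X z ** (Y z0 ** f z0)" if "z \<in> T" for z
  using c[OF that] fundD(3)[OF assms(1), of z] assms(2) that
  by (metis matrix_cancel subsetD)
 then show ?thesis by blast
qed simp

lemma fund_multc:
 assumes "fund A S X Y" "C ** D = mat 1"
 shows "fund A S (%z. X z ** C) (%z. D ** Y z)"
 unfolding fund_def
proof (intro ballI conjI)
 fix z assume z: "z \<in> S"
 have DC: "D ** C = mat 1" using assms(2) left_inverse_imp_right by blast
 note f = fundD[OF assms(1) z]
 show "has_mder (%z. X z ** C) (A z ** (X z ** C)) (at z)"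
  using has_mder_multc_right[OF f(1), of C] by (simp add: mat_assoc)
 show "has_mder (%z. D ** Y z) (- (D ** Y z ** A z)) (at z)"
  using has_mder_multc_left[OF f(2), of D] by (simp add: mat_assoc mat_distrib)
 have "X z ** C ** (D ** Y z) = X z ** ((C ** D) ** Y z)" by (simp add: mat_assoc)
 then show "X z ** C ** (D ** Y z) = mat 1" using f assms(2) by simp
 have "D ** Y z ** (X z ** C) = D ** ((Y z ** X z) ** C)" by (simp add: mat_assoc)
 then show "D ** Y z ** (X z ** C) = mat 1" using f DC by simp
qed

text \<open>The inverse comes from the transposed equation: a solution W of W' = - A^T W gives Y =
  W^T with Y' = - Y A, and \<open>Y ** X\<close> is then constant.\<close>

lemma fund_exists_convex:
 fixes A :: "complex => complex^'n^'n"
 assumes S: "open S" "convex S" and A: "mhol A S"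
 shows "\<exists>X Y. fund A S X Y"
proof (cases "S = {}")
 case False
 then obtain z0 where z0: "z0 \<in> S" by blast
 obtain X where X: "X z0 = mat 1" "\<And>z. z \<in> S ==> has_mder X (A z ** X z) (at z)"
  using picard_exists[OF S z0 A] by blast
 have "mhol (%z. - transpose (A z)) S"
  using mhol_transpose[OF A] unfolding mhol_def by (auto intro!: holomorphic_intros)
 from picard_exists[OF S z0 this] obtain W where W: "W z0 = mat 1"
  "\<And>z. z \<in> S ==> has_mder W (- transpose (A z) ** W z) (at z)" by blast
 define Y where "Y z = transpose (W z)" for z
 have Y: "has_mder Y (- (Y z ** A z)) (at z)" if "z \<in> S" for z
 proof -
  have "transpose (- transpose (A z) ** W z) = - (Y z ** A z)"
   by (simp add: Y_def matrix_transpose_mul mat_distrib transpose_uminus)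
  then show ?thesis using has_mder_transpose[OF W(2)[OF that]] unfolding Y_def by simp
 qed
 have Y0: "Y z0 = mat 1" using W(1) by (simp add: Y_def)
 have "has_mder (%z. Y z ** X z) 0 (at z)" if "z \<in> S" for z
  using has_mder_mult[OF Y[OF that] X(2)[OF that]] by (simp add: mat_distrib mat_assoc)
 then have "Y z ** X z = Y z0 ** X z0" if "z \<in> S" for z
  using mder_zero_const[OF S(1) convex_connected[OF S(2)], of "%z. Y z ** X z"] that z0 by blast
 then have "Y z ** X z = mat 1" if "z \<in> S" for z using that X(1) Y0 by simp
 moreover from this have "X z ** Y z = mat 1" if "z \<in> S" for z using that left_inverse_imp_right by blast
 ultimately show ?thesis using X(2) Y unfolding fund_def by blast
qed (auto simp: fund_def)

text \<open>Invertibility at one point spreads: relative to some fundamental solution the given one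
  is a constant matrix, which is invertible because it is so at \<open>z0\<close>.\<close>

lemma fund_inverse:
 assumes S: "open S" "convex S" and A: "mhol A S"
  and X: "\<And>z. z \<in> S ==> has_mder X (A z ** X z) (at z)" "z0 \<in> S" "invertible (X z0)"
 shows "\<exists>Y. fund A S X Y"
proof -
 obtain G H where GH: "fund A S G H" using fund_exists_convex[OF S A] by blast
 obtain C where C: "\<And>z. z \<in> S ==> X z = G z ** C"
  using fund_solution[OF GH order_refl S(1) convex_connected[OF S(2)] X(1)] by blast
 obtain D where "X z0 ** D = mat 1" using X(3) by (auto simp: invertible_def)
 then have "G z0 ** (C ** D) = mat 1" using C[OF X(2)] by (simp add: mat_assoc)
 then have "C ** (D ** G z0) = mat 1"
  using left_inverse_imp_right[of "G z0" "C ** D"] by (simp add: mat_assoc)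
 from fund_multc[OF GH this] have F: "fund A S (%z. G z ** C) (%z. D ** G z0 ** H z)" .
 have "has_mder X (A z ** X z) (at z) \<and> X z = G z ** C" if "z \<in> S" for z using X(1) C that by blast
 then have "fund A S X (%z. D ** G z0 ** H z)"
  using F unfolding fund_def by (metis (no_types, lifting))
 then show ?thesis by blast
qed

text \<open>Every piece meets the convex core \<open>L\<close> in a convex set, and distinct pieces
  meet only inside \<open>L\<close>. A constant factor adjusts the solution on each piece to the one
  on the core, and no loop of pieces arises along which monodromy could obstruct the gluing.\<close>

lemma fund_glue:
 assumes L: "open L" "convex L" and A: "mhol A (L \<union> \<Union>\<N>)"
  and N: "\<And>N. N \<in> \<N> ==> open N \<and> convex N \<and> N \<inter> L ~= {}"
  and disj: "\<And>N N'. N \<in> \<N> ==> N' \<in> \<N> ==> N ~= N' ==> N \<inter> N' \<subseteq> L"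
 shows "\<exists>X Y. fund A (L \<union> \<Union>\<N>) X Y"
proof -
 obtain G H where GH: "fund A L G H"
  using fund_exists_convex[OF L mhol_subset[OF A]] by blast
 have "\<exists>X Y. fund A N X Y \<and> (\<forall>z\<in>N \<inter> L. X z = G z \<and> Y z = H z)" if "N \<in> \<N>" for N
 proof -
  have oc: "open N" "convex N" "N \<inter> L ~= {}" using N[OF that] by auto
  obtain X Y where XY: "fund A N X Y"
  proof -
   have "N \<subseteq> L \<union> \<Union>\<N>" using \<open>N \<in> \<N>\<close> by blast
   then have "mhol A N" by (rule mhol_subset[OF A])
   then show ?thesis using fund_exists_convex[OF oc(1,2)] that by blast
  qed
  have "open (N \<inter> L)" "connected (N \<inter> L)"
   using oc L by (auto intro: convex_connected convex_Int)
  from fund_solution[OF XY _ this, of G] obtain C where C: "\<And>z. z \<in> N \<inter> L ==> G z = X z ** C"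
   using fundD(1)[OF GH] by blast
  obtain z0 where z0: "z0 \<in> N" "z0 \<in> L" using oc by blast
  define D where "D = H z0 ** X z0"
  have "D ** C = mat 1" using C[of z0] z0 fundD(4)[OF GH, of z0] by (simp add: D_def mat_assoc)
  then have CD: "C ** D = mat 1" using left_inverse_imp_right by blast
  have H: "H z = D ** Y z" if z: "z \<in> N \<inter> L" for z
  proof -
   have "H z = H z ** (X z ** C ** (D ** Y z))"
    using fundD(3)[OF fund_multc[OF XY CD], of z] z by simp
   also have "\<dots> = (H z ** G z) ** (D ** Y z)" using C[OF z] by (simp add: mat_assoc)
   finally show ?thesis using fundD(4)[OF GH, of z] z by simp
  qed
  show ?thesis
   by (rule exI[of _ "%z. X z ** C"], rule exI[of _ "%z. D ** Y z"])
    (use fund_multc[OF XY CD] C H in auto)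
 qed
 then obtain GN HN where GN: "\<And>N. N \<in> \<N> ==> fund A N (GN N) (HN N)"
  "\<And>N z. N \<in> \<N> ==> z \<in> N \<inter> L ==> GN N z = G z \<and> HN N z = H z" by metis
 define ch where "ch z = (SOME N. N \<in> \<N> \<and> z \<in> N)" for z
 define X where "X z = (if z \<in> L then G z else GN (ch z) z)" for z
 define Y where "Y z = (if z \<in> L then H z else HN (ch z) z)" for z
 have onN: "X z = GN N z \<and> Y z = HN N z" if "N \<in> \<N>" "z \<in> N" for N z
 proof (cases "z \<in> L")
  case True then show ?thesis using GN(2)[OF that(1), of z] that by (simp add: X_def Y_def)
 next
  case False
  have "ch z \<in> \<N> \<and> z \<in> ch z" unfolding ch_def by (rule someI[of _ N]) (use that in blast)
  then have "ch z = N" using disj[of "ch z" N] that False by blast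
  then show ?thesis using False by (simp add: X_def Y_def)
 qed
 have loc: "fund A T X Y" if "fund A T X' Y'" "open T" "\<And>z. z \<in> T ==> X z = X' z \<and> Y z = Y' z" for T X' Y'
  unfolding fund_def
 proof (intro ballI conjI)
  fix z assume z: "z \<in> T"
  note f = fundD[OF that(1) z] and eq = that(3)[OF z]
  show "has_mder X (A z ** X z) (at z)"
   using has_mder_transform[OF f(1) that(2) z, of X] that(3) eq by simp
  show "has_mder Y (- (Y z ** A z)) (at z)"
   using has_mder_transform[OF f(2) that(2) z, of Y] that(3) eq by simp
  show "X z ** Y z = mat 1" "Y z ** X z = mat 1" using f eq by auto
 qed
 have "fund A L X Y" by (rule loc[OF GH L(1)]) (auto simp: X_def Y_def)
 moreover have "fund A N X Y" if "N \<in> \<N>" for N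
  by (rule loc[OF GN(1)[OF that]]) (use N onN that in auto)
 ultimately show ?thesis unfolding fund_def by blast
qed

text \<open>Gronwall's inequality in the form that exp (- 2 M u) |f u|^2 is nonincreasing; the inner
  product makes the squared norm differentiable.\<close>

lemma growth_bound:
 fixes f :: "real => 'a::real_inner"
 assumes "a <= b" and der: "\<And>u. a <= u ==> u <= b ==> (f has_vector_derivative f' u) (at u)"
  and bd: "\<And>u. a <= u ==> u <= b ==> norm (f' u) <= M * norm (f u)"
 shows "norm (f b) <= norm (f a) * exp (M * (b - a))"
proof -
 define g where "g u = exp (- 2 * M * u) * (f u \<bullet> f u)" for u
 have "g a \<ge> g b"
 proof (rule DERIV_nonpos_imp_nonincreasing[OF assms(1)])
  fix u assume u: "a <= u" "u <= b"
  have "((%u. f u \<bullet> f u) has_real_derivative 2 * (f u \<bullet> f' u)) (at u)"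
   using has_derivative_inner[OF der[OF u, unfolded has_vector_derivative_def] der[OF u, unfolded has_vector_derivative_def]]
   unfolding has_field_derivative_def
   by (rule has_derivative_eq_rhs) (auto simp: fun_eq_iff inner_commute)
  then have "(g has_real_derivative exp (- 2 * M * u) * (2 * (f u \<bullet> f' u) - 2 * M * (f u \<bullet> f u))) (at u)"
   unfolding g_def by (auto intro!: derivative_eq_intros simp: algebra_simps)
  moreover have "f u \<bullet> f' u <= M * (f u \<bullet> f u)"
  proof -
   have "f u \<bullet> f' u <= norm (f u) * norm (f' u)" by (rule norm_cauchy_schwarz)
   also have "\<dots> <= norm (f u) * (M * norm (f u))" using bd[OF u] by (intro mult_left_mono) auto
   finally show ?thesis by (simp add: power2_norm_eq_inner[symmetric] power2_eq_square mult_ac)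
  qed
  ultimately show "\<exists>y. (g has_real_derivative y) (at u) \<and> y <= 0"
   by (intro exI[of _ "exp (- 2 * M * u) * (2 * (f u \<bullet> f' u) - 2 * M * (f u \<bullet> f u))"] conjI)
    (auto simp: mult_nonneg_nonpos)
 qed
 then have "exp (- 2 * M * b) * (norm (f b))\<^sup>2 <= exp (- 2 * M * a) * (norm (f a))\<^sup>2"
  by (simp add: g_def power2_norm_eq_inner)
 then have "exp (2 * M * b) * (exp (- 2 * M * b) * (norm (f b))\<^sup>2) <= exp (2 * M * b) * (exp (- 2 * M * a) * (norm (f a))\<^sup>2)"
  by (intro mult_left_mono) auto
 then have "(norm (f b))\<^sup>2 <= exp (2 * M * b) * (exp (- 2 * M * a) * (norm (f a))\<^sup>2)"
  by (simp add: mult.assoc[symmetric] exp_add[symmetric])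
 also have "\<dots> = (norm (f a) * exp (M * (b - a)))\<^sup>2"
  by (simp add: power2_eq_square exp_add[symmetric] exp_diff exp_minus field_simps)
 finally show ?thesis by (rule power2_le_imp_le) simp
qed

section \<open>Spectral projections and functions of a diagonalisable matrix\<close>

lemma matrix_mult_column: "(A ** B) $ i $ j = (A *v column j B) $ i"
 by (simp add: matrix_matrix_mult_def matrix_vector_mult_def column_def)

lemma matrix_eq_on_columns:
 fixes A B Q :: "complex^'n^'n"
 assumes "invertible Q" "\<And>c. A *v column c Q = B *v column c Q"
 shows "A = B"
proof -
 obtain Q' where Q': "Q ** Q' = mat 1" using assms(1) by (auto simp: invertible_def)
 have "A ** Q = B ** Q" by (simp add: mat_eq_iff matrix_mult_column assms(2))
 then have "A ** (Q ** Q') = B ** (Q ** Q')" by (simp add: matrix_mul_assoc)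
 then show ?thesis by (simp add: Q')
qed

lemma sum_matrix_vector_mult: "(\<Sum>k\<in>I. f k) *v v = (\<Sum>k\<in>I. f k *v (v :: complex^'n))"
 by (induction I rule: infinite_finite_induct) (auto simp: matrix_vector_mult_add_rdistrib)

lemma msmult_vector_mult: "(c *\<^sub>m A) *v v = c *s (A *v v)"
 by (simp add: vec_eq_iff matrix_vector_mult_def sum_distrib_left mult.assoc)

text \<open>All identities are checked on the columns of the diagonalising matrix, a basis of
  eigenvectors; \<open>ka c\<close> is the index of the eigenvalue belonging to column
  \<open>c\<close>.\<close>

lemma diagonalisable_projections:
 fixes Z :: "complex^'n^'n" and m :: nat
 assumes "diagonalisable Z" and bij: "bij_betw z {1..m} (eigenvalues Z)"
  and pr: "\<forall>k \<in> {1..m}. is_eigenprojection Z (z k) (P k)"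
 shows "\<And>k l. k \<in> {1..m} ==> l \<in> {1..m} ==> P k ** P l = (if k = l then P k else 0)"
  and "(\<Sum>k=1..m. P k) = mat 1" and "Z = (\<Sum>k=1..m. z k *\<^sub>m P k)"
proof -
 obtain Q D :: "complex^'n^'n" where Q: "invertible Q" and D: "\<And>i j. i ~= j ==> D $ i $ j = 0"
  and Z: "Z = Q ** D ** matrix_inv Q"
  using assms(1) by (auto simp: diagonalisable_def)
 have "matrix_inv Q ** Q = mat 1"
  using Q unfolding invertible_def matrix_inv_def by (rule someI2_ex) blast
 then have ZQ: "Z ** Q = Q ** D" by (simp add: Z mat_assoc)
 have eig: "column c Q \<in> eigenspace Z (D $ c $ c)" for c
 proof -
  have "(Z *v column c Q) $ i = D $ c $ c * column c Q $ i" for i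
  proof -
   have "(Z *v column c Q) $ i = (\<Sum>k\<in>UNIV. Q $ i $ k * D $ k $ c)"
    using ZQ matrix_mult_column[of Z Q i c] by (simp add: matrix_matrix_mult_def)
   also have "\<dots> = (\<Sum>k\<in>{c}. Q $ i $ k * D $ k $ c)"
    by (rule sum.mono_neutral_right) (auto simp: D)
   finally show ?thesis by (simp add: column_def)
  qed
  then show ?thesis by (simp add: eigenspace_def vec_eq_iff)
 qed
 have nz: "column c Q ~= 0" for c
 proof
  assume "column c Q = 0"
  then have "(matrix_inv Q ** Q) $ c $ c = 0" unfolding matrix_mult_column by simp
  then show False using \<open>matrix_inv Q ** Q = mat 1\<close> by (simp add: mat_def)
 qed
 have ex: "\<exists>k\<in>{1..m}. D $ c $ c = z k" for c
  using eig[of c] nz[of c] bij unfolding bij_betw_def eigenvalues_def by blast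
 then obtain ka where ka: "\<And>c. ka c \<in> {1..m}" "\<And>c. D $ c $ c = z (ka c)" by metis
 have inj: "inj_on z {1..m}" using bij by (simp add: bij_betw_def)
 have Pc: "P k *v column c Q = (if k = ka c then column c Q else 0)" if "k \<in> {1..m}" for k c
 proof (cases "k = ka c")
  case True
  then show ?thesis using pr that eig[of c] ka(2)[of c] by (auto simp: is_eigenprojection_def)
 next
  case False
  then have "z (ka c) ~= z k" using inj ka(1)[of c] that by (auto dest: inj_onD)
  then show ?thesis using pr that eig[of c] ka(2)[of c] False by (auto simp: is_eigenprojection_def)
 qed
 show "P k ** P l = (if k = l then P k else 0)" if "k \<in> {1..m}" "l \<in> {1..m}" for k l
  by (rule matrix_eq_on_columns[OF Q])
   (use that in \<open>auto simp: matrix_vector_mul_assoc[symmetric] Pc\<close>)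
 show "(\<Sum>k=1..m. P k) = mat 1"
 proof (rule matrix_eq_on_columns[OF Q])
  fix c
  have "(\<Sum>k=1..m. P k) *v column c Q = (\<Sum>k=1..m. if k = ka c then column c Q else 0)"
   unfolding sum_matrix_vector_mult by (intro sum.cong refl) (simp add: Pc)
  then show "(\<Sum>k=1..m. P k) *v column c Q = mat 1 *v column c Q"
   using ka(1)[of c] sum.delta[of "{1..m}" "ka c" "%k. column c Q"] by simp
 qed
 show "Z = (\<Sum>k=1..m. z k *\<^sub>m P k)"
 proof (rule matrix_eq_on_columns[OF Q])
  fix c
  have "(\<Sum>k=1..m. z k *\<^sub>m P k) *v column c Q = (\<Sum>k=1..m. if k = ka c then z k *s column c Q else 0)"
   unfolding sum_matrix_vector_mult by (intro sum.cong refl) (simp add: Pc msmult_vector_mult)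
  also have "\<dots> = z (ka c) *s column c Q" using ka(1)[of c] by (simp add: sum.delta)
  finally show "Z *v column c Q = (\<Sum>k=1..m. z k *\<^sub>m P k) *v column c Q"
   using eig[of c] ka(2)[of c] by (simp add: eigenspace_def)
 qed
qed

locale projections =
 fixes m :: nat and P :: "nat => complex^'n^'n"
 assumes orth: "\<And>k l. k \<in> {1..m} ==> l \<in> {1..m} ==> P k ** P l = (if k = l then P k else 0)"
  and sumP: "(\<Sum>k=1..m. P k) = mat 1"
begin

text \<open>Functional calculus of a diagonalisable matrix: for the eigenvalues z,
  \<open>diag z\<close> is Z, and the values exp (z k / t) give the exponential of Z / t.\<close>

definition diag :: "(nat => complex) => complex^'n^'n" where
 "diag f = (\<Sum>k=1..m. f k *\<^sub>m P k)"

lemma diag_mult: "diag f ** diag g = diag (%k. f k * g k)"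
proof -
 have "diag f ** diag g = (\<Sum>k=1..m. \<Sum>l=1..m. (f k * g l) *\<^sub>m (P k ** P l))"
  unfolding diag_def by (subst mm.sum_left) (intro sum.cong refl, simp add: mm.sum_right mult.commute)
 also have "\<dots> = (\<Sum>k=1..m. \<Sum>l=1..m. if l = k then (f k * g k) *\<^sub>m P k else 0)"
  by (intro sum.cong refl) (auto simp: orth)
 finally show ?thesis by (simp add: diag_def sum.delta)
qed

lemma P_diag: "k \<in> {1..m} ==> P k ** diag f = f k *\<^sub>m P k"
proof -
 assume k: "k \<in> {1..m}"
 have "P k ** diag f = (\<Sum>l=1..m. f l *\<^sub>m (P k ** P l))" unfolding diag_def mm.sum_right by simp
 also have "\<dots> = (\<Sum>l=1..m. if l = k then f k *\<^sub>m P k else 0)"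
  using k by (intro sum.cong refl) (auto simp: orth)
 finally show ?thesis using k by (simp add: sum.delta)
qed

lemma diag_P: "k \<in> {1..m} ==> diag f ** P k = f k *\<^sub>m P k"
proof -
 assume k: "k \<in> {1..m}"
 have "diag f ** P k = (\<Sum>l=1..m. f l *\<^sub>m (P l ** P k))" unfolding diag_def mm.sum_left by simp
 also have "\<dots> = (\<Sum>l=1..m. if l = k then f k *\<^sub>m P k else 0)"
  using k by (intro sum.cong refl) (auto simp: orth)
 finally show ?thesis using k by (simp add: sum.delta)
qed

lemma diag_one: "diag (%k. 1) = mat 1"
 by (simp add: diag_def sumP del: One_nat_def)

lemma diag_cmult: "c *\<^sub>m diag f = diag (%k. c * f k)"
 unfolding diag_def ms.sum_right by simp

lemma mpow_diag: "mpow (diag f) n = diag (%k. f k ^ n)"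
 by (induction n) (auto simp: mpow_def diag_one diag_mult)

lemma mexp_diag: "mexp (diag f) = diag (%k. exp (f k))"
proof -
 have "(%n. \<Sum>k=1..m. (f k ^ n /\<^sub>R fact n) *\<^sub>m P k) sums (\<Sum>k=1..m. exp (f k) *\<^sub>m P k)"
  by (intro sums_sum bounded_linear.sums[OF ms.bounded_linear_left] exp_converges)
 also have "(%n. \<Sum>k=1..m. (f k ^ n /\<^sub>R fact n) *\<^sub>m P k) = (%n. (1 / fact n) *\<^sub>m mpow (diag f) n)"
  by (simp add: mpow_diag fun_eq_iff) (simp add: diag_def ms.sum_right scaleR_conv_of_real field_simps)
 finally show ?thesis by (simp add: mexp_def sums_iff diag_def)
qed

lemma matrix_eq_P: fixes A B :: "complex^'n^'n" shows "(\<And>k. k \<in> {1..m} ==> P k ** A = P k ** B) ==> A = B"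
proof -
 assume *: "\<And>k. k \<in> {1..m} ==> P k ** A = P k ** B"
 have "(\<Sum>k=1..m. P k) ** A = (\<Sum>k=1..m. P k) ** B"
  unfolding mm.sum_left by (rule sum.cong[OF refl]) (rule *)
 then show ?thesis by (simp add: sumP del: One_nat_def)
qed

end

lemma mexp_nilpotent:
 fixes A :: "complex^'n^'n"
 assumes "A ** A = 0"
 shows "mexp (c *\<^sub>m A) = mat 1 + c *\<^sub>m A"
proof -
 have "mpow (c *\<^sub>m A) (Suc (Suc n)) = 0" for n
  by (induction n) (auto simp: mpow_def assms mm.zero_right)
 then have z: "mpow (c *\<^sub>m A) n = 0" if "n \<notin> {..<2}" for n
  using that by (metis Suc_1 less_Suc_eq_0_disj lessThan_iff not0_implies_Suc not_less_eq numeral_2_eq_2 One_nat_def)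
 have "(%n. (1 / fact n) *\<^sub>m mpow (c *\<^sub>m A) n) sums (\<Sum>n<2. (1 / fact n) *\<^sub>m mpow (c *\<^sub>m A) n)"
  by (rule sums_finite) (use z in auto)
 then show ?thesis by (simp add: mexp_def sums_iff numeral_2_eq_2 mpow_def)
qed

section \<open>Blocks of the Stokes factor off the ray and on the diagonal\<close>

text \<open>No bound on \<open>q\<close> is assumed: once \<open>X\<close> is within 1/2 of the
  identity, norm q <= 2 norm (X q), and then q - X q tends to 0.\<close>

lemma tendsto_cancel_left_factor:
 fixes X q :: "'a => complex^'n^'n"
 assumes X: "(X \<longlongrightarrow> mat 1) G" and Xq: "((%t. X t ** q t) \<longlongrightarrow> C) G"
 shows "(q \<longlongrightarrow> C) G"
proof -
 have e1: "\<forall>\<^sub>F t in G. norm (X t - mat 1) < 1/2"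
  using tendstoD[OF X, of "1/2"] by (simp only: dist_norm)
 have "\<forall>\<^sub>F t in G. norm (X t ** q t - C) < 1"
  using Xq by (simp add: tendsto_iff dist_norm)
 then have e2: "\<forall>\<^sub>F t in G. norm (X t ** q t) < norm C + 1"
 proof (rule eventually_mono)
  fix t assume "norm (X t ** q t - C) < 1"
  then show "norm (X t ** q t) < norm C + 1" using norm_triangle_ineq2[of "X t ** q t" C] by linarith
 qed
 have e3: "\<forall>\<^sub>F t in G. norm (q t - X t ** q t) <= norm (X t - mat 1) * (2 * (norm C + 1))"
  using e1 e2
 proof eventually_elim
  case (elim t)
  have eq: "q t - X t ** q t = - ((X t - mat 1) ** q t)" by (simp add: mat_distrib)
  have le: "norm (q t - X t ** q t) <= norm (X t - mat 1) * norm (q t)"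
   unfolding eq norm_minus_cancel by (rule norm_matrix_mult_le)
  have "norm (X t - mat 1) * norm (q t) <= 1/2 * norm (q t)"
   using elim by (intro mult_right_mono) auto
  then have "norm (q t) <= norm (X t ** q t) + 1/2 * norm (q t)"
   using le norm_triangle_ineq2[of "q t" "X t ** q t"] by linarith
  then have "norm (q t) <= 2 * norm (X t ** q t)" by (simp add: field_simps)
  also have "\<dots> <= 2 * (norm C + 1)" using elim by (intro mult_left_mono) auto
  finally have "norm (q t) <= 2 * (norm C + 1)" .
  then show ?case using le by (meson mult_left_mono norm_ge_zero order_trans)
 qed
 have "((%t. norm (X t - mat 1) * (2 * (norm C + 1))) \<longlongrightarrow> norm (mat 1 - mat 1 :: complex^'n^'n) * (2 * (norm C + 1))) G"
  by (intro tendsto_intros X)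
 then have "((%t. norm (X t - mat 1) * (2 * (norm C + 1))) \<longlongrightarrow> 0) G" by simp
 from Lim_null_comparison[OF e3 this] have "((%t. q t - X t ** q t) \<longlongrightarrow> 0) G" .
 from tendsto_add[OF this Xq] show ?thesis by simp
qed

text \<open>Up to full turns, the angles th that have positive cosine with every direction in
  [al, be] form the interval (be - pi/2, al + pi/2). Some of them make an obtuse angle with
  \<open>w\<close> unless the direction of \<open>w\<close> lies in [al, be] itself.\<close>

lemma obtuse_direction:
 fixes w :: complex
 assumes w: "w ~= 0" and ab: "al <= be" "be < al + pi"
  and no: "\<And>x r. al <= x ==> x <= be ==> 0 < r ==> w ~= of_real r * cis x"
 shows "\<exists>th. be - pi/2 < th \<and> th < al + pi/2 \<and> Re (w * cis (- th)) < 0"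
proof -
 \<comment> \<open>Full turns are added so that the argument \<open>ps\<close> of \<open>w\<close>
   lands in [al, al + 2 pi).\<close>
 define n where "n = \<lceil>(al - Arg w) / (2 * pi)\<rceil>"
 define ps where "ps = Arg w + 2 * pi * of_int n"
 have n: "(al - Arg w) / (2 * pi) <= of_int n" "of_int n < (al - Arg w) / (2 * pi) + 1"
  unfolding n_def by linarith+
 have ps: "al <= ps" "ps < al + 2 * pi"
  using n pi_gt_zero unfolding ps_def by (simp_all add: field_simps)
 have wc: "w = of_real (norm w) * cis ps"
 proof -
  have "cis ps = cis (Arg w) * cis (2 * pi * of_int n)" by (simp only: ps_def cis_mult)
  also have "cis (2 * pi * of_int n) = 1" by (rule cis_multiple_2pi) simp
  finally have "cis ps = cis (Arg w)" by (simp only: mult_1_right)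
  then show ?thesis using rcis_cmod_Arg[of w] by (simp add: rcis_def)
 qed
 then have "be < ps" using no[of ps "norm w"] ps(1) w by force
 \<comment> \<open>Midpoint of the intersection of two intervals: for th between ps - 3 pi/2 and ps
   - pi/2 the angle with \<open>w\<close> is obtuse.\<close>
 define th where "th = (max (ps - 3*pi/2) (be - pi/2) + min (ps - pi/2) (al + pi/2)) / 2"
 have th: "max (ps - 3*pi/2) (be - pi/2) < th" "th < min (ps - pi/2) (al + pi/2)"
  using ps \<open>be < ps\<close> ab pi_gt_zero unfolding th_def by (auto simp: max_def min_def field_simps)
 have "cos (ps - th) = - cos (ps - th - pi)" by (simp add: cos_diff)
 moreover have "0 < cos (ps - th - pi)" using th by (intro cos_gt_zero_pi) auto
 ultimately have "cos (ps - th) < 0" by simp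
 moreover have "Re (w * cis (- th)) = norm w * cos (ps - th)"
  by (subst wc) (simp add: mult.assoc cis_mult)
 ultimately have "Re (w * cis (- th)) < 0" using w by (simp add: mult_pos_neg)
 then show ?thesis using th by auto
qed

lemma rotate_ray_through: "rotate_ray th (ray_through w) = ray_through (cis th * w)"
 by (auto simp: rotate_ray_def ray_through_def image_def mult_ac)

lemma half_plane_ray_through:
 assumes "w ~= 0" shows "half_plane (ray_through w) = {t. 0 < Re (t / w)}"
proof (intro set_eqI iffI)
 fix t assume "t \<in> half_plane (ray_through w)"
 then obtain x v where "0 < x" "0 < Re v" "t = of_real x * w * v" by (auto simp: half_plane_def ray_through_def)
 then show "t \<in> {t. 0 < Re (t / w)}" using assms by simp
next
 fix t assume t: "t \<in> {t. 0 < Re (t / w)}"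
 have "t = (of_real 1 * w) * (t / w)" using assms by simp
 then show "t \<in> half_plane (ray_through w)" using t
  unfolding half_plane_def ray_through_def by (smt (verit) mem_Collect_eq)
qed

lemma open_half_plane: "w ~= 0 ==> open (half_plane (ray_through w))"
 unfolding half_plane_ray_through by (intro open_Collect_less continuous_intros) auto

lemma convex_half_plane: "w ~= 0 ==> convex (half_plane (ray_through w))"
 unfolding half_plane_ray_through
proof (rule convexI)
 fix x y and u v :: real
 assume "w ~= 0" "x \<in> {t. 0 < Re (t / w)}" "y \<in> {t. 0 < Re (t / w)}" "0 <= u" "0 <= v" "u + v = 1"
 moreover have "Re ((u *\<^sub>R x + v *\<^sub>R y) / w) = u * Re (x / w) + v * Re (y / w)"
  by (simp add: add_divide_distrib scaleR_conv_of_real)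
   (metis Re_complex_of_real mult.commute times_divide_eq_left scaleR_complex.simps(1) scaleR_conv_of_real times_divide_eq_right)
 ultimately show "u *\<^sub>R x + v *\<^sub>R y \<in> {t. 0 < Re (t / w)}"
  by (smt (verit) mem_Collect_eq mult_nonneg_nonneg mult_pos_pos)
qed

lemma Re_scaled: "Re (of_real s * t / v) = s * Re (t / v)"
proof -
 have eq: "of_real s * t / v = of_real s * (t / v)" by simp
 show ?thesis unfolding eq times_complex.sel by simp
qed

lemma tendsto_along_ray:
 assumes lim: "(f \<longlongrightarrow> L) (at 0 within half_plane (ray_through w))" and w: "w ~= 0"
  and t: "0 < Re (t / w)"
 shows "((%s. f (of_real s * t)) \<longlongrightarrow> L) (at_right (0::real))"
proof (rule filterlim_compose[OF lim])
 have t0: "t ~= 0" using t by auto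
 have "((%s. of_real s * t) \<longlongrightarrow> of_real 0 * t) (at_right (0::real))" by (intro tendsto_intros)
 moreover have "\<forall>\<^sub>F s::real in at_right 0. of_real s * t \<in> half_plane (ray_through w) - {0}"
  using eventually_at_right_less[of "0::real"]
 proof eventually_elim
  case (elim s)
  then show ?case using t t0 w by (simp add: half_plane_ray_through Re_scaled)
 qed
 ultimately show "filterlim (%s. of_real s * t) (at 0 within half_plane (ray_through w)) (at_right (0::real))"
  by (auto simp: filterlim_at elim: eventually_mono)
qed


lemma ray_through_mult:
 assumes "0 < r" shows "ray_through (of_real r * w) = ray_through w"
proof (intro set_eqI iffI)
 fix u assume "u \<in> ray_through (of_real r * w)"
 then obtain x where "0 < x" "u = of_real x * (of_real r * w)" by (auto simp: ray_through_def)
 then have "0 < x * r" "u = of_real (x * r) * w" using assms by auto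
 then show "u \<in> ray_through w" unfolding ray_through_def by blast
next
 fix u assume "u \<in> ray_through w"
 then obtain x where "0 < x" "u = of_real x * w" by (auto simp: ray_through_def)
 then have "0 < x / r" "u = of_real (x / r) * (of_real r * w)" using assms by auto
 then show "u \<in> ray_through (of_real r * w)" unfolding ray_through_def by blast
qed

context projections
begin

lemma mexp_diag_scaled: "mexp (c *\<^sub>m diag f) = diag (%k. exp (c * f k))"
 by (simp add: diag_cmult mexp_diag)

lemma diag_exp_inverse: "diag (%k. exp (f k)) ** diag (%k. exp (- f k)) = mat 1"
 by (simp add: diag_mult exp_add[symmetric] diag_one)

text \<open>On the common half plane Y_- e^(Z/t) is Y_+ e^(Z/t) times e^(-Z/t) S e^(Z/t). The first
  two tend to 1, hence so does the conjugate of S, whose block (j, i) is that of S times exp ((z_i -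
  z_j)/t).\<close>

lemma stokes_conjugation_limit:
 assumes d: "d ~= 0"
  and lp: "((%t. Yp t ** mexp ((1 / t) *\<^sub>m diag z)) \<longlongrightarrow> mat 1) (at 0 within half_plane (ray_through (cis a * d)))"
  and lm: "((%t. Ym t ** mexp ((1 / t) *\<^sub>m diag z)) \<longlongrightarrow> mat 1) (at 0 within half_plane (ray_through (cis (-b) * d)))"
  and S: "\<And>t. t \<in> half_plane (ray_through (cis (-b) * d)) \<inter> half_plane (ray_through (cis a * d)) ==> Ym t = Yp t ** S"
  and u: "0 < Re (u / (cis a * d))" "0 < Re (u / (cis (-b) * d))"
  and ij: "i \<in> {1..m}" "j \<in> {1..m}"
 shows "((%s. exp ((z i - z j) / (of_real s * u)) *\<^sub>m (P j ** S ** P i)) \<longlongrightarrow> P j ** P i) (at_right (0::real))"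
proof -
 define E where "E s = diag (%k. exp ((1 / (of_real s * u)) * z k))" for s :: real
 define E' where "E' s = diag (%k. exp (- ((1 / (of_real s * u)) * z k)))" for s :: real
 have EE: "E s ** E' s = mat 1" for s unfolding E_def E'_def by (rule diag_exp_inverse)
 have cd: "cis a * d ~= 0" "cis (-b) * d ~= 0" using d by auto
 have L1: "((%s. Yp (of_real s * u) ** E s) \<longlongrightarrow> mat 1) (at_right 0)"
  using tendsto_along_ray[OF lp cd(1) u(1)] by (simp add: mexp_diag_scaled E_def)
 have L2: "((%s. Ym (of_real s * u) ** E s) \<longlongrightarrow> mat 1) (at_right 0)"
  using tendsto_along_ray[OF lm cd(2) u(2)] by (simp add: mexp_diag_scaled E_def)
 have "\<forall>\<^sub>F s in at_right 0. Ym (of_real s * u) ** E s = (Yp (of_real s * u) ** E s) ** (E' s ** S ** E s)"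
  using eventually_at_right_less[of "0::real"]
 proof eventually_elim
  case (elim s)
  have "of_real s * u \<in> half_plane (ray_through (cis (-b) * d)) \<inter> half_plane (ray_through (cis a * d))"
   using elim u cd by (simp add: half_plane_ray_through Re_scaled)
  then have "Ym (of_real s * u) = Yp (of_real s * u) ** S" by (rule S)
  moreover have "(Yp (of_real s * u) ** E s) ** (E' s ** S ** E s) = Yp (of_real s * u) ** ((E s ** E' s) ** (S ** E s))"
   by (simp add: mat_assoc)
  ultimately show ?case by (simp add: EE mat_assoc)
 qed
 then have "((%s. (Yp (of_real s * u) ** E s) ** (E' s ** S ** E s)) \<longlongrightarrow> mat 1) (at_right 0)"
  using L2 by (simp add: tendsto_cong)
 from tendsto_cancel_left_factor[OF L1 this]
 have "((%s. E' s ** S ** E s) \<longlongrightarrow> mat 1) (at_right 0)" .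
 then have "((%s. P j ** (E' s ** S ** E s) ** P i) \<longlongrightarrow> P j ** mat 1 ** P i) (at_right 0)"
  by (intro mm.tendsto tendsto_const)
 moreover have "P j ** (E' s ** S ** E s) ** P i = exp ((z i - z j) / (of_real s * u)) *\<^sub>m (P j ** S ** P i)" for s
 proof -
  have "P j ** (E' s ** S ** E s) ** P i = (P j ** E' s) ** S ** (E s ** P i)" by (simp add: mat_assoc)
  also have "\<dots> = exp ((z i - z j) / (of_real s * u)) *\<^sub>m (P j ** S ** P i)"
   using ij by (simp add: P_diag diag_P E_def E'_def mat_assoc exp_add[symmetric] diff_divide_distrib)
  finally show ?thesis .
 qed
 ultimately show ?thesis by simp
qed

text \<open>If the direction of z_j - z_i lies outside the closed sector of the perturbed rays, then
  along some ray in the common half plane exp ((z_i - z_j)/t) has modulus at least 1, so the block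
  can tend to 0 only by vanishing. On the diagonal the exponential is 1.\<close>

lemma stokes_factor_entries:
 assumes sf: "is_stokes_factor (diag z) F l S" and l: "l \<in> stokes_rays (diag z)"
  and ev: "eigenvalues (diag z) = z ` {1..m}" and ij: "i \<in> {1..m}" "j \<in> {1..m}"
 shows "z j ~= z i ==> \<not> ray_less l (z i) (z j) ==> P j ** S ** P i = 0"
  and "P i ** S ** P i = P i"
proof -
 obtain p q where "p ~= q" "l = ray_through (p - q)"
  using l by (auto simp: stokes_rays_def)
 then obtain d where d: "d ~= 0" "l = ray_through d" by (metis right_minus_eq)
 obtain a b Yp Ym where ab: "0 < a" "a < pi / 2" "0 < b" "b < pi / 2"
  and no: "\<forall>th \<in> {-b..a}. th ~= 0 --> rotate_ray th l \<notin> stokes_rays (diag z)"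
  and cp: "is_canonical_solution (diag z) F (rotate_ray a l) Yp"
  and cm: "is_canonical_solution (diag z) F (rotate_ray (-b) l) Ym"
  and S: "\<forall>t \<in> half_plane (rotate_ray (-b) l) \<inter> half_plane (rotate_ray a l). Ym t = Yp t ** S"
  using sf by (auto simp: is_stokes_factor_def)
 note lim = stokes_conjugation_limit[OF d(1) cp[unfolded is_canonical_solution_def d(2) rotate_ray_through, THEN conjunct2, THEN conjunct2, THEN conjunct2]
   cm[unfolded is_canonical_solution_def d(2) rotate_ray_through, THEN conjunct2, THEN conjunct2, THEN conjunct2]
   S[unfolded d(2) rotate_ray_through, rule_format]]
 have re: "Re (d * cis th / (cis x * d)) = cos (th - x)" for th x
 proof -
  have "d * cis th / (cis x * d) = cis th / cis x" using d(1) by simp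
  then show ?thesis by (simp add: cis_divide)
 qed
 show "P i ** S ** P i = P i"
 proof -
  have "((%s. P i ** S ** P i) \<longlongrightarrow> P i ** P i) (at_right (0::real))"
   using lim[of "d * cis 0" i i] re[of 0] ab ij by (simp add: cos_gt_zero_pi)
  then show ?thesis using ij orth[of i i] by (simp add: tendsto_const_iff)
 qed
 assume ne: "z j ~= z i" and nl: "\<not> ray_less l (z i) (z j)"
 define w where "w = (z j - z i) / d"
 have w: "w ~= 0" using ne d by (simp add: w_def)
 \<comment> \<open>A direction of z_j - z_i inside the sector would be a Stokes ray, hence l itself,
   and would put z_j on z_i + l.\<close>
 have "w ~= of_real r * cis x" if "- b <= x" "x <= a" "0 < r" for x r
 proof
  assume "w = of_real r * cis x"
  then have zz: "z j - z i = of_real r * (cis x * d)" using d by (simp add: w_def field_simps)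
  then have "rotate_ray x l = ray_through (z j - z i)"
   using that by (simp only: ray_through_mult rotate_ray_through d(2))
  moreover have "\<dots> \<in> stokes_rays (diag z)"
   using ne ij unfolding stokes_rays_def ev by blast
  ultimately have "x = 0" using no that by (metis atLeastAtMost_iff)
  then have "z j - z i \<in> l" using zz that d by (auto simp: ray_through_def)
  then have "ray_less l (z i) (z j)" unfolding ray_less_def image_iff by (intro bexI[of _ "z j - z i"]) auto
  then show False using nl by simp
 qed
 then obtain th where th: "a - pi/2 < th" "th < - b + pi/2" "Re (w * cis (- th)) < 0"
  using obtuse_direction[OF w, of "- b" a] ab by auto
 have L: "((%s. exp ((z i - z j) / (of_real s * (d * cis th))) *\<^sub>m (P j ** S ** P i)) \<longlongrightarrow> P j ** P i) (at_right (0::real))"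
  using lim[of "d * cis th" i j] re[of th] th ab ij by (simp add: cos_gt_zero_pi)
 have "P j ** P i = 0" using orth[of j i] ij ne by auto
 then have L0: "((%s. norm (exp ((z i - z j) / (of_real s * (d * cis th))) *\<^sub>m (P j ** S ** P i))) \<longlongrightarrow> 0) (at_right (0::real))"
  using tendsto_norm[OF L] by simp
 have "norm (P j ** S ** P i) <= 0"
 proof (rule tendsto_lowerbound[OF L0])
  show "\<forall>\<^sub>F s::real in at_right 0. norm (P j ** S ** P i) <= norm (exp ((z i - z j) / (of_real s * (d * cis th))) *\<^sub>m (P j ** S ** P i))"
   using eventually_at_right_less[of "0::real"]
  proof eventually_elim
   case (elim s)
   have "(z i - z j) / (of_real s * (d * cis th)) = of_real (- 1 / s) * (w * cis (- th))"
    using d elim by (simp add: w_def field_simps cis_mult[symmetric] cis_inverse[symmetric])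
   then have "Re ((z i - z j) / (of_real s * (d * cis th))) = - 1 / s * Re (w * cis (- th))" by simp
   also have "\<dots> \<ge> 0" using elim th(3) by (simp add: divide_nonpos_pos)
   finally show ?case by (simp add: mult_le_cancel_right1)
  qed
 qed simp
 then show "P j ** S ** P i = 0" by simp
qed

end

section \<open>Local solutions at a pole with nilpotent residue\<close>

definition commut :: "complex^'n^'n => complex^'n^'n => complex^'n^'n" where
 "commut A X = A ** X - X ** A"

text \<open>For A^2 = 0 the double commutator is - 2 A X A, which \<open>A\<close> annihilates from
  both sides.\<close>

lemma commut_nilpotent:
 fixes A X :: "complex^'n^'n"
 assumes "A ** A = 0" shows "commut A (commut A (commut A X)) = 0"
proof -
 have "A ** (A ** M) = 0" for M :: "complex^'n^'n" using assms by (simp add: matrix_mul_assoc mm.zero_left)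
 moreover define N where "N = A ** (X ** A)"
 ultimately have N: "A ** N = 0" "N ** A = 0"
  using assms by (simp_all add: mat_assoc mm.zero_right)
 have eq: "commut A (commut A X) = - N - N"
  using assms \<open>\<And>M. A ** (A ** M) = 0\<close>
  by (simp add: commut_def mat_distrib mat_assoc mm.zero_right N_def)
 show ?thesis unfolding eq unfolding commut_def mat_distrib N by simp
qed

lemma commut_add: "commut A (X + Y) = commut A X + commut A Y"
 by (simp add: commut_def mat_distrib)

lemma commut_msmult: "commut A (c *\<^sub>m X) = c *\<^sub>m commut A X"
 by (simp add: commut_def mat_distrib)

lemma norm_commut: "norm (commut A X) <= 2 * norm A * norm X"
proof -
 have "norm (commut A X) <= norm (A ** X) + norm (X ** A)" unfolding commut_def by (rule norm_triangle_ineq4)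
 also have "\<dots> <= norm A * norm X + norm X * norm A" by (intro add_mono norm_matrix_mult_le)
 finally show ?thesis by (simp add: mult_ac)
qed

text \<open>Inverse of \<open>X \<mapsto> n X - [A, X]\<close> for \<open>A\<^sup>2 = 0\<close> and \<open>n > 0\<close>: the commutator with \<open>A\<close> is nilpotent
 of order three.\<close>
definition commut_resolvent :: "complex^'n^'n => nat => complex^'n^'n => complex^'n^'n" where
 "commut_resolvent A n X = (1 / of_nat n) *\<^sub>m X + (1 / of_nat n ^ 2) *\<^sub>m commut A X
   + (1 / of_nat n ^ 3) *\<^sub>m commut A (commut A X)"

lemma commut_resolvent:
 assumes "A ** A = 0" "0 < n"
 shows "of_nat n *\<^sub>m commut_resolvent A n X = commut A (commut_resolvent A n X) + X"
proof -
 have "of_nat n ~= (0::complex)" using assms by simp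
 then show ?thesis unfolding commut_resolvent_def
  by (simp add: commut_add commut_msmult commut_nilpotent[OF assms(1)] mat_distrib field_simps
    power2_eq_square power3_eq_cube)
qed

text \<open>The bound is independent of \<open>n\<close>; this uniformity turns the recursion for
  the power series into a geometric estimate.\<close>

lemma norm_commut_resolvent:
 assumes "0 < n"
 shows "norm (commut_resolvent A n X) <= (1 + 2 * norm A + 4 * (norm A)\<^sup>2) * norm X"
proof -
 have i: "norm ((1 / of_nat n ^ k) *\<^sub>m M) <= norm M" for k and M :: "complex^'n^'n"
 proof -
  have "1 <= real n ^ k" using assms by (simp add: one_le_power)
  then have "norm (1 / (of_nat n :: complex) ^ k) <= 1" using assms by (simp add: norm_divide norm_power divide_le_eq_1)
  then show ?thesis by (simp add: mult_left_le_one_le)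
 qed
 have "norm (commut_resolvent A n X) <= norm X + norm (commut A X) + norm (commut A (commut A X))"
  unfolding commut_resolvent_def using i[of 1 X]
  by (intro order_trans[OF norm_triangle_ineq] add_mono i) simp_all
 also have "\<dots> <= norm X + 2 * norm A * norm X + 2 * norm A * (2 * norm A * norm X)"
  using norm_commut[of A X] norm_commut[of A "commut A X"]
   mult_left_mono[OF norm_commut[of A X], of "2 * norm A"]
  by (smt (verit) norm_ge_zero mult_nonneg_nonneg)
 finally show ?thesis by (simp add: algebra_simps power2_eq_square)
qed

text \<open>Power series coefficients h_n of H with H(0) = 1 and zeta H' = [A, H] + zeta B H. Order
  n reads n h_n - [A, h_n] = known terms, solvable for every n > 0 because the commutator with A is
  nilpotent: resonances cannot occur.\<close>

fun frobenius_coeff :: "complex^'n^'n => (nat => complex^'n^'n) => nat => complex^'n^'n" where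
 "frobenius_coeff A b n = (if n = 0 then mat 1 else
   commut_resolvent A n (\<Sum>q<n. b (n - Suc q) ** frobenius_coeff A b q))"

declare frobenius_coeff.simps [simp del]


text \<open>The constant \<open>ta\<close> is chosen so that (1 + 2 |A| + 4 |A|^2) be <= ta - si;
  the convolution sum then telescopes to ta^n - si^n.\<close>

lemma norm_frobenius_coeff:
 fixes A :: "complex^'n^'n" and b :: "nat => complex^'n^'n"
 assumes b: "\<And>n. norm (b n) <= be * si ^ n" and "0 <= be" "0 <= si"
  and ta: "ta = si + (1 + 2 * norm A + 4 * (norm A)\<^sup>2) * be + 1"
 shows "norm (frobenius_coeff A b n) <= norm (mat 1 :: complex^'n^'n) * ta ^ n"
proof (induction n rule: less_induct)
 case (less n)
 define c where "c = norm (mat 1 :: complex^'n^'n)"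
 define ka where "ka = 1 + 2 * norm A + 4 * (norm A)\<^sup>2"
 have pos: "0 <= c" "0 <= ka" by (simp_all add: c_def ka_def)
 then have ta0: "0 <= ta" using assms by (simp add: ta ka_def)
 show ?case
 proof (cases "n = 0")
  case False
  have "norm (frobenius_coeff A b n) <= ka * norm (\<Sum>q<n. b (n - Suc q) ** frobenius_coeff A b q)"
   using False norm_commut_resolvent[of n A] by (simp add: frobenius_coeff.simps[of A b n] ka_def)
  also have "\<dots> <= ka * (\<Sum>q<n. (be * si ^ (n - Suc q)) * (c * ta ^ q))"
  proof (rule mult_left_mono[OF sum_norm_le pos(2)])
   fix q assume q: "q \<in> {..<n}"
   have "norm (b (n - Suc q) ** frobenius_coeff A b q) <= norm (b (n - Suc q)) * norm (frobenius_coeff A b q)"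
    by (rule norm_matrix_mult_le)
   also have "\<dots> <= (be * si ^ (n - Suc q)) * (c * ta ^ q)"
    using b less q assms pos ta0 unfolding c_def by (intro mult_mono) auto
   finally show "norm (b (n - Suc q) ** frobenius_coeff A b q) <= (be * si ^ (n - Suc q)) * (c * ta ^ q)" .
  qed
  also have "(\<Sum>q<n. (be * si ^ (n - Suc q)) * (c * ta ^ q)) = be * c * (\<Sum>q<n. si ^ (n - Suc q) * ta ^ q)"
   by (simp add: sum_distrib_left mult_ac)
  finally have "norm (frobenius_coeff A b n) <= c * ((ka * be) * (\<Sum>q<n. si ^ (n - Suc q) * ta ^ q))"
   using pos by (simp add: mult_ac)
  also have "(ka * be) * (\<Sum>q<n. si ^ (n - Suc q) * ta ^ q) <= (ta - si) * (\<Sum>q<n. si ^ (n - Suc q) * ta ^ q)"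
   using assms ta0 by (intro mult_right_mono sum_nonneg mult_nonneg_nonneg zero_le_power) (auto simp: ta ka_def)
  also have "\<dots> = ta ^ n - si ^ n" by (rule power_diff_sumr2[symmetric])
  also have "\<dots> <= ta ^ n" using assms by simp
  finally show ?thesis using pos by (simp add: c_def mult_left_mono)
 qed (simp add: frobenius_coeff.simps)
qed

text \<open>The gauge transformation H removes the holomorphic part B from the connection A / zeta +
  B. Its coefficients grow at most geometrically, and comparing coefficients through a Cauchy
  product gives the equation.\<close>

lemma frobenius_solution:
 fixes A :: "complex^'n^'n" and b :: "nat => complex^'n^'n"
 assumes A: "A ** A = 0"
  and b: "\<And>n. norm (b n) <= be * si ^ n" and be: "0 <= be" and si: "0 < si"
  and B: "\<And>ze. norm ze < 1 / si ==> (%n. ze ^ n *\<^sub>m b n) sums B ze"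
 shows "\<exists>rh>0. \<exists>H. H 0 = mat 1 \<and> (\<forall>ze. norm ze < rh -->
  (\<exists>D. has_mder H D (at ze) \<and> ze *\<^sub>m D = A ** H ze - H ze ** A + ze *\<^sub>m (B ze ** H ze)))"
proof -
 define ta where "ta = si + (1 + 2 * norm A + 4 * (norm A)\<^sup>2) * be + 1"
 have ta: "si <= ta" "0 < ta" using be si by (simp_all add: ta_def add_pos_nonneg)
 define c where "c = norm (mat 1 :: complex^'n^'n)"
 define h where "h = frobenius_coeff A b"
 have hb: "norm (h n) <= c * ta ^ n" for n
  unfolding h_def c_def by (rule norm_frobenius_coeff[OF b be _ ta_def]) (use si in simp)
 have hrec: "of_nat n *\<^sub>m h n = commut A (h n) + (\<Sum>q<n. b (n - Suc q) ** h q)" for n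
 proof (cases "n = 0")
  case True then show ?thesis by (simp add: h_def frobenius_coeff.simps commut_def)
 next
  case False then show ?thesis
   using commut_resolvent[OF A, of n] by (simp add: h_def frobenius_coeff.simps[of A b n])
 qed
 have geo: "summable (%n. norm (x n * ze ^ n))" if "norm ze < 1 / ta" "\<And>n. norm (x n) <= C * s ^ n" "s <= ta" "0 <= s"
  for x :: "nat => complex" and ze C s
 proof (rule summable_comparison_test')
  have "s * norm ze <= ta * norm ze" using that by (intro mult_right_mono) auto
  also have "\<dots> < 1" using that ta by (simp add: field_simps)
  finally show "summable (%n. C * (s * norm ze) ^ n)"
   using that by (intro summable_mult summable_geometric) auto
  fix n
  have "norm (x n * ze ^ n) <= C * s ^ n * norm ze ^ n"
   using that(2)[of n] by (simp add: norm_mult norm_power mult_right_mono)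
  then show "norm (norm (x n * ze ^ n)) <= C * (s * norm ze) ^ n" by (simp add: power_mult_distrib mult_ac)
 qed
 have sh: "summable (%n. norm (h n $ i $ j * ze ^ n))" if "norm ze < 1 / ta" for ze i j
  by (rule geo[OF that, of _ c ta]) (use order_trans[OF norm_entry_le hb] ta in auto)
 have sb: "summable (%n. norm (b n $ i $ j * ze ^ n))" if "norm ze < 1 / ta" for ze i j
  by (rule geo[OF that, of _ be si]) (use order_trans[OF norm_entry_le b] ta si in auto)
 define H where "H ze = (\<chi> i j. \<Sum>n. h n $ i $ j * ze ^ n)" for ze
 have H0: "H 0 = mat 1"
  by (simp add: H_def mat_eq_iff powser_zero) (simp add: h_def frobenius_coeff.simps)
 have "\<exists>D. has_mder H D (at ze) \<and> ze *\<^sub>m D = A ** H ze - H ze ** A + ze *\<^sub>m (B ze ** H ze)"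
  if ze: "norm ze < 1 / ta" for ze
 proof -
  define D where "D = (\<chi> i j. \<Sum>n. diffs (%n. h n $ i $ j) n * ze ^ n)"
  have "has_mder H D (at ze)" unfolding has_mder_iff
   by (auto simp: H_def D_def intro!: termdiffs_strong'[of "1 / ta"] ze summable_norm_cancel[OF sh])
  have Hs: "(%n. h n $ i $ j * ze ^ n) sums (H ze $ i $ j)" for i j
   using summable_sums[OF summable_norm_cancel[OF sh[OF ze]]] by (simp add: H_def)
  have Bs: "(%n. b n $ i $ j * ze ^ n) sums (B ze $ i $ j)" for i j
  proof -
   have "1 / ta <= 1 / si" using ta si by (simp add: field_simps)
   then have "(%n. ze ^ n *\<^sub>m b n) sums B ze" using ze by (intro B) auto
   then have "(%n. (ze ^ n *\<^sub>m b n) $ i $ j) sums (B ze $ i $ j)"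
    by (intro bounded_linear.sums[OF bounded_linear_vec_nth])
   then show ?thesis by (simp add: mult.commute)
  qed
  have BH: "(%k. (\<Sum>q\<le>k. b (k - q) ** h q) $ i $ j * ze ^ k) sums ((B ze ** H ze) $ i $ j)" for i j
  proof -
   have "(%k. \<Sum>r\<in>UNIV. \<Sum>q\<le>k. (h q $ r $ j * ze ^ q) * (b (k - q) $ i $ r * ze ^ (k - q)))
     sums (\<Sum>r\<in>UNIV. H ze $ r $ j * B ze $ i $ r)"
   proof (rule sums_sum)
    fix r
    show "(%k. \<Sum>q\<le>k. (h q $ r $ j * ze ^ q) * (b (k - q) $ i $ r * ze ^ (k - q))) sums (H ze $ r $ j * B ze $ i $ r)"
     using Cauchy_product_sums[OF sh[OF ze, of r j] sb[OF ze, of i r]] Hs[of r j] Bs[of i r]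
     by (simp add: sums_iff)
   qed
   moreover have "(\<Sum>r\<in>UNIV. \<Sum>q\<le>k. (h q $ r $ j * ze ^ q) * (b (k - q) $ i $ r * ze ^ (k - q)))
     = (\<Sum>q\<le>k. b (k - q) ** h q) $ i $ j * ze ^ k" for k
   proof -
    have "ze ^ q * ze ^ (k - q) = ze ^ k" if "q <= k" for q using that by (simp add: power_add[symmetric])
    then have "(\<Sum>r\<in>UNIV. \<Sum>q\<le>k. (h q $ r $ j * ze ^ q) * (b (k - q) $ i $ r * ze ^ (k - q)))
      = (\<Sum>r\<in>UNIV. \<Sum>q\<le>k. b (k - q) $ i $ r * h q $ r $ j * ze ^ k)"
     by (intro sum.cong refl) (simp add: mult_ac)
    also have "\<dots> = (\<Sum>q\<le>k. b (k - q) ** h q) $ i $ j * ze ^ k"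
     by (subst sum.swap) (simp add: matrix_matrix_mult_def sum_distrib_right)
    finally show ?thesis .
   qed
   ultimately show ?thesis by (simp add: matrix_matrix_mult_def mult.commute)
  qed
  have cs: "(%n. commut A (h n) $ i $ j * ze ^ n) sums (commut A (H ze) $ i $ j)" for i j
  proof -
   have "(%n. \<Sum>k\<in>UNIV. A $ i $ k * (h n $ k $ j * ze ^ n)) sums (\<Sum>k\<in>UNIV. A $ i $ k * H ze $ k $ j)"
    by (intro sums_sum sums_mult Hs)
   moreover have "(%n. \<Sum>k\<in>UNIV. (h n $ i $ k * ze ^ n) * A $ k $ j) sums (\<Sum>k\<in>UNIV. H ze $ i $ k * A $ k $ j)"
    by (intro sums_sum sums_mult2 Hs)
   ultimately have "(%n. (\<Sum>k\<in>UNIV. A $ i $ k * (h n $ k $ j * ze ^ n)) - (\<Sum>k\<in>UNIV. (h n $ i $ k * ze ^ n) * A $ k $ j))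
     sums ((\<Sum>k\<in>UNIV. A $ i $ k * H ze $ k $ j) - (\<Sum>k\<in>UNIV. H ze $ i $ k * A $ k $ j))"
    by (rule sums_diff)
   then show ?thesis
    by (simp add: commut_def matrix_matrix_mult_def left_diff_distrib right_diff_distrib
      sum_distrib_right sum_distrib_left mult_ac)
  qed
  have "ze *\<^sub>m D = commut A (H ze) + ze *\<^sub>m (B ze ** H ze)" unfolding mat_eq_iff
  proof (intro allI)
   fix i j
   have "(%n. ze * ((\<Sum>q\<le>n. b (n - q) ** h q) $ i $ j * ze ^ n)) sums (ze * (B ze ** H ze) $ i $ j)"
    by (intro sums_mult BH)
   \<comment> \<open>The factor \<open>ze\<close> in front of B shifts the coefficients by one
     place, as in the recursion; the coefficient of order 0 is an empty sum.\<close>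
   then have "(%n. (\<Sum>q<Suc n. b (Suc n - Suc q) ** h q) $ i $ j * ze ^ Suc n) sums (ze * (B ze ** H ze) $ i $ j)"
    by (simp add: lessThan_Suc_atMost mult_ac)
   then have "(%n. (\<Sum>q<n. b (n - Suc q) ** h q) $ i $ j * ze ^ n) sums (ze * (B ze ** H ze) $ i $ j + 0)"
    by (subst (asm) sums_Suc_iff) simp
   from sums_add[OF cs[of i j] this]
   have "(%n. (commut A (h n) + (\<Sum>q<n. b (n - Suc q) ** h q)) $ i $ j * ze ^ n) sums
     (commut A (H ze) $ i $ j + ze * (B ze ** H ze) $ i $ j)" by (simp add: distrib_right)
   then have 1: "(%n. of_nat n * h n $ i $ j * ze ^ n) sums (commut A (H ze) $ i $ j + ze * (B ze ** H ze) $ i $ j)"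
    unfolding hrec[symmetric] by simp
   have "summable (%n. diffs (%n. h n $ i $ j) n * ze ^ n)"
   proof -
    obtain K where K: "norm ze < K" "K < 1 / ta" using dense[OF ze] by blast
    then have "0 <= K" using norm_ge_zero[of ze] by linarith
    show ?thesis
     by (rule termdiff_converges[OF K(1)])
      (rule summable_norm_cancel[OF sh], use K in auto)
   qed
   then have "(%n. ze * (diffs (%n. h n $ i $ j) n * ze ^ n)) sums (ze * D $ i $ j)"
    by (simp add: D_def summable_sums sums_mult)
   then have "(%n. of_nat (Suc n) * h (Suc n) $ i $ j * ze ^ Suc n) sums (ze * D $ i $ j)"
    by (simp add: diffs_def mult_ac)
   then have 2: "(%n. of_nat n * h n $ i $ j * ze ^ n) sums (ze * D $ i $ j)"
    by (subst (asm) sums_Suc_iff) simp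
   show "(ze *\<^sub>m D) $ i $ j = (commut A (H ze) + ze *\<^sub>m (B ze ** H ze)) $ i $ j"
    using sums_unique2[OF 1 2] by simp
  qed
  then show ?thesis using \<open>has_mder H D (at ze)\<close> by (auto simp: commut_def)
 qed
 moreover have "0 < 1 / ta" using ta by simp
 ultimately show ?thesis using H0 by blast
qed

text \<open>A kernel vector v satisfies v = - (X - 1) v. It is repeated in all columns of a square
  matrix so that the submultiplicative matrix norm applies to it.\<close>

lemma invertible_near_one:
 fixes X :: "complex^'n^'n"
 assumes "norm (X - mat 1) < 1"
 shows "\<exists>Y. X ** Y = mat 1 \<and> Y ** X = mat 1"
proof -
 have "v = 0" if "X *v v = 0" for v
 proof -
  define V where "V = (\<chi> i (j::'n). v $ i)"
  have "X ** V = 0"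
   using that by (simp add: V_def vec_eq_iff matrix_matrix_mult_def matrix_vector_mult_def)
  then have "V = - ((X - mat 1) ** V)" by (simp add: mm.diff_left)
  then have "norm V <= norm (X - mat 1) * norm V" by (metis norm_matrix_mult_le norm_minus_cancel)
  then have "V = 0" using assms
   by (metis linorder_not_less mult_le_cancel_right1 norm_le_zero_iff)
  then show ?thesis by (simp add: V_def vec_eq_iff)
 qed
 then obtain Y where "Y ** X = mat 1" using matrix_left_invertible_ker[of X] by blast
 then show ?thesis using left_inverse_imp_right by blast
qed

text \<open>Branch of the logarithm cut along the negative imaginary axis for si = 1 and along the
  positive one for si = -1. The two branches agree on the positive reals and differ by 2 pi i on the
  negative reals, which is the source of every jump below.\<close>

definition lg :: "real => complex => complex" where
 "lg si w = Ln (- \<i> * of_real si * w) + \<i> * of_real si * of_real (pi / 2)"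

lemma lg_deriv:
 assumes "\<bar>si\<bar> = 1" "0 < si * Im w \<or> Re w ~= 0"
 shows "(lg si has_field_derivative 1 / w) (at w)"
proof -
 have si: "si = 1 \<or> si = -1" using assms(1) by linarith
 have "- \<i> * of_real si * w \<notin> \<real>\<^sub>\<le>\<^sub>0"
  using si assms(2) by (auto simp: complex_nonpos_Reals_iff)
 moreover have "w ~= 0" using assms(2) by auto
 ultimately show ?thesis unfolding lg_def using si
  by (auto intro!: derivative_eq_intros simp: field_simps)
qed

lemma exp_lg: "\<bar>si\<bar> = 1 ==> w ~= 0 ==> exp (lg si w) = w"
proof -
 assume si: "\<bar>si\<bar> = 1" and "w ~= 0"
 have s: "si = 1 \<or> si = -1" using si by linarith
 have "exp (\<i> * of_real si * of_real (pi / 2)) = \<i> * of_real si"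
 proof -
  have "exp (\<i> * complex_of_real pi / 2) = \<i>" using cis_pi_half by (simp add: cis_conv_exp)
  then show ?thesis using s by (auto simp: exp_minus)
 qed
 moreover have "- (\<i> * w * \<i>) = w" by (simp add: complex_eq_iff)
 ultimately show ?thesis using s \<open>w ~= 0\<close> by (auto simp: lg_def exp_add)
qed

lemma lg_pos: assumes "\<bar>si\<bar> = 1" "0 < r" shows "lg si (of_real r) = of_real (ln r)"
proof -
 have s: "si = 1 \<or> si = -1" using assms by linarith
 have "Ln (of_real r * (- \<i> * of_real si)) = ln r + Ln (- \<i> * of_real si)"
  using assms s Ln_of_real[of r] by (subst Ln_times_of_real) auto
 moreover have "Ln (- \<i> * of_real si) = - \<i> * of_real si * of_real (pi / 2)" using s by auto
 ultimately show ?thesis by (simp add: lg_def mult_ac)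
qed

lemma lg_neg: assumes "\<bar>si\<bar> = 1" "0 < r" shows "lg si (- of_real r) = of_real (ln r) + \<i> * of_real si * of_real pi"
proof -
 have s: "si = 1 \<or> si = -1" using assms by linarith
 have "Ln (of_real r * (\<i> * of_real si)) = ln r + Ln (\<i> * of_real si)"
  using assms s Ln_of_real[of r] by (subst Ln_times_of_real) auto
 moreover have "Ln (\<i> * of_real si) = \<i> * of_real si * of_real (pi / 2)" using s by auto
 ultimately show ?thesis by (simp add: lg_def mult_ac)
qed

locale fuchs = projections m P for m and P :: "nat => complex^'n^'n" +
 fixes F :: "complex^'n^'n" and x :: "nat => complex"
 assumes PFP: "\<And>k. k \<in> {1..m} ==> P k ** F ** P k = 0"
  and inj: "inj_on x {1..m}"
begin

definition res :: "nat => complex^'n^'n" where "res k = P k ** F"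
definition A :: "complex => complex^'n^'n" where "A ze = (\<Sum>k=1..m. (1 / (ze - x k)) *\<^sub>m res k)"

lemma res_P: "k \<in> {1..m} ==> res k ** P k = 0"
 using PFP by (simp add: res_def mat_assoc)

lemma res_res: "k \<in> {1..m} ==> res k ** res k = 0"
 using res_P[of k] by (simp add: res_def matrix_mul_assoc mm.zero_left)

text \<open>The equation phi' = A phi in the form (zeta - Z) phi' = F phi that suits the Laplace
  transform; the normalised Z is \<open>diag x\<close>.\<close>

lemma diag_A:
 assumes "\<And>k. k \<in> {1..m} ==> ze ~= x k"
 shows "diag (%k. ze - x k) ** A ze = F"
proof -
 have "diag (%k. ze - x k) ** A ze = (\<Sum>k=1..m. (1 / (ze - x k)) *\<^sub>m (diag (%k. ze - x k) ** P k ** F))"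
  unfolding A_def mm.sum_right res_def by (simp add: mat_assoc)
 also have "\<dots> = (\<Sum>k=1..m. P k ** F)"
  using assms by (intro sum.cong refl) (simp add: diag_P)
 also have "\<dots> = (\<Sum>k=1..m. P k) ** F" by (simp add: mm.sum_left)
 finally show ?thesis by (simp add: sumP del: One_nat_def)
qed

lemma mhol_A: "(\<And>k. k \<in> {1..m} ==> x k \<notin> S) ==> mhol A S"
 unfolding A_def by (intro mhol_sum mhol_msmult mhol_const holomorphic_intros) auto

text \<open>\<open>H\<close> times (zeta - x_k)^(res k) is a fundamental solution near the pole. At
  the pole only the existence of a derivative is required, as the formula has the denominator zeta -
  x_k; distance less than 1 from the identity makes \<open>H\<close> invertible on the whole
  disc.\<close>

definition near_solution :: "nat => real => (complex => complex^'n^'n) => bool" where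
 "near_solution k rh H \<longleftrightarrow> 0 < rh \<and> H (x k) = mat 1 \<and> (\<forall>l\<in>{1..m}. l ~= k --> x l \<notin> ball (x k) rh) \<and>
  (\<forall>ze\<in>ball (x k) rh. norm (H ze - mat 1) < 1 \<and>
    (\<exists>D. has_mder H D (at ze) \<and>
     (ze ~= x k --> D = A ze ** H ze - (1 / (ze - x k)) *\<^sub>m (H ze ** res k))))"

text \<open>Near x_k the other poles contribute a holomorphic part of the connection, expanded in
  geometric series; the resulting power series solution is restricted to a disc on which it is close
  to 1.\<close>

lemma near_solution_exists:
 assumes k: "k \<in> {1..m}"
 shows "\<exists>rh H. near_solution k rh H"
proof -
 define I where "I = {1..m} - {k}"
 have I: "finite I" "\<And>l. l \<in> I ==> x l ~= x k"
  using inj k by (auto simp: I_def dest: inj_onD)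
 define b where "b n = - (\<Sum>l\<in>I. (1 / (x l - x k) ^ Suc n) *\<^sub>m res l)" for n
 \<comment> \<open>\<open>si\<close> exceeds every 1 / |x_l - x_k|, so the disc of radius 1 / si
   around x_k contains no other pole; the summand 1 keeps it positive when there is no other
   pole.\<close>
 define si where "si = 1 + (\<Sum>l\<in>I. norm (1 / (x l - x k)))"
 define be where "be = (\<Sum>l\<in>I. norm (1 / (x l - x k)) * norm (res l))"
 define B where "B w = (\<Sum>l\<in>I. (1 / (w + x k - x l)) *\<^sub>m res l)" for w
 have si0: "0 < si" by (simp add: si_def add_pos_nonneg sum_nonneg)
 have sil: "norm (1 / (x l - x k)) <= si" if "l \<in> I" for l
 proof -
  have "norm (1 / (x l - x k)) <= (\<Sum>l\<in>I. norm (1 / (x l - x k)))"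
   by (rule member_le_sum[OF that]) (use I in auto)
  then show ?thesis by (simp add: si_def)
 qed
 have bb: "norm (b n) <= be * si ^ n" for n
 proof -
  have "norm (b n) <= (\<Sum>l\<in>I. norm ((1 / (x l - x k) ^ Suc n) *\<^sub>m res l))"
   unfolding b_def norm_minus_cancel by (rule norm_sum)
  also have "\<dots> <= (\<Sum>l\<in>I. norm (1 / (x l - x k)) * norm (res l) * si ^ n)"
  proof (rule sum_mono)
   fix l assume l: "l \<in> I"
   have "norm ((1 / (x l - x k) ^ Suc n) *\<^sub>m res l) = norm (1 / (x l - x k)) * norm (res l) * norm (1 / (x l - x k)) ^ n"
    by (simp add: norm_divide norm_mult norm_power power_divide)
   also have "\<dots> <= norm (1 / (x l - x k)) * norm (res l) * si ^ n"
    by (intro mult_left_mono power_mono sil l) auto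
   finally show "norm ((1 / (x l - x k) ^ Suc n) *\<^sub>m res l) <= norm (1 / (x l - x k)) * norm (res l) * si ^ n" .
  qed
  finally show ?thesis by (simp add: be_def sum_distrib_right)
 qed
 have far: "norm w < norm (x l - x k)" if "norm w < 1 / si" "l \<in> I" for w l
 proof -
  have "norm (x l - x k) > 0" using I that by simp
  then have "1 / si <= norm (x l - x k)" using sil[OF that(2)] si0 by (simp add: norm_divide field_simps)
  then show ?thesis using that by simp
 qed
 have Bs: "(%n. w ^ n *\<^sub>m b n) sums B w" if w: "norm w < 1 / si" for w
 proof -
  have "(%n. \<Sum>l\<in>I. (- (1 / (x l - x k)) * (w / (x l - x k)) ^ n) *\<^sub>m res l) sums (\<Sum>l\<in>I. (- (1 / (x l - x k)) * (1 / (1 - w / (x l - x k)))) *\<^sub>m res l)"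
  proof (intro sums_sum bounded_linear.sums[OF ms.bounded_linear_left] sums_mult geometric_sums)
   fix l assume l: "l \<in> I"
   then have "0 < norm (x l - x k)" using I by simp
   then show "norm (w / (x l - x k)) < 1" using far[OF w l] by (simp add: norm_divide)
  qed
  moreover have "(\<Sum>l\<in>I. (- (1 / (x l - x k)) * (1 / (1 - w / (x l - x k)))) *\<^sub>m res l) = B w" unfolding B_def
  proof (rule sum.cong[OF refl])
   fix l assume l: "l \<in> I"
   have "x l - x k ~= 0" "x l - x k - w ~= 0" using I far[OF w l] l by auto
   then have "- (1 / (x l - x k)) * (1 / (1 - w / (x l - x k))) = 1 / (w + x k - x l)"
    by (simp add: divide_simps) (simp add: algebra_simps)
   then show "(- (1 / (x l - x k)) * (1 / (1 - w / (x l - x k)))) *\<^sub>m res l = (1 / (w + x k - x l)) *\<^sub>m res l"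
    by metis
  qed
  moreover have "(\<Sum>l\<in>I. (- (1 / (x l - x k)) * (w / (x l - x k)) ^ n) *\<^sub>m res l) = w ^ n *\<^sub>m b n" for n
   by (simp add: b_def ms.sum_right ms.minus_right ms.minus_left sum_negf power_divide mult.commute)
  ultimately show ?thesis by simp
 qed
 have "0 <= be" by (simp add: be_def sum_nonneg)
 from frobenius_solution[OF res_res[OF k] bb this si0 Bs] obtain rh1 H where rh1: "0 < rh1" and H0: "H 0 = mat 1"
  and H: "\<And>w. norm w < rh1 ==> \<exists>D. has_mder H D (at w) \<and> w *\<^sub>m D = res k ** H w - H w ** res k + w *\<^sub>m (B w ** H w)"
  by blast
 obtain D0 where "has_mder H D0 (at 0)" using H[of 0] rh1 by auto
 then have "continuous (at 0) H" by (rule has_mder_imp_continuous)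
 then obtain rh2 where rh2: "0 < rh2" "\<And>w. norm w < rh2 ==> norm (H w - mat 1) < 1"
  unfolding continuous_at_eps_delta using H0 by (metis diff_zero dist_norm zero_less_one)
 define rh where "rh = Min {rh1, rh2, 1 / si}"
 have rh: "0 < rh" "rh <= rh1" "rh <= rh2" "rh <= 1 / si" using rh1 rh2 si0 by (auto simp: rh_def)
 have "near_solution k rh (%ze. H (ze - x k))" unfolding near_solution_def
 proof (intro conjI ballI impI)
  fix l assume l: "l \<in> {1..m}" "l ~= k"
  then have "l \<in> I" by (simp add: I_def)
  then have "norm (x l - x k) < norm (x l - x k)" if "x l \<in> ball (x k) rh"
   using that rh by (intro far) (auto simp: dist_norm norm_minus_commute)
  then show "x l \<notin> ball (x k) rh" by blast
 next
  fix ze assume "ze \<in> ball (x k) rh"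
  then have w: "norm (ze - x k) < rh" by (simp add: dist_norm norm_minus_commute)
  then show "norm (H (ze - x k) - mat 1) < 1" using rh rh2 by auto
  obtain D where D: "has_mder H D (at (ze - x k))" "(ze - x k) *\<^sub>m D =
    res k ** H (ze - x k) - H (ze - x k) ** res k + (ze - x k) *\<^sub>m (B (ze - x k) ** H (ze - x k))"
   using H[of "ze - x k"] w rh by auto
  have "has_mder (%ze. H (ze - x k)) (1 *\<^sub>m D) (at ze)"
   by (rule has_mder_chain[where g = "%ze. ze - x k" and S = UNIV, OF D(1)]) (auto intro!: derivative_eq_intros)
  moreover have "D = A ze ** H (ze - x k) - (1 / (ze - x k)) *\<^sub>m (H (ze - x k) ** res k)" if "ze ~= x k"
  proof -
   have Asplit: "A ze = (1 / (ze - x k)) *\<^sub>m res k + B (ze - x k)"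
    using sum.remove[of "{1..m}" k "%l. (1 / (ze - x l)) *\<^sub>m res l"] k by (simp add: A_def B_def I_def)
   have "D = (1 / (ze - x k)) *\<^sub>m ((ze - x k) *\<^sub>m D)" using that by simp
   also have "\<dots> = A ze ** H (ze - x k) - (1 / (ze - x k)) *\<^sub>m (H (ze - x k) ** res k)"
   proof -
    have "w ~= 0 ==> (1 / w) *\<^sub>m (Q ** Hw - Hw ** Q + w *\<^sub>m (Bw ** Hw)) =
      ((1 / w) *\<^sub>m Q + Bw) ** Hw - (1 / w) *\<^sub>m (Hw ** Q)" for w and Q Hw Bw :: "complex^'n^'n"
     by (simp add: mat_distrib)
    then show ?thesis unfolding D(2) Asplit using that by (metis right_minus_eq)
   qed
   finally show ?thesis .
  qed
  ultimately show "\<exists>D. has_mder (%ze. H (ze - x k)) D (at ze) \<and>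
     (ze ~= x k --> D = A ze ** H (ze - x k) - (1 / (ze - x k)) *\<^sub>m (H (ze - x k) ** res k))"
   by auto
 qed (use rh H0 in auto)
 then show ?thesis by blast
qed

lemma near_solution_mono: "near_solution k rh H ==> 0 < rh' ==> rh' <= rh ==> near_solution k rh' H"
 unfolding near_solution_def by (auto simp: ball_def)

text \<open>Since the residue squares to zero, the derivative of the logarithmic factor exactly
  cancels the term H res / (zeta - x_k) in the equation of \<open>H\<close>.\<close>

lemma near_solution_log:
 assumes k: "k \<in> {1..m}" and H: "near_solution k rh H" and ze: "ze \<in> ball (x k) rh" and si: "\<bar>si\<bar> = 1"
  and d: "0 < si * Im (ze - x k) \<or> Re ze ~= Re (x k)"
 shows "has_mder (%ze. H ze ** (mat 1 + lg si (ze - x k) *\<^sub>m res k))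
      (A ze ** (H ze ** (mat 1 + lg si (ze - x k) *\<^sub>m res k))) (at ze)"
proof -
 have ne: "ze ~= x k" using d by auto
 have l: "((%ze. lg si (ze - x k)) has_field_derivative 1 / (ze - x k)) (at ze)"
 proof -
  have "((%ze. ze - x k) has_field_derivative 1) (at ze)" by (auto intro!: derivative_eq_intros)
  from DERIV_chain2[where f = "lg si" and g = "%ze. ze - x k", OF lg_deriv[OF si] this] d
  show ?thesis by simp
 qed
 have "has_mder (%ze. lg si (ze - x k) *\<^sub>m res k) ((1 / (ze - x k)) *\<^sub>m res k + lg si (ze - x k) *\<^sub>m 0) (at ze)"
  by (rule has_mder_msmult[OF l has_mder_const])
 from has_mder_add[OF has_mder_const[of "mat 1"] this]
 have L: "has_mder (%ze. mat 1 + lg si (ze - x k) *\<^sub>m res k) ((1 / (ze - x k)) *\<^sub>m res k) (at ze)"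
  by (simp add: ms.zero_right)
 have "has_mder H (A ze ** H ze - (1 / (ze - x k)) *\<^sub>m (H ze ** res k)) (at ze)"
  using H ze ne unfolding near_solution_def by metis
 from has_mder_mult[OF this L] show ?thesis
  by (simp add: mat_distrib mat_assoc res_res[OF k] mm.zero_right ms.zero_right)
qed

text \<open>As \<open>res k ** P k\<close> vanishes, the part of the local solution selected by P k
  carries no logarithm; such solutions are the ones to be Laplace transformed.\<close>

lemma near_solution_P:
 assumes k: "k \<in> {1..m}" and H: "near_solution k rh H" and ze: "ze \<in> ball (x k) rh" "ze ~= x k"
 shows "has_mder (%ze. H ze ** P k) (A ze ** (H ze ** P k)) (at ze)"
proof -
 have "has_mder H (A ze ** H ze - (1 / (ze - x k)) *\<^sub>m (H ze ** res k)) (at ze)"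
  using H ze unfolding near_solution_def by metis
 from has_mder_multc_right[OF this, of "P k"] show ?thesis
  by (simp add: mat_distrib mat_assoc res_P[OF k] mm.zero_right ms.zero_right)
qed

end

section \<open>Slit wedges around the normalised Stokes ray and solutions on them\<close>

text \<open>The normalised situation: the pole \<open>x i0\<close> is \<open>0\<close>, the Stokes ray is the positive real axis,
 and all the poles in an open wedge around it are real.\<close>
locale fuchs_wedge = fuchs m P F x for m P and F :: "complex^'n^'n" and x +
 fixes nu :: real and i0 :: nat
 assumes nu: "0 < nu" and i0: "i0 \<in> {1..m}" "x i0 = 0"
  and wedge_real: "\<And>k. k \<in> {1..m} ==> \<bar>Im (x k)\<bar> < nu * Re (x k) ==> Im (x k) = 0"
begin

definition W :: "complex set" where "W = {ze. \<bar>Im ze\<bar> < nu * Re ze}"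
definition K :: "nat set" where "K = {k \<in> {1..m}. x k \<in> W}"
definition X :: "real set" where "X = (%k. Re (x k)) ` K"

definition half :: "real => complex set" where "half si = {ze\<in>W. 0 < si * Im ze}"
text \<open>For \<open>c\<close> off \<open>X\<close> this is the part of the wedge between the
  vertical lines through the poles next to \<open>c\<close>; it depends on \<open>c\<close> only
  through these poles.\<close>

definition column :: "real => complex set" where
 "column c = {ze\<in>W. \<forall>p\<in>X. (c < p --> Re ze < p) \<and> (p < c --> p < Re ze)}"

text \<open>Discs of radius \<open>R\<close> around distinct poles are disjoint; the extra 1 keeps
  the set nonempty.\<close>

definition R :: real where
 "R = Min (insert 1 ((%(k, l). dist (x k) (x l) / 2) ` {(k, l). k \<in> {1..m} \<and> l \<in> {1..m} \<and> k ~= l}))"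

text \<open>Half discs may leave the wedge; they are included so that detours around the poles with
  every sufficiently small radius stay in the domain.\<close>

definition hdisc :: "real => nat => complex set" where
 "hdisc si k = {ze. norm (ze - x k) < R \<and> 0 < si * Im ze}"

definition pieces :: "real => complex set set" where
 "pieces si = column ` ({0<..} - X) \<union> hdisc si ` K"

text \<open>The wedge cut along vertical half lines that start at the poles and point away from the
  side \<open>si\<close>, together with half discs on that side. The vertex 0 of the wedge, which is
  the pole \<open>i0\<close>, does not belong to it.\<close>

definition dom :: "real => complex set" where "dom si = half si \<union> \<Union>(pieces si)"

lemma WI: "\<bar>Im ze\<bar> < nu * Re ze ==> ze \<in> W" and WD: "ze \<in> W ==> \<bar>Im ze\<bar> < nu * Re ze"
 by (auto simp: W_def)

lemma W_Re_pos: "ze \<in> W ==> 0 < Re ze"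
 using nu WD[of ze] by (smt (verit) zero_less_mult_iff)

lemma W_of_real: "0 < r ==> of_real r \<in> W"
 using nu by (simp add: W_def)

lemma W_add_real: "ze \<in> W ==> 0 <= r ==> of_real r + ze \<in> W"
 using nu by (auto simp: W_def algebra_simps) (smt (verit) mult_nonneg_nonneg)

lemma open_W: "open W"
 unfolding W_def by (intro open_Collect_less continuous_intros)

lemma convex_W: "convex W"
proof (rule convexI)
 fix a b and u v :: real assume ab: "a \<in> W" "b \<in> W" "0 <= u" "0 <= v" "u + v = 1"
 have "\<bar>u * Im a + v * Im b\<bar> <= u * \<bar>Im a\<bar> + v * \<bar>Im b\<bar>"
  using ab abs_triangle_ineq[of "u * Im a" "v * Im b"] by (simp add: abs_mult)
 also have "\<dots> < u * (nu * Re a) + v * (nu * Re b)"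
 proof (cases "u = 0")
  case True then show ?thesis using ab WD by auto
 next
  case False
  then have "u * \<bar>Im a\<bar> < u * (nu * Re a)" using ab WD[of a] by simp
  moreover have "v * \<bar>Im b\<bar> <= v * (nu * Re b)" using ab WD[of b] by (intro mult_left_mono) auto
  ultimately show ?thesis by linarith
 qed
 finally show "u *\<^sub>R a + v *\<^sub>R b \<in> W" by (intro WI) (simp add: algebra_simps)
qed

lemma half_subset: "half si \<subseteq> W" by (auto simp: half_def)

lemma open_half: "open (half si)"
proof -
 have "half si = W \<inter> {ze. 0 < si * Im ze}" by (auto simp: half_def)
 then show ?thesis by (auto intro!: open_Int open_W open_Collect_less continuous_intros)
qed

lemma convex_half: "convex (half si)"
proof -
 have "half si = W \<inter> {ze. (si * \<i>) \<bullet> ze > 0}" by (auto simp: half_def inner_complex_def)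
 then show ?thesis by (metis convex_Int convex_W convex_halfspace_gt)
qed

lemma finite_X: "finite X"
 by (simp add: X_def K_def)

lemma K_real: "k \<in> K ==> x k = of_real (Re (x k))"
 using wedge_real[of k] by (auto simp: K_def W_def complex_eq_iff)

lemma K_pos: "k \<in> K ==> 0 < Re (x k)"
 by (simp add: K_def W_Re_pos)

lemma X_pos: "p \<in> X ==> 0 < p"
 by (auto simp: X_def K_pos)

lemma column_eq: "column c = (W \<inter> (\<Inter>p\<in>X. {ze. c < p --> Re ze < p})) \<inter> (\<Inter>p\<in>X. {ze. p < c --> p < Re ze})"
 by (auto simp: column_def)

lemma open_column: "open (column c)"
 unfolding column_eq
proof (intro open_Int open_W open_INT finite_X ballI)
 fix p show "open {ze. c < p --> Re ze < p}" by (cases "c < p") (simp_all add: open_halfspace_Re_lt)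
 show "open {ze. p < c --> p < Re ze}" by (cases "p < c") (simp_all add: open_halfspace_Re_gt)
qed

lemma convex_column: "convex (column c)"
 unfolding column_eq
proof (intro convex_Int convex_W convex_INT)
 fix p show "convex {ze. c < p --> Re ze < p}" by (cases "c < p") (simp_all add: convex_halfspace_Re_lt)
 show "convex {ze. p < c --> p < Re ze}" by (cases "p < c") (simp_all add: convex_halfspace_Re_gt)
qed

lemma in_column: "ze \<in> W ==> ze \<in> column (Re ze)"
 by (simp add: column_def)

lemma R_pos: "0 < R" and R_le: "k \<in> {1..m} ==> l \<in> {1..m} ==> k ~= l ==> 2 * R <= dist (x k) (x l)"
proof -
 have fin: "finite ((%(k, l). dist (x k) (x l) / 2) ` {(k, l). k \<in> {1..m} \<and> l \<in> {1..m} \<and> k ~= l})"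
  by (rule finite_imageI, rule finite_subset[of _ "{1..m} \<times> {1..m}"]) auto
 show "0 < R" unfolding R_def
  by (subst Min_gr_iff) (use fin inj in \<open>auto dest: inj_onD\<close>)
 assume kl: "k \<in> {1..m}" "l \<in> {1..m}" "k ~= l"
 have "R <= dist (x k) (x l) / 2" unfolding R_def by (rule Min_le) (use fin kl in force)+
 then show "2 * R <= dist (x k) (x l)" by simp
qed

lemma open_hdisc: "open (hdisc si k)"
proof -
 have "hdisc si k = {ze. norm (ze - x k) < R} \<inter> {ze. 0 < si * Im ze}" by (auto simp: hdisc_def)
 then show ?thesis by (auto intro!: open_Int open_Collect_less continuous_intros)
qed

lemma convex_hdisc: "convex (hdisc si k)"
proof -
 have "hdisc si k = ball (x k) R \<inter> {ze. (si * \<i>) \<bullet> ze > 0}"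
  by (auto simp: hdisc_def inner_complex_def dist_norm norm_minus_commute)
 then show ?thesis by (metis convex_Int convex_ball convex_halfspace_gt)
qed

lemma poles_off_dom: assumes "k \<in> {1..m}" "\<bar>si\<bar> = 1" shows "x k \<notin> dom si"
proof
 assume "x k \<in> dom si"
 then consider "x k \<in> half si" | c where "c \<notin> X" "x k \<in> column c" | l where "l \<in> K" "x k \<in> hdisc si l"
  by (auto simp: dom_def pieces_def)
 then show False
 proof cases
  case 1
  then have "k \<in> K" using assms by (auto simp: K_def half_def)
  then have "Im (x k) = 0" using K_real[of k] by (metis Im_complex_of_real)
  then show False using 1 by (simp add: half_def)
 next
  case (2 c)
  then have "k \<in> K" using assms by (auto simp: K_def column_def)
  then have "Re (x k) \<in> X" by (simp add: X_def)
  then show False using 2 by (auto simp: column_def)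
 next
  case (3 l)
  have "k = l"
  proof (rule ccontr)
   assume "k ~= l"
   then have "2 * R <= dist (x k) (x l)" using R_le[of k l] assms 3 by (auto simp: K_def)
   then show False using 3 R_pos by (simp add: hdisc_def dist_norm)
  qed
  then have "Im (x k) = 0" using K_real[of k] 3 by (metis Im_complex_of_real)
  then show False using 3 by (simp add: hdisc_def)
 qed
qed

lemma half_upper_point: assumes "0 < c" "\<bar>si\<bar> = 1" "0 < e" "e < nu * c" shows "Complex c (si * e) \<in> half si"
proof -
 have "si = 1 \<or> si = -1" using assms by linarith
 then show ?thesis using assms by (auto simp: half_def W_def)
qed

text \<open>The half wedge is the core of the gluing. Two columns coincide or are disjoint, half
  discs of different poles are disjoint, and a half disc meets a column only on the side
  \<open>si\<close>, that is in the core.\<close>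

lemma fund_dom:
 assumes si: "\<bar>si\<bar> = 1"
 shows "\<exists>Ps Th. fund A (dom si) Ps Th"
 unfolding dom_def
proof (rule fund_glue[OF open_half convex_half])
 show "mhol A (half si \<union> \<Union>(pieces si))"
  using poles_off_dom[OF _ si] by (intro mhol_A) (auto simp: dom_def)
 fix N assume N: "N \<in> pieces si"
 have s: "si = 1 \<or> si = -1" using si by linarith
 show "open N \<and> convex N \<and> N \<inter> half si ~= {}"
 proof (cases "N \<in> hdisc si ` K")
  case False
  then obtain c where c: "N = column c" "0 < c" "c \<notin> X" using N by (auto simp: pieces_def)
  have h: "Complex c (si * (nu * c / 2)) \<in> half si" using c nu si by (intro half_upper_point) auto
  then have "Complex c (si * (nu * c / 2)) \<in> column c"
   using in_column[of "Complex c (si * (nu * c / 2))"] half_subset by auto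
  then show ?thesis using h c open_column convex_column by auto
 next
  case True
  then obtain k where k: "N = hdisc si k" "k \<in> K" by blast
  \<comment> \<open>Small enough for the point at height si e over the pole to lie in the half disc
    as well as in the half wedge.\<close>
  define e where "e = min (R / 2) (nu * Re (x k) / 2)"
  have e: "0 < e" "e < R" "e < nu * Re (x k)" using R_pos nu K_pos[OF k(2)] by (auto simp: e_def min_def)
  have "Complex (Re (x k)) (si * e) \<in> half si" using e si K_pos[OF k(2)] by (intro half_upper_point) auto
  moreover have "Complex (Re (x k)) (si * e) \<in> hdisc si k"
  proof -
   have "Complex (Re (x k)) (si * e) - x k = Complex 0 (si * e)"
    using K_real[OF k(2)] by (metis Im_complex_of_real complex_eq_iff complex.sel diff_zero minus_complex.sel diff_self)
   then have "norm (Complex (Re (x k)) (si * e) - x k) = e" using e s by (auto simp: cmod_def)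
   then show ?thesis using e s by (auto simp: hdisc_def)
  qed
  ultimately show ?thesis using k open_hdisc convex_hdisc by auto
 qed
 fix N' assume N': "N' \<in> pieces si" and ne: "N ~= N'"
 show "N \<inter> N' \<subseteq> half si"
 proof
  fix ze assume ze: "ze \<in> N \<inter> N'"
  have cc: "column c = column c'" if "ze \<in> column c" "ze \<in> column c'" "c \<notin> X" "c' \<notin> X" for c c'
  proof -
   have "(c < p \<longleftrightarrow> c' < p) \<and> (p < c \<longleftrightarrow> p < c')" if "p \<in> X" for p
    using that \<open>ze \<in> column c\<close> \<open>ze \<in> column c'\<close> \<open>c \<notin> X\<close> \<open>c' \<notin> X\<close> unfolding column_def
    by (smt (verit) mem_Collect_eq)
   then show ?thesis unfolding column_def by auto
  qed
  have hh: "k = l" if "k \<in> K" "l \<in> K" "ze \<in> hdisc si k" "ze \<in> hdisc si l" for k l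
  proof (rule ccontr)
   assume "k ~= l"
   then have "2 * R <= dist (x k) (x l)" using R_le[of k l] that by (auto simp: K_def)
   then show False using that dist_triangle[of "x k" "x l" ze]
    by (simp add: hdisc_def dist_norm norm_minus_commute)
  qed
  have "ze \<in> W \<and> 0 < si * Im ze"
  proof (cases "N \<in> hdisc si ` K")
   case True
   then obtain k where k: "N = hdisc si k" "k \<in> K" by blast
   then have "N' \<notin> hdisc si ` K" using hh ne ze by auto
   then obtain c where "N' = column c" using N' by (auto simp: pieces_def)
   then show ?thesis using k ze by (auto simp: column_def hdisc_def)
  next
   case False
   then obtain c where c: "N = column c" "c \<notin> X" using N by (auto simp: pieces_def)
   show ?thesis
   proof (cases "N' \<in> hdisc si ` K")
    case True then show ?thesis using c ze by (auto simp: column_def hdisc_def)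
   next
    case False
    then obtain c' where c': "N' = column c'" "c' \<notin> X" using N' by (auto simp: pieces_def)
    then show ?thesis using cc[of c c'] c ze ne by auto
   qed
  qed
  then show "ze \<in> half si" by (simp add: half_def)
 qed
qed

lemma W_in_dom:
 assumes "ze \<in> W" "0 < si * Im ze \<or> Re ze \<notin> X" shows "ze \<in> dom si"
proof (cases "0 < si * Im ze")
 case True then show ?thesis using assms by (simp add: dom_def half_def)
next
 case False
 then have "ze \<in> column (Re ze)" "0 < Re ze" "Re ze \<notin> X" using assms in_column W_Re_pos by auto
 then show ?thesis by (auto simp: dom_def pieces_def)
qed

text \<open>The relevant part of the disc around a pole: \<open>rh\<close> is so small that it meets no other pole.\<close>
definition slit :: "real => nat => real => complex set" where
 "slit si k rh = {ze \<in> W \<inter> ball (x k) rh. 0 < si * Im ze \<or> Re ze ~= Re (x k)}"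

text \<open>No other pole of the wedge has its real part less than \<open>rh\<close> away. The disc
  is asked to lie in the wedge only for poles inside it, since \<open>i0\<close> sits at the
  vertex.\<close>

definition admissible :: "nat => real => bool" where
 "admissible k rh \<longleftrightarrow> 0 < rh \<and> (\<forall>p\<in>X. p ~= Re (x k) --> rh <= \<bar>p - Re (x k)\<bar>) \<and> (k \<in> K --> ball (x k) rh \<subseteq> W)"

lemma admissible_exists: "\<exists>rh. admissible k rh"
proof -
 obtain rh1 where rh1: "0 < rh1" "k \<in> K --> ball (x k) rh1 \<subseteq> W"
  using open_W open_contains_ball by (metis (no_types, lifting) K_def mem_Collect_eq zero_less_one)
 define rh where "rh = Min (insert rh1 ((%p. \<bar>p - Re (x k)\<bar>) ` (X - {Re (x k)})))"
 have fin: "finite ((%p. \<bar>p - Re (x k)\<bar>) ` (X - {Re (x k)}))" using finite_X by simp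
 have "0 < rh" unfolding rh_def by (subst Min_gr_iff) (use fin rh1 in auto)
 moreover have "rh <= \<bar>p - Re (x k)\<bar>" if "p \<in> X" "p ~= Re (x k)" for p
  unfolding rh_def by (rule Min_le) (use fin that in auto)
 moreover have "rh <= rh1" unfolding rh_def by (rule Min_le) (use fin in auto)
 ultimately show ?thesis using rh1 by (auto simp: admissible_def intro!: exI[of _ rh])
qed

lemma admissible_mono: "admissible k rh ==> 0 < rh' ==> rh' <= rh ==> admissible k rh'"
 unfolding admissible_def by (fastforce simp: ball_def)

lemma slit_in_dom:
 assumes "admissible k rh" shows "slit si k rh \<subseteq> dom si"
proof
 fix ze assume ze: "ze \<in> slit si k rh"
 have "\<bar>Re (ze - x k)\<bar> <= norm (ze - x k)" by (rule abs_Re_le_cmod)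
 then have "\<bar>Re ze - Re (x k)\<bar> < rh" using ze by (simp add: slit_def dist_norm norm_minus_commute)
 then have "Re ze \<notin> X" if "Re ze ~= Re (x k)" using assms that unfolding admissible_def by fastforce
 then show "ze \<in> dom si" using ze by (intro W_in_dom) (auto simp: slit_def)
qed

lemma x_nonneg: assumes "k \<in> insert i0 K" shows "0 <= Re (x k)" "Im (x k) = 0" "x k = of_real (Re (x k))"
proof -
 show "x k = of_real (Re (x k))" using assms i0 K_real by auto
 then show "Im (x k) = 0" by (metis Im_complex_of_real)
 show "0 <= Re (x k)" using assms i0 K_pos[of k] by auto
qed

lemma slit_right_point:
 assumes k: "k \<in> insert i0 K" and "0 < rh" and si: "\<bar>si\<bar> = 1"
 shows "\<exists>ze. ze \<in> W \<inter> ball (x k) rh \<and> 0 < si * Im ze \<and> Re (x k) < Re ze"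
proof -
 define e where "e = rh / (2 + nu)"
 have e: "0 < e" "e * (2 + nu) = rh" using assms nu by (auto simp: e_def)
 have s: "si = 1 \<or> si = -1" using si by linarith
 define w where "w = Complex e (si * (nu * e / 2))"
 have "w \<in> W" unfolding w_def W_def using s e nu by auto
 then have "x k + w \<in> W" using W_add_real[of w "Re (x k)"] x_nonneg[OF k] by simp
 moreover have "norm w <= e + nu * e / 2" using s e nu cmod_le[of w] by (auto simp: w_def)
 then have "norm w < rh" using e nu assms by (simp add: algebra_simps)
 ultimately show ?thesis
  by (intro exI[of _ "x k + w"]) (use s e nu x_nonneg[OF k] in \<open>auto simp: w_def dist_norm\<close>)
qed

lemma open_slit: "open (slit si k rh)"
proof -
 have "slit si k rh = (W \<inter> ball (x k) rh) \<inter> ({ze. 0 < si * Im ze} \<union> ({ze. Re ze < Re (x k)} \<union> {ze. Re ze > Re (x k)}))"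
  by (auto simp: slit_def)
 then show ?thesis
  by (auto intro!: open_Int open_Un open_W open_Collect_less continuous_intros)
qed

text \<open>The slit disc is the union of three convex pieces: the side \<open>si\<close>, the right
  half and the left half. The first meets both others, except at the vertex of the wedge, where the
  left half is empty.\<close>

lemma connected_slit:
 assumes k: "k \<in> insert i0 K" and rh: "admissible k rh" and si: "\<bar>si\<bar> = 1"
 shows "connected (slit si k rh)"
proof -
 have s: "si = 1 \<or> si = -1" using si by linarith
 define B where "B = W \<inter> ball (x k) rh"
 have cB: "convex B" unfolding B_def by (intro convex_Int convex_W convex_ball)
 define U where "U = B \<inter> {ze. 0 < si * Im ze}"
 define V where "V = B \<inter> {ze. Re ze > Re (x k)}"
 define V' where "V' = B \<inter> {ze. Re ze < Re (x k)}"
 have eq: "slit si k rh = (U \<union> V) \<union> V'" by (auto simp: slit_def U_def V_def V'_def B_def)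
 have "{ze. 0 < si * Im ze} = {ze. (si * \<i>) \<bullet> ze > 0}" by (auto simp: inner_complex_def)
 then have "connected U" "connected V" "connected V'"
  unfolding U_def V_def V'_def using cB
  by (auto intro!: convex_connected convex_Int convex_halfspace_gt convex_halfspace_Re_lt convex_halfspace_Re_gt)
 moreover have "U \<inter> V ~= {}"
  using slit_right_point[OF k, of rh si] si rh by (auto simp: admissible_def U_def V_def B_def)
 moreover have "V' = {} \<or> U \<inter> V' ~= {}"
 proof (cases "k \<in> K")
  case True
  define e where "e = rh / 4"
  have e: "0 < e" using rh by (simp add: e_def admissible_def)
  define w where "w = Complex (- e) (si * e)"
  have "norm w <= 2 * e" using s e cmod_le[of w] by (auto simp: w_def)
  then have "x k + w \<in> ball (x k) rh" using e by (simp add: dist_norm e_def)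
  moreover from this have "x k + w \<in> W" using rh True by (auto simp: admissible_def)
  moreover have "0 < si * Im (x k + w)" "Re (x k + w) < Re (x k)"
   using e s x_nonneg[OF k] by (auto simp: w_def)
  ultimately show ?thesis by (auto simp: U_def V'_def B_def)
 next
  case False
  then have "x k = 0" using k i0 by auto
  then have "V' = {}" using W_Re_pos by (fastforce simp: V'_def B_def)
  then show ?thesis ..
 qed
 ultimately show ?thesis unfolding eq
  by (cases "V' = {}") (auto intro!: connected_Un)
qed

text \<open>Both sides solve the equation on the connected slit disc and so differ by a constant
  matrix; it is invertible because the local solution is invertible at one point.\<close>

lemma local_form:
 assumes si: "\<bar>si\<bar> = 1" and F: "fund A (dom si) Ps Th" and k: "k \<in> insert i0 K"
  and H: "near_solution k rh H" and rh: "admissible k rh"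
 shows "\<exists>C D. C ** D = mat 1 \<and> D ** C = mat 1 \<and>
   (\<forall>ze\<in>slit si k rh. Ps ze = H ze ** (mat 1 + lg si (ze - x k) *\<^sub>m res k) ** C)"
proof -
 have km: "k \<in> {1..m}" using k i0 by (auto simp: K_def)
 define G where "G ze = H ze ** (mat 1 + lg si (ze - x k) *\<^sub>m res k)" for ze
 have G: "has_mder G (A ze ** G ze) (at ze)" if "ze \<in> slit si k rh" for ze
  unfolding G_def using that x_nonneg[OF k] by (intro near_solution_log[OF km H _ si]) (auto simp: slit_def)
 obtain E where E: "\<And>ze. ze \<in> slit si k rh ==> G ze = Ps ze ** E"
  using fund_solution[OF F slit_in_dom[OF rh] open_slit connected_slit[OF k rh si] G] by blast
 obtain ze0 where ze0: "ze0 \<in> slit si k rh"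
  using slit_right_point[OF k _ si, of rh] rh by (auto simp: admissible_def slit_def)
 have "norm (H ze0 - mat 1) < 1" using H ze0 by (auto simp: near_solution_def slit_def)
 then obtain Hi where Hi: "Hi ** H ze0 = mat 1" using invertible_near_one by blast
 define L where "L = lg si (ze0 - x k) *\<^sub>m res k"
 have "L ** L = 0" by (simp add: L_def res_res[OF km] ms.zero_right)
 then have LL: "(mat 1 - L) ** (mat 1 + L) = mat 1" by (simp add: mat_distrib)
 have "((mat 1 - L) ** Hi ** Ps ze0) ** E = (mat 1 - L) ** (Hi ** G ze0)"
  by (simp add: E[OF ze0] mat_assoc)
 also have "Hi ** G ze0 = mat 1 + L" using Hi by (simp add: G_def L_def matrix_mul_assoc)
 finally have DE: "((mat 1 - L) ** Hi ** Ps ze0) ** E = mat 1" using LL by simp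
 define D where "D = (mat 1 - L) ** Hi ** Ps ze0"
 have DE: "D ** E = mat 1" "E ** D = mat 1" using DE left_inverse_imp_right unfolding D_def by blast+
 have "Ps ze = G ze ** D" if "ze \<in> slit si k rh" for ze
  unfolding E[OF that] by (simp add: mat_assoc DE)
 then show ?thesis using DE unfolding G_def by blast
qed

end

text \<open>\<open>C si k\<close> expresses the global solution \<open>Ps si\<close> in the local
  solution at the pole k, and \<open>D si k\<close> inverts it. Hence
  \<open>C (-1) j ** D (-1) i0\<close> is the connection matrix from the pole \<open>i0\<close> to
  the pole j below the real axis.\<close>

locale fuchs_solutions = fuchs_wedge m P F x nu i0 for m P and F :: "complex^'n^'n" and x nu i0 +
 fixes Ps Th :: "real => complex => complex^'n^'n" and H :: "nat => complex => complex^'n^'n" and rh :: "nat => real"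
  and C D :: "real => nat => complex^'n^'n"
 assumes fund: "\<And>si. \<bar>si\<bar> = 1 ==> fund A (dom si) (Ps si) (Th si)"
  and near: "\<And>k. k \<in> insert i0 K ==> near_solution k (rh k) (H k)"
  and adm: "\<And>k. k \<in> insert i0 K ==> admissible k (rh k)"
  and CD: "\<And>si k. \<bar>si\<bar> = 1 ==> k \<in> insert i0 K ==> C si k ** D si k = mat 1"
  and DC: "\<And>si k. \<bar>si\<bar> = 1 ==> k \<in> insert i0 K ==> D si k ** C si k = mat 1"
  and form: "\<And>si k ze. \<bar>si\<bar> = 1 ==> k \<in> insert i0 K ==> ze \<in> slit si k (rh k) ==>
    Ps si ze = H k ze ** (mat 1 + lg si (ze - x k) *\<^sub>m res k) ** C si k"

lemma (in fuchs_wedge) fuchs_solutions_exist: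
 "\<exists>Ps Th H rh C D. fuchs_solutions m P F x nu i0 Ps Th H rh C D"
proof -
 have km: "k \<in> {1..m}" if "k \<in> insert i0 K" for k using that i0 by (auto simp: K_def)
 have "\<exists>rh H. near_solution k rh H \<and> admissible k rh" if k: "k \<in> insert i0 K" for k
 proof -
  obtain rh1 H where 1: "near_solution k rh1 H" using near_solution_exists[OF km[OF k]] by blast
  obtain rh2 where 2: "admissible k rh2" using admissible_exists by blast
  have "0 < min rh1 rh2" using 1 2 by (simp add: near_solution_def admissible_def)
  then have "near_solution k (min rh1 rh2) H \<and> admissible k (min rh1 rh2)"
   using near_solution_mono[OF 1, of "min rh1 rh2"] admissible_mono[OF 2, of "min rh1 rh2"] by simp
  then show ?thesis by blast
 qed
 then obtain rh H where RH: "\<And>k. k \<in> insert i0 K ==> near_solution k (rh k) (H k) \<and> admissible k (rh k)" by metis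
 obtain Ps Th where F: "\<And>si. \<bar>si\<bar> = 1 ==> fund A (dom si) (Ps si) (Th si)" using fund_dom by metis
 have "\<exists>C D. C ** D = mat 1 \<and> D ** C = mat 1 \<and> (\<forall>ze\<in>slit si k (rh k).
   Ps si ze = H k ze ** (mat 1 + lg si (ze - x k) *\<^sub>m res k) ** C)" if "\<bar>si\<bar> = 1" "k \<in> insert i0 K" for si k
  using local_form[OF that(1) F[OF that(1)] that(2)] RH[OF that(2)] by blast
 then obtain C D where "\<And>si k. \<bar>si\<bar> = 1 ==> k \<in> insert i0 K ==> C si k ** D si k = mat 1 \<and> D si k ** C si k = mat 1 \<and>
   (\<forall>ze\<in>slit si k (rh k). Ps si ze = H k ze ** (mat 1 + lg si (ze - x k) *\<^sub>m res k) ** C si k)" by metis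
 then have "fuchs_solutions m P F x nu i0 Ps Th H rh C D"
  using F RH by unfold_locales blast+
 then show ?thesis by blast
qed

section \<open>Jumps between the upper and the lower solution along the real axis\<close>

context fuchs_solutions
begin

lemma ks: "k \<in> insert i0 K ==> k \<in> {1..m}"
 using i0 by (auto simp: K_def)

lemma rho_pos: "k \<in> insert i0 K ==> 0 < rh k"
 using adm by (simp add: admissible_def)

text \<open>2 pi i times the residue, written in the bases of \<open>Ps 1\<close> and
  \<open>Ps (-1)\<close>: the change of the matrix comparing these solutions when a real point
  passes x_k from left to right.\<close>

definition jump :: "nat => complex^'n^'n" where
 "jump k = (2 * of_real pi * \<i>) *\<^sub>m (D 1 k ** res k ** C (-1) k)"

lemma real_in_dom: "0 < r ==> r \<notin> X ==> of_real r \<in> dom si"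
 by (rule W_in_dom) (auto simp: W_of_real)

lemma real_in_slit:
 assumes k: "k \<in> insert i0 K" and r: "0 < r" "\<bar>r - Re (x k)\<bar> < rh k" "r ~= Re (x k)"
 shows "of_real r \<in> slit si k (rh k)"
proof -
 have "complex_of_real r - x k = of_real (r - Re (x k))" using x_nonneg[OF k] by simp
 then have "dist (x k) (of_real r) = \<bar>r - Re (x k)\<bar>" by (metis dist_commute dist_norm norm_of_real)
 then show ?thesis using r by (simp add: slit_def W_of_real)
qed

text \<open>In local form the two solutions differ only in the branch of the logarithm and in the
  constants \<open>C\<close>; the branches agree to the right of the pole and differ by 2 pi i to
  the left of it.\<close>

lemma crossing:
 assumes k: "k \<in> insert i0 K" and r: "0 < r" "\<bar>r - Re (x k)\<bar> < rh k" "r ~= Re (x k)"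
 shows "Ps (-1) (of_real r) = Ps 1 (of_real r) **
   (D 1 k ** (if r < Re (x k) then mat 1 - (2 * of_real pi * \<i>) *\<^sub>m res k else mat 1) ** C (-1) k)"
proof -
 have xk: "complex_of_real r - x k = of_real (r - Re (x k))" using x_nonneg[OF k] by simp
 define N where "N = res k"
 have NN: "N ** N = 0" using res_res[OF ks[OF k]] by (simp add: N_def)
 define l where "l si = lg si (of_real r - x k)" for si
 define E where "E = (if r < Re (x k) then mat 1 - (2 * of_real pi * \<i>) *\<^sub>m N else mat 1)"
 have f: "Ps si (of_real r) = H k (of_real r) ** (mat 1 + l si *\<^sub>m N) ** C si k" if "\<bar>si\<bar> = 1" for si
  using form[OF that k real_in_slit[OF k r]] by (simp add: l_def N_def)
 have "(mat 1 + l 1 *\<^sub>m N) ** E = mat 1 + l (-1) *\<^sub>m N"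
 proof (cases "r < Re (x k)")
  case True
  then have e: "complex_of_real r - x k = - of_real (Re (x k) - r)" using xk by simp
  have "l si = of_real (ln (Re (x k) - r)) + \<i> * of_real si * of_real pi" if "\<bar>si\<bar> = 1" for si
   unfolding l_def e using True by (intro lg_neg that) simp
  then have "l (-1) = l 1 - 2 * of_real pi * \<i>" by simp
  then show ?thesis using True NN by (simp add: E_def mat_distrib mm.zero_right ms.zero_right)
 next
  case False
  then have "0 < r - Re (x k)" using r by simp
  then have "l si = of_real (ln (r - Re (x k)))" if "\<bar>si\<bar> = 1" for si
   unfolding l_def xk by (rule lg_pos[OF that])
  then show ?thesis using False by (simp add: E_def)
 qed
 then have "H k (of_real r) ** (mat 1 + l 1 *\<^sub>m N) ** E ** C (-1) k = Ps (-1) (of_real r)"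
  using f[of "-1"] by (simp add: mat_assoc)
 moreover have "Ps 1 (of_real r) ** (D 1 k ** E ** C (-1) k) =
   H k (of_real r) ** (mat 1 + l 1 *\<^sub>m N) ** (C 1 k ** D 1 k) ** E ** C (-1) k"
  using f[of 1] by (simp add: mat_assoc)
 ultimately show ?thesis using CD[of 1, OF _ k] by (auto simp: E_def N_def)
qed

text \<open>The comparison matrix minus the jumps passed so far is locally constant on the positive
  reals; near 0 it is determined by the local forms at the vertex alone.\<close>

lemma jump_formula:
 assumes r: "0 < r" "r \<notin> X"
 shows "Ps (-1) (of_real r) = Ps 1 (of_real r) **
   (D 1 i0 ** C (-1) i0 + (\<Sum>k\<in>{k\<in>K. Re (x k) < r}. jump k))"
proof -
 have finK: "finite K" by (simp add: K_def)
 define S where "S r = (\<Sum>k\<in>{k\<in>K. Re (x k) < r}. jump k)" for r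
 define ix where "ix p = (THE k. k \<in> K \<and> Re (x k) = p)" for p
 have ix: "ix (Re (x k)) = k" if "k \<in> K" for k
 proof -
  have "l = k" if "l \<in> K" "Re (x l) = Re (x k)" for l
   using that \<open>k \<in> K\<close> K_real[of l] K_real[of k] inj by (auto simp: K_def dest: inj_onD)
  then show ?thesis unfolding ix_def using that by blast
 qed
 \<comment> \<open>At a pole itself the value is taken from the left, in agreement with the strict
   inequality in \<open>S\<close>, so that the function is locally constant there as well.\<close>
 define G where "G r = (if r \<in> X then D 1 (ix r) ** (mat 1 - (2 * of_real pi * \<i>) *\<^sub>m res (ix r)) ** C (-1) (ix r)
   else Th 1 (of_real r) ** Ps (-1) (of_real r)) - S r" for r
 note F1 = fund[of 1, simplified] and Fm = fund[of "-1", simplified]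
 have Grel: "G r = M - S r" if "0 < r" "r \<notin> X" "Ps (-1) (of_real r) = Ps 1 (of_real r) ** M" for r M
  using that fundD(4)[OF F1 real_in_dom, of r] by (simp add: G_def matrix_cancel)
 have "G a = G b" if "0 < a" "0 < b" for a b
 proof (rule connected_local_const[where f = G and A = "{0<..}"])
  show "\<forall>a\<in>{0<..}. \<forall>\<^sub>F b in at a within {0<..}. G a = G b"
  proof
   fix a :: real assume a: "a \<in> {0<..}"
   show "\<forall>\<^sub>F b in at a within {0<..}. G a = G b"
   proof (cases "a \<in> X")
    case False
    define T where "T = column a"
    have aT: "of_real a \<in> T" using in_column[of "of_real a"] a W_of_real by (simp add: T_def)
    have Tdom: "T \<subseteq> dom si" for si using a False by (auto simp: T_def dom_def pieces_def)
    obtain M where M: "\<And>ze. ze \<in> T ==> Ps (-1) ze = Ps 1 ze ** M"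
     using fund_solution[OF F1 Tdom _ _ fundD(1)[OF Fm subsetD[OF Tdom]]] open_column[of a] convex_connected[OF convex_column[of a]]
     unfolding T_def by blast
    have "open {b::real. of_real b \<in> T}"
     using open_vimage[OF open_column[of a], of complex_of_real] by (auto simp: T_def vimage_def intro: continuous_intros)
    then have "\<forall>\<^sub>F b in at a within {0<..}. of_real b \<in> T"
     using aT eventually_at_topological by blast
    then show ?thesis
    proof eventually_elim
     case (elim b)
     then have b: "b \<notin> X" "0 < b" using W_Re_pos[of "of_real b"]
      by (auto simp: T_def column_def) (metis False linorder_neqE_linordered_idom order_less_irrefl)
     have "{k\<in>K. Re (x k) < b} = {k\<in>K. Re (x k) < a}"
      using elim False b unfolding T_def column_def X_def by (auto simp: less_le)
     then have "S b = S a" by (simp add: S_def)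
     then show ?case using Grel[OF b(2,1) M[OF elim]] Grel[OF _ False M[OF aT]] a by simp
    qed
   next
    case True
    then obtain k where k: "k \<in> K" "a = Re (x k)" by (auto simp: X_def)
    have k': "k \<in> insert i0 K" using k by simp
    have "\<forall>\<^sub>F b in at a within {0<..}. b ~= a \<and> dist b a < rh k \<and> b \<in> {0<..}"
     using rho_pos[OF k'] unfolding eventually_at by blast
    then show ?thesis
    proof eventually_elim
     case (elim b)
     then have b: "0 < b" "\<bar>b - Re (x k)\<bar> < rh k" "b ~= Re (x k)" using k by (auto simp: dist_real_def)
     have near: "rh k <= \<bar>p - Re (x k)\<bar>" if "p \<in> X" "p ~= Re (x k)" for p
      using adm[OF k'] that by (simp add: admissible_def)
     have bX: "b \<notin> X" using near[of b] b by auto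
     note Gb = Grel[OF b(1) bX crossing[OF k' b]]
     have Ga: "G a = D 1 k ** (mat 1 - (2 * of_real pi * \<i>) *\<^sub>m res k) ** C (-1) k - S a"
      using True k ix by (simp add: G_def)
     show ?case
     proof (cases "b < Re (x k)")
      case True
      have "{l\<in>K. Re (x l) < b} = {l\<in>K. Re (x l) < a}"
      proof -
       have "Re (x l) < b" if "l \<in> K" "Re (x l) < Re (x k)" for l
       proof -
        have "Re (x l) \<in> X" using that by (auto simp: X_def)
        from near[OF this] show ?thesis using that(2) b(2) True by linarith
       qed
       then show ?thesis using True k by auto
      qed
      then have "S b = S a" by (simp add: S_def)
      then show ?thesis using Ga Gb True by simp
     next
      case False
      \<comment> \<open>To the right of the pole the branches agree, while \<open>S\<close> gains
        exactly \<open>jump k\<close>.\<close>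
      have "{l\<in>K. Re (x l) < b} = insert k {l\<in>K. Re (x l) < a}"
      proof -
       have "l = k \<or> Re (x l) < Re (x k)" if "l \<in> K" "Re (x l) < b" for l
       proof (cases "Re (x l) = Re (x k)")
        case True then have "l = k" using ix[OF that(1)] ix[OF k(1)] by metis
        then show ?thesis ..
       next
        case False
        have "Re (x l) \<in> X" using that by (auto simp: X_def)
        from near[OF this False] have "Re (x l) < Re (x k)" using that(2) b(2) by linarith
        then show ?thesis ..
       qed
       then show ?thesis using k False b by auto
      qed
      then have "S b = jump k + S a" using finK k by (simp add: S_def)
      then show ?thesis using Ga Gb False by (simp add: jump_def mat_distrib mat_assoc)
     qed
    qed
   qed
  qed
 qed (use that in \<open>auto intro: convex_connected\<close>)
 note const = this
 obtain r0 where r0: "0 < r0" "r0 < rh i0" "\<forall>p\<in>X. r0 < p"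
 proof -
  define r0 where "r0 = Min (insert (rh i0) X) / 2"
  have fin: "finite (insert (rh i0) X)" using finite_X by simp
  have "0 < Min (insert (rh i0) X)" by (subst Min_gr_iff) (use fin rho_pos[of i0] X_pos in auto)
  then have pos: "0 < r0" "r0 < Min (insert (rh i0) X)" by (simp_all add: r0_def)
  have "r0 < p" if "p \<in> insert (rh i0) X" for p
   using Min_le[OF fin that] pos by linarith
  then show ?thesis using that pos by simp
 qed
 have r0X: "r0 \<notin> X" using r0 by auto
 have "Ps (-1) (of_real r0) = Ps 1 (of_real r0) ** (D 1 i0 ** C (-1) i0)"
  using crossing[of i0 r0] r0 i0 by simp
 from Grel[OF r0(1) r0X this] have "G r0 = D 1 i0 ** C (-1) i0 - S r0" .
 moreover have "{k\<in>K. Re (x k) < r0} = {}" using r0 by (force simp: X_def)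
 then have "S r0 = 0" by (simp only: S_def sum.empty)
 ultimately have "G r = D 1 i0 ** C (-1) i0" using const[OF r0(1) r(1)] by simp
 then have "Th 1 (of_real r) ** Ps (-1) (of_real r) = D 1 i0 ** C (-1) i0 + S r"
  using r by (simp add: G_def algebra_simps)
 then show ?thesis using fundD(3)[OF F1 real_in_dom[OF r]] by (metis S_def matrix_cancel)
qed

end

section \<open>Logarithmic estimates and growth of the solutions\<close>

text \<open>The imaginary part of \<open>Ln\<close> and the shift by pi/2 together contribute at
  most 3 pi/2 < 6.\<close>

lemma norm_lg_le: assumes "\<bar>si\<bar> = 1" "w ~= 0" shows "norm (lg si w) <= \<bar>ln (norm w)\<bar> + 6"
proof -
 define u where "u = - \<i> * of_real si * w"
 have u: "u ~= 0" "norm u = norm w" using assms by (auto simp: u_def norm_mult)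
 have "norm (Ln u) <= \<bar>Re (Ln u)\<bar> + \<bar>Im (Ln u)\<bar>" by (rule cmod_le)
 also have "\<dots> <= \<bar>ln (norm w)\<bar> + pi"
  using u mpi_less_Im_Ln[OF u(1)] Im_Ln_le_pi[OF u(1)] by simp
 finally have "norm (Ln u) <= \<bar>ln (norm w)\<bar> + pi" .
 moreover have "norm (\<i> * of_real si * of_real (pi / 2)) = pi / 2" using assms by (simp add: norm_mult)
 moreover have "norm (lg si w) <= norm (Ln u) + norm (\<i> * of_real si * of_real (pi / 2))"
  unfolding lg_def u_def by (rule norm_triangle_ineq)
 ultimately show ?thesis using pi_less_4 by linarith
qed

text \<open>With s = |w|^(1/4) one has |ln s| <= 1/s, hence |lg w| <= 4/s + 6 <= 10/s; squaring
  gives the constant 100.\<close>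

lemma lg_square_bound:
 assumes "\<bar>si\<bar> = 1" "0 < norm w" "norm w < 1"
 shows "norm w * (norm (lg si w))\<^sup>2 <= 100 * sqrt (norm w)"
proof -
 define s where "s = sqrt (sqrt (norm w))"
 have s: "0 < s" "s < 1" "s\<^sup>2 = sqrt (norm w)" using assms by (auto simp: s_def)
 have s4: "norm w = s ^ 4"
 proof -
  have "s ^ 4 = (s\<^sup>2)\<^sup>2" by (simp flip: power_mult)
  then show ?thesis using s assms by simp
 qed
 have "ln (1 / s) <= 1 / s - 1" using s by (intro ln_le_minus_one) simp
 then have "\<bar>ln s\<bar> <= 1 / s" using s by (simp add: ln_div abs_if)
 moreover have "ln (norm w) = 4 * ln s" unfolding s4 using s by (simp add: ln_realpow)
 ultimately have "\<bar>ln (norm w)\<bar> <= 4 / s" by simp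
 moreover have "6 <= 6 / s" using s by (simp add: field_simps)
 ultimately have "norm (lg si w) <= 10 / s"
  using norm_lg_le[OF assms(1), of w] assms(2) by (simp add: add_divide_distrib[symmetric])
 then have "norm w * (norm (lg si w))\<^sup>2 <= norm w * (10 / s)\<^sup>2"
  by (intro mult_left_mono power_mono) auto
 also have "\<dots> = 100 * s\<^sup>2" using s unfolding s4 by (simp add: power_divide power4_eq_xxxx power2_eq_square)
 finally show ?thesis using s by simp
qed

lemma lg_bound:
 assumes "\<bar>si\<bar> = 1" "0 < norm w" "norm w < 1"
 shows "norm w * norm (lg si w) <= norm w + 100 * sqrt (norm w)"
proof -
 have "norm (lg si w) <= 1 + (norm (lg si w))\<^sup>2"
  using zero_le_power2[of "norm (lg si w) - 1/2"] by (simp add: power2_eq_square algebra_simps)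
 then have "norm w * norm (lg si w) <= norm w * (1 + (norm (lg si w))\<^sup>2)" by (intro mult_left_mono) auto
 also have "\<dots> = norm w + norm w * (norm (lg si w))\<^sup>2" by (simp add: algebra_simps)
 also have "\<dots> <= norm w + 100 * sqrt (norm w)" using lg_square_bound[OF assms] by simp
 finally show ?thesis .
qed

lemma tendsto_lg:
 assumes "\<bar>si\<bar> = 1"
 shows "((%w. norm w * norm (lg si w)) \<longlongrightarrow> 0) (at 0)"
  and "((%w. norm w * (norm (lg si w))\<^sup>2) \<longlongrightarrow> 0) (at 0)"
proof -
 have ev: "\<forall>\<^sub>F w in at (0::complex). 0 < norm w \<and> norm w < 1"
  by (auto simp: eventually_at intro!: exI[of _ 1])
 have l1: "((%w::complex. norm w + 100 * sqrt (norm w)) \<longlongrightarrow> norm (0::complex) + 100 * sqrt (norm (0::complex))) (at 0)"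
  by (intro tendsto_intros)
 have l2: "((%w::complex. 100 * sqrt (norm w)) \<longlongrightarrow> 100 * sqrt (norm (0::complex))) (at 0)"
  by (intro tendsto_intros)
 show "((%w. norm w * norm (lg si w)) \<longlongrightarrow> 0) (at 0)"
  by (rule Lim_null_comparison[OF _ l1[simplified]])
   (use ev in \<open>eventually_elim, use lg_bound[OF assms] in simp\<close>)
 show "((%w. norm w * (norm (lg si w))\<^sup>2) \<longlongrightarrow> 0) (at 0)"
  by (rule Lim_null_comparison[OF _ l2[simplified]])
   (use ev in \<open>eventually_elim, use lg_square_bound[OF assms] in simp\<close>)
qed

lemma has_mder_lipschitz:
 assumes "has_mder f E (at z)"
 shows "\<exists>B de. 0 < de \<and> 0 <= B \<and> (\<forall>y. norm (y - z) < de --> norm (f y - f z) <= B * norm (y - z))"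
proof -
 obtain de where de: "0 < de" "\<And>y. norm (y - z) < de ==> norm (f y - f z - (y - z) *\<^sub>m E) <= 1 * norm (y - z)"
  using assms unfolding has_mder_def has_derivative_at_alt by (metis zero_less_one)
 have "norm (f y - f z) <= (1 + norm E) * norm (y - z)" if "norm (y - z) < de" for y
 proof -
  have "norm (f y - f z) <= norm (f y - f z - (y - z) *\<^sub>m E) + norm ((y - z) *\<^sub>m E)"
   using norm_triangle_sub by (metis add.commute)
  then show ?thesis using de(2)[OF that] by (simp add: algebra_simps)
 qed
 then show ?thesis using de(1) by (intro exI[of _ "1 + norm E"] exI[of _ de]) auto
qed

context projections
begin

lemma norm_diag_le: "norm (diag f) <= (\<Sum>k=1..m. norm (f k) * norm (P k))"
 unfolding diag_def by (rule order_trans[OF norm_sum]) simp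

lemma tendsto_diag: "(\<And>k. k \<in> {1..m} ==> ((%t. f t k) \<longlongrightarrow> g k) G) ==> ((%t. diag (f t)) \<longlongrightarrow> diag g) G"
 unfolding diag_def by (intro tendsto_sum ms.tendsto tendsto_const)

lemma has_mder_diag: "has_mder (%ze. diag (%k. ze - x k)) (mat 1) (at ze within S)"
proof -
 have "(%ze. diag (%k. ze - x k)) = (%ze. ze *\<^sub>m mat 1 - diag x)"
  by (simp add: diag_def ms.diff_left sum_subtractf fun_eq_iff ms.sum_right[symmetric] sumP del: One_nat_def)
 moreover have "has_mder (%ze. ze *\<^sub>m mat 1 :: complex^'n^'n) (1 *\<^sub>m mat 1 + ze *\<^sub>m 0) (at ze within S)"
  by (rule has_mder_msmult) (auto intro!: derivative_eq_intros)
 from has_mder_diff[OF this has_mder_const[of "diag x"]]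
 have "has_mder (%ze. ze *\<^sub>m mat 1 - diag x) (mat 1) (at ze within S)" by (simp add: ms.zero_right)
 ultimately show ?thesis by simp
qed

end

context fuchs
begin

text \<open>The \<open>P l\<close>-component carries the whole logarithmic singularity at \<open>x l\<close>, and \<open>ze - x\<close> kills it.\<close>
lemma tendsto_diag_log:
 assumes l: "l \<in> {1..m}" and H: "near_solution l rh H" and si: "\<bar>si\<bar> = 1"
 shows "((%ze. diag (%j. ze - x j) ** H ze ** (mat 1 + lg si (ze - x l) *\<^sub>m res l)) \<longlongrightarrow> diag (%j. x l - x j)) (at (x l))"
proof -
 define N where "N = res l"
 define d where "d ze = diag (%j. ze - x j)" for ze
 have H0: "H (x l) = mat 1" using H by (simp add: near_solution_def)
 obtain E where E: "has_mder H E (at (x l))"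
  using H unfolding near_solution_def by (meson centre_in_ball)
 obtain B de where B: "0 < de" "0 <= B" "\<And>y. norm (y - x l) < de ==> norm (H y - mat 1) <= B * norm (y - x l)"
  using has_mder_lipschitz[OF E] H0 by auto
 have Hc: "(H \<longlongrightarrow> mat 1) (at (x l))"
  using has_mder_imp_continuous[OF E] H0 by (simp add: continuous_at)
 have dc: "(d \<longlongrightarrow> d (x l)) (at (x l))"
  unfolding d_def by (intro tendsto_diag tendsto_intros)
 have T1: "((%ze. d ze ** H ze) \<longlongrightarrow> d (x l) ** mat 1) (at (x l))" by (intro mm.tendsto dc Hc)
 have dN: "d ze ** N = (ze - x l) *\<^sub>m N" for ze
  using diag_P[OF l, of "%j. ze - x j"] by (simp add: d_def N_def res_def matrix_mul_assoc)
 have lim: "((%ze. norm (ze - x l) * norm (lg si (ze - x l))) \<longlongrightarrow> 0) (at (x l))"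
  using tendsto_lg(1)[OF si] LIM_offset[of "%w. norm w * norm (lg si w)" 0 0 "- x l"] by simp
 have T2: "((%ze. lg si (ze - x l) *\<^sub>m (d ze ** H ze ** N)) \<longlongrightarrow> 0) (at (x l))"
 proof (rule Lim_null_comparison)
  show "((%ze. (norm (ze - x l) * norm (lg si (ze - x l))) * ((norm (d ze) * B + 1) * norm N)) \<longlongrightarrow> 0) (at (x l))"
   using tendsto_mult[OF lim, of "%ze. (norm (d ze) * B + 1) * norm N" "(norm (d (x l)) * B + 1) * norm N"]
   by (simp add: tendsto_intros dc)
  have "\<forall>\<^sub>F ze in at (x l). norm (ze - x l) < de"
   using B(1) by (auto simp: eventually_at dist_norm)
  then show "\<forall>\<^sub>F ze in at (x l). norm (lg si (ze - x l) *\<^sub>m (d ze ** H ze ** N)) <=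
    (norm (ze - x l) * norm (lg si (ze - x l))) * ((norm (d ze) * B + 1) * norm N)"
  proof eventually_elim
   case (elim ze)
   \<comment> \<open>Both parts are of order zeta - x_l: the first because \<open>H\<close> is
     Lipschitz at the pole, the second because zeta - x acts on the image of P l as the scalar zeta
     - x_l. This factor absorbs the logarithm.\<close>
   have "d ze ** H ze ** N = d ze ** (H ze - mat 1) ** N + (ze - x l) *\<^sub>m N"
    unfolding dN[symmetric] by (simp add: mat_distrib)
   then have "norm (d ze ** H ze ** N) <= norm (d ze ** (H ze - mat 1) ** N) + norm (ze - x l) * norm N"
    by (metis norm_msmult norm_triangle_ineq)
   also have "norm (d ze ** (H ze - mat 1) ** N) <= norm (d ze) * norm (H ze - mat 1) * norm N"
    by (meson norm_matrix_mult_le order_trans mult_right_mono norm_ge_zero)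
   also have "\<dots> <= norm (d ze) * (B * norm (ze - x l)) * norm N"
    using B(3)[OF elim] by (intro mult_right_mono mult_left_mono) auto
   finally have "norm (d ze ** H ze ** N) <= norm (ze - x l) * ((norm (d ze) * B + 1) * norm N)"
    by (simp add: algebra_simps)
   then have "norm (lg si (ze - x l)) * norm (d ze ** H ze ** N) <=
     norm (lg si (ze - x l)) * (norm (ze - x l) * ((norm (d ze) * B + 1) * norm N))"
    by (rule mult_left_mono) simp
   then show ?case by (simp add: mult_ac)
  qed
 qed
 from tendsto_add[OF T1 T2] show ?thesis by (simp add: mat_distrib d_def N_def)
qed

end

context fuchs_solutions
begin

text \<open>The solution without logarithm at the pole k, equal to \<open>H k ze ** P k\<close> near
  it and continued over \<open>dom si\<close>.\<close>

definition Ph :: "real => nat => complex => complex^'n^'n" where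
 "Ph si k ze = Ps si ze ** D si k ** P k"

lemma Phi_mder: "\<bar>si\<bar> = 1 ==> ze \<in> dom si ==> has_mder (Ph si k) (A ze ** Ph si k ze) (at ze)"
 unfolding Ph_def mat_assoc using has_mder_multc_right[OF fundD(1)[OF fund]] by (simp add: mat_assoc)

lemma Phi_near:
 assumes "\<bar>si\<bar> = 1" "k \<in> insert i0 K" "ze \<in> slit si k (rh k)"
 shows "Ph si k ze = H k ze ** P k"
proof -
 have "Ph si k ze = H k ze ** (mat 1 + lg si (ze - x k) *\<^sub>m res k) ** (C si k ** D si k) ** P k"
  unfolding Ph_def form[OF assms] by (simp add: mat_assoc)
 then show ?thesis using CD[OF assms(1,2)] res_P[OF ks[OF assms(2)]]
  by (simp add: mat_distrib mat_assoc ms.zero_right mm.zero_right)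
qed

text \<open>Beyond \<open>R0\<close> all poles are at distance at least 1, so \<open>A\<close> is
  bounded and Gronwall's inequality along the segment from \<open>R0\<close> gives exponential
  growth. The extra 1 in the exponent absorbs the linear factor zeta - x.\<close>

lemma Phi_growth:
 assumes si: "\<bar>si\<bar> = 1"
 shows "\<exists>B M R0. 0 <= B \<and> 0 <= M \<and> 0 < R0 \<and> (\<forall>ze. R0 <= Re ze --> 0 <= si * Im ze --> si * Im ze <= nu / 2 * Re ze -->
   ze \<in> dom si \<and> norm (Ph si k ze) <= B * exp (M * Re ze) \<and>
   norm (diag (%l. ze - x l) ** Ph si k ze) <= B * exp (M * Re ze))"
proof -
 have s: "si = 1 \<or> si = -1" using si by linarith
 define Xm where "Xm = (\<Sum>l=1..m. norm (x l))"
 have Xm: "norm (x l) <= Xm" if "l \<in> {1..m}" for l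
  unfolding Xm_def by (rule member_le_sum[OF that]) auto
 have Xm0: "0 <= Xm" by (simp add: Xm_def sum_nonneg)
 define R0 where "R0 = Xm + 1"
 define E where "E = {ze. R0 <= Re ze \<and> 0 <= si * Im ze \<and> si * Im ze <= nu / 2 * Re ze}"
 have Edom: "ze \<in> dom si" if "ze \<in> E" for ze
 proof (rule W_in_dom)
  have "0 < Re ze" using that Xm0 by (simp add: E_def R0_def)
  then have "0 < nu * Re ze" using nu by simp
  then show "ze \<in> W" using that s by (auto simp: E_def W_def)
  have "Re (x l) < Re ze" if l: "l \<in> K" for l
  proof -
   have "l \<in> {1..m}" using l by (simp add: K_def)
   then have "Re (x l) <= Xm" using Xm complex_Re_le_cmod order_trans by blast
   then show ?thesis using \<open>ze \<in> E\<close> by (simp add: E_def R0_def)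
  qed
  then show "0 < si * Im ze \<or> Re ze \<notin> X" by (force simp: X_def)
 qed
 define M0 where "M0 = (\<Sum>l=1..m. norm (res l))"
 have M00: "0 <= M0" by (simp add: M0_def sum_nonneg)
 have AE: "norm (A ze) <= M0" if "ze \<in> E" for ze
  unfolding A_def M0_def
 proof (rule order_trans[OF norm_sum], rule sum_mono)
  fix l assume l: "l \<in> {1..m}"
  have "R0 <= norm ze" using that complex_Re_le_cmod[of ze] by (simp add: E_def)
  then have "1 <= norm (ze - x l)" using Xm[OF l] norm_triangle_ineq2[of ze "x l"] by (simp add: R0_def)
  then have "norm (1 / (ze - x l)) <= 1" by (simp add: norm_divide divide_le_eq_1)
  then show "norm ((1 / (ze - x l)) *\<^sub>m res l) <= norm (res l)" by (simp add: mult_left_le_one_le)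
 qed
 define M1 where "M1 = M0 * (1 + nu)"
 define B0 where "B0 = norm (Ph si k (of_real R0))"
 have M10: "0 <= M1" using M00 nu by (simp add: M1_def)
 have nE: "norm (ze - of_real R0) <= (1 + nu) * Re ze" "norm ze <= (1 + nu) * Re ze" if "ze \<in> E" for ze
 proof -
  have p: "0 <= Re ze" using that Xm0 by (auto simp: E_def R0_def)
  then have "0 <= nu * Re ze" using nu by simp
  then have im: "\<bar>Im ze\<bar> <= nu * Re ze" using that s by (auto simp: E_def)
  show "norm (ze - of_real R0) <= (1 + nu) * Re ze"
   using cmod_le[of "ze - of_real R0"] im that Xm0 by (simp add: E_def R0_def algebra_simps)
  show "norm ze <= (1 + nu) * Re ze"
   using cmod_le[of "ze"] im p by (simp add: algebra_simps)
 qed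
 have main: "norm (Ph si k ze) <= B0 * exp (M1 * Re ze)" if ze: "ze \<in> E" for ze
 proof -
  define p where "p u = of_real R0 + of_real u * (ze - of_real R0)" for u :: real
  have pE: "p u \<in> E" if "0 <= u" "u <= 1" for u
  proof -
   have "0 <= nu / 2 * R0" using nu Xm0 by (simp add: R0_def)
   then have "u * (si * Im ze) <= u * (nu / 2 * Re ze) + (1 - u) * (nu / 2 * R0)"
    using ze that mult_left_mono[of "si * Im ze" "nu / 2 * Re ze" u] by (simp add: E_def add_increasing2)
   also have "\<dots> = nu / 2 * (R0 + u * (Re ze - R0))" by (simp add: field_simps)
   finally have le: "u * (si * Im ze) <= nu / 2 * (R0 + u * (Re ze - R0))" .
   have nn: "0 <= u * (Re ze - R0)" "0 <= u * (si * Im ze)" using ze that by (auto simp: E_def)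
   have e: "si * Im (p u) = u * (si * Im ze)" "Re (p u) = R0 + u * (Re ze - R0)" by (simp_all add: p_def)
   show ?thesis unfolding E_def mem_Collect_eq e using le nn by simp
  qed
  have dp: "(p has_vector_derivative (ze - of_real R0)) (at u)" for u
   unfolding p_def by (auto intro!: derivative_eq_intros)
  have "norm (Ph si k (p 1)) <= norm (Ph si k (p 0)) * exp ((M0 * norm (ze - of_real R0)) * (1 - 0))"
  proof (rule growth_bound[where f = "%u. Ph si k (p u)"])
   fix u :: real assume u: "0 <= u" "u <= 1"
   show "((%u. Ph si k (p u)) has_vector_derivative (ze - of_real R0) *\<^sub>m (A (p u) ** Ph si k (p u))) (at u)"
    by (rule has_mder_path[OF Phi_mder[OF si Edom[OF pE[OF u]]] dp])
   have "norm (A (p u) ** Ph si k (p u)) <= M0 * norm (Ph si k (p u))"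
    using AE[OF pE[OF u]] by (meson norm_matrix_mult_le order_trans mult_right_mono norm_ge_zero)
   then show "norm ((ze - of_real R0) *\<^sub>m (A (p u) ** Ph si k (p u))) <= M0 * norm (ze - of_real R0) * norm (Ph si k (p u))"
    using mult_left_mono[of _ _ "norm (ze - of_real R0)"] by (fastforce simp: mult_ac)
  qed simp
  then have "norm (Ph si k ze) <= B0 * exp (M0 * norm (ze - of_real R0))" by (simp add: p_def B0_def)
  also have "\<dots> <= B0 * exp (M1 * Re ze)"
   using mult_left_mono[OF nE(1)[OF ze] M00] by (intro mult_left_mono) (auto simp: M1_def B0_def mult_ac)
  finally show ?thesis .
 qed
 define c where "c = (\<Sum>l=1..m. (1 + nu + Xm) * norm (P l))"
 have c0: "0 <= c" using nu Xm0 by (auto simp: c_def intro!: sum_nonneg mult_nonneg_nonneg)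
 have dg: "norm (diag (%l. ze - x l)) <= c * exp (Re ze)" if ze: "ze \<in> E" for ze
 proof -
  have p: "0 <= Re ze" using ze Xm0 by (auto simp: E_def R0_def)
  have "norm (ze - x l) <= (1 + nu + Xm) * exp (Re ze)" if "l \<in> {1..m}" for l
  proof -
   have "norm (ze - x l) <= (1 + nu) * Re ze + Xm"
    using nE(2)[OF ze] Xm[OF that] norm_triangle_ineq4[of ze "x l"] by linarith
   also have "\<dots> <= (1 + nu) * exp (Re ze) + Xm * exp (Re ze)"
   proof (intro add_mono mult_left_mono)
    show "Re ze <= exp (Re ze)" using exp_ge_add_one_self[of "Re ze"] by linarith
    show "Xm <= Xm * exp (Re ze)" using Xm0 p by (simp add: mult_le_cancel_left1)
   qed (use nu in auto)
   finally show ?thesis by (simp add: algebra_simps)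
  qed
  then have "(\<Sum>l=1..m. norm (ze - x l) * norm (P l)) <= (\<Sum>l=1..m. (1 + nu + Xm) * exp (Re ze) * norm (P l))"
   by (intro sum_mono mult_right_mono) auto
  also have "\<dots> = c * exp (Re ze)" by (simp add: c_def sum_distrib_right sum_distrib_left mult_ac)
  finally show ?thesis using norm_diag_le[of "%l. ze - x l"] by linarith
 qed
 define B where "B = (1 + c) * B0"
 have B: "B0 <= B" "0 <= B" "c * B0 <= B" using c0 by (auto simp: B_def B0_def algebra_simps)
 have "norm (Ph si k ze) <= B * exp ((M1 + 1) * Re ze) \<and> norm (diag (%l. ze - x l) ** Ph si k ze) <= B * exp ((M1 + 1) * Re ze)"
  if ze: "ze \<in> E" for ze
 proof
  have p: "0 <= Re ze" using ze Xm0 by (auto simp: E_def R0_def)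
  have "norm (Ph si k ze) <= B0 * exp (M1 * Re ze)" by (rule main[OF ze])
  also have "\<dots> <= B * exp ((M1 + 1) * Re ze)" using B p by (intro mult_mono) (auto simp: algebra_simps)
  finally show "norm (Ph si k ze) <= B * exp ((M1 + 1) * Re ze)" .
  have "norm (diag (%l. ze - x l) ** Ph si k ze) <= norm (diag (%l. ze - x l)) * norm (Ph si k ze)"
   by (rule norm_matrix_mult_le)
  also have "\<dots> <= (c * exp (Re ze)) * (B0 * exp (M1 * Re ze))"
   using dg[OF ze] main[OF ze] c0 by (intro mult_mono) auto
  also have "\<dots> = (c * B0) * exp ((M1 + 1) * Re ze)" by (simp add: algebra_simps exp_add)
  also have "\<dots> <= B * exp ((M1 + 1) * Re ze)" using B by (intro mult_right_mono) auto
  finally show "norm (diag (%l. ze - x l) ** Ph si k ze) <= B * exp ((M1 + 1) * Re ze)" .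
 qed
 then show ?thesis
  by (intro exI[of _ B] exI[of _ "M1 + 1"] exI[of _ R0]) (use B M10 Xm0 Edom in \<open>auto simp: E_def R0_def\<close>)
qed

text \<open>The closed sector with vertex x_k between the real axis and the slanted ray on the side
  \<open>si\<close>; the contours are moved within it.\<close>

definition cone :: "real => nat => complex set" where
 "cone si k = {ze. Re (x k) <= Re ze \<and> 0 <= si * Im ze \<and> si * Im ze <= nu / 2 * (Re ze - Re (x k))}"

text \<open>Continuous extension of (zeta - x) times the solution to the poles: the value at a pole
  is the limit found in \<open>tendsto_diag_log\<close>, with the constant \<open>C\<close> of that
  pole.\<close>

definition gext :: "real => nat => complex => complex^'n^'n" where
 "gext si k ze = (if ze \<in> x ` insert i0 K
   then diag (%j. ze - x j) ** C si (inv_into (insert i0 K) x ze) ** D si k ** P k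
   else diag (%j. ze - x j) ** Ph si k ze)"

lemma cone_W:
 assumes si: "\<bar>si\<bar> = 1" and "k \<in> insert i0 K" "ze \<in> cone si k" "ze ~= 0" shows "ze \<in> W"
proof -
 have s: "si = 1 \<or> si = -1" using si by linarith
 have p: "0 <= Re (x k)" "Re (x k) <= Re ze" using assms x_nonneg by (auto simp: cone_def)
 have le: "\<bar>Im ze\<bar> <= nu / 2 * Re ze"
 proof -
  have "\<bar>Im ze\<bar> <= nu / 2 * (Re ze - Re (x k))" using assms s by (auto simp: cone_def)
  also have "\<dots> <= nu / 2 * Re ze" using nu p by (intro mult_left_mono) auto
  finally show ?thesis .
 qed
 have "Re ze ~= 0" using le assms(4) by (auto simp: complex_eq_iff)
 then have "0 < Re ze" using p by simp
 then have "nu / 2 * Re ze < nu * Re ze" using nu by simp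
 then show ?thesis using le by (simp add: W_def)
qed

lemma cone_dom:
 assumes si: "\<bar>si\<bar> = 1" and k: "k \<in> insert i0 K" and ze: "ze \<in> cone si k" "ze \<notin> x ` insert i0 K" shows "ze \<in> dom si"
proof (rule W_in_dom)
 show "ze \<in> W" by (rule cone_W[OF si k ze(1)]) (use ze(2) i0 in auto)
 show "0 < si * Im ze \<or> Re ze \<notin> X"
 proof (rule ccontr)
  assume "\<not> (0 < si * Im ze \<or> Re ze \<notin> X)"
  then obtain l where l: "l \<in> K" "Re ze = Re (x l)" and "si * Im ze = 0" using ze by (auto simp: X_def cone_def)
  moreover from this have "Im ze = 0" using si by auto
  ultimately have "ze = x l" using x_nonneg[of l] by (simp add: complex_eq_iff)
  then show False using ze(2) l by auto
 qed
qed

text \<open>Only the poles need care. Points of the cone close to a pole lie in its slit disc, where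
  the local form applies and the factor zeta - x removes the logarithm.\<close>

lemma gext_continuous:
 assumes si: "\<bar>si\<bar> = 1" and k: "k \<in> insert i0 K"
 shows "continuous_on (cone si k) (gext si k)"
proof -
 have fin: "finite (x ` insert i0 K)" by (simp add: K_def)
 have "(gext si k \<longlongrightarrow> gext si k z) (at z within cone si k)" if z: "z \<in> cone si k" for z
 proof (cases "z \<in> x ` insert i0 K")
  case True
  then obtain l where l: "l \<in> insert i0 K" "z = x l" by blast
  have inj': "inj_on x (insert i0 K)" using inj ks by (meson inj_on_subset subsetI)
  define Q where "Q = C si l ** D si k ** P k"
  have gl: "gext si k (x l) = diag (%j. x l - x j) ** Q"
   using True l inv_into_f_f[OF inj' l(1)] by (simp add: gext_def Q_def mat_assoc)
  have "((%ze. diag (%j. ze - x j) ** H l ze ** (mat 1 + lg si (ze - x l) *\<^sub>m res l) ** Q) \<longlongrightarrow> diag (%j. x l - x j) ** Q) (at (x l))"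
   by (intro mm.tendsto tendsto_const tendsto_diag_log[OF ks[OF l(1)] near[OF l(1)] si])
  then have lim: "((%ze. diag (%j. ze - x j) ** H l ze ** (mat 1 + lg si (ze - x l) *\<^sub>m res l) ** Q) \<longlongrightarrow> diag (%j. x l - x j) ** Q) (at (x l) within cone si k)"
   by (rule tendsto_within_subset) auto
  have "\<forall>\<^sub>F ze in at (x l) within cone si k. ze ~= x l \<and> dist ze (x l) < rh l \<and> ze \<in> cone si k"
   using rho_pos[OF l(1)] unfolding eventually_at by blast
  then have "\<forall>\<^sub>F ze in at (x l) within cone si k.
    diag (%j. ze - x j) ** H l ze ** (mat 1 + lg si (ze - x l) *\<^sub>m res l) ** Q = gext si k ze"
  proof eventually_elim
   case (elim ze)
   have np: "ze ~= x l'" if "l' \<in> insert i0 K" for l'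
    using elim near[OF l(1)] ks[OF that] unfolding near_solution_def by (metis dist_commute mem_ball)
   then have "ze ~= 0" using i0 by auto
   then have W: "ze \<in> W" using cone_W[OF si k] elim by blast
   have "0 < si * Im ze \<or> Re ze ~= Re (x l)"
   proof (rule ccontr)
    assume "\<not> ?thesis"
    then have "si * Im ze = 0" "Re ze = Re (x l)" using elim by (auto simp: cone_def)
    then have "ze = x l" using x_nonneg[OF l(1)] si by (auto simp: complex_eq_iff)
    then show False using elim by simp
   qed
   then have "ze \<in> slit si l (rh l)" using W elim by (simp add: slit_def dist_commute)
   from form[OF si l(1) this] show ?case using np by (auto simp: gext_def Ph_def Q_def mat_assoc)
  qed
  from tendsto_cong[THEN iffD1, OF this lim] show ?thesis using l gl by simp
 next
  case False
  have "z \<in> dom si" by (rule cone_dom[OF si k z False])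
  from Phi_mder[OF si this, of k] have "(Ph si k \<longlongrightarrow> Ph si k z) (at z)"
   using has_mder_imp_continuous continuous_at by blast
  then have lim: "((%ze. diag (%j. ze - x j) ** Ph si k ze) \<longlongrightarrow> diag (%j. z - x j) ** Ph si k z) (at z)"
   by (intro mm.tendsto tendsto_diag tendsto_intros)
  have ev: "\<forall>\<^sub>F ze in at z. diag (%j. ze - x j) ** Ph si k ze = gext si k ze"
  proof -
   have "\<forall>\<^sub>F ze in at z. ze \<in> - x ` insert i0 K"
    using False finite_imp_closed[OF fin] by (intro eventually_at_in_open') auto
   then show ?thesis by eventually_elim (auto simp: gext_def)
  qed
  have "gext si k z = diag (%j. z - x j) ** Ph si k z" using False by (simp add: gext_def)
  then have "(gext si k \<longlongrightarrow> gext si k z) (at z)"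
   using tendsto_cong[THEN iffD1, OF ev lim] by simp
  then show ?thesis by (rule tendsto_within_subset) simp
 qed
 then show ?thesis by (simp add: continuous_on_def)
qed

end

section \<open>Truncated Laplace integrals\<close>

lemma integral_entry:
 fixes f :: "real => complex^'n^'n"
 assumes "f integrable_on S"
 shows "integral S f $ i $ j = integral S (%u. f u $ i $ j)"
proof -
 have "bounded_linear (%M :: complex^'n^'n. M $ i $ j)"
  by (rule bounded_linear_compose[OF bounded_linear_vec_nth bounded_linear_vec_nth])
 from integral_linear[OF assms this] show ?thesis by (simp add: o_def)
qed

lemma integral_msmult:
 fixes f :: "real => complex^'n^'n"
 assumes "f integrable_on S"
 shows "integral S (%u. c *\<^sub>m f u) = c *\<^sub>m integral S f"
 using integral_linear[OF assms ms.bounded_linear_right[of c]] by (simp add: o_def)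

lemma integral_u_exp_le:
 fixes a :: real assumes "0 < a" "0 <= R"
 shows "(%u. u * exp (- a * u)) integrable_on {0..R}" "integral {0..R} (%u. u * exp (- a * u)) <= 1 / a\<^sup>2"
proof -
 define f where "f u = - (u / a + 1 / a\<^sup>2) * exp (- a * u)" for u
 have d: "(f has_vector_derivative u * exp (- a * u)) (at u within {0..R})" for u
  unfolding f_def has_real_derivative_iff_has_vector_derivative[symmetric] using assms
  by (auto intro!: derivative_eq_intros simp: field_simps power2_eq_square)
 have I: "((%u. u * exp (- a * u)) has_integral f R - f 0) {0..R}"
  by (rule fundamental_theorem_of_calculus[OF assms(2) d])
 then show "(%u. u * exp (- a * u)) integrable_on {0..R}" by blast
 have "0 <= R / a + 1 / a\<^sup>2" using assms by simp
 then have "f R <= 0" unfolding f_def by (intro mult_nonpos_nonneg) (simp_all only: neg_le_0_iff_le exp_ge_zero)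
 then show "integral {0..R} (%u. u * exp (- a * u)) <= 1 / a\<^sup>2"
  using I by (simp add: integral_unique f_def)
qed

context projections
begin

text \<open>Laplace integrals of a solution \<open>\<phi>\<close> of the transformed equation along the ray \<open>x k + u w\<close>, cut off at \<open>R\<close>.\<close>

lemma continuous_on_diag: "(\<And>k. continuous_on S (%u. f u k)) ==> continuous_on S (%u. diag (f u))"
 unfolding diag_def by (intro continuous_on_sum ms.continuous_on continuous_on_const)

lemma diag_const: "diag (%j. c) = c *\<^sub>m mat 1"
 using diag_cmult[of c "%j. 1"] by (simp add: diag_one)

lemma diag_diff: "diag (%j. f j - g j) = diag f - diag g"
 by (simp add: diag_def ms.diff_left sum_subtractf)

context
 fixes F :: "complex^'n^'n" and x :: "nat => complex" and k :: nat and w :: complex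
  and \<phi> \<phi>' :: "real => complex^'n^'n" and B M :: real
 assumes k: "k \<in> {1..m}" and \<phi>0: "\<phi> 0 = P k" and cont: "continuous_on {0..} \<phi>"
  and der: "\<And>u. 0 < u ==> (\<phi> has_vector_derivative \<phi>' u) (at u)"
  and ode: "\<And>u. 0 < u ==> diag (%j. x k + of_real u * w - x j) ** \<phi>' u = w *\<^sub>m (F ** \<phi> u)"
  and B: "0 <= B" and M: "0 < M"
  and bd: "\<And>u. 0 <= u ==> norm (diag (%j. x k + of_real u * w - x j) ** \<phi> u) <= B * exp (M * u)"
  and lip: "\<And>u. 0 <= u ==> norm (\<phi> u - P k) <= B * u * exp (M * u)"
begin

definition lexp :: "real => complex => complex" where "lexp u t = exp (- (x k + of_real u * w) / t)"
definition dray :: "real => complex^'n^'n" where "dray u = diag (%j. x k + of_real u * w - x j)"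
text \<open>\<open>lapI\<close> transforms the solution itself, \<open>lapG\<close> its product with
  zeta - x. The differential equation in \<open>t\<close> concerns the first, the contour shift the
  second.\<close>

definition lapI :: "real => complex => complex^'n^'n" where
 "lapI R t = integral {0..R} (%u. (w * lexp u t) *\<^sub>m \<phi> u)"
definition lapG :: "real => complex => complex^'n^'n" where
 "lapG R t = integral {0..R} (%u. (w * lexp u t) *\<^sub>m (dray u ** \<phi> u))"

lemma contR: "continuous_on {0..R} \<phi>"
 by (rule continuous_on_subset[OF cont]) auto

lemma cont_lexp: "t ~= 0 ==> continuous_on S (%u. lexp u t)"
 unfolding lexp_def by (intro continuous_intros) auto

lemma cont_dray: "continuous_on S dray"
 unfolding dray_def by (intro continuous_on_diag continuous_intros)

lemma int_I: "t ~= 0 ==> (%u. (w * lexp u t) *\<^sub>m \<phi> u) integrable_on {0..R}"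
 by (intro integrable_continuous_real ms.continuous_on contR continuous_on_mult_left cont_lexp)

lemma int_G: "t ~= 0 ==> (%u. (w * lexp u t) *\<^sub>m (dray u ** \<phi> u)) integrable_on {0..R}"
 by (intro integrable_continuous_real ms.continuous_on mm.continuous_on contR continuous_on_mult_left cont_lexp cont_dray)

text \<open>The derivative of (zeta - x) phi along the ray is w (1 + F) phi. The boundary term at u
  = 0 vanishes because x_k - x annihilates P k.\<close>

lemma lap_by_parts:
 assumes t: "t ~= 0" and R: "0 <= R"
 shows "lapG R t = t *\<^sub>m (lapI R t + F ** lapI R t) - (t * lexp R t) *\<^sub>m (dray R ** \<phi> R)"
proof -
 define f where "f u = (- t * lexp u t) *\<^sub>m (dray u ** \<phi> u)" for u
 define g where "g u = (w * lexp u t) *\<^sub>m (dray u ** \<phi> u) - t *\<^sub>m ((w * lexp u t) *\<^sub>m \<phi> u + F ** ((w * lexp u t) *\<^sub>m \<phi> u))" for u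
 have gi: "(g has_integral f R - f 0) {0..R}"
 proof (rule fundamental_theorem_of_calculus_interior[OF R])
  show "continuous_on {0..R} f" unfolding f_def
   by (intro ms.continuous_on mm.continuous_on contR continuous_on_mult_left cont_lexp[OF t] cont_dray)
  fix u assume "u \<in> {0<..<R}"
  then have u: "0 < u" by simp
  have ray: "((%u. x k + of_real u * w) has_vector_derivative w) (at u)"
   by (auto intro!: derivative_eq_intros)
  have "((%z. - t * exp (- z / t)) has_field_derivative exp (- v / t)) (at v)" for v
   using t by (auto intro!: derivative_eq_intros)
  from field_vector_diff_chain_at[OF ray this]
  have e: "((%u. - t * lexp u t) has_vector_derivative w * lexp u t) (at u)"
   by (simp only: lexp_def o_def)
  have d: "(dray has_vector_derivative w *\<^sub>m mat 1) (at u)"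
   unfolding dray_def by (rule has_mder_path[OF has_mder_diag ray])
  have "(f has_vector_derivative (- t * lexp u t) *\<^sub>m (dray u ** \<phi>' u + (w *\<^sub>m mat 1) ** \<phi> u)
    + (w * lexp u t) *\<^sub>m (dray u ** \<phi> u)) (at u)"
   unfolding f_def by (intro ms.has_vector_derivative mm.has_vector_derivative e d der u)
  moreover have "(- t * lexp u t) *\<^sub>m (dray u ** \<phi>' u + (w *\<^sub>m mat 1) ** \<phi> u) + (w * lexp u t) *\<^sub>m (dray u ** \<phi> u) = g u"
  proof -
   have od: "dray u ** \<phi>' u = w *\<^sub>m (F ** \<phi> u)" using ode[OF u] by (simp only: dray_def)
   show ?thesis by (simp add: g_def od mat_distrib mult_ac)
  qed
  ultimately show "(f has_vector_derivative g u) (at u)" by simp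
 qed
 have "dray 0 ** \<phi> 0 = 0" using diag_P[OF k] by (simp add: dray_def \<phi>0 ms.zero_left)
 then have f0: "f 0 = 0" by (simp add: f_def ms.zero_right)
 have "(g has_integral lapG R t - t *\<^sub>m (lapI R t + F ** lapI R t)) {0..R}"
 proof -
  have FI: "((%u. F ** ((w * lexp u t) *\<^sub>m \<phi> u)) has_integral F ** lapI R t) {0..R}"
   unfolding lapI_def using has_integral_linear[OF integrable_integral[OF int_I[OF t]] mm.bounded_linear_right[of F]]
   by (simp add: o_def)
  have "((%u. (w * lexp u t) *\<^sub>m \<phi> u + F ** ((w * lexp u t) *\<^sub>m \<phi> u)) has_integral lapI R t + F ** lapI R t) {0..R}"
   using has_integral_add[OF integrable_integral[OF int_I[OF t]] FI] by (simp add: lapI_def)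
  from has_integral_linear[OF this ms.bounded_linear_right[of t]]
  show ?thesis unfolding g_def
   using has_integral_diff[OF integrable_integral[OF int_G[OF t]]] by (simp add: o_def lapG_def)
 qed
 from has_integral_unique[OF this gi]
 have "lapG R t - t *\<^sub>m (lapI R t + F ** lapI R t) = f R" by (simp only: f0 diff_0_right)
 then show ?thesis by (simp add: f_def ms.minus_left algebra_simps)
qed

text \<open>Differentiation under the integral brings down zeta / t^2, and zeta is split as (zeta -
  x) + x.\<close>

lemma lapI_mder:
 assumes t: "t ~= 0" and R: "0 <= R"
 shows "has_mder (lapI R) ((1 / t\<^sup>2) *\<^sub>m (lapG R t + diag x ** lapI R t)) (at t)"
proof -
 define q where "q u t = ((x k + of_real u * w) / t\<^sup>2 * (w * lexp u t))" for u t
 define U where "U = ball t (norm t)"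
 have U0: "s ~= 0" if "s \<in> U" for s using that by (auto simp: U_def dist_norm)
 have qi: "(%u. q u t *\<^sub>m \<phi> u) integrable_on {0..R}"
  unfolding q_def
  by (intro integrable_continuous_real ms.continuous_on contR continuous_on_mult_left continuous_on_mult cont_lexp t continuous_intros) (use t in auto)
 have "has_mder (lapI R) (integral {0..R} (%u. q u t *\<^sub>m \<phi> u)) (at t)"
  unfolding has_mder_iff
 proof (intro allI)
  fix i j
  have "((%s. integral (cbox 0 R) (%u. (w * lexp u s) * \<phi> u $ i $ j)) has_field_derivative
    integral (cbox 0 R) (%u. q u t * \<phi> u $ i $ j)) (at t within U)"
  proof (rule leibniz_rule_field_derivative)
   show "((%s. (w * lexp u s) * \<phi> u $ i $ j) has_field_derivative q u s * \<phi> u $ i $ j) (at s within U)"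
    if "s \<in> U" for s u
    unfolding lexp_def q_def using U0[OF that]
    by (auto intro!: derivative_eq_intros simp: power2_eq_square)
   have ce: "continuous_on {0..R} (%u. \<phi> u $ i $ j)" by (intro continuous_intros contR)
   show "(%u. (w * lexp u s) * \<phi> u $ i $ j) integrable_on cbox 0 R" if "s \<in> U" for s
    using U0[OF that] by (auto intro!: integrable_continuous_real continuous_intros ce cont_lexp)
   have cs: "continuous_on (U \<times> cbox 0 R) (%z. \<phi> (snd z) $ i $ j)"
    by (rule continuous_on_compose2[OF ce]) (auto intro!: continuous_intros)
   show "continuous_on (U \<times> cbox 0 R) (%(s, u). q u s * \<phi> u $ i $ j)"
    unfolding q_def lexp_def case_prod_unfold
    by (rule continuous_on_mult[OF _ cs])
     (intro continuous_intros, use U0 in auto)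
  qed (use t in \<open>auto simp: U_def\<close>)
  moreover have "at t within U = at t" using t by (intro at_within_open) (auto simp: U_def)
  ultimately have "((%s. integral {0..R} (%u. (w * lexp u s) * \<phi> u $ i $ j)) has_field_derivative
    integral {0..R} (%u. q u t * \<phi> u $ i $ j)) (at t)" by simp
  moreover have "lapI R s $ i $ j = integral {0..R} (%u. (w * lexp u s) * \<phi> u $ i $ j)" if "s \<in> U" for s
   unfolding lapI_def integral_entry[OF int_I[OF U0[OF that]]] by simp
  ultimately show "((%s. lapI R s $ i $ j) has_field_derivative integral {0..R} (%u. q u t *\<^sub>m \<phi> u) $ i $ j) (at t)"
   unfolding integral_entry[OF qi] using t
   by (auto simp: U_def intro: has_field_derivative_transform_within_open[of _ _ _ U])
 qed
 moreover have "integral {0..R} (%u. q u t *\<^sub>m \<phi> u) = (1 / t\<^sup>2) *\<^sub>m (lapG R t + diag x ** lapI R t)"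
 proof -
  have XI: "((%u. diag x ** ((w * lexp u t) *\<^sub>m \<phi> u)) has_integral diag x ** lapI R t) {0..R}"
   unfolding lapI_def using has_integral_linear[OF integrable_integral[OF int_I[OF t]] mm.bounded_linear_right[of "diag x"]]
   by (simp add: o_def)
  from has_integral_linear[OF has_integral_add[OF integrable_integral[OF int_G[OF t]] XI] ms.bounded_linear_right[of "1 / t\<^sup>2"]]
  have "((%u. (1 / t\<^sup>2) *\<^sub>m ((w * lexp u t) *\<^sub>m (dray u ** \<phi> u) + diag x ** ((w * lexp u t) *\<^sub>m \<phi> u))) has_integral
    (1 / t\<^sup>2) *\<^sub>m (lapG R t + diag x ** lapI R t)) {0..R}" by (simp add: o_def lapG_def)
  moreover have "(1 / t\<^sup>2) *\<^sub>m ((w * lexp u t) *\<^sub>m (dray u ** \<phi> u) + diag x ** ((w * lexp u t) *\<^sub>m \<phi> u)) = q u t *\<^sub>m \<phi> u" for u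
   by (simp add: dray_def diag_diff diag_const q_def mat_distrib mult_ac add_divide_distrib distrib_left distrib_right)
  ultimately show ?thesis by (simp add: integral_unique)
 qed
 ultimately show ?thesis by simp
qed

definition lapy :: "real => complex => complex^'n^'n" where "lapy R t = (1 / t) *\<^sub>m lapI R t"

text \<open>After integration by parts the summand t \<open>lapI\<close> of \<open>lapG\<close>
  cancels the derivative of the prefactor 1/t; what remains is the original equation up to the
  boundary term at \<open>R\<close>.\<close>

lemma lapy_mder:
 assumes t: "t ~= 0" and R: "0 <= R"
 shows "has_mder (lapy R) (((1 / t\<^sup>2) *\<^sub>m diag x + (1 / t) *\<^sub>m F) ** lapy R t - (lexp R t / t\<^sup>2) *\<^sub>m (dray R ** \<phi> R)) (at t)"
proof -
 have "((%t. 1 / t) has_field_derivative - 1 / t\<^sup>2) (at t)"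
  using t by (auto intro!: derivative_eq_intros simp: power2_eq_square)
 from has_mder_msmult[OF this lapI_mder[OF t R]]
 have "has_mder (lapy R) ((- 1 / t\<^sup>2) *\<^sub>m lapI R t + (1 / t) *\<^sub>m ((1 / t\<^sup>2) *\<^sub>m (lapG R t + diag x ** lapI R t))) (at t)"
  unfolding lapy_def[abs_def] .
 moreover have "(- 1 / t\<^sup>2) *\<^sub>m lapI R t + (1 / t) *\<^sub>m ((1 / t\<^sup>2) *\<^sub>m (lapG R t + diag x ** lapI R t)) =
   ((1 / t\<^sup>2) *\<^sub>m diag x + (1 / t) *\<^sub>m F) ** lapy R t - (lexp R t / t\<^sup>2) *\<^sub>m (dray R ** \<phi> R)"
  unfolding lap_by_parts[OF t R] lapy_def using t
  by (simp add: mat_distrib ms.minus_left power2_eq_square field_simps)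
 ultimately show ?thesis by simp
qed

text \<open>Replacing phi by its initial value P k gives an elementary integral. The error of phi is
  at most B u exp (M u), which leads to the integral of u exp (- a u) with a = Re (w/t) - M, bounded
  by 1/a^2 independently of \<open>R\<close>.\<close>

lemma lapy_asymptotic:
 assumes R: "0 <= R" and t: "t ~= 0" and a: "M < Re (w / t)"
 shows "norm (exp (x k / t) *\<^sub>m lapy R t - (1 - exp (- (of_real R * w) / t)) *\<^sub>m P k) <=
   norm (w / t) * B / (Re (w / t) - M)\<^sup>2"
proof -
 define e where "e u = w / t * exp (- (of_real u * w) / t)" for u :: real
 have ce: "continuous_on S e" for S unfolding e_def using t by (intro continuous_intros) auto
 have "exp (x k / t) *\<^sub>m lapy R t = (exp (x k / t) * (1 / t)) *\<^sub>m integral {0..R} (%u. (w * lexp u t) *\<^sub>m \<phi> u)"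
  by (simp add: lapy_def lapI_def)
 also have "\<dots> = integral {0..R} (%u. (exp (x k / t) * (1 / t)) *\<^sub>m ((w * lexp u t) *\<^sub>m \<phi> u))"
  by (rule integral_msmult[OF int_I[OF t], symmetric])
 also have "(%u. (exp (x k / t) * (1 / t)) *\<^sub>m ((w * lexp u t) *\<^sub>m \<phi> u)) = (%u. e u *\<^sub>m \<phi> u)"
 proof -
  have "exp (x k / t) * lexp u t = exp (- (of_real u * w) / t)" for u
   unfolding lexp_def exp_add[symmetric] using t by (simp add: field_simps)
  then have "exp (x k / t) * (1 / t) * (w * lexp u t) = e u" for u
   by (simp add: e_def)
  then show ?thesis by simp
 qed
 finally have 1: "exp (x k / t) *\<^sub>m lapy R t = integral {0..R} (%u. e u *\<^sub>m \<phi> u)" .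
 have "(e has_integral (- exp (- (of_real R * w) / t)) - (- exp (- (of_real 0 * w) / t))) {0..R}"
 proof (rule fundamental_theorem_of_calculus[OF R])
  fix u assume "u \<in> {0..R}"
  have "((%z. - exp (- (z * w) / t)) has_field_derivative e u) (at (of_real u))"
   unfolding e_def using t by (auto intro!: derivative_eq_intros)
  from has_vector_derivative_real_field[OF this]
  show "((%u. - exp (- (complex_of_real u * w) / t)) has_vector_derivative e u) (at u within {0..R})" .
 qed
 then have "(e has_integral 1 - exp (- (of_real R * w) / t)) {0..R}" by simp
 from has_integral_linear[OF this ms.bounded_linear_left[of "P k"]]
 have 2: "((%u. e u *\<^sub>m P k) has_integral (1 - exp (- (of_real R * w) / t)) *\<^sub>m P k) {0..R}" by (simp add: o_def)
 have 3: "(%u. e u *\<^sub>m \<phi> u) integrable_on {0..R}"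
  by (intro integrable_continuous_real ms.continuous_on ce contR)
 have i4: "(%u. e u *\<^sub>m (\<phi> u - P k)) integrable_on {0..R}"
  by (intro integrable_continuous_real ms.continuous_on ce contR continuous_intros)
 have eq: "exp (x k / t) *\<^sub>m lapy R t - (1 - exp (- (of_real R * w) / t)) *\<^sub>m P k = integral {0..R} (%u. e u *\<^sub>m (\<phi> u - P k))"
  using has_integral_diff[OF integrable_integral[OF 3] 2] by (simp add: 1 ms.diff_right integral_unique)
 define a where "a = Re (w / t) - M"
 have a0: "0 < a" using assms by (simp add: a_def)
 note i5 = integral_u_exp_le[OF a0 R]
 have "norm (integral {0..R} (%u. e u *\<^sub>m (\<phi> u - P k))) <= integral {0..R} (%u. norm (w / t) * B * (u * exp (- a * u)))"
 proof (rule integral_norm_bound_integral[OF i4])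
  show "(%u. norm (w / t) * B * (u * exp (- a * u))) integrable_on {0..R}"
   using i5(1) by (intro integrable_on_mult_right)
  fix u assume u: "u \<in> {0..R}"
  have re: "Re (- (of_real u * w) / t) = - u * Re (w / t)" using Re_scaled[of u w t] by simp
  have "norm (e u) = norm (w / t) * exp (- u * Re (w / t))"
   unfolding e_def norm_mult norm_exp_eq_Re re ..
  then have "norm (e u *\<^sub>m (\<phi> u - P k)) <= norm (w / t) * exp (- u * Re (w / t)) * (B * u * exp (M * u))"
   using lip[of u] u by (simp add: mult_left_mono)
  also have "\<dots> = norm (w / t) * B * (u * exp (- a * u))"
   by (simp add: a_def algebra_simps exp_diff exp_minus exp_add field_simps)
  finally show "norm (e u *\<^sub>m (\<phi> u - P k)) <= norm (w / t) * B * (u * exp (- a * u))" .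
 qed
 also have "\<dots> = norm (w / t) * B * integral {0..R} (%u. u * exp (- a * u))" by simp
 also have "\<dots> <= norm (w / t) * B * (1 / a\<^sup>2)"
  using i5(2) B by (intro mult_left_mono) auto
 finally show ?thesis unfolding eq by (simp add: a_def)
qed

lemma norm_boundary:
 assumes "0 <= R"
 shows "norm (lexp R t *\<^sub>m (dray R ** \<phi> R)) <= exp (Re (- x k / t)) * B * exp (- (Re (w / t) - M) * R)"
proof -
 have "- (x k + of_real R * w) / t = - x k / t - of_real R * w / t" by (simp add: diff_divide_distrib)
 then have "Re (- (x k + of_real R * w) / t) = Re (- x k / t) - R * Re (w / t)"
  using Re_scaled[of R w t] by simp
 then have "norm (lexp R t) = exp (Re (- x k / t)) * exp (- R * Re (w / t))"
  unfolding lexp_def norm_exp_eq_Re exp_add[symmetric] by (simp only:) simp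
 then have "norm (lexp R t *\<^sub>m (dray R ** \<phi> R)) <= exp (Re (- x k / t)) * exp (- R * Re (w / t)) * (B * exp (M * R))"
  using bd[OF assms] by (simp add: dray_def mult_left_mono)
 also have "\<dots> = exp (Re (- x k / t)) * B * (exp (- R * Re (w / t)) * exp (M * R))" by simp
 also have "exp (- R * Re (w / t)) * exp (M * R) = exp (- (Re (w / t) - M) * R)"
  by (simp add: exp_add[symmetric] algebra_simps)
 finally show ?thesis .
qed

context
 fixes Y V :: "complex => complex^'n^'n" and T :: "complex set"
 assumes T: "open T" "convex T" "0 \<notin> T"
  and YV: "fund (%t. (1 / t\<^sup>2) *\<^sub>m diag x + (1 / t) *\<^sub>m F) T Y V"
begin

lemma lapc_mder:
 assumes t: "t \<in> T" and R: "0 <= R"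
 shows "has_mder (%t. V t ** lapy R t) (- (V t ** ((lexp R t / t\<^sup>2) *\<^sub>m (dray R ** \<phi> R)))) (at t)"
proof -
 have "t ~= 0" using t T by auto
 from has_mder_mult[OF fundD(2)[OF YV t] lapy_mder[OF this R]]
 show ?thesis by (simp add: mm.diff_right mm.minus_left mat_assoc)
qed

text \<open>The derivative of \<open>V ** lapy\<close> consists of the boundary term alone, which is
  exponentially small in \<open>R\<close> uniformly on the segment between the two points.\<close>

lemma lapc_difference:
 assumes t1: "t1 \<in> T" "M < Re (w / t1)" and t2: "t2 \<in> T" "M < Re (w / t2)"
 shows "((%R. V t1 ** lapy R t1 - V t2 ** lapy R t2) \<longlongrightarrow> 0) at_top"
proof -
 define S where "S = closed_segment t1 t2"
 have ST: "S \<subseteq> T" unfolding S_def by (rule closed_segment_subset) (use t1 t2 T in auto)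
 \<comment> \<open>The region Re (w/t) > M is a disc with 0 on its boundary; being convex, it
   contains the segment along with its end points.\<close>
 have disc: "M < Re (w / t) \<longleftrightarrow> t \<in> ball (w / of_real (2 * M)) (norm w / (2 * M))" if "t ~= 0" for t
 proof -
  have "Re (w / t) = (Re w * Re t + Im w * Im t) / (norm t)\<^sup>2"
   by (simp add: Re_divide cmod_power2)
  then have 1: "M < Re (w / t) \<longleftrightarrow> M * (norm t)\<^sup>2 < Re w * Re t + Im w * Im t"
   using that by (subst \<open>Re (w / t) = _\<close>, subst pos_less_divide_eq) auto
  have "t \<in> ball (w / of_real (2 * M)) (norm w / (2 * M)) \<longleftrightarrow> (norm (w / of_real (2 * M) - t))\<^sup>2 < (norm w / (2 * M))\<^sup>2"
  proof -
   have "0 <= norm w / (2 * M)" using M by simp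
   then show ?thesis using power_strict_mono[of "norm (w / of_real (2 * M) - t)" "norm w / (2 * M)" 2]
     power2_less_imp_less[of "norm (w / of_real (2 * M) - t)" "norm w / (2 * M)"]
    unfolding mem_ball dist_norm by auto
  qed
  also have "(norm (w / of_real (2 * M) - t))\<^sup>2 = (norm w / (2 * M))\<^sup>2 - (Re w * Re t + Im w * Im t) / M + (norm t)\<^sup>2"
   unfolding cmod_power2 power_divide using M
   by (simp add: Re_divide_of_real Im_divide_of_real power2_eq_square field_simps)
  also have "\<dots> < (norm w / (2 * M))\<^sup>2 \<longleftrightarrow> M * (norm t)\<^sup>2 < Re w * Re t + Im w * Im t"
  proof -
   have "a - b / M + c < a \<longleftrightarrow> c < b / M" for a b c :: real by linarith
   then show ?thesis using M by (simp only: pos_less_divide_eq mult.commute)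
  qed
  finally show ?thesis using 1 by simp
 qed
 have S0: "t ~= 0" if "t \<in> S" for t using that ST T by auto
 have SM: "M < Re (w / t)" if "t \<in> S" for t
 proof -
  have "t1 ~= 0" "t2 ~= 0" using t1 t2 T by auto
  then have "S \<subseteq> ball (w / of_real (2 * M)) (norm w / (2 * M))"
   unfolding S_def using t1 t2 disc by (intro closed_segment_subset) auto
  then show ?thesis using disc[OF S0[OF that]] that by blast
 qed
 have cS: "compact S" by (simp add: S_def)
 have "continuous_on S (%t. Re (w / t))" using S0 by (intro continuous_intros) auto
 from continuous_attains_inf[OF cS _ this] obtain t0 where t0: "t0 \<in> S" "\<And>t. t \<in> S ==> Re (w / t0) <= Re (w / t)"
  by (auto simp: S_def)
 define de where "de = Re (w / t0) - M"
 have de: "0 < de" using SM[OF t0(1)] by (simp add: de_def)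
 have "continuous_on S V"
  by (intro continuous_at_imp_continuous_on ballI has_mder_imp_continuous[OF fundD(2)[OF YV]]) (use ST in auto)
 then have "continuous_on S (%t. norm (V t) * norm (1 / t\<^sup>2) * (exp (Re (- x k / t)) * B))"
  using S0 by (intro continuous_intros) auto
 from continuous_attains_sup[OF cS _ this] obtain t3 where t3: "\<And>t. t \<in> S ==>
   norm (V t) * norm (1 / t\<^sup>2) * (exp (Re (- x k / t)) * B) <= norm (V t3) * norm (1 / t3\<^sup>2) * (exp (Re (- x k / t3)) * B)"
  by (auto simp: S_def)
 define v where "v = norm (V t3) * norm (1 / t3\<^sup>2) * (exp (Re (- x k / t3)) * B)"
 have bound: "norm (V t1 ** lapy R t1 - V t2 ** lapy R t2) <= v * exp (- de * R) * norm (t1 - t2)" if R: "0 <= R" for R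
 proof (rule differentiable_bound[where f = "%t. V t ** lapy R t" and S = S])
  fix t assume t: "t \<in> S"
  let ?E = "- (V t ** ((lexp R t / t\<^sup>2) *\<^sub>m (dray R ** \<phi> R)))"
  show "((%t. V t ** lapy R t) has_derivative (%h. h *\<^sub>m ?E)) (at t within S)"
   using has_mder_within[OF lapc_mder[OF _ R]] t ST unfolding has_mder_def by blast
  have "norm ?E <= norm (V t) * norm ((1 / t\<^sup>2) *\<^sub>m (lexp R t *\<^sub>m (dray R ** \<phi> R)))"
  proof -
   have "(lexp R t / t\<^sup>2) *\<^sub>m (dray R ** \<phi> R) = (1 / t\<^sup>2) *\<^sub>m (lexp R t *\<^sub>m (dray R ** \<phi> R))" by simp
   then show ?thesis unfolding norm_minus_cancel by (simp only: norm_matrix_mult_le)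
  qed
  also have "\<dots> = norm (V t) * norm (1 / t\<^sup>2) * norm (lexp R t *\<^sub>m (dray R ** \<phi> R))" by (simp only: norm_msmult)
  also have "\<dots> <= norm (V t) * norm (1 / t\<^sup>2) * (exp (Re (- x k / t)) * B * exp (- (Re (w / t) - M) * R))"
   by (intro mult_left_mono norm_boundary R) auto
  also have "\<dots> <= norm (V t) * norm (1 / t\<^sup>2) * (exp (Re (- x k / t)) * B * exp (- de * R))"
   using t0(2)[OF t] R B by (intro mult_left_mono) (auto simp: de_def mult_right_mono)
  also have "\<dots> <= v * exp (- de * R)"
   using mult_right_mono[OF t3[OF t], of "exp (- de * R)"] by (simp add: v_def mult_ac)
  finally have "norm ?E <= v * exp (- de * R)" .
  moreover have "onorm (%h. h *\<^sub>m ?E) <= norm ?E"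
   by (rule onorm_le) (simp add: mult.commute)
  ultimately show "onorm (%h. h *\<^sub>m ?E) <= v * exp (- de * R)" by linarith
 qed (auto simp: S_def)
 have "((%R. exp (- de * R)) \<longlongrightarrow> 0) at_top"
 proof (rule filterlim_compose[OF exp_at_bot])
  show "filterlim (%R. - de * R) at_bot at_top"
   using de by (intro filterlim_tendsto_neg_mult_at_bot[OF tendsto_const _ filterlim_ident]) auto
 qed
 then have "((%R. v * exp (- de * R) * norm (t1 - t2)) \<longlongrightarrow> v * 0 * norm (t1 - t2)) at_top"
  by (intro tendsto_intros)
 then have g0: "((%R. v * exp (- de * R) * norm (t1 - t2)) \<longlongrightarrow> 0) at_top" by simp
 show ?thesis
  by (rule Lim_null_comparison[OF _ g0]) (rule eventually_mono[OF eventually_ge_at_top[of 0]], rule bound)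
qed

text \<open>The quotient of the truncated Laplace integral by the canonical solution is nearly constant in \<open>t\<close>;
 comparing with the asymptotics at \<open>0\<close> in suitable directions identifies it.\<close>
lemma lapc_limit:
 assumes t1: "t1 \<in> T" "M < Re (w / t1)"
  and dirs: "\<And>l. l \<in> {1..m} ==> \<exists>u. (\<forall>s>0. of_real s * u \<in> T) \<and> 0 < Re (w / u) \<and> Re ((x l - x k) / u) <= 0 \<and>
    ((%s. Y (of_real s * u) ** diag (%j. exp (x j / (of_real s * u)))) \<longlongrightarrow> mat 1) (at_right (0::real))"
 shows "((%R. V t1 ** lapy R t1) \<longlongrightarrow> P k) at_top"
proof -
 have comp: "((%R. P l ** (V t1 ** lapy R t1)) \<longlongrightarrow> P l ** P k) at_top" if l: "l \<in> {1..m}" for l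
 proof (rule tendstoI)
  fix eps :: real assume eps: "0 < eps"
  obtain u where u: "\<And>s. 0 < s ==> of_real s * u \<in> T" "0 < Re (w / u)" "Re ((x l - x k) / u) <= 0"
   and lim: "((%s. Y (of_real s * u) ** diag (%j. exp (x j / (of_real s * u)))) \<longlongrightarrow> mat 1) (at_right (0::real))"
   using dirs[OF l] by blast
  have u0: "u ~= 0" using u(2) by auto
  define p where "p = norm (P l) + 1"
  have p: "0 < p" "norm (P l) <= p" by (simp_all add: p_def add_nonneg_pos)
  \<comment> \<open>Error budget: \<open>q\<close> is shown to lie within 6 et of P k, which costs
    eps/2 after multiplication by norm (P l) <= p; passing from \<open>t1\<close> to
    \<open>t\<close> costs at most eps/12.\<close>
  define et where "et = eps / (12 * p)"
  have et: "0 < et" using eps p by (simp add: et_def)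
  define X where "X s = Y (of_real s * u) ** diag (%j. exp (x j / (of_real s * u)))" for s :: real
  have "((%s. norm (X s - mat 1) * norm (P k)) \<longlongrightarrow> norm (mat 1 - mat 1 :: complex^'n^'n) * norm (P k)) (at_right 0)"
   using lim unfolding X_def[symmetric] by (intro tendsto_intros)
  then have e1: "\<forall>\<^sub>F s in at_right 0. norm (X s - mat 1) * norm (P k) < et"
   using et by (intro order_tendstoD) auto
  have "((%s. norm (X s - mat 1)) \<longlongrightarrow> norm (mat 1 - mat 1 :: complex^'n^'n)) (at_right 0)"
   using lim unfolding X_def[symmetric] by (intro tendsto_intros)
  then have e2: "\<forall>\<^sub>F s in at_right 0. norm (X s - mat 1) < 1/2" by (intro order_tendstoD) auto
  define ka where "ka = Re (w / u)"
  define c where "c = norm (w / u) * B"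
  have "((%s. c * s / (ka - M * s)\<^sup>2) \<longlongrightarrow> c * 0 / (ka - M * 0)\<^sup>2) (at_right 0)"
   using u(2) by (intro tendsto_intros) (auto simp: ka_def)
  then have e3: "\<forall>\<^sub>F s in at_right 0. c * s / (ka - M * s)\<^sup>2 < et"
   using et by (intro order_tendstoD) auto
  have "((%s. M * s) \<longlongrightarrow> M * 0) (at_right 0)" by (intro tendsto_intros)
  then have e4: "\<forall>\<^sub>F s in at_right 0. M * s < ka" using u(2) by (intro order_tendstoD) (auto simp: ka_def)
  have "\<forall>\<^sub>F s in at_right 0. norm (X s - mat 1) * norm (P k) < et \<and> norm (X s - mat 1) < 1/2 \<and>
    c * s / (ka - M * s)\<^sup>2 < et \<and> M * s < ka \<and> 0 < s"
   using e1 e2 e3 e4 eventually_at_right_less[of "0::real"] by eventually_elim auto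
  then obtain s where s: "norm (X s - mat 1) * norm (P k) < et" "norm (X s - mat 1) < 1/2"
    "c * s / (ka - M * s)\<^sup>2 < et" "M * s < ka" "0 < s"
   using eventually_happens[of _ "at_right (0::real)"] by auto
  define t where "t = of_real s * u"
  have t: "t \<in> T" "t ~= 0" using u(1) s(5) u0 by (auto simp: t_def)
  have wt: "w / t = of_real (1 / s) * (w / u)" using s(5) u0 by (simp add: t_def field_simps)
  have Rwt: "Re (w / t) = ka / s" unfolding wt times_complex.sel by (simp add: ka_def)
  have tM: "M < Re (w / t)" unfolding Rwt using s by (simp add: field_simps)
  have as: "norm (w / t) * B / (Re (w / t) - M)\<^sup>2 < et"
  proof -
   have "norm (w / t) = norm (w / u) / s" unfolding wt norm_mult norm_of_real using s(5) by simp
   moreover have "Re (w / t) - M = (ka - M * s) / s" unfolding Rwt using s(5) by (simp add: field_simps)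
   ultimately have "norm (w / t) * B / (Re (w / t) - M)\<^sup>2 = c * s / (ka - M * s)\<^sup>2"
    using s(5) by (simp add: c_def power_divide power2_eq_square)
   then show ?thesis using s by simp
  qed
  have d0: "\<forall>\<^sub>F R in at_top. norm (V t1 ** lapy R t1 - V t ** lapy R t) < et"
   using lapc_difference[OF t1 t(1) tM] et by (auto simp: tendsto_iff dist_norm)
  have "((%R. norm (exp (- (of_real R * w) / t) *\<^sub>m P k)) \<longlongrightarrow> 0) at_top"
  proof -
   have "norm (exp (- (of_real R * w) / t) *\<^sub>m P k) = exp (- Re (w / t) * R) * norm (P k)" for R
    using Re_scaled[of R w t] by (simp add: norm_exp_eq_Re mult.commute)
   moreover have "((%R. exp (- Re (w / t) * R)) \<longlongrightarrow> 0) at_top"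
   proof (rule filterlim_compose[OF exp_at_bot])
    show "filterlim (%R. - Re (w / t) * R) at_bot at_top"
     using tM M by (intro filterlim_tendsto_neg_mult_at_bot[OF tendsto_const _ filterlim_ident]) auto
   qed
   from tendsto_mult_right[OF this, of "norm (P k)"]
   have "((%R. exp (- Re (w / t) * R) * norm (P k)) \<longlongrightarrow> 0) at_top" by simp
   ultimately show ?thesis by (simp only:)
  qed
  then have d1: "\<forall>\<^sub>F R in at_top. norm (exp (- (of_real R * w) / t) *\<^sub>m P k) < et"
   using et by (intro order_tendstoD)
  from d0 d1 eventually_ge_at_top[of "0::real"]
  show "\<forall>\<^sub>F R in at_top. dist (P l ** (V t1 ** lapy R t1)) (P l ** P k) < eps"
  proof eventually_elim
   case (elim R)
   \<comment> \<open>The quotient conjugated so that the canonical asymptotics apply: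
     \<open>X s ** q\<close> is exp (x_k / t) times the truncated integral, hence close to P k, and
     \<open>q\<close> inherits this because \<open>X s\<close> is close to 1.\<close>
   define q where "q = exp (x k / t) *\<^sub>m (diag (%j. exp (- (x j / t))) ** (V t ** lapy R t))"
   have Xq: "X s ** q = exp (x k / t) *\<^sub>m lapy R t"
   proof -
    have "X s ** q = exp (x k / t) *\<^sub>m (Y t ** (diag (%j. exp (x j / t)) ** diag (%j. exp (- (x j / t)))) ** (V t ** lapy R t))"
     by (simp add: X_def t_def[symmetric] q_def mat_assoc)
    then show ?thesis
     using fundD(3)[OF YV t(1)] by (simp add: diag_exp_inverse matrix_mul_assoc)
   qed
   have "norm (X s ** q - P k) <= norm (exp (x k / t) *\<^sub>m lapy R t - (1 - exp (- (of_real R * w) / t)) *\<^sub>m P k)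
     + norm (exp (- (of_real R * w) / t) *\<^sub>m P k)"
    unfolding Xq by (rule order_trans[OF _ norm_triangle_ineq4]) (simp add: ms.diff_left)
   then have Xqk: "norm (X s ** q - P k) < 2 * et"
    using lapy_asymptotic[OF elim(3) t(2) tM] as elim(2) by linarith
   have "q - P k = (X s ** q - P k) - (X s - mat 1) ** (q - P k) - (X s - mat 1) ** P k"
    by (simp add: mat_distrib)
   then have "norm (q - P k) = norm ((X s ** q - P k) - (X s - mat 1) ** (q - P k) - (X s - mat 1) ** P k)"
    by (rule arg_cong)
   also have "\<dots> <= norm (X s ** q - P k) + norm ((X s - mat 1) ** (q - P k)) + norm ((X s - mat 1) ** P k)"
   proof -
    have "norm (a - b - c) <= norm a + norm b + norm c" for a b c :: "complex^'n^'n"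
     using norm_triangle_ineq4[of "a - b" c] norm_triangle_ineq4[of a b] by linarith
    then show ?thesis .
   qed
   also have "norm ((X s - mat 1) ** (q - P k)) <= 1/2 * norm (q - P k)"
    by (rule order_trans[OF norm_matrix_mult_le]) (use s(2) in \<open>intro mult_right_mono, auto\<close>)
   also have "norm ((X s - mat 1) ** P k) <= et"
    by (rule order_trans[OF norm_matrix_mult_le]) (use s(1) in simp)
   finally have "norm (q - P k) <= 6 * et" using Xqk by simp
   then have "norm (P l) * norm (q - P k) <= p * (6 * et)" using p by (intro mult_mono) auto
   then have qk: "norm (P l ** (q - P k)) <= eps / 2"
    using norm_matrix_mult_le[of "P l" "q - P k"] p by (simp add: et_def)
   \<comment> \<open>The component l is that of \<open>q\<close> times exp ((x_l - x_k)/t), whose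
     modulus is at most 1 in the chosen direction.\<close>
   have Plq: "P l ** (V t ** lapy R t) = exp ((x l - x k) / t) *\<^sub>m (P l ** q)"
   proof -
    have "exp ((x l - x k) / t) *\<^sub>m (P l ** q) = (exp ((x l - x k) / t) * exp (x k / t) * exp (- (x l / t))) *\<^sub>m (P l ** (V t ** lapy R t))"
     by (simp add: q_def matrix_mul_assoc P_diag[OF l] mult_ac)
    also have "exp ((x l - x k) / t) * exp (x k / t) * exp (- (x l / t)) = 1"
     by (simp add: exp_add[symmetric] diff_divide_distrib)
    finally show ?thesis by simp
   qed
   have "norm (P l ** (V t ** lapy R t) - P l ** P k) <= norm (P l ** (q - P k))"
   proof (cases "l = k")
    case True then show ?thesis unfolding Plq by (simp add: mm.diff_right)
   next
    case False
    then have 0: "P l ** P k = 0" using orth[OF l k] by simp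
    have "(x l - x k) / t = of_real (1 / s) * ((x l - x k) / u)" using s(5) u0 by (simp add: t_def field_simps)
    then have "Re ((x l - x k) / t) = 1 / s * Re ((x l - x k) / u)" by (metis Re_complex_of_real Re_scaled mult.commute times_divide_eq_right)
    then have "Re ((x l - x k) / t) <= 0" using u(3) s(5) by (simp add: divide_nonpos_pos)
    then have "norm (exp ((x l - x k) / t)) <= 1" by (simp add: norm_exp_eq_Re)
    then show ?thesis unfolding Plq 0 by (simp add: mm.diff_right 0 mult_left_le_one_le)
   qed
   then have 1: "norm (P l ** (V t ** lapy R t) - P l ** P k) <= eps / 2" using qk by linarith
   have "norm (P l ** (V t1 ** lapy R t1) - P l ** (V t ** lapy R t)) <= norm (P l) * norm (V t1 ** lapy R t1 - V t ** lapy R t)"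
    unfolding mm.diff_right[symmetric] by (rule norm_matrix_mult_le)
   also have "\<dots> <= p * et" using p elim(1) by (intro mult_mono) auto
   also have "\<dots> < eps / 2" using p eps by (simp add: et_def)
   finally show ?case using 1 norm_triangle_ineq[of "P l ** (V t1 ** lapy R t1) - P l ** (V t ** lapy R t)" "P l ** (V t ** lapy R t) - P l ** P k"]
    by (simp add: dist_norm)
  qed
 qed
 have "((%R. \<Sum>l=1..m. P l ** (V t1 ** lapy R t1)) \<longlongrightarrow> (\<Sum>l=1..m. P l ** P k)) at_top"
  by (intro tendsto_sum comp)
 then show ?thesis by (simp add: mm.sum_left[symmetric] sumP del: One_nat_def)
qed

text \<open>In terms of \<open>lapy\<close>, integration by parts gives t^2 (1 + F)
  \<open>lapy\<close> minus a boundary term that vanishes as \<open>R\<close> grows.\<close>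

lemma lapG_limit:
 assumes t1: "t1 \<in> T" "M < Re (w / t1)"
  and dirs: "\<And>l. l \<in> {1..m} ==> \<exists>u. (\<forall>s>0. of_real s * u \<in> T) \<and> 0 < Re (w / u) \<and> Re ((x l - x k) / u) <= 0 \<and>
    ((%s. Y (of_real s * u) ** diag (%j. exp (x j / (of_real s * u)))) \<longlongrightarrow> mat 1) (at_right (0::real))"
 shows "((%R. lapG R t1) \<longlongrightarrow> t1\<^sup>2 *\<^sub>m (Y t1 ** P k + F ** (Y t1 ** P k))) at_top"
proof -
 have t0: "t1 ~= 0" using t1 T by auto
 have y: "lapy R t1 = Y t1 ** (V t1 ** lapy R t1)" for R
  using fundD(3)[OF YV t1(1)] by (simp add: matrix_mul_assoc)
 have "((%R. Y t1 ** (V t1 ** lapy R t1)) \<longlongrightarrow> Y t1 ** P k) at_top"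
  by (intro mm.tendsto tendsto_const lapc_limit[OF t1 dirs])
 then have "((%R. lapy R t1) \<longlongrightarrow> Y t1 ** P k) at_top" unfolding y[symmetric] .
 then have 1: "((%R. t1\<^sup>2 *\<^sub>m (lapy R t1 + F ** lapy R t1)) \<longlongrightarrow> t1\<^sup>2 *\<^sub>m (Y t1 ** P k + F ** (Y t1 ** P k))) at_top"
  by (intro ms.tendsto mm.tendsto tendsto_const tendsto_add)
 have "((%R. (norm t1 * (exp (Re (- x k / t1)) * B)) * exp (- (Re (w / t1) - M) * R)) \<longlongrightarrow> (norm t1 * (exp (Re (- x k / t1)) * B)) * 0) at_top"
 proof (intro tendsto_mult_left filterlim_compose[OF exp_at_bot])
  show "filterlim (%R. - (Re (w / t1) - M) * R) at_bot at_top"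
   using t1(2) by (intro filterlim_tendsto_neg_mult_at_bot[OF tendsto_const _ filterlim_ident]) auto
 qed
 then have "((%R. (norm t1 * (exp (Re (- x k / t1)) * B)) * exp (- (Re (w / t1) - M) * R)) \<longlongrightarrow> 0) at_top" by simp
 moreover have ev: "\<forall>\<^sub>F R in at_top. norm ((t1 * lexp R t1) *\<^sub>m (dray R ** \<phi> R)) <= (norm t1 * (exp (Re (- x k / t1)) * B)) * exp (- (Re (w / t1) - M) * R)"
  using eventually_ge_at_top[of "0::real"]
 proof eventually_elim
  case (elim R)
  have "norm ((t1 * lexp R t1) *\<^sub>m (dray R ** \<phi> R)) = norm t1 * norm (lexp R t1 *\<^sub>m (dray R ** \<phi> R))"
   by (simp add: norm_mult)
  also have "\<dots> <= norm t1 * (exp (Re (- x k / t1)) * B * exp (- (Re (w / t1) - M) * R))"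
   by (intro mult_left_mono norm_boundary elim) auto
  finally show ?case by (simp add: mult_ac)
 qed
 ultimately have 2: "((%R. (t1 * lexp R t1) *\<^sub>m (dray R ** \<phi> R)) \<longlongrightarrow> 0) at_top"
  by (rule Lim_null_comparison[rotated])
 have "\<forall>\<^sub>F R in at_top. t1\<^sup>2 *\<^sub>m (lapy R t1 + F ** lapy R t1) - (t1 * lexp R t1) *\<^sub>m (dray R ** \<phi> R) = lapG R t1"
  using eventually_ge_at_top[of "0::real"]
 proof eventually_elim
  case (elim R)
  then show ?case using lap_by_parts[OF t0 elim] t0
   by (simp add: lapy_def mat_distrib power2_eq_square)
 qed
 from tendsto_cong[THEN iffD1, OF this tendsto_diff[OF 1 2]] show ?thesis by simp
qed

end

end

end

section \<open>Moving the Laplace contours onto the real axis\<close>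

context fuchs_solutions
begin

text \<open>Half the slope of the wedge, so that the slanted rays stay inside it on the side
  \<open>si\<close>.\<close>

definition wdir :: "real => complex" where "wdir si = Complex 1 (si * (nu / 2))"

definition phi :: "real => nat => real => complex^'n^'n" where
 "phi si k u = (if u = 0 then P k else Ph si k (x k + of_real u * wdir si))"

lemma ray_half:
 assumes si: "\<bar>si\<bar> = 1" and k: "k \<in> insert i0 K" and u: "0 < u"
 shows "x k + of_real u * wdir si \<in> half si"
proof -
 have s: "si = 1 \<or> si = -1" using si by linarith
 have im: "Im (x k + of_real u * wdir si) = si * (nu * u / 2)" and re: "Re (x k + of_real u * wdir si) = Re (x k) + u"
  using x_nonneg[OF k] by (simp_all add: wdir_def)
 have "0 < nu * u" "0 <= nu * Re (x k)" using nu u x_nonneg[OF k] by auto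
 then have "\<bar>Im (x k + of_real u * wdir si)\<bar> < nu * Re (x k + of_real u * wdir si)" "0 < si * Im (x k + of_real u * wdir si)"
  unfolding im re using s by (auto simp: distrib_left)
 then show ?thesis by (simp add: half_def W_def)
qed

lemma half_dom: "half si \<subseteq> dom si" by (auto simp: dom_def)

lemma phi_der:
 assumes si: "\<bar>si\<bar> = 1" and k: "k \<in> insert i0 K" and u: "0 < u"
 shows "(phi si k has_vector_derivative wdir si *\<^sub>m (A (x k + of_real u * wdir si) ** phi si k u)) (at u)"
proof -
 have d: "x k + of_real u * wdir si \<in> dom si" using ray_half[OF si k u] half_dom by blast
 have "((%u. x k + of_real u * wdir si) has_vector_derivative wdir si) (at u)"
  by (auto intro!: derivative_eq_intros)
 from has_mder_path[OF Phi_mder[OF si d] this]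
 have "((%u. Ph si k (x k + of_real u * wdir si)) has_vector_derivative
   wdir si *\<^sub>m (A (x k + of_real u * wdir si) ** phi si k u)) (at u)" using u by (simp add: phi_def)
 then show ?thesis
  by (rule has_vector_derivative_transform_within_open[where S = "{0<..}"]) (use u in \<open>auto simp: phi_def\<close>)
qed

lemma phi_near_zero:
 assumes si: "\<bar>si\<bar> = 1" and k: "k \<in> insert i0 K"
 shows "\<exists>L de. 0 < de \<and> 0 <= L \<and> (\<forall>u. 0 <= u --> u < de --> norm (phi si k u - P k) <= L * u)"
proof -
 have w0: "0 < norm (wdir si)" by (simp add: wdir_def complex_eq_iff)
 have H0: "H k (x k) = mat 1" using near[OF k] by (simp add: near_solution_def)
 obtain E where E: "has_mder (H k) E (at (x k))"
  using near[OF k] unfolding near_solution_def by (meson centre_in_ball)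
 obtain B de where B: "0 < de" "0 <= B" "\<And>y. norm (y - x k) < de ==> norm (H k y - mat 1) <= B * norm (y - x k)"
  using has_mder_lipschitz[OF E] H0 by auto
 define de' where "de' = min de (rh k) / norm (wdir si)"
 have de': "0 < de'" using B rho_pos[OF k] w0 by (simp add: de'_def)
 have "norm (phi si k u - P k) <= (B * norm (wdir si) * norm (P k)) * u" if u: "0 < u" "u < de'" for u
 proof -
  define ze where "ze = x k + of_real u * wdir si"
  have n: "norm (ze - x k) = u * norm (wdir si)" using u by (simp add: ze_def norm_mult)
  have "u * norm (wdir si) < min de (rh k)" using u(2) w0 by (simp add: de'_def field_simps)
  then have lt: "norm (ze - x k) < de" "norm (ze - x k) < rh k" using n by auto
  have "ze \<in> half si" unfolding ze_def by (rule ray_half[OF si k u(1)])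
  then have "ze \<in> slit si k (rh k)" using lt by (simp add: slit_def half_def dist_norm norm_minus_commute)
  then have "phi si k u = H k ze ** P k" using Phi_near[OF si k] u by (simp add: phi_def ze_def)
  then have "phi si k u - P k = (H k ze - mat 1) ** P k" by (simp add: mat_distrib)
  then have "norm (phi si k u - P k) <= norm (H k ze - mat 1) * norm (P k)" by (simp add: norm_matrix_mult_le)
  also have "\<dots> <= (B * norm (ze - x k)) * norm (P k)" by (intro mult_right_mono B(3) lt) auto
  finally show ?thesis unfolding n by (simp add: mult_ac)
 qed
 note bd = this
 have "norm (phi si k u - P k) <= (B * norm (wdir si) * norm (P k)) * u" if "0 <= u" "u < de'" for u
 proof (cases "u = 0")
  case True then show ?thesis by (simp add: phi_def)
 next
  case False then show ?thesis using bd[of u] that by simp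
 qed
 then show ?thesis using de' B(2) by (metis mult_nonneg_nonneg norm_ge_zero)
qed

lemma phi_cont:
 assumes si: "\<bar>si\<bar> = 1" and k: "k \<in> insert i0 K"
 shows "continuous_on {0..} (phi si k)"
 unfolding continuous_on_def
proof
 fix u :: real assume u: "u \<in> {0..}"
 show "(phi si k \<longlongrightarrow> phi si k u) (at u within {0..})"
 proof (cases "u = 0")
  case False
  then have "isCont (phi si k) u" using phi_der[OF si k, of u] u by (auto intro: has_vector_derivative_continuous)
  then show ?thesis by (simp add: continuous_at tendsto_within_subset[of _ _ _ UNIV])
 next
  case True
  obtain L de where L: "0 < de" "\<And>u. 0 <= u ==> u < de ==> norm (phi si k u - P k) <= L * u"
   using phi_near_zero[OF si k] by blast
  have "((%u. phi si k u - P k) \<longlongrightarrow> 0) (at 0 within {0..})"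
  proof (rule Lim_null_comparison)
   have "((%u. L * u) \<longlongrightarrow> L * 0) (at 0 within {0..})" by (intro tendsto_intros)
   then show "((%u. L * u) \<longlongrightarrow> 0) (at 0 within {0..})" by simp
   show "\<forall>\<^sub>F u in at 0 within {0..}. norm (phi si k u - P k) <= L * u"
    using L by (auto simp: eventually_at dist_real_def intro!: exI[of _ de])
  qed
  moreover have "phi si k 0 = P k" by (simp add: phi_def)
  ultimately show ?thesis using True by (simp add: LIM_zero_iff)
 qed
qed

text \<open>The solution is Lipschitz near 0, bounded on a compact interval and of exponential
  growth beyond \<open>R0\<close>. Away from 0 the factor u in the second estimate is bought with B4
  / de and u >= de.\<close>

lemma phi_bounds:
 assumes si: "\<bar>si\<bar> = 1" and k: "k \<in> insert i0 K"
 shows "\<exists>B M. 0 <= B \<and> 0 < M \<and>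
  (\<forall>u\<ge>0. norm (diag (%j. x k + of_real u * wdir si - x j) ** phi si k u) <= B * exp (M * u)) \<and>
  (\<forall>u\<ge>0. norm (phi si k u - P k) <= B * u * exp (M * u))"
proof -
 have s: "si = 1 \<or> si = -1" using si by linarith
 obtain B0 M R0 where G: "0 <= B0" "0 <= M" "0 < R0" and
  g: "\<And>ze. R0 <= Re ze ==> 0 <= si * Im ze ==> si * Im ze <= nu / 2 * Re ze ==>
   norm (Ph si k ze) <= B0 * exp (M * Re ze) \<and> norm (diag (%l. ze - x l) ** Ph si k ze) <= B0 * exp (M * Re ze)"
  using Phi_growth[OF si, of k] by metis
 define B1 where "B1 = B0 * exp (M * Re (x k))"
 have far: "norm (phi si k u) <= B1 * exp (M * u)" "norm (diag (%j. x k + of_real u * wdir si - x j) ** phi si k u) <= B1 * exp (M * u)"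
  if u: "R0 <= u" for u
 proof -
  have re: "Re (x k + of_real u * wdir si) = Re (x k) + u" and im: "si * Im (x k + of_real u * wdir si) = nu / 2 * u"
   using x_nonneg[OF k] s by (auto simp: wdir_def)
  have "0 <= nu / 2 * Re (x k)" "0 <= nu / 2 * u" using nu x_nonneg[OF k] u G by auto
  then have "norm (Ph si k (x k + of_real u * wdir si)) <= B0 * exp (M * (Re (x k) + u)) \<and>
    norm (diag (%l. x k + of_real u * wdir si - x l) ** Ph si k (x k + of_real u * wdir si)) <= B0 * exp (M * (Re (x k) + u))"
   using g[of "x k + of_real u * wdir si"] x_nonneg(1)[OF k] u unfolding re im by (simp add: distrib_left)
  then show "norm (phi si k u) <= B1 * exp (M * u)" "norm (diag (%j. x k + of_real u * wdir si - x j) ** phi si k u) <= B1 * exp (M * u)"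
   using u G(3) by (simp_all add: phi_def B1_def distrib_left exp_add mult_ac)
 qed
 have c1: "continuous_on {0..R0} (phi si k)" by (rule continuous_on_subset[OF phi_cont[OF si k]]) auto
 have c2: "continuous_on {0..R0} (%u. norm (phi si k u) + norm (diag (%j. x k + of_real u * wdir si - x j) ** phi si k u))"
  by (intro continuous_intros c1 mm.continuous_on continuous_on_diag)
 obtain B2 where B2: "\<And>u. 0 <= u ==> u <= R0 ==>
   norm (phi si k u) + norm (diag (%j. x k + of_real u * wdir si - x j) ** phi si k u) <= B2"
  using continuous_attains_sup[OF _ _ c2] G by fastforce
 have B20: "0 <= B2" using B2[of 0] G(3) by (smt (verit) norm_ge_zero)
 define B3 where "B3 = max B1 B2"
 have B3: "norm (phi si k u) <= B3 * exp (M * u) \<and> norm (diag (%j. x k + of_real u * wdir si - x j) ** phi si k u) <= B3 * exp (M * u)"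
  if u: "0 <= u" for u
 proof (cases "u <= R0")
  case True
  have "B2 <= B3 * exp (M * u)"
  proof -
   have "B2 <= B3" "1 <= exp (M * u)" using u G by (auto simp: B3_def)
   then show ?thesis using B20 mult_mono[of B2 B3 1 "exp (M * u)"] by simp
  qed
  moreover have "norm (phi si k u) <= B2" "norm (diag (%j. x k + of_real u * wdir si - x j) ** phi si k u) <= B2"
   using B2[OF u True] norm_ge_zero by (smt (verit))+
  ultimately show ?thesis by linarith
 next
  case False
  then have "B1 * exp (M * u) <= B3 * exp (M * u)" by (auto simp: B3_def)
  then show ?thesis using far[of u] False by linarith
 qed
 obtain L de where L: "0 < de" "0 <= L" "\<And>u. 0 <= u ==> u < de ==> norm (phi si k u - P k) <= L * u"
  using phi_near_zero[OF si k] by blast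
 define B4 where "B4 = B3 + norm (P k)"
 have B30: "0 <= B3" using B20 by (auto simp: B3_def)
 have B40: "0 <= B4" using B30 by (simp add: B4_def)
 define B where "B = B3 + L + B4 / de"
 have B: "0 <= B" "B3 <= B" "L <= B" "B4 / de <= B" using B30 B40 L by (auto simp: B_def)
 have Mle: "exp (M * u) <= exp ((M + 1) * u)" if "0 <= u" for u using that by (simp add: distrib_right)
 have "norm (phi si k u - P k) <= B * u * exp ((M + 1) * u)" if u: "0 <= u" for u
 proof (cases "u < de")
  case True
  have "norm (phi si k u - P k) <= L * u" using L(3)[OF u True] .
  also have "\<dots> <= B * u * 1" using B u by (simp add: mult_right_mono)
  also have "\<dots> <= B * u * exp ((M + 1) * u)" using B u G by (intro mult_left_mono) auto
  finally show ?thesis .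
 next
  case False
  have "norm (phi si k u - P k) <= norm (phi si k u) + norm (P k)" by (rule norm_triangle_ineq4)
  also have "\<dots> <= B3 * exp (M * u) + norm (P k) * exp (M * u)"
   using B3[OF u] u G by (intro add_mono) (auto simp: mult_le_cancel_left1)
  also have "\<dots> = B4 * exp (M * u)" by (simp add: B4_def distrib_right)
  also have "\<dots> <= (B4 / de * u) * exp (M * u)"
   using False L(1) B40 by (intro mult_right_mono) (auto simp: field_simps mult_left_mono)
  also have "\<dots> <= (B * u) * exp ((M + 1) * u)"
   using B u Mle[OF u] by (intro mult_mono) (auto simp: mult_right_mono)
  finally show ?thesis .
 qed
 moreover have "norm (diag (%j. x k + of_real u * wdir si - x j) ** phi si k u) <= B * exp ((M + 1) * u)" if u: "0 <= u" for u
 proof -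
  have "B3 * exp (M * u) <= B * exp ((M + 1) * u)" using B B30 Mle[OF u] by (intro mult_mono) auto
  then show ?thesis using B3[OF u] by linarith
 qed
 ultimately show ?thesis using B(1) G(2) by (intro exI[of _ B] exI[of _ "M + 1"]) auto
qed

lemma convex_cone: "convex (cone si k)"
proof -
 have "cone si k = {ze. 1 \<bullet> ze \<ge> Re (x k)} \<inter> {ze. (si * \<i>) \<bullet> ze \<ge> 0} \<inter> {ze. (si * \<i> - nu / 2) \<bullet> ze <= - nu / 2 * Re (x k)}"
  by (auto simp: cone_def inner_complex_def algebra_simps)
 then show ?thesis by (metis convex_Int convex_halfspace_ge convex_halfspace_le)
qed

lemma gext_ray:
 assumes si: "\<bar>si\<bar> = 1" and k: "k \<in> insert i0 K" and u: "0 <= u"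
 shows "gext si k (x k + of_real u * wdir si) = diag (%j. x k + of_real u * wdir si - x j) ** phi si k u"
proof (cases "u = 0")
 case True
 have inj': "inj_on x (insert i0 K)" using inj ks by (meson inj_on_subset subsetI)
 have "gext si k (x k) = diag (%j. x k - x j) ** (C si k ** D si k) ** P k"
  using inv_into_f_f[OF inj' k] by (simp only: gext_def if_P[OF imageI[OF k]] mat_assoc)
 then show ?thesis using True CD[OF si k] by (simp add: phi_def)
next
 case False
 have "0 < si * Im (x k + of_real u * wdir si)" using ray_half[OF si k, of u] False u by (simp add: half_def)
 then have "x k + of_real u * wdir si ~= x l" if "l \<in> insert i0 K" for l
  using x_nonneg(2)[OF that] by (metis mult_zero_right order_less_irrefl)
 then show ?thesis using False by (auto simp: gext_def phi_def)
qed

text \<open>Cauchy's theorem for the triangle x_k, Q, q. Poles may lie on its real side, but the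
  integrand is continuous on the closed triangle and holomorphic in the interior, which
  suffices.\<close>

lemma gext_contour:
 assumes si: "\<bar>si\<bar> = 1" and k: "k \<in> insert i0 K" and t: "0 < t" and Q: "Re (x k) < Q"
 defines "f \<equiv> %i j ze. exp (- ze / of_real t) * gext si k ze $ i $ j"
  and "q \<equiv> x k + of_real (Q - Re (x k)) * wdir si"
 shows "((%r. exp (- of_real r / of_real t) *\<^sub>m gext si k (of_real r)) has_integral
   (integral {0..Q - Re (x k)} (%u. (wdir si * exp (- (x k + of_real u * wdir si) / of_real t)) *\<^sub>m
     (diag (%j. x k + of_real u * wdir si - x j) ** phi si k u))
    - (\<chi> i j. contour_integral (linepath (of_real Q) q) (f i j)))) {Re (x k)..Q}"
proof -
 have s: "si = 1 \<or> si = -1" using si by linarith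
 define R where "R = Q - Re (x k)"
 have R: "0 < R" using Q by (simp add: R_def)
 have qq: "q = x k + of_real R * wdir si" by (simp add: q_def R_def)
 have pts: "x k \<in> cone si k" "of_real Q \<in> cone si k" "q \<in> cone si k"
  using x_nonneg[OF k] Q nu s by (auto simp: cone_def q_def wdir_def)
 have hull: "convex hull {x k, of_real Q, q} \<subseteq> cone si k"
  by (rule hull_minimal) (use pts convex_cone in auto)
 have cg: "continuous_on (cone si k) (f i j)" for i j
  unfolding f_def using t by (intro continuous_intros gext_continuous[OF si k]) auto
 have tri: "contour_integral (linepath (x k) (of_real Q)) (f i j) + contour_integral (linepath (of_real Q) q) (f i j)
   + contour_integral (linepath q (x k)) (f i j) = 0" for i j
 proof (rule has_chain_integral_chain_integral3[OF Cauchy_theorem_triangle_interior])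
  show "continuous_on (convex hull {x k, of_real Q, q}) (f i j)" by (rule continuous_on_subset[OF cg hull])
  define I where "I = interior (convex hull {x k, of_real Q, q})"
  have "I \<subseteq> interior {ze. (si * \<i>) \<bullet> ze \<ge> 0}"
   unfolding I_def using hull by (intro interior_mono) (auto simp: cone_def inner_complex_def)
  moreover have "complex_of_real si * \<i> ~= 0" using s by auto
  ultimately have "I \<subseteq> {ze. (si * \<i>) \<bullet> ze > 0}" by (metis interior_halfspace_ge)
  then have I: "0 < si * Im ze" "ze \<in> cone si k" if "ze \<in> I" for ze
   using that hull interior_subset[of "convex hull {x k, of_real Q, q}"] by (auto simp: inner_complex_def I_def)
  have "f i j holomorphic_on I"
  proof (rule holomorphic_transform)
   have dI: "I \<subseteq> dom si"
   proof
    fix ze assume "ze \<in> I"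
    then have "ze \<in> W" using cone_W[OF si k I(2)] I(1) by fastforce
    then show "ze \<in> dom si" using I(1)[OF \<open>ze \<in> I\<close>] half_dom by (auto simp: half_def)
   qed
   have "mhol (%ze. diag (%j. ze - x j) ** Ph si k ze) I"
    by (rule has_mder_imp_mhol) (use has_mder_mult[OF has_mder_diag Phi_mder[OF si]] dI in blast)
   then show "(%ze. exp (- ze / of_real t) * (diag (%j. ze - x j) ** Ph si k ze) $ i $ j) holomorphic_on I"
    using t unfolding mhol_def by (intro holomorphic_intros) auto
   fix ze assume "ze \<in> I"
   then have "ze \<notin> x ` insert i0 K" using I(1)[of ze] x_nonneg(2) by fastforce
   then show "exp (- ze / of_real t) * (diag (%j. ze - x j) ** Ph si k ze) $ i $ j = f i j ze"
    unfolding f_def gext_def by (simp only: if_False)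
  qed
  then show "f i j holomorphic_on interior (convex hull {x k, of_real Q, q})" by (simp add: I_def)
 qed
 have segc: "continuous_on (closed_segment a b) (f i j)" if "a \<in> cone si k" "b \<in> cone si k" for a b i j
  by (rule continuous_on_subset[OF cg]) (rule closed_segment_subset[OF that convex_cone])
 have rev: "contour_integral (linepath q (x k)) (f i j) = - contour_integral (linepath (x k) q) (f i j)" for i j
  using contour_integral_reverse_linepath[OF segc[OF pts(1,3)], of i j] by simp
 have ray: "contour_integral (linepath (x k) q) (f i j) = integral {0..R} (%u. (wdir si * exp (- (x k + of_real u * wdir si) / of_real t)) *\<^sub>m
     (diag (%j. x k + of_real u * wdir si - x j) ** phi si k u)) $ i $ j" for i j
 proof -
  define h where "h u = (wdir si * exp (- (x k + of_real u * wdir si) / of_real t)) *\<^sub>m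
     (diag (%j. x k + of_real u * wdir si - x j) ** phi si k u)" for u
  have ch: "continuous_on {0..R} h" unfolding h_def using t
   by (intro ms.continuous_on mm.continuous_on continuous_on_diag continuous_intros continuous_on_subset[OF phi_cont[OF si k]]) auto
  have he: "h u $ i $ j = f i j (x k + of_real u * wdir si) * wdir si" if "0 <= u" for u
   unfolding h_def f_def gext_ray[OF si k that] by simp
  have "((%u. h u $ i $ j) has_integral integral {0..R} h $ i $ j) {0..R}"
   unfolding integral_entry[OF integrable_continuous_real[OF ch]]
   by (intro integrable_integral integrable_continuous_real continuous_intros ch)
  from has_integral_stretch_real[OF this, of R] R
  have "((%v. h (R * v) $ i $ j) has_integral (1 / R) *\<^sub>R (integral {0..R} h $ i $ j)) {0..1}"
   by (simp add: image_divide_atLeastAtMost)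
  from has_integral_cmul[OF this, of R] R
  have "((%v. R *\<^sub>R (h (R * v) $ i $ j)) has_integral integral {0..R} h $ i $ j) {0..1}" by simp
  then have "((%v. f i j (linepath (x k) q v) * (q - x k)) has_integral integral {0..R} h $ i $ j) {0..1}"
  proof (rule has_integral_eq[rotated])
   fix v :: real assume v: "v \<in> {0..1}"
   have "linepath (x k) q v = x k + of_real (R * v) * wdir si"
    by (simp add: linepath_def qq scaleR_conv_of_real algebra_simps)
   moreover have "0 <= R * v" using R v by simp
   ultimately show "R *\<^sub>R (h (R * v) $ i $ j) = f i j (linepath (x k) q v) * (q - x k)"
    by (simp add: he qq scaleR_conv_of_real)
  qed
  then show ?thesis unfolding has_contour_integral_linepath[symmetric] h_def by (rule contour_integral_unique)
 qed
 have xr: "x k \<in> \<real>" using x_nonneg(3)[OF k] by (metis Reals_of_real)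
 have hor: "((%r. f i j (of_real r)) has_integral contour_integral (linepath (x k) (of_real Q)) (f i j)) {Re (x k)..Q}" for i j
 proof -
  have "(f i j has_contour_integral contour_integral (linepath (x k) (of_real Q)) (f i j)) (linepath (x k) (of_real Q))"
   by (intro has_contour_integral_integral contour_integrable_continuous_linepath segc pts)
  then show ?thesis
   using has_contour_integral_linepath_Reals_iff[OF xr, of "of_real Q"] Q by simp
 qed
 have gr: "continuous_on {Re (x k)..Q} (%r. exp (- of_real r / of_real t) *\<^sub>m gext si k (of_real r))"
 proof -
  have "continuous_on {Re (x k)..Q} (%r. gext si k (of_real r))"
   by (rule continuous_on_compose2[OF gext_continuous[OF si k]])
    (use nu in \<open>auto intro!: continuous_intros simp: cone_def\<close>)
  then show ?thesis using t by (intro ms.continuous_on continuous_intros) auto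
 qed
 let ?g = "%r. exp (- of_real r / of_real t) *\<^sub>m gext si k (of_real r)"
 have gi: "?g integrable_on {Re (x k)..Q}" by (rule integrable_continuous_real[OF gr])
 have "integral {Re (x k)..Q} ?g $ i $ j = integral {0..R} (%u. (wdir si * exp (- (x k + of_real u * wdir si) / of_real t)) *\<^sub>m
     (diag (%j. x k + of_real u * wdir si - x j) ** phi si k u)) $ i $ j - contour_integral (linepath (of_real Q) q) (f i j)" for i j
 proof -
  have "integral {Re (x k)..Q} ?g $ i $ j = contour_integral (linepath (x k) (of_real Q)) (f i j)"
   unfolding integral_entry[OF gi] using integral_unique[OF hor[of i j]] by (simp add: f_def)
  then show ?thesis using tri[of i j] rev[of i j] ray[of i j] by (simp add: algebra_simps add_eq_0_iff)
 qed
 then have "integral {Re (x k)..Q} ?g = integral {0..R} (%u. (wdir si * exp (- (x k + of_real u * wdir si) / of_real t)) *\<^sub>m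
     (diag (%j. x k + of_real u * wdir si - x j) ** phi si k u)) - (\<chi> i j. contour_integral (linepath (of_real Q) q) (f i j))"
  by (simp add: mat_eq_iff)
 then show ?thesis using integrable_integral[OF gi] by (simp add: R_def)
qed

text \<open>On the vertical side the integrand is at most B exp (- Q/t + M Q) and the length at most
  nu exp Q, so the integral vanishes in the limit once 1/t > M + 1.\<close>

lemma gext_vertical:
 assumes si: "\<bar>si\<bar> = 1" and k: "k \<in> insert i0 K"
 shows "\<exists>t0>0. \<forall>t. 0 < t --> t < t0 --> (\<forall>i j. ((%Q. contour_integral (linepath (of_real Q) (x k + of_real (Q - Re (x k)) * wdir si))
    (%ze. exp (- ze / of_real t) * gext si k ze $ i $ j)) \<longlongrightarrow> 0) at_top)"
proof -
 have s: "si = 1 \<or> si = -1" using si by linarith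
 obtain B M R0 where G: "0 <= B" "0 <= M" "0 < R0" and
  g: "\<And>ze. R0 <= Re ze ==> 0 <= si * Im ze ==> si * Im ze <= nu / 2 * Re ze ==>
   ze \<in> dom si \<and> norm (diag (%l. ze - x l) ** Ph si k ze) <= B * exp (M * Re ze)"
  using Phi_growth[OF si, of k] by metis
 define a where "a = Re (x k)"
 have a: "0 <= a" using x_nonneg[OF k] by (simp add: a_def)
 have "((%Q. contour_integral (linepath (of_real Q) (x k + of_real (Q - a) * wdir si))
    (%ze. exp (- ze / of_real t) * gext si k ze $ i $ j)) \<longlongrightarrow> 0) at_top" if t: "0 < t" "t < 1 / (M + 1)" for t i j
 proof (rule Lim_null_comparison)
  define de where "de = 1 / t - (M + 1)"
  have de: "0 < de" using t G by (simp add: de_def field_simps)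
  have "((%Q. exp (- de * Q)) \<longlongrightarrow> 0) at_top"
  proof (rule filterlim_compose[OF exp_at_bot])
   show "filterlim (%Q. - de * Q) at_bot at_top"
    using de by (intro filterlim_tendsto_neg_mult_at_bot[OF tendsto_const _ filterlim_ident]) auto
  qed
  then have "((%Q. (B * nu) * exp (- de * Q)) \<longlongrightarrow> (B * nu) * 0) at_top" by (intro tendsto_intros)
  then show "((%Q. (B * nu) * exp (- de * Q)) \<longlongrightarrow> 0) at_top" by simp
  show "\<forall>\<^sub>F Q in at_top. norm (contour_integral (linepath (of_real Q) (x k + of_real (Q - a) * wdir si))
    (%ze. exp (- ze / of_real t) * gext si k ze $ i $ j)) <= (B * nu) * exp (- de * Q)"
   using eventually_gt_at_top[of "R0 + a"]
  proof eventually_elim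
   case (elim Q)
   define q where "q = x k + of_real (Q - a) * wdir si"
   define f where "f ze = exp (- ze / of_real t) * gext si k ze $ i $ j" for ze
   have q: "Re q = Q" "Im q = si * (nu / 2 * (Q - a))" using x_nonneg[OF k] by (auto simp: q_def wdir_def a_def)
   have seg: "closed_segment (of_real Q) q \<subseteq> cone si k"
   proof (rule closed_segment_subset[OF _ _ convex_cone])
    have sq: "si * Im q = nu / 2 * (Q - a)" using q s by auto
    have "0 <= nu / 2 * (Q - a)" using nu elim G by simp
    then show "of_real Q \<in> cone si k" "q \<in> cone si k"
     unfolding cone_def mem_Collect_eq sq q(1) a_def[symmetric] using elim G by auto
   qed
   have re: "Re ze = Q" if "ze \<in> closed_segment (of_real Q) q" for ze
   proof -
    obtain v where "ze = (1 - v) *\<^sub>R of_real Q + v *\<^sub>R q" using \<open>ze \<in> _\<close> unfolding closed_segment_def by blast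
    then have "Re ze = (1 - v) * Q + v * Re q" by simp
    then show ?thesis unfolding q(1) by (simp add: algebra_simps)
   qed
   have bd: "norm (f ze) <= exp (- Q / t) * (B * exp (M * Q))" if z: "ze \<in> closed_segment (of_real Q) q" for ze
   proof -
    have c: "ze \<in> cone si k" using seg z by blast
    have "si * Im ze <= nu / 2 * Re ze"
    proof -
     have "nu / 2 * (Re ze - Re (x k)) <= nu / 2 * Re ze" using nu a by (simp add: a_def algebra_simps)
     then show ?thesis using c by (simp add: cone_def)
    qed
    then have gg: "ze \<in> dom si" "norm (diag (%l. ze - x l) ** Ph si k ze) <= B * exp (M * Q)"
     using g[of ze] re[OF z] elim a c by (auto simp: cone_def)
    have "ze \<notin> x ` insert i0 K" using poles_off_dom[OF ks si] gg(1) by auto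
    then have "gext si k ze = diag (%l. ze - x l) ** Ph si k ze" unfolding gext_def by (simp only: if_False)
    then have "norm (gext si k ze $ i $ j) <= B * exp (M * Q)"
     using gg(2) norm_entry_le order_trans by metis
    moreover have "norm (exp (- ze / of_real t)) = exp (- Q / t)"
     using re[OF z] by (simp add: norm_exp_eq_Re)
    ultimately show ?thesis unfolding f_def norm_mult using G by (intro mult_mono) auto
   qed
   have "continuous_on (closed_segment (of_real Q) q) f"
    unfolding f_def using t by (intro continuous_intros continuous_on_subset[OF gext_continuous[OF si k] seg]) auto
   then have "f contour_integrable_on linepath (of_real Q) q" by (rule contour_integrable_continuous_linepath)
   from contour_integral_bound_linepath[OF this _ bd]
   have "norm (contour_integral (linepath (of_real Q) q) f) <= exp (- Q / t) * (B * exp (M * Q)) * norm (q - of_real Q)"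
    using G by simp
   also have "norm (q - of_real Q) <= nu * exp Q"
   proof -
    have "q - of_real Q = \<i> * of_real (si * (nu / 2 * (Q - a)))" using q by (simp add: complex_eq_iff)
    then have "norm (q - of_real Q) = \<bar>si * (nu / 2 * (Q - a))\<bar>"
     by (simp only: norm_mult norm_ii norm_of_real mult_1)
    also have "\<dots> = nu / 2 * (Q - a)" using si nu elim G by (simp add: abs_mult)
    finally have "norm (q - of_real Q) = nu / 2 * (Q - a)" .
    also have "\<dots> <= nu * Q" using nu a elim G by (simp add: mult_left_mono)
    also have "\<dots> <= nu * exp Q" using exp_ge_add_one_self[of Q] nu by (intro mult_left_mono) linarith+
    finally show ?thesis .
   qed
   finally have "norm (contour_integral (linepath (of_real Q) q) f) <= exp (- Q / t) * (B * exp (M * Q)) * (nu * exp Q)"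
    using G by (simp add: mult_left_mono)
   also have "\<dots> = (B * nu) * (exp (- Q / t) * exp (M * Q) * exp Q)" by simp
   also have "exp (- Q / t) * exp (M * Q) * exp Q = exp (- de * Q)"
    unfolding exp_add[symmetric] de_def by (simp add: algebra_simps)
   finally show ?case unfolding q_def f_def .
  qed
 qed
 then show ?thesis unfolding a_def using G by (intro exI[of _ "1 / (M + 1)"]) auto
qed

end

section \<open>Stokes factor and connection matrix in normalised position\<close>

context fuchs_solutions
begin

text \<open>What is used of a canonical solution after normalisation. The last clause supplies, for
  every pair of poles, a direction that lies in the half plane, makes the Laplace integral along
  \<open>wdir si\<close> converge near 0 and keeps exp ((x_l - x_k)/t) bounded.\<close>

definition canon :: "real => (complex => complex^'n^'n) => complex set => bool" where
 "canon si Y T \<longleftrightarrow> open T \<and> convex T \<and> 0 \<notin> T \<and>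
   (\<forall>t\<in>T. has_mder Y (((1 / t\<^sup>2) *\<^sub>m diag x + (1 / t) *\<^sub>m F) ** Y t) (at t)) \<and> (\<forall>t\<in>T. invertible (Y t)) \<and>
   (\<exists>t0>0. \<forall>t. 0 < t --> t < t0 --> complex_of_real t \<in> T) \<and>
   (\<forall>k\<in>insert i0 K. \<forall>l\<in>{1..m}. \<exists>u. (\<forall>s>0. of_real s * u \<in> T) \<and> 0 < Re (wdir si / u) \<and> Re ((x l - x k) / u) <= 0 \<and>
    ((%s. Y (of_real s * u) ** diag (%j. exp (x j / (of_real s * u)))) \<longlongrightarrow> mat 1) (at_right (0::real)))"

lemma canon_fund: "canon si Y T ==> \<exists>V. fund (%t. (1 / t\<^sup>2) *\<^sub>m diag x + (1 / t) *\<^sub>m F) T Y V"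
proof -
 assume c: "canon si Y T"
 then have T: "open T" "convex T" "0 \<notin> T" by (auto simp: canon_def)
 obtain t0 where t0: "0 < t0" "\<And>t. 0 < t ==> t < t0 ==> complex_of_real t \<in> T" using c by (auto simp: canon_def)
 have tT: "of_real (t0 / 2) \<in> T" by (rule t0(2)) (use t0(1) in auto)
 show ?thesis
 proof (rule fund_inverse[OF T(1,2) _ _ tT])
  show "mhol (%t. (1 / t\<^sup>2) *\<^sub>m diag x + (1 / t) *\<^sub>m F) T"
   by (intro mhol_add mhol_msmult mhol_const holomorphic_intros) (use T(3) in auto)
 qed (use c tT in \<open>auto simp: canon_def\<close>)
qed

text \<open>The limit of the slanted integrals is known from their comparison with the canonical
  solution; the contour shift and the vanishing vertical side carry it over to the real
  axis.\<close>

lemma real_axis_limit: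
 assumes si: "\<bar>si\<bar> = 1" and k: "k \<in> insert i0 K" and c: "canon si Y T"
 shows "\<exists>t0>0. \<forall>t. 0 < t --> t < t0 --> complex_of_real t \<in> T \<and>
  ((%Q. integral {Re (x k)..Q} (%r. exp (- of_real r / of_real t) *\<^sub>m gext si k (of_real r))) \<longlongrightarrow>
   (of_real t)\<^sup>2 *\<^sub>m (Y (of_real t) ** P k + F ** (Y (of_real t) ** P k))) at_top"
proof -
 obtain V where V: "fund (%t. (1 / t\<^sup>2) *\<^sub>m diag x + (1 / t) *\<^sub>m F) T Y V" using canon_fund[OF c] by blast
 have T: "open T" "convex T" "0 \<notin> T" using c by (auto simp: canon_def)
 obtain B M where BM: "0 <= B" "0 < M"
  "\<And>u. 0 <= u ==> norm (diag (%j. x k + of_real u * wdir si - x j) ** phi si k u) <= B * exp (M * u)"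
  "\<And>u. 0 <= u ==> norm (phi si k u - P k) <= B * u * exp (M * u)"
  using phi_bounds[OF si k] by auto
 obtain t0 where t0: "0 < t0" "\<And>t. 0 < t ==> t < t0 ==> complex_of_real t \<in> T" using c by (auto simp: canon_def)
 obtain t1 where t1: "0 < t1" "\<And>t i j. 0 < t ==> t < t1 ==>
   ((%Q. contour_integral (linepath (of_real Q) (x k + of_real (Q - Re (x k)) * wdir si))
    (%ze. exp (- ze / of_real t) * gext si k ze $ i $ j)) \<longlongrightarrow> 0) at_top"
  using gext_vertical[OF si k] by blast
 have dirs: "\<And>l. l \<in> {1..m} ==> \<exists>u. (\<forall>s>0. of_real s * u \<in> T) \<and> 0 < Re (wdir si / u) \<and> Re ((x l - x k) / u) <= 0 \<and>
    ((%s. Y (of_real s * u) ** diag (%j. exp (x j / (of_real s * u)))) \<longlongrightarrow> mat 1) (at_right (0::real))"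
  using c k unfolding canon_def by blast
 have ode: "diag (%j. x k + of_real u * wdir si - x j) ** (wdir si *\<^sub>m (A (x k + of_real u * wdir si) ** phi si k u))
   = wdir si *\<^sub>m (F ** phi si k u)" if u: "0 < u" for u
 proof -
  have "x k + of_real u * wdir si \<in> dom si" using ray_half[OF si k u] half_dom by blast
  then have "x k + of_real u * wdir si ~= x j" if "j \<in> {1..m}" for j using poles_off_dom[OF that si] by auto
  from diag_A[OF this] show ?thesis by (simp add: matrix_mul_assoc)
 qed
 have "complex_of_real t \<in> T \<and> ((%Q. integral {Re (x k)..Q} (%r. exp (- of_real r / of_real t) *\<^sub>m gext si k (of_real r))) \<longlongrightarrow>
   (of_real t)\<^sup>2 *\<^sub>m (Y (of_real t) ** P k + F ** (Y (of_real t) ** P k))) at_top"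
  if t: "0 < t" "t < min t0 (min t1 (1 / M))" for t
 proof
  show tT: "complex_of_real t \<in> T" using t0(2) t by simp
  have "Re (wdir si / of_real t) = 1 / t" by (simp add: wdir_def Re_divide_of_real)
  then have tM: "M < Re (wdir si / of_real t)" using t BM(2) by (simp add: field_simps)
  have "phi si k 0 = P k" by (simp add: phi_def)
  have L0: "((%R. lapG x k (wdir si) (phi si k) R (of_real t)) \<longlongrightarrow>
    (of_real t)\<^sup>2 *\<^sub>m (Y (of_real t) ** P k + F ** (Y (of_real t) ** P k))) at_top"
   by (rule lapG_limit[OF ks[OF k] \<open>phi si k 0 = P k\<close> phi_cont[OF si k] phi_der[OF si k] ode BM T V tT tM dirs])
  have L: "((%R. integral {0..R} (%u. (wdir si * exp (- (x k + of_real u * wdir si) / of_real t)) *\<^sub>m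
     (diag (%j. x k + of_real u * wdir si - x j) ** phi si k u))) \<longlongrightarrow>
    (of_real t)\<^sup>2 *\<^sub>m (Y (of_real t) ** P k + F ** (Y (of_real t) ** P k))) at_top"
  proof -
   note hyps = ks[OF k] \<open>phi si k 0 = P k\<close> phi_cont[OF si k] phi_der[OF si k] ode BM
   have 1: "lexp x k (wdir si) u s = exp (- (x k + of_real u * wdir si) / s)" for u s
    by (rule lexp_def[OF hyps])
   have 2: "dray x k (wdir si) u = diag (%j. x k + of_real u * wdir si - x j)" for u
    by (rule dray_def[OF hyps])
   have "lapG x k (wdir si) (phi si k) R s = integral {0..R} (%u. (wdir si * lexp x k (wdir si) u s) *\<^sub>m (dray x k (wdir si) u ** phi si k u))" for R s
    by (rule lapG_def[OF hyps])
   then show ?thesis using L0 by (simp only: 1 2)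
  qed
  have "filterlim (%Q. Q - Re (x k)) at_top at_top"
   using filterlim_tendsto_add_at_top[OF tendsto_const filterlim_ident, of "- Re (x k)"] by simp
  from filterlim_compose[OF L this]
  have L1: "((%Q. integral {0..Q - Re (x k)} (%u. (wdir si * exp (- (x k + of_real u * wdir si) / of_real t)) *\<^sub>m
     (diag (%j. x k + of_real u * wdir si - x j) ** phi si k u))) \<longlongrightarrow>
    (of_real t)\<^sup>2 *\<^sub>m (Y (of_real t) ** P k + F ** (Y (of_real t) ** P k))) at_top" .
  have L2: "((%Q. \<chi> i j. contour_integral (linepath (of_real Q) (x k + of_real (Q - Re (x k)) * wdir si))
    (%ze. exp (- ze / of_real t) * gext si k ze $ i $ j)) \<longlongrightarrow> 0) at_top"
   unfolding tendsto_matrix_iff using t1(2)[OF t(1)] t by simp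
  from tendsto_diff[OF L1 L2]
  show "((%Q. integral {Re (x k)..Q} (%r. exp (- of_real r / of_real t) *\<^sub>m gext si k (of_real r))) \<longlongrightarrow>
   (of_real t)\<^sup>2 *\<^sub>m (Y (of_real t) ** P k + F ** (Y (of_real t) ** P k))) at_top"
   unfolding diff_zero
  proof (rule tendsto_cong[THEN iffD1, rotated])
   show "\<forall>\<^sub>F Q in at_top. integral {0..Q - Re (x k)} (%u. (wdir si * exp (- (x k + of_real u * wdir si) / of_real t)) *\<^sub>m
     (diag (%j. x k + of_real u * wdir si - x j) ** phi si k u)) - (\<chi> i j. contour_integral (linepath (of_real Q) (x k + of_real (Q - Re (x k)) * wdir si))
    (%ze. exp (- ze / of_real t) * gext si k ze $ i $ j)) =
     integral {Re (x k)..Q} (%r. exp (- of_real r / of_real t) *\<^sub>m gext si k (of_real r))"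
    using eventually_gt_at_top[of "Re (x k)"]
    by eventually_elim (rule integral_unique[OF gext_contour[OF si k t(1)], symmetric])
  qed
 qed
 then show ?thesis using t0(1) t1(1) BM(2) by (intro exI[of _ "min t0 (min t1 (1 / M))"]) auto
qed

text \<open>\<open>1 + F\<close> is injective on values of solutions: its kernel would have to contain all \<open>Z^n v\<close>,
 hence all \<open>P k v\<close>, but \<open>P k F P k = 0\<close>.\<close>
lemma kernel_trivial:
 fixes v :: "real => complex^'n^'n"
 assumes t0: "0 < t0" and v: "\<And>t. 0 < t ==> t < t0 ==>
   (v has_vector_derivative ((1 / (of_real t)\<^sup>2) *\<^sub>m diag x + (1 / of_real t) *\<^sub>m F) ** v t) (at t)"
  and ker: "\<And>t. 0 < t ==> t < t0 ==> v t + F ** v t = 0" and t: "0 < t" "t < t0"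
 shows "v t = 0"
proof -
 \<comment> \<open>\<open>N f\<close> is (1 + F) f(Z) v for a function f of the eigenvalues, with Z
   normalised.\<close>
 define N where "N f t = diag f ** v t + F ** (diag f ** v t)" for f t
 \<comment> \<open>On the kernel F v = - v, so v' = Z v / t^2 - v / t. Differentiating
   \<open>N f\<close> = 0 therefore gives the same relation for x f.\<close>
 have step: "N (%j. x j * f j) t = 0" if N: "\<And>t. 0 < t ==> t < t0 ==> N f t = 0" and t: "0 < t" "t < t0" for f t
 proof -
  define c where "c = complex_of_real t"
  have c: "c ~= 0" using t by (simp add: c_def)
  define v' where "v' = ((1 / c\<^sup>2) *\<^sub>m diag x + (1 / c) *\<^sub>m F) ** v t"
  have dv: "(v has_vector_derivative v') (at t)" using v[OF t] by (simp add: v'_def c_def)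
  have "((%t. diag f ** v t) has_vector_derivative (diag f ** v')) (at t)"
   using mm.has_vector_derivative[OF has_vector_derivative_const dv, of "diag f"] by (simp add: mm.zero_left)
  from has_vector_derivative_add[OF this mm.has_vector_derivative[OF has_vector_derivative_const this, of F]]
  have "(N f has_vector_derivative (diag f ** v' + F ** (diag f ** v'))) (at t)"
   by (simp add: N_def[abs_def] mm.zero_left)
  moreover have "(N f has_vector_derivative 0) (at t)"
   by (rule has_vector_derivative_transform_within_open[where f = "%t. 0" and S = "{0<..<t0}"]) (use t N in auto)
  ultimately have "diag f ** v' + F ** (diag f ** v') = 0" by (metis vector_derivative_at)
  moreover have "v' = (1 / c\<^sup>2) *\<^sub>m (diag x ** v t) - (1 / c) *\<^sub>m v t"
  proof -
   have "F ** v t = - v t" using ker[OF t] by (simp add: add_eq_0_iff)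
   then show ?thesis by (simp add: v'_def mat_distrib)
  qed
  moreover have "diag f ** diag x ** v t = diag (%j. x j * f j) ** v t" by (simp add: diag_mult mult.commute)
  ultimately have "(1 / c\<^sup>2) *\<^sub>m N (%j. x j * f j) t - (1 / c) *\<^sub>m N f t = 0"
   by (simp add: N_def mat_distrib matrix_mul_assoc algebra_simps)
  then show ?thesis using N[OF t] c by (simp add: ms.zero_right)
 qed
 have Nl: "N (%j. f j - a * g j) t = N f t - a *\<^sub>m N g t" for f g a t
  by (simp add: N_def diag_diff diag_cmult[symmetric] mat_distrib)
 have prod: "finite L ==> 0 < t ==> t < t0 ==> N (%j. \<Prod>l\<in>L. x j - x l) t = 0" for L t
 proof (induction L arbitrary: t rule: finite_induct)
  case empty then show ?case using ker by (simp add: N_def diag_one)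
 next
  case (insert l L)
  have "N (%j. \<Prod>l\<in>insert l L. x j - x l) t = N (%j. x j * (\<Prod>l\<in>L. x j - x l) - x l * (\<Prod>l\<in>L. x j - x l)) t"
   using insert by (simp add: left_diff_distrib)
  also have "\<dots> = 0" unfolding Nl using insert step by (simp add: ms.zero_right)
  finally show ?case .
 qed
 show ?thesis
 proof (rule matrix_eq_P)
  fix k assume k: "k \<in> {1..m}"
  \<comment> \<open>Lagrange polynomial without normalisation: it vanishes at every x_j with j
    different from k, so \<open>diag f\<close> is a nonzero multiple of P k.\<close>
  define f where "f j = (\<Prod>l\<in>{1..m} - {k}. x j - x l)" for j
  have fk: "f k ~= 0" using inj k by (auto simp: f_def dest: inj_onD)
  have "diag f = (\<Sum>j=1..m. if j = k then f k *\<^sub>m P k else 0)" unfolding diag_def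
  proof (rule sum.cong[OF refl])
   fix j assume j: "j \<in> {1..m}"
   have "f j = 0" if "j ~= k" unfolding f_def by (rule prod_zero) (use j that in auto)
   then show "f j *\<^sub>m P j = (if j = k then f k *\<^sub>m P k else 0)" by (simp add: ms.zero_left)
  qed
  then have df: "diag f = f k *\<^sub>m P k" using k by (simp add: sum.delta)
  have "N f t = 0" using prod[of "{1..m} - {k}" t] t by (simp add: f_def[abs_def])
  then have "f k *\<^sub>m (P k ** v t + F ** (P k ** v t)) = 0" by (simp add: N_def df mat_distrib)
  then have "P k ** v t + F ** (P k ** v t) = 0" using fk by simp
  then have "P k ** (P k ** v t + F ** (P k ** v t)) = 0" by (simp add: mm.zero_right)
  then have "P k ** v t + (P k ** F ** P k) ** v t = 0"
   using orth[OF k k] by (simp add: mat_distrib matrix_mul_assoc)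
  then show "P k ** v t = P k ** 0" using PFP[OF k] by (simp add: mm.zero_left mm.zero_right)
 qed
qed

text \<open>Contribution of the pole k to the difference between the two continuations of the
  solution starting at \<open>i0\<close>, as a coefficient of the solution without logarithm at
  k.\<close>

definition conn :: "nat => complex^'n^'n" where
 "conn k = (2 * of_real pi * \<i>) *\<^sub>m (F ** C (-1) k ** D (-1) i0 ** P i0)"

lemma gext_jump:
 assumes r: "0 < r" "r \<notin> X"
 shows "gext (-1) i0 (of_real r) = gext 1 i0 (of_real r) + (\<Sum>k\<in>{k\<in>K. Re (x k) < r}. gext 1 k (of_real r) ** conn k)"
proof -
 have "complex_of_real r \<notin> x ` insert i0 K"
  using real_in_dom[OF r, of 1] poles_off_dom[of _ 1] ks by auto
 then have g: "gext si k (of_real r) = diag (%j. of_real r - x j) ** (Ps si (of_real r) ** D si k ** P k)" for si k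
  unfolding gext_def Ph_def by (simp only: if_False)
 define U where "U = diag (%j. of_real r - x j) ** Ps 1 (of_real r)"
 have "gext (-1) i0 (of_real r) = U ** (D 1 i0 ** C (-1) i0 + (\<Sum>k\<in>{k\<in>K. Re (x k) < r}. jump k)) ** D (-1) i0 ** P i0"
  unfolding g jump_formula[OF r] U_def by (simp add: mat_assoc)
 also have "\<dots> = U ** D 1 i0 ** (C (-1) i0 ** D (-1) i0) ** P i0 + (\<Sum>k\<in>{k\<in>K. Re (x k) < r}. U ** jump k ** D (-1) i0 ** P i0)"
  by (simp add: mat_distrib mm.sum_left mm.sum_right mat_assoc)
 also have "U ** D 1 i0 ** (C (-1) i0 ** D (-1) i0) ** P i0 = gext 1 i0 (of_real r)"
  using CD[of "-1" i0] by (simp add: g U_def mat_assoc)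
 also have "(\<Sum>k\<in>{k\<in>K. Re (x k) < r}. U ** jump k ** D (-1) i0 ** P i0) = (\<Sum>k\<in>{k\<in>K. Re (x k) < r}. gext 1 k (of_real r) ** conn k)"
  by (simp add: g U_def jump_def conn_def res_def mat_assoc)
 finally show ?thesis .
qed

text \<open>Integrating the jump relation against exp (- r/t) turns the solution belonging to k into
  t^2 (1 + F) Y P k. With Y_- = Y_+ S this says that 1 + F annihilates the solution Y_+ c, where c
  is S P_i0 - P_i0 minus the sum of all P k \<open>conn k\<close>. Hence c = 0, and P j selects one
  summand.\<close>

theorem stokes_connection:
 assumes cp: "canon 1 Yp Tp" and cm: "canon (-1) Ym Tm"
  and S: "\<And>t. t \<in> Tp \<inter> Tm ==> Ym t = Yp t ** S"
  and j: "j \<in> K"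
 shows "P j ** S ** P i0 = P j ** conn j"
proof -
 have finK: "finite K" by (simp add: K_def)
 have "\<forall>k\<in>insert i0 K. \<exists>t0>0. \<forall>t. 0 < t --> t < t0 --> complex_of_real t \<in> Tp \<and>
  ((%Q. integral {Re (x k)..Q} (%r. exp (- of_real r / of_real t) *\<^sub>m gext 1 k (of_real r))) \<longlongrightarrow>
   (of_real t)\<^sup>2 *\<^sub>m (Yp (of_real t) ** P k + F ** (Yp (of_real t) ** P k))) at_top"
  using real_axis_limit[OF _ _ cp] by simp
 from bchoice[OF this] obtain tp where tp': "\<forall>k\<in>insert i0 K. 0 < tp k \<and> (\<forall>t. 0 < t --> t < tp k --> complex_of_real t \<in> Tp \<and>
  ((%Q. integral {Re (x k)..Q} (%r. exp (- of_real r / of_real t) *\<^sub>m gext 1 k (of_real r))) \<longlongrightarrow>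
   (of_real t)\<^sup>2 *\<^sub>m (Yp (of_real t) ** P k + F ** (Yp (of_real t) ** P k))) at_top)" ..
 have tp: "0 < tp k" "\<And>t. 0 < t ==> t < tp k ==> complex_of_real t \<in> Tp \<and>
  ((%Q. integral {Re (x k)..Q} (%r. exp (- of_real r / of_real t) *\<^sub>m gext 1 k (of_real r))) \<longlongrightarrow>
   (of_real t)\<^sup>2 *\<^sub>m (Yp (of_real t) ** P k + F ** (Yp (of_real t) ** P k))) at_top" if "k \<in> insert i0 K" for k
  using bspec[OF tp' that] by simp_all
 obtain tm where tm: "0 < tm" "\<And>t. 0 < t ==> t < tm ==> complex_of_real t \<in> Tm \<and>
  ((%Q. integral {Re (x i0)..Q} (%r. exp (- of_real r / of_real t) *\<^sub>m gext (-1) i0 (of_real r))) \<longlongrightarrow>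
   (of_real t)\<^sup>2 *\<^sub>m (Ym (of_real t) ** P i0 + F ** (Ym (of_real t) ** P i0))) at_top"
  using real_axis_limit[OF _ _ cm, of i0, simplified abs_minus_cancel abs_one, OF refl insertI1] by blast
 define t0 where "t0 = Min (insert tm (tp ` insert i0 K))"
 have t0: "0 < t0" unfolding t0_def by (subst Min_gr_iff) (use finK tp tm in auto)
 have t0le: "t0 <= tm" "k \<in> insert i0 K ==> t0 <= tp k" for k
  unfolding t0_def by (rule Min_le; use finK in auto)+
 define c where "c = S ** P i0 - P i0 - (\<Sum>k\<in>K. P k ** conn k)"
 have ker: "Yp (of_real t) ** c + F ** (Yp (of_real t) ** c) = 0" if t: "0 < t" "t < t0" for t
 proof -
  define E where "E r = exp (- complex_of_real r / of_real t)" for r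
  define L where "L k = (of_real t)\<^sup>2 *\<^sub>m (Yp (of_real t) ** P k + F ** (Yp (of_real t) ** P k))" for k
  define Jp where "Jp k Q = integral {Re (x k)..Q} (%r. E r *\<^sub>m gext 1 k (of_real r))" for k Q
  define Jm where "Jm Q = integral {Re (x i0)..Q} (%r. E r *\<^sub>m gext (-1) i0 (of_real r))" for Q
  have Lp: "(Jp k \<longlongrightarrow> L k) at_top" if "k \<in> insert i0 K" for k
   using tp(2)[OF that t(1)] t0le(2)[OF that] t by (simp add: Jp_def[abs_def] L_def E_def)
  have Lm: "(Jm \<longlongrightarrow> (of_real t)\<^sup>2 *\<^sub>m (Ym (of_real t) ** P i0 + F ** (Ym (of_real t) ** P i0))) at_top"
   using tm(2)[OF t(1)] t0le(1) t by (simp add: Jm_def[abs_def] E_def)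
  have "((%Q. Jp i0 Q + (\<Sum>k\<in>K. Jp k Q ** conn k)) \<longlongrightarrow> L i0 + (\<Sum>k\<in>K. L k ** conn k)) at_top"
   by (intro tendsto_add tendsto_sum mm.tendsto tendsto_const Lp) auto
  moreover have "\<forall>\<^sub>F Q in at_top. Jp i0 Q + (\<Sum>k\<in>K. Jp k Q ** conn k) = Jm Q"
   using eventually_gt_at_top[of "Max (insert 0 X)"]
  proof eventually_elim
   case (elim Q)
   then have Q: "0 < Q" "\<And>k. k \<in> K ==> Re (x k) < Q" using finite_X by (auto simp: X_def)
   have int: "((%r. E r *\<^sub>m gext 1 k (of_real r)) has_integral Jp k Q) {Re (x k)..Q}" if "k \<in> insert i0 K" for k
    using gext_contour[OF _ that t(1), of 1 Q] Q i0 that unfolding Jp_def E_def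
    by (intro integrable_integral) auto
   have i1: "((%r. E r *\<^sub>m gext 1 i0 (of_real r)) has_integral Jp i0 Q) {0..Q}" using int[of i0] i0 by simp
   have i2: "((%r. (if r \<in> {Re (x k)..Q} then E r *\<^sub>m gext 1 k (of_real r) else 0) ** conn k) has_integral Jp k Q ** conn k) {0..Q}"
    if "k \<in> K" for k
   proof -
    have "((%r. if r \<in> {Re (x k)..Q} then E r *\<^sub>m gext 1 k (of_real r) else 0) has_integral Jp k Q) {0..Q}"
     by (subst has_integral_restrict) (use int[of k] that K_pos[OF that] in auto)
    from has_integral_linear[OF this mm.bounded_linear_left[of "conn k"]] show ?thesis by (simp add: o_def)
   qed
   have sum: "((%r. E r *\<^sub>m gext 1 i0 (of_real r) + (\<Sum>k\<in>K. (if r \<in> {Re (x k)..Q} then E r *\<^sub>m gext 1 k (of_real r) else 0) ** conn k))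
     has_integral Jp i0 Q + (\<Sum>k\<in>K. Jp k Q ** conn k)) {0..Q}"
    by (intro has_integral_add i1 has_integral_sum finK i2)
   have "((%r. E r *\<^sub>m gext (-1) i0 (of_real r)) has_integral Jp i0 Q + (\<Sum>k\<in>K. Jp k Q ** conn k)) {0..Q}"
   proof (rule has_integral_spike_finite[OF _ _ sum])
    \<comment> \<open>The jump relation is available off 0 and the poles; finitely many points do
      not affect the integral.\<close>
    show "finite (insert 0 X)" using finite_X by simp
    fix r assume r: "r \<in> {0..Q} - insert 0 X"
    then have r': "0 < r" "r \<notin> X" by auto
    have "(\<Sum>k\<in>{k\<in>K. Re (x k) < r}. gext 1 k (of_real r) ** conn k) =
      (\<Sum>k\<in>K. if Re (x k) < r then gext 1 k (of_real r) ** conn k else 0)"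
     by (rule sum.mono_neutral_cong_left) (use finK in auto)
    then have "E r *\<^sub>m gext (-1) i0 (of_real r) = E r *\<^sub>m gext 1 i0 (of_real r) + (\<Sum>k\<in>K. E r *\<^sub>m (if Re (x k) < r then gext 1 k (of_real r) ** conn k else 0))"
     unfolding gext_jump[OF r'] by (simp add: ms.add_right ms.sum_right)
    also have "(\<Sum>k\<in>K. E r *\<^sub>m (if Re (x k) < r then gext 1 k (of_real r) ** conn k else 0)) =
      (\<Sum>k\<in>K. (if r \<in> {Re (x k)..Q} then E r *\<^sub>m gext 1 k (of_real r) else 0) ** conn k)"
    proof (rule sum.cong[OF refl])
     fix k assume "k \<in> K"
     then have "Re (x k) ~= r" using r' by (auto simp: X_def)
     then show "E r *\<^sub>m (if Re (x k) < r then gext 1 k (of_real r) ** conn k else 0) =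
       (if r \<in> {Re (x k)..Q} then E r *\<^sub>m gext 1 k (of_real r) else 0) ** conn k"
      using r by (auto simp: mm.zero_left ms.zero_right)
    qed
    finally show "E r *\<^sub>m gext (-1) i0 (of_real r) =
     E r *\<^sub>m gext 1 i0 (of_real r) + (\<Sum>k\<in>K. (if r \<in> {Re (x k)..Q} then E r *\<^sub>m gext 1 k (of_real r) else 0) ** conn k)" .
   qed
   then show ?case unfolding Jm_def using i0 by (simp add: integral_unique)
  qed
  ultimately have "(Jm \<longlongrightarrow> L i0 + (\<Sum>k\<in>K. L k ** conn k)) at_top" by (rule tendsto_cong[THEN iffD1, rotated])
  from tendsto_unique[OF _ this Lm]
  have eq: "L i0 + (\<Sum>k\<in>K. L k ** conn k) = (of_real t)\<^sup>2 *\<^sub>m (Ym (of_real t) ** P i0 + F ** (Ym (of_real t) ** P i0))" by simp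
  have "complex_of_real t \<in> Tp \<inter> Tm" using tp(2)[of i0 t] tm(2)[of t] t t0le(1) t0le(2)[of i0] by auto
  from S[OF this] have Ym: "Ym (of_real t) = Yp (of_real t) ** S" .
  define U where "U = (of_real t)\<^sup>2 *\<^sub>m (Yp (of_real t) + F ** Yp (of_real t))"
  have LU: "L k = U ** P k" for k by (simp add: L_def U_def mat_distrib mat_assoc)
  have "U ** S ** P i0 = (of_real t)\<^sup>2 *\<^sub>m (Ym (of_real t) ** P i0 + F ** (Ym (of_real t) ** P i0))"
   by (simp add: Ym U_def mat_distrib mat_assoc)
  moreover have "U ** c = U ** S ** P i0 - (L i0 + (\<Sum>k\<in>K. L k ** conn k))"
   by (simp add: c_def LU mat_distrib mm.sum_right mat_assoc)
  ultimately have "U ** c = 0" using eq by simp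
  then have "(of_real t)\<^sup>2 *\<^sub>m (Yp (of_real t) ** c + F ** (Yp (of_real t) ** c)) = 0"
   by (simp add: U_def mat_distrib mat_assoc)
  then show ?thesis using t by simp
 qed
 obtain V where V: "fund (%t. (1 / t\<^sup>2) *\<^sub>m diag x + (1 / t) *\<^sub>m F) Tp Yp V" using canon_fund[OF cp] by blast
 have tTp: "complex_of_real t \<in> Tp" if "0 < t" "t < t0" for t
  using tp(2)[of i0 t] that t0le(2)[of i0] by auto
 have "Yp (of_real (t0 / 2)) ** c = 0"
 proof (rule kernel_trivial[OF t0, where v = "%t. Yp (of_real t) ** c"])
  fix t assume t: "0 < t" "t < t0"
  show "Yp (of_real t) ** c + F ** (Yp (of_real t) ** c) = 0" by (rule ker[OF t])
  have "(complex_of_real has_vector_derivative 1) (at t)" by (auto intro!: derivative_eq_intros)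
  from has_mder_path[OF has_mder_multc_right[OF fundD(1)[OF V tTp[OF t]], of c] this]
  show "((%t. Yp (of_real t) ** c) has_vector_derivative ((1 / (of_real t)\<^sup>2) *\<^sub>m diag x + (1 / of_real t) *\<^sub>m F) ** (Yp (of_real t) ** c)) (at t)"
   by (simp add: mat_assoc)
 qed (use t0 in auto)
 moreover have "V (of_real (t0 / 2)) ** (Yp (of_real (t0 / 2)) ** c) = c"
  by (rule matrix_cancel[OF fundD(4)[OF V tTp]]) (use t0 in auto)
 ultimately have "c = 0" by (simp add: mm.zero_right)
 then have "P j ** (S ** P i0 - P i0 - (\<Sum>k\<in>K. P k ** conn k)) = 0" by (simp add: c_def mm.zero_right)
 moreover have jm: "j \<in> {1..m}" "j ~= i0" using j i0 K_pos[OF j] by (auto simp: K_def)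
 then have "P j ** P i0 = 0" using orth[of j i0] i0 by auto
 moreover have "(\<Sum>k\<in>K. P j ** (P k ** conn k)) = (\<Sum>k\<in>K. if k = j then P j ** conn j else 0)"
 proof (rule sum.cong[OF refl])
  fix k assume "k \<in> K"
  then have "P j ** P k = (if k = j then P j else 0)" using orth[OF jm(1), of k] by (auto simp: K_def)
  then show "P j ** (P k ** conn k) = (if k = j then P j ** conn j else 0)"
   by (simp add: matrix_mul_assoc mm.zero_left)
 qed
 ultimately show ?thesis using j finK by (simp add: mat_distrib mm.sum_right sum.delta mat_assoc)
qed

end

text \<open>With d = z_j - z_i, the substitution of (zeta - z_i)/d for zeta moves z_i to 0, z_j to 1
  and l to the positive reals. On the other side t becomes d t, and the factor exp (z_i / (d t))
  accounts for the shift of Z.\<close>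

lemma (in projections) stokes_normalised:
 fixes F S :: "complex^'n^'n" and z :: "nat => complex" and l :: "complex set"
 assumes PFP: "\<And>k. k \<in> {1..m} ==> P k ** F ** P k = 0" and inj: "inj_on z {1..m}"
  and ev: "eigenvalues (diag z) = z ` {1..m}" and sf: "is_stokes_factor (diag z) F l S"
  and i: "i \<in> {1..m}" and j: "j \<in> {1..m}" and ij: "z j ~= z i" and l: "l = ray_through (z j - z i)"
 defines "x \<equiv> %k. (z k - z i) / (z j - z i)"
 shows "\<exists>nu Ps Th H rh C D. fuchs_solutions m P F x nu i Ps Th H rh C D \<and>
   P j ** S ** P i = (2 * of_real pi * \<i>) *\<^sub>m (P j ** F ** C (-1) j ** D (-1) i ** P i)"
proof -
 define d where "d = z j - z i"
 have d: "d ~= 0" using ij by (simp add: d_def)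
 have zx: "z k = z i + d * x k" for k using d by (simp add: x_def d_def[symmetric])
 obtain a b Yp Ym where ab: "0 < a" "a < pi / 2" "0 < b" "b < pi / 2"
  and no: "\<forall>th \<in> {-b..a}. th ~= 0 --> rotate_ray th l \<notin> stokes_rays (diag z)"
  and cp: "is_canonical_solution (diag z) F (rotate_ray a l) Yp"
  and cm: "is_canonical_solution (diag z) F (rotate_ray (-b) l) Ym"
  and S: "\<forall>t \<in> half_plane (rotate_ray (-b) l) \<inter> half_plane (rotate_ray a l). Ym t = Yp t ** S"
  using sf by (auto simp: is_stokes_factor_def)
 have noray: "ps = 0" if "- b <= ps" "ps <= a" "0 < r" "k \<in> {1..m}" "k' \<in> {1..m}" "x k - x k' = of_real r * cis ps" for ps r k k'
 proof -
  have zz: "z k - z k' = of_real r * (cis ps * d)" using that(6) zx[of k] zx[of k'] by (simp add: algebra_simps)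
  then have ne: "z k ~= z k'" using that d by auto
  have "rotate_ray ps l = ray_through (z k - z k')"
   using that(3) by (simp only: zz ray_through_mult rotate_ray_through l d_def)
  also have "\<dots> \<in> stokes_rays (diag z)" using that ne unfolding stokes_rays_def ev by blast
  finally show ?thesis using no that by (metis atLeastAtMost_iff)
 qed
 \<comment> \<open>A wedge of half angle min a b lies in the sector that contains no Stokes ray but
   l, which forces its poles to be real.\<close>
 define c where "c = min a b"
 have c: "0 < c" "c < pi / 2" "c <= a" "c <= b" using ab by (auto simp: c_def)
 define nu where "nu = tan c"
 have mu: "0 < nu" "arctan nu = c" using c by (simp_all add: nu_def tan_gt_zero arctan_tan)
 interpret fuchs_wedge m P F x nu i
 proof
  show "inj_on x {1..m}" using inj zx by (intro inj_onI) (metis inj_onD)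
  show "0 < nu" by (rule mu(1))
  show "x i = 0" by (simp add: x_def)
  fix k assume k: "k \<in> {1..m}" "\<bar>Im (x k)\<bar> < nu * Re (x k)"
  have "0 < nu * Re (x k)" using k(2) abs_ge_zero[of "Im (x k)"] by linarith
  then have re: "0 < Re (x k)" using mu(1) by (rule zero_less_mult_pos)
  define ps where "ps = arctan (Im (x k) / Re (x k))"
  have co: "0 < cos ps" unfolding ps_def using arctan_lbound arctan_ubound by (intro cos_gt_zero_pi) auto
  have tan: "tan ps = Im (x k) / Re (x k)" by (simp add: ps_def tan_arctan)
  have "Im (x k) / Re (x k) < nu" "- nu < Im (x k) / Re (x k)" using k re by (auto simp: field_simps abs_less_iff)
  then have "ps < arctan nu" "- arctan nu < ps" unfolding ps_def by (auto simp: arctan_less_iff arctan_minus[symmetric] simp del: arctan_minus)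
  moreover have "x k - x i = of_real (Re (x k) / cos ps) * cis ps"
  proof -
   have "Re (x k) / cos ps * sin ps = Re (x k) * tan ps" by (simp add: tan_def)
   then have "Re (x k) / cos ps * sin ps = Im (x k)" using tan re by simp
   then show ?thesis using co by (simp add: complex_eq_iff x_def)
  qed
  ultimately have "ps = 0" using noray[of ps "Re (x k) / cos ps" k i] re co k i c mu by simp
  then show "Im (x k) = 0" using tan re by simp
 qed (use PFP i in auto)
 obtain Ps Th H rh C D where fs: "fuchs_solutions m P F x nu i Ps Th H rh C D" using fuchs_solutions_exist by blast
 then interpret fuchs_solutions m P F x nu i Ps Th H rh C D .
 \<comment> \<open>The angle of \<open>wdir\<close>; it is smaller than c, so the Laplace direction
   lies strictly between l and the perturbed ray.\<close>
 define be where "be = arctan (nu / 2)"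
 have be: "0 < be" "be < c" using mu by (auto simp: be_def zero_less_arctan_iff arctan_less_iff[of "nu / 2" nu, unfolded mu(2)])
 have w: "wdir si = of_real (norm (wdir si)) * cis (si * be)" "0 < norm (wdir si)" if "\<bar>si\<bar> = 1" for si
 proof -
  have s: "si = 1 \<or> si = -1" using that by linarith
  have co: "0 < cos be" using be c by (intro cos_gt_zero_pi) auto
  have t: "sin be = nu / 2 * cos be"
  proof -
   have "tan be = nu / 2" by (simp add: be_def tan_arctan)
   then show ?thesis using co by (simp add: tan_def field_simps)
  qed
  have e: "wdir si = of_real (1 / cos be) * cis (si * be)"
   using s co t by (auto simp: wdir_def complex_eq_iff)
  then have "norm (wdir si) = 1 / cos be" using co by (simp add: norm_mult norm_divide)
  then show "wdir si = of_real (norm (wdir si)) * cis (si * be)" "0 < norm (wdir si)" using e co by auto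
 qed
 define Tp where "Tp e = {ta. 0 < Re (ta / cis e)}" for e
 define Y1 where "Y1 Y ta = exp (z i / (d * ta)) *\<^sub>m Y (d * ta)" for Y :: "complex => complex^'n^'n" and ta
 have Tp: "Tp e = half_plane (ray_through (cis e))" for e by (simp add: Tp_def half_plane_ray_through)
 have Thp: "ta \<in> Tp e \<longleftrightarrow> d * ta \<in> half_plane (rotate_ray e l)" for ta e
 proof -
  have "d * ta / (cis e * d) = ta / cis e" using d by simp
  then show ?thesis using d by (simp add: l d_def[symmetric] rotate_ray_through half_plane_ray_through Tp_def)
 qed
 \<comment> \<open>\<open>al1\<close> and \<open>al2\<close> are the angle \<open>e\<close> of the
   perturbed ray and the angle si be of the Laplace ray in increasing order. The interval between
   them avoids 0 and thus contains no direction of a difference of poles, so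
   \<open>obtuse_direction\<close> yields the directions that \<open>canon\<close> demands.\<close>
 have canon: "canon si (Y1 Y) (Tp e)"
  if si: "\<bar>si\<bar> = 1" and Y: "is_canonical_solution (diag z) F (rotate_ray e l) Y"
   and e: "\<bar>e\<bar> < pi / 2" and lo: "al1 <= al2" "{al1, al2} = {e, si * be}" "al2 < al1 + pi" "- b <= al1" "al2 <= a" "0 \<notin> {al1..al2}"
  for si Y e al1 al2
  unfolding canon_def
 proof (intro conjI)
  show "open (Tp e)" "convex (Tp e)" unfolding Tp by (simp_all add: open_half_plane convex_half_plane)
  show "0 \<notin> Tp e" by (simp add: Tp_def)
  show "\<exists>t0>0. \<forall>t. 0 < t --> t < t0 --> complex_of_real t \<in> Tp e"
  proof -
   have "0 < cos e" using e by (intro cos_gt_zero_pi) auto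
   then have "complex_of_real t \<in> Tp e" if "0 < t" for t
    using that Re_scaled[of t 1 "cis e"] by (simp add: Tp_def cis_divide[of 0, simplified] divide_inverse)
   then show ?thesis by (intro exI[of _ 1]) auto
  qed
  show "\<forall>t\<in>Tp e. invertible (Y1 Y t)"
  proof
   fix t assume "t \<in> Tp e"
   then have "invertible (Y (d * t))" using Y Thp by (auto simp: is_canonical_solution_def)
   then obtain V where V: "Y (d * t) ** V = mat 1" "V ** Y (d * t) = mat 1" by (auto simp: invertible_def)
   have "exp (z i / (d * t)) * exp (- (z i / (d * t))) = 1" by (simp add: exp_add[symmetric])
   then show "invertible (Y1 Y t)" unfolding invertible_def Y1_def
    by (intro exI[of _ "exp (- (z i / (d * t))) *\<^sub>m V"]) (simp add: V mult.commute)
  qed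
  show "\<forall>t\<in>Tp e. has_mder (Y1 Y) (((1 / t\<^sup>2) *\<^sub>m diag x + (1 / t) *\<^sub>m F) ** Y1 Y t) (at t)"
  proof
   fix t assume t: "t \<in> Tp e"
   then have t0: "t ~= 0" by (auto simp: Tp_def)
   have "has_mder Y (((1 / (d * t)\<^sup>2) *\<^sub>m diag z + (1 / (d * t)) *\<^sub>m F) ** Y (d * t)) (at (d * t))"
    using Y t Thp unfolding is_canonical_solution_def has_mder_iff by blast
   from has_mder_chain[where g = "%t. d * t" and E = d, OF this]
   have 1: "has_mder (%t. Y (d * t)) (d *\<^sub>m (((1 / (d * t)\<^sup>2) *\<^sub>m diag z + (1 / (d * t)) *\<^sub>m F) ** Y (d * t))) (at t)"
    by (auto intro!: derivative_eq_intros)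
   have "((%t. exp (z i / (d * t))) has_field_derivative (- z i / (d * t\<^sup>2)) * exp (z i / (d * t))) (at t)"
    using t0 d by (auto intro!: derivative_eq_intros simp: field_simps power2_eq_square)
   from has_mder_msmult[OF this 1]
   have "has_mder (Y1 Y) (((- z i / (d * t\<^sup>2)) * exp (z i / (d * t))) *\<^sub>m Y (d * t) + exp (z i / (d * t)) *\<^sub>m
     (d *\<^sub>m (((1 / (d * t)\<^sup>2) *\<^sub>m diag z + (1 / (d * t)) *\<^sub>m F) ** Y (d * t)))) (at t)"
    unfolding Y1_def[abs_def] .
   moreover have "diag z = z i *\<^sub>m mat 1 + d *\<^sub>m diag x"
   proof -
    have "diag z = diag (%k. z i) + diag (%k. d * x k)"
     unfolding diag_def sum.distrib[symmetric] ms.add_left[symmetric] zx[symmetric] by simp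
    then show ?thesis by (simp add: diag_const diag_cmult)
   qed
   ultimately show "has_mder (Y1 Y) (((1 / t\<^sup>2) *\<^sub>m diag x + (1 / t) *\<^sub>m F) ** Y1 Y t) (at t)"
   proof -
    assume h: "has_mder (Y1 Y) (((- z i / (d * t\<^sup>2)) * exp (z i / (d * t))) *\<^sub>m Y (d * t) + exp (z i / (d * t)) *\<^sub>m
     (d *\<^sub>m (((1 / (d * t)\<^sup>2) *\<^sub>m diag z + (1 / (d * t)) *\<^sub>m F) ** Y (d * t)))) (at t)"
     and dz: "diag z = z i *\<^sub>m mat 1 + d *\<^sub>m diag x"
    define E where "E = exp (z i / (d * t))"
    define Q where "Q = Y (d * t)"
    have "(- z i / (d * t\<^sup>2) * E) *\<^sub>m Q + E *\<^sub>m (d *\<^sub>m (((1 / (d * t)\<^sup>2) *\<^sub>m (z i *\<^sub>m mat 1 + d *\<^sub>m diag x) + (1 / (d * t)) *\<^sub>m F) ** Q)) =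
      (- z i / (d * t\<^sup>2) * E + E * d * (1 / (d * t)\<^sup>2) * z i) *\<^sub>m Q + (E * d * (1 / (d * t)\<^sup>2) * d) *\<^sub>m (diag x ** Q) + (E * d * (1 / (d * t))) *\<^sub>m (F ** Q)"
     by (simp only: mat_distrib msmult_msmult msmult_mult_left matrix_mul_lid mult.assoc add.assoc)
    also have "- z i / (d * t\<^sup>2) * E + E * d * (1 / (d * t)\<^sup>2) * z i = 0" using d t0 by (simp add: field_simps power2_eq_square)
    also have "E * d * (1 / (d * t)\<^sup>2) * d = E * (1 / t\<^sup>2)" using d t0 by (simp add: field_simps power2_eq_square)
    also have "E * d * (1 / (d * t)) = E * (1 / t)" using d t0 by (simp add: field_simps)
    also have "0 *\<^sub>m Q + (E * (1 / t\<^sup>2)) *\<^sub>m (diag x ** Q) + (E * (1 / t)) *\<^sub>m (F ** Q) = ((1 / t\<^sup>2) *\<^sub>m diag x + (1 / t) *\<^sub>m F) ** (E *\<^sub>m Q)"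
     by (simp add: mat_distrib ms.zero_left mult.commute)
    finally show ?thesis using h unfolding dz E_def Q_def Y1_def by simp
   qed
  qed
  show "\<forall>k\<in>insert i K. \<forall>l\<in>{1..m}. \<exists>u. (\<forall>s>0. of_real s * u \<in> Tp e) \<and> 0 < Re (wdir si / u) \<and> Re ((x l - x k) / u) <= 0 \<and>
    ((%s. Y1 Y (of_real s * u) ** diag (%j. exp (x j / (of_real s * u)))) \<longlongrightarrow> mat 1) (at_right (0::real))"
  proof (intro ballI)
   fix k l' assume kl: "k \<in> insert i K" "l' \<in> {1..m}"
   have km: "k \<in> {1..m}" using ks[OF kl(1)] .
   have "\<exists>th. al2 - pi/2 < th \<and> th < al1 + pi/2 \<and> Re ((x l' - x k) * cis (- th)) <= 0"
   proof (cases "x l' - x k = 0")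
    case True
    show ?thesis by (rule exI[of _ "(al1 + al2) / 2"]) (use True lo in auto)
   next
    case False
    have "x l' - x k ~= of_real r * cis y" if "al1 <= y" "y <= al2" "0 < r" for y r
     using noray[of y r l' k] that kl(2) km lo(4-6) by auto
    from obtuse_direction[OF False lo(1,3) this] show ?thesis by (meson less_imp_le)
   qed
   then obtain th where th: "al2 - pi/2 < th" "th < al1 + pi/2" "Re ((x l' - x k) * cis (- th)) <= 0" by blast
   have co: "0 < cos (th - e)" "0 < cos (si * be - th)"
    using th lo(1,2) by (auto intro!: cos_gt_zero_pi simp: doubleton_eq_iff)
   define u where "u = cis th"
   have q: "v / u = v * cis (- th)" for v by (simp add: u_def divide_inverse)
   have uT: "0 < Re (u / cis e)" using co by (simp add: u_def cis_divide)
   have "\<forall>s>0. of_real s * u \<in> Tp e" using uT by (simp add: Tp_def Re_scaled)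
   moreover have "0 < Re (wdir si / u)"
   proof -
    have "wdir si / u = of_real (norm (wdir si)) * cis (si * be - th)"
     unfolding q by (subst w(1)[OF si]) (simp add: mult.assoc cis_mult)
    then show ?thesis using w(2)[OF si] co by simp
   qed
   moreover have "Re ((x l' - x k) / u) <= 0" using th(3) by (simp add: q)
   moreover have "((%s. Y1 Y (of_real s * u) ** diag (%j. exp (x j / (of_real s * u)))) \<longlongrightarrow> mat 1) (at_right (0::real))"
   proof -
    have lim: "((%t. Y t ** mexp ((1 / t) *\<^sub>m diag z)) \<longlongrightarrow> mat 1) (at 0 within half_plane (ray_through (cis e * d)))"
     using Y unfolding is_canonical_solution_def l rotate_ray_through d_def by blast
    have "d * u / (cis e * d) = u / cis e" using d by simp
    then have "((%s. Y (of_real s * (d * u)) ** mexp ((1 / (of_real s * (d * u))) *\<^sub>m diag z)) \<longlongrightarrow> mat 1) (at_right (0::real))"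
     using uT d by (intro tendsto_along_ray[OF lim]) auto
    moreover have "Y1 Y (of_real s * u) ** diag (%j. exp (x j / (of_real s * u))) =
      Y (of_real s * (d * u)) ** mexp ((1 / (of_real s * (d * u))) *\<^sub>m diag z)" for s
    proof -
     define t where "t = of_real s * u"
     have "exp (z i / (d * t)) * exp (x k / t) = exp (1 / (d * t) * z k)" for k
      unfolding zx[of k] exp_add[symmetric] using d by (simp add: add_divide_distrib)
     then have "Y1 Y t ** diag (%j. exp (x j / t)) = Y (d * t) ** mexp ((1 / (d * t)) *\<^sub>m diag z)"
      by (simp add: Y1_def diag_cmult mexp_diag msmult_mult_right[symmetric] del: msmult_mult_right)
     then show ?thesis by (simp add: t_def mult_ac)
    qed
    ultimately show ?thesis by simp
   qed
   ultimately show "\<exists>u. (\<forall>s>0. of_real s * u \<in> Tp e) \<and> 0 < Re (wdir si / u) \<and> Re ((x l' - x k) / u) <= 0 \<and>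
     ((%s. Y1 Y (of_real s * u) ** diag (%j. exp (x j / (of_real s * u)))) \<longlongrightarrow> mat 1) (at_right (0::real))" by blast
  qed
 qed
 have "canon 1 (Y1 Yp) (Tp a)" by (rule canon[OF _ cp, of 1 be a]) (use ab be c in auto)
 moreover have "canon (-1) (Y1 Ym) (Tp (-b))" by (rule canon[OF _ cm, of "-1" "-b" "-be"]) (use ab be c in auto)
 moreover have "Y1 Ym t = Y1 Yp t ** S" if "t \<in> Tp a \<inter> Tp (-b)" for t
  using that S Thp by (simp add: Y1_def)
 moreover have "x j = 1" using d by (simp add: x_def d_def)
 then have "j \<in> K" using j nu by (simp add: K_def W_def)
 ultimately have "P j ** S ** P i = P j ** conn j" by (intro stokes_connection)
 then have "P j ** S ** P i = (2 * of_real pi * \<i>) *\<^sub>m (P j ** F ** C (-1) j ** D (-1) i ** P i)"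
  by (simp add: conn_def mat_assoc)
 then show ?thesis using fs by blast
qed

section \<open>Geometry of the perturbed segment\<close>

text \<open>Boundedness of the velocity enters the estimates of the pulled-back forms, its
  continuity off the corners their measurability.\<close>

definition tame :: "(real => complex) => bool" where
 "tame p \<longleftrightarrow> continuous_on {0..1} p \<and> (\<exists>L v M. finite L \<and> continuous_on ({0<..<1} - L) v \<and>
   (\<forall>t\<in>{0<..<1} - L. (p has_vector_derivative v t) (at t) \<and> norm (v t) <= M))"

lemma tameI:
 assumes "continuous_on {0..1} p" "finite L" "continuous_on ({0<..<1} - L) v"
  "\<And>t. t \<in> {0<..<1} - L ==> (p has_vector_derivative v t) (at t)" "\<And>t. t \<in> {0<..<1} - L ==> norm (v t) <= M"
 shows "tame p"
 using assms unfolding tame_def by blast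

lemma tame_linepath: "tame (linepath a b)"
 by (rule tameI[where L = "{}" and v = "%t. b - a" and M = "norm (b - a)"])
  (auto intro!: continuous_intros has_vector_derivative_linepath_within)

lemma tame_part_circlepath: "tame (part_circlepath c r a b)"
proof (rule tameI[where L = "{}" and v = "%t. \<i> * of_real r * (of_real b - of_real a) * exp (\<i> * linepath (of_real a) (of_real b) t)"
   and M = "\<bar>r\<bar> * \<bar>b - a\<bar>"])
 show "continuous_on {0..1} (part_circlepath c r a b)"
  unfolding part_circlepath_def by (intro continuous_intros)
 show "continuous_on ({0<..<1} - {}) (%t. \<i> * of_real r * (of_real b - of_real a) * exp (\<i> * linepath (of_real a) (of_real b) t))"
  by (intro continuous_intros)
 fix t :: real
 show "(part_circlepath c r a b has_vector_derivative \<i> * of_real r * (of_real b - of_real a) * exp (\<i> * linepath (of_real a) (of_real b) t)) (at t)"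
  unfolding part_circlepath_def
  by (auto simp: linepath_def scaleR_conv_of_real algebra_simps intro!: derivative_eq_intros has_vector_derivative_real_field)
 have "norm (exp (\<i> * complex_of_real (linepath a b t))) = 1" by (simp add: norm_exp_eq_Re)
 then have "norm (exp (\<i> * linepath (complex_of_real a) (of_real b) t)) = 1" by (simp add: linepath_of_real)
 then show "norm (\<i> * of_real r * (of_real b - of_real a) * exp (\<i> * linepath (complex_of_real a) (of_real b) t)) <= \<bar>r\<bar> * \<bar>b - a\<bar>"
  by (simp add: norm_mult flip: of_real_diff)
qed auto

lemma tame_join:
 assumes p: "tame p" and q: "tame q" and pq: "pathfinish p = pathstart q"
 shows "tame (p +++ q)"
proof -
 obtain L v M where L: "continuous_on {0..1} p" "finite L" "continuous_on ({0<..<1} - L) v"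
   "\<And>t. t\<in>{0<..<1} - L ==> (p has_vector_derivative v t) (at t) \<and> norm (v t) <= M"
  using p unfolding tame_def by blast
 obtain L' v' M' where L': "continuous_on {0..1} q" "finite L'" "continuous_on ({0<..<1} - L') v'"
   "\<And>t. t\<in>{0<..<1} - L' ==> (q has_vector_derivative v' t) (at t) \<and> norm (v' t) <= M'"
  using q unfolding tame_def by blast
 define Lj where "Lj = insert (1/2) ((%t. t / 2) ` L \<union> (%t. (t + 1) / 2) ` L')"
 define vj where "vj t = (if t <= 1/2 then 2 *\<^sub>R v (2 * t) else 2 *\<^sub>R v' (2 * t - 1))" for t :: real
 have left: "2 * t \<in> {0<..<1} - L" if "t \<in> {0<..<1} - Lj" "t < 1/2" for t
 proof -
  have "t = (2 * t) / 2" by simp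
  then have "2 * t \<notin> L" using that(1) unfolding Lj_def by blast
  then show ?thesis using that by auto
 qed
 have right: "2 * t - 1 \<in> {0<..<1} - L'" if "t \<in> {0<..<1} - Lj" "t > 1/2" for t
 proof -
  have "t = ((2 * t - 1) + 1) / 2" by simp
  then have "2 * t - 1 \<notin> L'" using that(1) unfolding Lj_def by blast
  then show ?thesis using that by auto
 qed
 have ne: "t < 1/2 \<or> t > 1/2" if "t \<in> {0<..<1} - Lj" for t
  using that by (auto simp: Lj_def)
 show ?thesis
 proof (rule tameI[where L = Lj and v = vj and M = "2 * max M M'"])
  have "path p" "path q" using L L' by (simp_all add: path_def)
  then have "path (p +++ q)" using pq by simp
  then show "continuous_on {0..1} (p +++ q)" by (simp add: path_def)
  show "finite Lj" using L L' by (simp add: Lj_def)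
  show "continuous_on ({0<..<1} - Lj) vj"
  proof -
   have "continuous_on (({0<..<1} - Lj) \<inter> {..<1/2}) (%t. 2 *\<^sub>R v (2 * t))"
    by (intro continuous_intros continuous_on_compose2[OF L(3)]) (use left in auto)
   then have 1: "continuous_on (({0<..<1} - Lj) \<inter> {..<1/2}) vj"
    by (rule continuous_on_eq) (auto simp: vj_def)
   have "continuous_on (({0<..<1} - Lj) \<inter> {1/2<..}) (%t. 2 *\<^sub>R v' (2 * t - 1))"
    by (intro continuous_intros continuous_on_compose2[OF L'(3)]) (use right in auto)
   then have 2: "continuous_on (({0<..<1} - Lj) \<inter> {1/2<..}) vj"
    by (rule continuous_on_eq) (auto simp: vj_def)
   have "open ({0<..<1} - Lj)" using \<open>finite Lj\<close> by (intro open_Diff finite_imp_closed) auto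
   then have "continuous_on ((({0<..<1} - Lj) \<inter> {..<1/2}) \<union> (({0<..<1} - Lj) \<inter> {1/2<..})) vj"
    using 1 2 by (intro continuous_on_open_Un) auto
   moreover have "(({0<..<1} - Lj) \<inter> {..<1/2}) \<union> (({0<..<1} - Lj) \<inter> {1/2<..}) = {0<..<1} - Lj"
   proof (intro set_eqI iffI)
    fix t assume "t \<in> {0<..<1} - Lj"
    then show "t \<in> (({0<..<1} - Lj) \<inter> {..<1/2}) \<union> (({0<..<1} - Lj) \<inter> {1/2<..})" using ne[of t] by blast
   qed blast
   ultimately show ?thesis by simp
  qed
  fix t assume t: "t \<in> {0<..<1} - Lj"
  show "((p +++ q) has_vector_derivative vj t) (at t)"
  proof (cases "t < 1/2")
   case True
   have "((%t. p (2 * t)) has_vector_derivative 2 *\<^sub>R v (2 * t)) (at t)"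
   proof -
    have "((%t::real. 2 * t) has_vector_derivative 2) (at t)"
     by (rule has_vector_derivative_eq_rhs, (rule derivative_intros)+) simp
    then show ?thesis
     using vector_diff_chain_at[of "%t. 2 * t" 2 t p "v (2 * t)"] L(4)[OF left[OF t True]] by (simp add: o_def)
   qed
   then have "((p +++ q) has_vector_derivative 2 *\<^sub>R v (2 * t)) (at t)"
    by (rule has_vector_derivative_transform_within_open[where S = "{..<1/2}"]) (use True in \<open>auto simp: joinpaths_def\<close>)
   then show ?thesis using True by (simp add: vj_def)
  next
   case False
   then have F: "t > 1/2" using ne[OF t] by simp
   have "((%t. q (2 * t - 1)) has_vector_derivative 2 *\<^sub>R v' (2 * t - 1)) (at t)"
   proof -
    have "((%t::real. 2 * t - 1) has_vector_derivative 2) (at t)"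
     by (rule has_vector_derivative_eq_rhs, (rule derivative_intros)+) simp
    then show ?thesis
     using vector_diff_chain_at[of "%t. 2 * t - 1" 2 t q "v' (2 * t - 1)"] L'(4)[OF right[OF t F]] by (simp add: o_def)
   qed
   then have "((p +++ q) has_vector_derivative 2 *\<^sub>R v' (2 * t - 1)) (at t)"
    by (rule has_vector_derivative_transform_within_open[where S = "{1/2<..}"]) (use F in \<open>auto simp: joinpaths_def\<close>)
   then show ?thesis using F by (simp add: vj_def)
  qed
  show "norm (vj t) <= 2 * max M M'"
   using ne[OF t] L(4)[OF left[OF t]] L'(4)[OF right[OF t]] by (auto simp: vj_def max_def)
 qed
qed

text \<open>The arcs of radius \<open>eps\<close> about the listed points neither overlap nor reach
  the end points.\<close>

fun gapped :: "real => real => real list => real => bool" where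
 "gapped eps al [] be = (al < be)"
| "gapped eps al (x # xs) be = (al < x - eps \<and> gapped eps (x + eps) xs be)"

lemma gapped_bounds:
 "gapped eps al xs be ==> 0 < eps ==> al < be \<and> (\<forall>x\<in>set xs. al < x - eps \<and> x + eps < be)"
 by (induction xs arbitrary: al) force+

lemma gappedI:
 "sorted xs ==> distinct xs ==> (\<And>x y. x \<in> set xs ==> y \<in> set xs ==> x ~= y ==> 2 * eps < \<bar>x - y\<bar>) ==>
  (\<And>x. x \<in> set xs ==> al < x - eps \<and> x + eps < be) ==> al < be ==> gapped eps al xs be"
proof (induction xs arbitrary: al)
 case (Cons x xs)
 have "x + eps < y - eps" if y: "y \<in> set xs" for y
 proof -
  have "x <= y" "x ~= y" using Cons.prems(1,2) y by auto
  then show ?thesis using Cons.prems(3)[of x y] y by simp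
 qed
 then have "gapped eps (x + eps) xs be" using Cons.prems by (intro Cons.IH) auto
 then show ?case using Cons.prems(4)[of x] by simp
qed simp

text \<open>Positions in the coordinate in which the segment is real and traversed in increasing
  direction; there the anticlockwise arcs lie in the lower half plane.\<close>

definition detour_point :: "real => real list => real => real => complex => bool" where
 "detour_point eps xs al be y \<longleftrightarrow> (Im y = 0 \<and> al <= Re y \<and> Re y <= be \<and> (\<forall>x\<in>set xs. eps <= \<bar>Re y - x\<bar>)) \<or>
   (Im y < 0 \<and> (\<exists>x\<in>set xs. norm (y - of_real x) = eps))"

text \<open>Induction over the centres, each of which puts a segment and a half circle in front of
  the remaining path. Linear behaviour near both ends is recorded because it makes the distances to
  the end poles comparable to t and 1 - t.\<close>

lemma detour_path_props:
 fixes d z0 :: complex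
 assumes d: "d ~= 0" and eps: "0 < eps" and "gapped eps al xs be"
  and p: "p = detour_path (eps * norm d) d (z0 + d * of_real al) (map (%x. z0 + d * of_real x) xs) (z0 + d * of_real be)"
 shows "pathstart p = z0 + d * of_real al \<and> pathfinish p = z0 + d * of_real be \<and> tame p \<and>
  (\<forall>t\<in>{0..1}. \<exists>y. p t = z0 + d * y \<and> detour_point eps xs al be y \<and> (y = of_real al --> t = 0) \<and> (y = of_real be --> t = 1)) \<and>
  (\<exists>ta c. 0 < ta \<and> ta <= 1 \<and> 0 < c \<and> (\<forall>t\<in>{0..ta}. p t = z0 + d * of_real (al + c * t))) \<and>
  (\<exists>ta c. 0 <= ta \<and> ta < 1 \<and> 0 < c \<and> (\<forall>t\<in>{ta..1}. p t = z0 + d * of_real (be - c * (1 - t))))"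
 using assms(3) p
proof (induction xs arbitrary: al p)
 case Nil
 then have ab: "al < be" and p: "p = linepath (z0 + d * of_real al) (z0 + d * of_real be)" by auto
 have pt: "p t = z0 + d * of_real (al + (be - al) * t)" for t
  by (simp add: p linepath_def scaleR_conv_of_real algebra_simps)
 have "\<forall>t\<in>{0..1}. \<exists>y. p t = z0 + d * y \<and> detour_point eps [] al be y \<and> (y = of_real al --> t = 0) \<and> (y = of_real be --> t = 1)"
 proof
  fix t :: real assume t: "t \<in> {0..1}"
  have "(be - al) * t <= (be - al) * 1" using t ab by (intro mult_left_mono) auto
  then have "al + (be - al) * t <= be" unfolding mult_1_right by linarith
  moreover have "t = 1" if "al + (be - al) * t = be"
  proof -
   have "(be - al) * (t - 1) = 0" using that by (simp add: algebra_simps)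
   then show ?thesis using ab by simp
  qed
  ultimately show "\<exists>y. p t = z0 + d * y \<and> detour_point eps [] al be y \<and> (y = of_real al --> t = 0) \<and> (y = of_real be --> t = 1)"
   using pt[of t] t ab
   by (intro exI[of _ "of_real (al + (be - al) * t)"])
     (auto simp: detour_point_def simp del: of_real_add of_real_mult of_real_diff)
 qed
 moreover have "\<exists>ta c. 0 < ta \<and> ta <= 1 \<and> 0 < c \<and> (\<forall>t\<in>{0..ta}. p t = z0 + d * of_real (al + c * t))"
  using ab pt by (intro exI[of _ 1] exI[of _ "be - al"]) auto
 moreover have "\<exists>ta c. 0 <= ta \<and> ta < 1 \<and> 0 < c \<and> (\<forall>t\<in>{ta..1}. p t = z0 + d * of_real (be - c * (1 - t)))"
  using ab by (intro exI[of _ 0] exI[of _ "be - al"]) (auto simp: pt algebra_simps)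
 moreover have "tame p" unfolding p by (rule tame_linepath)
 ultimately show ?case by (simp add: p)
next
 case (Cons x xs)
 define r where "r = detour_path (eps * norm d) d (z0 + d * of_real (x + eps)) (map (%x. z0 + d * of_real x) xs) (z0 + d * of_real be)"
 define q where "q = part_circlepath (z0 + d * of_real x) (eps * norm d) (Arg d + pi) (Arg d + 2 * pi)"
 define l where "l = linepath (z0 + d * of_real al) (z0 + d * of_real (x - eps))"
 have g: "al < x - eps" "gapped eps (x + eps) xs be" using Cons.prems by auto
 note gb = gapped_bounds[OF g(2) eps]
 have sg: "of_real (eps * norm d) * sgn d = d * of_real eps"
  using d by (simp add: sgn_div_norm scaleR_conv_of_real field_simps)
 have p: "p = l +++ (q +++ r)"
  unfolding Cons.prems(2) l_def q_def r_def list.map detour_path.simps sg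
  by (simp add: right_diff_distrib distrib_left add.assoc add_diff_eq)
 have q: "q s = z0 + d * (of_real x + of_real eps * cis (pi + pi * s))" for s
 proof -
  have "linepath (Arg d + pi) (Arg d + 2 * pi) s = Arg d + (pi + pi * s)"
   by (simp add: linepath_def algebra_simps)
  then have "q s = z0 + d * of_real x + of_real (eps * norm d) * cis (Arg d + (pi + pi * s))"
   by (simp only: q_def part_circlepath_def cis_conv_exp linepath_of_real)
  also have "of_real (eps * norm d) * cis (Arg d + (pi + pi * s)) = of_real eps * (rcis (norm d) (Arg d)) * cis (pi + pi * s)"
   by (simp add: rcis_def cis_mult[symmetric])
  finally show ?thesis by (simp add: rcis_cmod_Arg algebra_simps)
 qed
 have lt: "l s = z0 + d * of_real (al + (x - eps - al) * s)" for s
  by (simp add: l_def linepath_def scaleR_conv_of_real algebra_simps)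
 note IH = Cons.IH[OF g(2) r_def]
 have ends: "pathstart l = z0 + d * of_real al" "pathfinish l = pathstart q" "pathfinish q = pathstart r" "pathfinish r = z0 + d * of_real be"
 proof -
  show "pathstart l = z0 + d * of_real al" by (simp add: l_def)
  have "cis (pi + pi * 0) = -1" "cis (pi + pi * 1) = 1" by (simp_all add: complex_eq_iff)
  then show "pathfinish l = pathstart q" "pathfinish q = pathstart r"
   using IH q[of 0] q[of 1] by (simp_all add: l_def pathstart_def pathfinish_def linepath_def)
  show "pathfinish r = z0 + d * of_real be" using IH by blast
 qed
 have tame: "tame p" unfolding p
  using IH ends by (intro tame_join) (auto simp: l_def q_def tame_linepath tame_part_circlepath)
 have pts: "\<exists>y. p t = z0 + d * y \<and> detour_point eps (x # xs) al be y \<and> (y = of_real al --> t = 0) \<and> (y = of_real be --> t = 1)"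
  if t: "t \<in> {0..1}" for t
 proof -
  consider "t <= 1/2" | "t > 1/2" "2 * t - 1 <= 1/2" | "2 * t - 1 > 1/2" by linarith
  then show ?thesis
  proof cases
   case 1
   define y where "y = al + (x - eps - al) * (2 * t)"
   have pt: "p t = z0 + d * of_real y" using 1 lt[of "2 * t"] by (simp add: p joinpaths_def y_def)
   have "(x - eps - al) * (2 * t) <= (x - eps - al) * 1" using 1 t g by (intro mult_left_mono) auto
   then have "al + (x - eps - al) * (2 * t) <= x - eps" unfolding mult_1_right by linarith
   then have y: "al <= y" "y <= x - eps" using g t by (auto simp: y_def)
   have far: "eps <= \<bar>y - x'\<bar>" if "x' \<in> set (x # xs)" for x'
   proof (cases "x' = x")
    case False
    then have "x + eps < x' - eps" using gb that by auto
    then show ?thesis using y eps by simp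
   qed (use y eps in auto)
   have "t = 0" if "y = al" using that g by (simp add: y_def)
   then show ?thesis using pt y far gb eps by (intro exI[of _ "of_real y"]) (auto simp: detour_point_def)
  next
   case 2
   define s where "s = 2 * (2 * t - 1)"
   have s: "0 < s" "s <= 1" using 2 by (auto simp: s_def)
   define y where "y = of_real x + of_real eps * cis (pi + pi * s)"
   have pt: "p t = z0 + d * y" using 2 q[of s] by (simp add: p joinpaths_def y_def s_def)
   have im: "Im y = - eps * sin (pi * s)" by (simp add: y_def)
   show ?thesis
   proof (cases "s = 1")
    case False
    then have "0 < sin (pi * s)" using s by (intro sin_gt_zero) auto
    then have "Im y < 0" using eps im by simp
    moreover have "norm (y - of_real x) = eps" using eps by (simp add: y_def norm_mult)
    ultimately show ?thesis using pt by (intro exI[of _ y]) (auto simp: detour_point_def)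
   next
    case True
    have yy: "y = of_real (x + eps)" by (simp add: y_def True complex_eq_iff)
    have "eps <= \<bar>x + eps - x'\<bar>" if "x' \<in> set xs" for x' using gb that eps by force
    then show ?thesis using pt yy gb g eps
     by (intro exI[of _ y]) (auto simp: detour_point_def simp del: of_real_add)
   qed
  next
   case 3
   define s where "s = 2 * (2 * t - 1) - 1"
   have s: "0 < s" "s <= 1" using 3 t by (auto simp: s_def)
   then obtain y where y: "r s = z0 + d * y" "detour_point eps xs (x + eps) be y" "y = of_real be --> s = 1" using IH by fastforce
   have pt: "p t = z0 + d * y" using 3 y(1) by (simp add: p joinpaths_def s_def)
   have "y = of_real be --> t = 1" using y(3) by (auto simp: s_def)
   moreover have "y ~= of_real al" using y(2) g gb eps by (auto simp: detour_point_def)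
   moreover have "detour_point eps (x # xs) al be y" using y(2) g eps by (auto simp: detour_point_def)
   ultimately show ?thesis using pt by blast
  qed
 qed
 have start: "\<exists>ta c. 0 < ta \<and> ta <= 1 \<and> 0 < c \<and> (\<forall>t\<in>{0..ta}. p t = z0 + d * of_real (al + c * t))"
  using g lt by (intro exI[of _ "1/2"] exI[of _ "2 * (x - eps - al)"]) (auto simp: p joinpaths_def mult_ac)
 obtain ta c where ta: "0 <= ta" "ta < 1" "0 < c" "\<And>t. t\<in>{ta..1} ==> r t = z0 + d * of_real (be - c * (1 - t))" using IH by blast
 \<comment> \<open>Under the two nested joins the rest of the path runs over [3/4, 1] at four times
   the speed, t corresponding to 4 t - 3. At t = 3/4 itself the value comes from the arc, which ends
   where the rest starts.\<close>
 define ta' where "ta' = (ta + 3) / 4"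
 have "p t = z0 + d * of_real (be - (4 * c) * (1 - t))" if t: "t \<in> {ta'..1}" for t
 proof (cases "2 * t - 1 <= 1/2")
  case True
  then have t34: "t = 3/4" "ta = 0" using t ta by (auto simp: ta'_def)
  have "r 0 = z0 + d * of_real (be - c * 1)" using ta(4)[of 0] t34 by simp
  moreover have "p t = r 0" using ends(3) by (simp add: p joinpaths_def t34 pathfinish_def pathstart_def)
  ultimately show ?thesis by (simp add: t34)
 next
  case False
  have "p t = r (4 * t - 3)" using False by (simp add: p joinpaths_def algebra_simps)
  also have "\<dots> = z0 + d * of_real (be - c * (1 - (4 * t - 3)))" using t by (intro ta(4)) (auto simp: ta'_def)
  finally show ?thesis by (simp add: algebra_simps)
 qed
 then have fin: "\<exists>ta c. 0 <= ta \<and> ta < 1 \<and> 0 < c \<and> (\<forall>t\<in>{ta..1}. p t = z0 + d * of_real (be - c * (1 - t)))"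
  using ta by (intro exI[of _ ta'] exI[of _ "4 * c"]) (auto simp: ta'_def)
 show ?case using ends tame pts start fin by (simp add: p)
qed

text \<open>On the segment the distance to z_i is |d| times the parameter, so sorting the poles by
  distance sorts their parameters. The condition on the radius, applied also to the two end poles,
  gives the gaps.\<close>

lemma perturbed_segment_detour:
 assumes sr: "small_radius m z e" and ij: "i \<in> {1..m}" "j \<in> {1..m}" "z i ~= z j" and inj: "inj_on z {1..m}"
 defines "d \<equiv> z j - z i"
 shows "\<exists>xs. gapped (e / norm d) 0 xs 1 \<and>
   perturbed_segment m z e j i = detour_path e d (z i) (map (%x. z i + d * of_real x) xs) (z j) \<and>
   set xs = {r. 0 < r \<and> r < 1 \<and> (\<exists>k\<in>{1..m}. z k = z i + d * of_real r)}"
proof -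
 have d: "d ~= 0" using ij by (simp add: d_def)
 define eps where "eps = e / norm d"
 have e: "0 < e" "\<And>k l. k \<in> {1..m} ==> l \<in> {1..m} ==> k ~= l ==> 2 * e < dist (z k) (z l)"
  using sr by (auto simp: small_radius_def)
 define cs where "cs = sort_key (dist (z i)) (map z (filter (%k. z k \<in> open_segment (z i) (z j)) [1..<Suc m]))"
 define rr where "rr c = Re ((c - z i) / d)" for c
 define xs where "xs = map rr cs"
 have mem: "c \<in> set cs \<longleftrightarrow> (\<exists>k\<in>{1..m}. c = z k) \<and> c \<in> open_segment (z i) (z j)" for c
  by (auto simp: cs_def)
 have os: "c \<in> open_segment (z i) (z j) \<longleftrightarrow> (\<exists>r. 0 < r \<and> r < 1 \<and> c = z i + d * of_real r)" for c
 proof -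
  have "(1 - u) *\<^sub>R z i + u *\<^sub>R z j = z i + d * of_real u" for u
   by (simp add: d_def scaleR_conv_of_real algebra_simps)
  then show ?thesis using ij unfolding in_segment(2) by (simp add: conj_assoc)
 qed
 have rr: "rr (z i + d * of_real r) = r" for r using d by (simp add: rr_def)
 have csr: "z i + d * of_real (rr c) = c" "0 < rr c" "rr c < 1" if "c \<in> set cs" for c
 proof -
  have "c \<in> open_segment (z i) (z j)" using that mem[of c] by simp
  then obtain r where "0 < r" "r < 1" "c = z i + d * of_real r" unfolding os by (elim exE conjE)
  then show "z i + d * of_real (rr c) = c" "0 < rr c" "rr c < 1" using rr by simp_all
 qed
 have cs: "cs = map (%x. z i + d * of_real x) xs"
  unfolding xs_def map_map by (rule map_idI[symmetric]) (simp add: csr)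
 have sxs: "set xs = {r. 0 < r \<and> r < 1 \<and> (\<exists>k\<in>{1..m}. z k = z i + d * of_real r)}"
 proof (intro set_eqI iffI)
  fix r assume "r \<in> set xs"
  then obtain c where c: "c \<in> set cs" "r = rr c" by (auto simp: xs_def)
  then show "r \<in> {r. 0 < r \<and> r < 1 \<and> (\<exists>k\<in>{1..m}. z k = z i + d * of_real r)}"
   using csr[OF c(1)] mem[of c] by auto
 next
  fix r assume r: "r \<in> {r. 0 < r \<and> r < 1 \<and> (\<exists>k\<in>{1..m}. z k = z i + d * of_real r)}"
  then obtain k where k: "k \<in> {1..m}" "z k = z i + d * of_real r" by blast
  have "z k \<in> open_segment (z i) (z j)" unfolding os by (intro exI[of _ r]) (use k r in simp)
  then have "z k \<in> set cs" unfolding mem using k(1) by blast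
  then have "rr (z k) \<in> set xs" by (simp add: xs_def)
  then show "r \<in> set xs" using k rr by simp
 qed
 have dd: "dist (z i + d * of_real r) (z i + d * of_real s) = norm d * \<bar>r - s\<bar>" for r s
  by (simp add: dist_norm norm_mult flip: right_diff_distrib of_real_diff)
 have gap: "2 * eps < \<bar>r - s\<bar>" if rs: "\<exists>k\<in>{1..m}. z k = z i + d * of_real r" "\<exists>k\<in>{1..m}. z k = z i + d * of_real s" "r ~= s" for r s
 proof -
  obtain k l where kl: "k \<in> {1..m}" "z k = z i + d * of_real r" "l \<in> {1..m}" "z l = z i + d * of_real s" using rs(1,2) by blast
  then have "k ~= l" using rs(3) d by auto
  then have "2 * e < dist (z k) (z l)" using e(2) kl by blast
  then have "2 * e < norm d * \<bar>r - s\<bar>" unfolding kl dd .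
  then have "2 * e / norm d < \<bar>r - s\<bar>" using d by (subst pos_divide_less_eq) (auto simp: mult.commute)
  then show ?thesis by (simp add: eps_def)
 qed
 have pole: "\<exists>k\<in>{1..m}. z k = z i + d * of_real 0" "\<exists>k\<in>{1..m}. z k = z i + d * of_real 1"
  using ij by (auto simp: d_def)
 have "0 < eps" using e d by (simp add: eps_def)
 have "gapped eps 0 xs 1"
 proof (rule gappedI)
  have "sorted (map (dist (z i)) cs)" unfolding cs_def by (rule sorted_sort_key)
  also have "map (dist (z i)) cs = map (%x. norm d * x) xs"
   unfolding xs_def map_map o_def
  proof (rule map_cong[OF refl])
   fix c assume "c \<in> set cs"
   then show "dist (z i) c = norm d * rr c" using csr[of c] dd[of 0 "rr c"] by simp
  qed
  finally show "sorted xs" using d by (simp add: sorted_map)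
  have "distinct cs" unfolding cs_def distinct_sort distinct_map
   by (intro conjI inj_on_subset[OF inj]) auto
  then show "distinct xs" unfolding cs by (simp only: distinct_map)
  fix r assume r: "r \<in> set xs"
  show "0 < r - eps \<and> r + eps < 1" proof -
   have r': "0 < r" "r < 1" "\<exists>k\<in>{1..m}. z k = z i + d * of_real r" using r unfolding sxs by simp_all
   show ?thesis using gap[OF r'(3) pole(1)] gap[OF r'(3) pole(2)] r' \<open>0 < eps\<close> by linarith
  qed
  fix s assume "s \<in> set xs" "r ~= s"
  then show "2 * eps < \<bar>r - s\<bar>" using r unfolding sxs by (intro gap) auto
 qed simp
 moreover have "perturbed_segment m z e j i = detour_path e d (z i) cs (z j)"
  by (simp add: perturbed_segment_def cs_def d_def)
 ultimately show ?thesis using cs sxs by (intro exI[of _ xs]) (simp add: eps_def)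
qed

text \<open>Order of vanishing of the distance from the path to the pole k: linear at the start for
  k = i, linear at the end for k = j, bounded below otherwise.\<close>

definition end_weight :: "nat => nat => nat => real => real" where
 "end_weight i j k t = (if k = i then t else if k = j then 1 - t else 1)"

lemma linear_lower_bound:
 fixes f :: "real => real"
 assumes "continuous_on {0..1} f" "\<And>t. 0 < t ==> t <= 1 ==> 0 < f t"
  and ta: "0 < ta" "ta <= 1" "0 < a" "\<And>t. t \<in> {0..ta} ==> f t = a * t"
 shows "\<exists>c>0. \<forall>t\<in>{0<..<1}. c * t <= f t"
proof -
 have "continuous_on {ta..1} f" using ta by (intro continuous_on_subset[OF assms(1)]) auto
 then obtain t0 where t0: "t0 \<in> {ta..1}" "\<And>t. t \<in> {ta..1} ==> f t0 <= f t"
  using continuous_attains_inf[of "{ta..1}" f] ta by auto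
 have pos: "0 < f t0" using t0 ta by (intro assms(2)) auto
 have "min a (f t0) * t <= f t" if t: "t \<in> {0<..<1}" for t
 proof (cases "t <= ta")
  case True
  then show ?thesis using ta(4)[of t] t by (simp add: mult_right_mono)
 next
  case False
  then have "min a (f t0) * t <= f t0 * 1" using t pos ta by (intro mult_mono) auto
  also have "\<dots> <= f t" using False t t0(2)[of t] by simp
  finally show ?thesis .
 qed
 then show ?thesis using pos ta by (intro exI[of _ "min a (f t0)"]) auto
qed

text \<open>What later arguments use about the perturbed segment, apart from the domain that
  contains it.\<close>

locale pole_path =
 fixes m :: nat and z :: "nat => complex" and i j :: nat and C :: "real => complex" and d :: complex
 assumes ij: "i \<in> {1..m}" "j \<in> {1..m}" "z i ~= z j" and injz: "inj_on z {1..m}"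
  and C0: "C 0 = z i" and C1: "C 1 = z j"
  and tame: "tame C"
  and avoids: "\<And>k t. k \<in> {1..m} ==> t \<in> {0<..<1} ==> C t ~= z k"
  and dnz: "d ~= 0"
  and start: "\<exists>ta c. 0 < ta \<and> ta <= 1 \<and> 0 < c \<and> (\<forall>t\<in>{0..ta}. C t = z i + d * of_real (c * t))"
  and finish: "\<exists>ta c. 0 <= ta \<and> ta < 1 \<and> 0 < c \<and> (\<forall>t\<in>{ta..1}. C t = z j - d * of_real (c * (1 - t)))"
begin

lemma neq: "i ~= j" using ij by auto

lemma continuous_C: "continuous_on {0..1} C"
 using tame by (simp add: tame_def)

lemma velocity:
 obtains L v M where "finite L" "continuous_on ({0<..<1} - L) v"
  "\<And>t. t \<in> {0<..<1} - L ==> (C has_vector_derivative v t) (at t)"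
  "\<And>t. t \<in> {0<..<1} - L ==> vector_derivative C (at t) = v t"
  "\<And>t. t \<in> {0<..<1} ==> norm (vector_derivative C (at t)) <= M" "0 < M"
proof -
 obtain L v M where L: "finite L" "continuous_on ({0<..<1} - L) v"
  "\<And>t. t \<in> {0<..<1} - L ==> (C has_vector_derivative v t) (at t) \<and> norm (v t) <= M"
  using tame unfolding tame_def by blast
 \<comment> \<open>At corners \<open>vector_derivative\<close> has an unspecified value; these
   finitely many values are absorbed into the bound.\<close>
 define M' where "M' = \<bar>M\<bar> + (\<Sum>t\<in>L. norm (vector_derivative C (at t))) + 1"
 have "norm (vector_derivative C (at t)) <= M'" if "t \<in> {0<..<1}" for t
 proof (cases "t \<in> L")
  case True
  then show ?thesis using member_le_sum[of t L "%t. norm (vector_derivative C (at t))"] L(1) by (simp add: M'_def)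
 next
  case False
  then have "norm (vector_derivative C (at t)) <= M" using L(3)[of t] that vector_derivative_at[of C "v t" t] by simp
  moreover have "0 <= (\<Sum>t\<in>L. norm (vector_derivative C (at t)))" by (simp add: sum_nonneg)
  ultimately show ?thesis by (simp add: M'_def)
 qed
 moreover have "0 < M'" by (simp add: M'_def add_nonneg_pos sum_nonneg)
 ultimately show ?thesis using that[of L v M'] L by (simp add: vector_derivative_at)
qed

lemma distance_lower_bound: "\<exists>c>0. \<forall>k\<in>{1..m}. \<forall>t\<in>{0<..<1}. c * end_weight i j k t <= norm (C t - z k)"
proof -
 have "\<exists>c>0. \<forall>t\<in>{0<..<1}. c * end_weight i j k t <= norm (C t - z k)" if k: "k \<in> {1..m}" for k
 proof -
  define f where "f t = norm (C t - z k)" for t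
  have cf: "continuous_on {0..1} f" unfolding f_def by (intro continuous_intros continuous_C)
  have pos: "0 < f t" if "t \<in> {0<..<1}" for t using avoids[OF k that] by (simp add: f_def)
  consider "k = i" | "k = j" | "k ~= i" "k ~= j" by blast
  then show ?thesis
  proof cases
   case 1
   obtain ta c where ta: "0 < ta" "ta <= 1" "0 < c" "\<And>t. t\<in>{0..ta} ==> C t = z i + d * of_real (c * t)"
    using start by blast
   have "\<exists>c>0. \<forall>t\<in>{0<..<1}. c * t <= f t"
   proof (rule linear_lower_bound[OF cf _ ta(1,2)])
    fix t :: real assume "0 < t" "t <= 1"
    then show "0 < f t" using pos[of t] ij C1 1 by (cases "t = 1") (auto simp: f_def)
   next
    show "0 < norm d * c" using dnz ta by simp
    fix t assume "t \<in> {0..ta}"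
    then show "f t = norm d * c * t" using ta by (simp add: f_def 1 norm_mult)
   qed
   then show ?thesis by (simp add: 1 f_def end_weight_def)
  next
   case 2
   obtain ta c where ta: "0 <= ta" "ta < 1" "0 < c" "\<And>t. t\<in>{ta..1} ==> C t = z j - d * of_real (c * (1 - t))"
    using finish by blast
   have "\<exists>c>0. \<forall>t\<in>{0<..<1}. c * t <= f (1 - t)"
   proof (rule linear_lower_bound[of _ "1 - ta"])
    show "continuous_on {0..1} (%t. f (1 - t))"
     by (rule continuous_on_compose2[OF cf]) (auto intro!: continuous_intros)
    fix t :: real assume "0 < t" "t <= 1"
    then show "0 < f (1 - t)" using pos[of "1 - t"] ij C0 2 by (cases "t = 1") (auto simp: f_def)
   next
    show "0 < norm d * c" using dnz ta by simp
    fix t assume t: "t \<in> {0..1 - ta}"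
    then have "C (1 - t) = z j - d * of_real (c * (1 - (1 - t)))" by (intro ta(4)) auto
    then show "f (1 - t) = norm d * c * t" using t ta by (simp add: f_def 2 norm_mult)
   qed (use ta in auto)
   then obtain c' where c': "c' > 0" "\<And>t. t\<in>{0<..<1} ==> c' * t <= f (1 - t)" by blast
   have "c' * (1 - t) <= f t" if "t \<in> {0<..<1}" for t using c'(2)[of "1 - t"] that by simp
   then show ?thesis using c'(1) 2 neq by (auto simp: f_def end_weight_def)
  next
   case 3
   obtain t0 where t0: "t0 \<in> {0..1}" "\<And>t. t \<in> {0..1} ==> f t0 <= f t"
    using continuous_attains_inf[OF _ _ cf] by auto
   have "z k ~= z i" "z k ~= z j" using 3 k ij injz by (auto dest: inj_onD)
   then have "0 < f t0" using pos[of t0] t0(1) C0 C1 by (cases "t0 = 0 \<or> t0 = 1") (auto simp: f_def)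
   then show ?thesis using t0 3 by (intro exI[of _ "f t0"]) (auto simp: f_def end_weight_def)
  qed
 qed
 then have "\<exists>c. \<forall>k\<in>{1..m}. 0 < c k \<and> (\<forall>t\<in>{0<..<1}. c k * end_weight i j k t <= norm (C t - z k))"
  by (intro bchoice) blast
 then obtain c where c: "\<And>k. k \<in> {1..m} ==> 0 < c k"
  "\<And>k t. k \<in> {1..m} ==> t \<in> {0<..<1} ==> c k * end_weight i j k t <= norm (C t - z k)" by blast
 have ne: "c ` {1..m} ~= {}" using ij by auto
 define c0 where "c0 = Min (c ` {1..m})"
 have "0 < c0" unfolding c0_def using ne c(1) by (subst Min_gr_iff) auto
 moreover have "c0 * end_weight i j k t <= norm (C t - z k)" if "k \<in> {1..m}" "t \<in> {0<..<1}" for k t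
 proof -
  have "c0 <= c k" unfolding c0_def using that by (intro Min_le) auto
  moreover have "0 <= end_weight i j k t" using that by (auto simp: end_weight_def)
  ultimately have "c0 * end_weight i j k t <= c k * end_weight i j k t" by (rule mult_right_mono)
  then show ?thesis using c(2)[OF that] by linarith
 qed
 ultimately show ?thesis by blast
qed

text \<open>The pulled-back form dz / (z - z_k), cut off outside the open interval so that integrals
  up to 0 and 1 can be written without a separate convention at the ends.\<close>

definition letter :: "nat => real => complex" where
 "letter k t = (if t \<in> {0<..<1} then vector_derivative C (at t) / (C t - z k) else 0)"

lemma letter_measurable: "letter k \<in> borel_measurable borel"
proof -
 obtain L v M where L: "finite L" "continuous_on ({0<..<1} - L) v"
  "\<And>t. t \<in> {0<..<1} - L ==> vector_derivative C (at t) = v t" using velocity by metis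
 define L' where "L' = L \<union> {0, 1}"
 have CC: "continuous_on ({0<..<1} - L) C" by (rule continuous_on_subset[OF continuous_C]) auto
 have m1: "C \<in> borel_measurable (restrict_space borel ({0<..<1} - L))"
  by (rule borel_measurable_continuous_on_restrict[OF CC])
 have m2: "v \<in> borel_measurable (restrict_space borel ({0<..<1} - L))"
  by (rule borel_measurable_continuous_on_restrict[OF L(2)])
 have "(%t. v t / (C t - z k)) \<in> borel_measurable (restrict_space borel ({0<..<1} - L))"
  using m1 m2 by measurable
 then have m: "letter k \<in> borel_measurable (restrict_space borel ({0<..<1} - L))"
  by (rule measurable_cong[THEN iffD1, rotated]) (auto simp: letter_def L(3) space_restrict_space)
 have b: "{0<..<1} - L \<in> sets borel" using L(1) by (intro sets.Diff) (auto intro: finite_imp_closed borel_closed)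
 have "(%t. indicat_real ({0<..<1} - L) t *\<^sub>R letter k t) \<in> borel_measurable borel"
  using m b borel_measurable_restrict_space_iff[of "{0<..<1} - L" borel "letter k"] by simp
 moreover have "(%t. \<Sum>s\<in>L. indicat_real {s} t *\<^sub>R letter k s) \<in> borel_measurable borel" by measurable
 ultimately have "(%t. indicat_real ({0<..<1} - L) t *\<^sub>R letter k t + (\<Sum>s\<in>L. indicat_real {s} t *\<^sub>R letter k s)) \<in> borel_measurable borel"
  by (rule borel_measurable_add)
 moreover have "indicat_real ({0<..<1} - L) t *\<^sub>R letter k t + (\<Sum>s\<in>L. indicat_real {s} t *\<^sub>R letter k s) = letter k t" for t
 proof -
  have "(\<Sum>s\<in>L. indicat_real {s} t *\<^sub>R letter k s) = (\<Sum>s\<in>L. if t = s then letter k s else 0)"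
   by (intro sum.cong) (auto simp: indicator_def)
  then show ?thesis using L(1) by (auto simp: indicator_def letter_def)
 qed
 ultimately show ?thesis by simp
qed

lemma letter_bound: "\<exists>c>0. \<forall>k\<in>{1..m}. \<forall>t\<in>{0<..<1}. norm (letter k t) <= c / end_weight i j k t"
proof -
 obtain M where M: "\<And>t. t \<in> {0<..<1} ==> norm (vector_derivative C (at t)) <= M" "0 < M" using velocity by metis
 obtain c where c: "0 < c" "\<And>k t. k \<in> {1..m} ==> t \<in> {0<..<1} ==> c * end_weight i j k t <= norm (C t - z k)"
  using distance_lower_bound by blast
 have "norm (letter k t) <= (M / c) / end_weight i j k t" if kt: "k \<in> {1..m}" "t \<in> {0<..<1}" for k t
 proof -
  have "0 < end_weight i j k t" using kt by (auto simp: end_weight_def)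
  then have "norm (vector_derivative C (at t)) / norm (C t - z k) <= M / (c * end_weight i j k t)"
   using M(1)[OF kt(2)] M(2) c(1) c(2)[OF kt] by (intro frac_le) auto
  then show ?thesis using kt by (simp add: letter_def norm_divide)
 qed
 then show ?thesis using M c by (intro exI[of _ "M / c"]) auto
qed

end

text \<open>In the normalised coordinate the real points of the path avoid the poles and lie in
  columns, and the arcs lie in lower half discs because their radius is below \<open>R\<close>. The
  perturbed segment thus runs in the domain of the lower solution.\<close>

lemma (in fuchs_wedge) perturbed_segment_path:
 fixes z :: "nat => complex" and d :: complex
 assumes sr: "small_radius m z e" and j: "j \<in> {1..m}" "z j ~= z i0" and injz: "inj_on z {1..m}"
  and d: "d = z j - z i0" and x: "\<And>k. x k = (z k - z i0) / d"
 defines "Cp \<equiv> perturbed_segment m z e j i0"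
 shows "pole_path m z i0 j Cp d" "\<And>t. t \<in> {0<..<1} ==> (Cp t - z i0) / d \<in> dom (-1)"
proof -
 have dnz: "d ~= 0" using j d by simp
 define eps where "eps = e / norm d"
 have e: "0 < e" "\<And>k l. k \<in> {1..m} ==> l \<in> {1..m} ==> k ~= l ==> 2 * e < dist (z k) (z l)"
  using sr by (auto simp: small_radius_def)
 have eps: "0 < eps" using e dnz by (simp add: eps_def)
 have zx: "z k = z i0 + d * x k" for k using x dnz by simp
 obtain xs where xs: "gapped eps 0 xs 1"
  "Cp = detour_path e d (z i0) (map (%x. z i0 + d * of_real x) xs) (z j)"
  "set xs = {r. 0 < r \<and> r < 1 \<and> (\<exists>k\<in>{1..m}. z k = z i0 + d * of_real r)}"
  using perturbed_segment_detour[OF sr i0(1) j(1) _ injz] j(2) unfolding Cp_def eps_def d by auto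
 have "Cp = detour_path (eps * norm d) d (z i0 + d * of_real 0) (map (%x. z i0 + d * of_real x) xs) (z i0 + d * of_real 1)"
  using xs(2) dnz by (simp add: eps_def) (simp add: d)
 note props = detour_path_props[OF dnz eps xs(1) this]
 have dxl: "eps < dist (x k) (x l) / 2" if kl: "k \<in> {1..m}" "l \<in> {1..m}" "k ~= l" for k l
 proof -
  have "dist (z k) (z l) = norm d * dist (x k) (x l)"
   by (simp add: zx[of k] zx[of l] dist_norm flip: right_diff_distrib norm_mult)
  then have "2 * e < norm d * dist (x k) (x l)" using e(2)[OF kl] by simp
  then have "2 * e / norm d < dist (x k) (x l)" using dnz by (subst pos_divide_less_eq) (auto simp: mult.commute)
  then show ?thesis unfolding eps_def by (simp add: mult.commute)
 qed
 have "x i0 = 0" "x j = 1" using x d dnz by auto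
 then have "eps * 2 < 1" using dxl[OF i0(1) j(1)] j by (auto simp: dist_norm)
 then have "eps < 1" using eps by linarith
 then have "eps < R"
 proof -
  have fin: "finite ((%(k, l). dist (x k) (x l) / 2) ` {(k, l). k \<in> {1..m} \<and> l \<in> {1..m} \<and> k ~= l})"
   by (rule finite_imageI, rule finite_subset[of _ "{1..m} \<times> {1..m}"]) auto
  show ?thesis unfolding R_def using fin \<open>eps < 1\<close> dxl by (subst Min_gr_iff) auto
 qed
 show D: "(Cp t - z i0) / d \<in> dom (-1)" if t: "t \<in> {0<..<1}" for t
 proof -
  obtain y where y: "Cp t = z i0 + d * y" "detour_point eps xs 0 1 y" "y = of_real 0 --> t = 0" "y = of_real 1 --> t = 1"
   using props t by (meson atLeastAtMost_iff greaterThanLessThan_iff less_imp_le)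
  have yy: "(Cp t - z i0) / d = y" using y(1) dnz by simp
  have K: "k \<in> K \<and> x k = of_real r" if "r \<in> set xs" "k \<in> {1..m}" "z k = z i0 + d * of_real r" for k r
  proof -
   have "x k = of_real r" using that(3) x dnz by simp
   then show ?thesis using that xs(3) by (auto simp: K_def W_of_real)
  qed
  from y(2) consider "Im y = 0" "0 <= Re y" "Re y <= 1" "\<forall>r\<in>set xs. eps <= \<bar>Re y - r\<bar>"
   | r where "Im y < 0" "r \<in> set xs" "norm (y - of_real r) = eps"
   unfolding detour_point_def by blast
  then show ?thesis
  proof cases
   case 1
   have yr: "y = of_real (Re y)" using 1 by (simp add: complex_eq_iff)
   have "Re y ~= 0" using y(3) t yr by auto
   moreover have "Re y ~= 1" using y(4) t yr by auto
   ultimately have r: "0 < Re y" "Re y < 1" using 1 by auto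
   have "Re y \<notin> X"
   proof
    assume "Re y \<in> X"
    then obtain k where k: "k \<in> K" "Re y = Re (x k)" by (auto simp: X_def)
    then have "z k = z i0 + d * of_real (Re y)" using zx[of k] K_real[of k] by simp
    then have "Re y \<in> set xs" unfolding xs(3) using k r by (auto simp: K_def)
    then show False using 1 eps by fastforce
   qed
   then have "of_real (Re y) \<in> dom (-1)" using r by (intro W_in_dom) (auto simp: W_of_real)
   then show ?thesis using yy yr by simp
  next
   case (2 r)
   obtain k where k: "k \<in> {1..m}" "z k = z i0 + d * of_real r" using 2(2) unfolding xs(3) by blast
   have "k \<in> K" "x k = of_real r" using K[OF 2(2) k] by auto
   then have "y \<in> hdisc (-1) k" using 2 \<open>eps < R\<close> by (simp add: hdisc_def)
   then show ?thesis using \<open>k \<in> K\<close> yy by (auto simp: dom_def pieces_def)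
  qed
 qed
 show "pole_path m z i0 j Cp d"
 proof (unfold_locales, goal_cases)
  case (8 k t)
  show ?case
  proof
   assume "Cp t = z k"
   then have "x k \<in> dom (-1)" using D[OF 8(2)] x by simp
   then show False using poles_off_dom[OF 8(1), of "-1"] by simp
  qed
 next
  case 10
  show ?case using props by simp
 next
  case 11
  show ?case using props by (simp add: d algebra_simps)
 qed (use i0 j injz dnz props in \<open>auto simp: pathstart_def pathfinish_def d\<close>)
qed

section \<open>Parallel transport and its regularised limit\<close>

lemma vector_derivative_zero_const:
 fixes f :: "real => 'a::banach"
 assumes "continuous_on {s..t} f" "finite K" "\<And>u. u \<in> {s<..<t} - K ==> (f has_vector_derivative 0) (at u)" "s <= t"
 shows "f t = f s"
proof -
 have "((%u. 0) has_integral (f t - f s)) {s..t}"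
  by (rule fundamental_theorem_of_calculus_interior_strong[OF assms(2,4) _ assms(1)]) (use assms(3) in auto)
 then show ?thesis using has_integral_unique[of "%u. 0" "f t - f s" "{s..t}" 0] by simp
qed

text \<open>For any candidate Phi the product V Phi is continuous with derivative zero off the
  corners, so Phi is determined by its initial value. This is the uniqueness behind
  \<open>THE\<close>; each candidate may come with its own set of corners.\<close>

lemma parallel_transport_eq:
 fixes U V :: "real => complex^'n^'n"
 assumes st: "s <= t" and cU: "continuous_on {s..t} U" and cV: "continuous_on {s..t} V" and fin: "finite K"
  and dU: "\<And>u. u \<in> {s<..<t} - K ==> (U has_vector_derivative (vector_derivative ga (at u) *\<^sub>m (A (ga u) ** U u))) (at u)"
  and dV: "\<And>u. u \<in> {s<..<t} - K ==> (V has_vector_derivative (vector_derivative ga (at u) *\<^sub>m (- (V u ** A (ga u))))) (at u)"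
  and inv: "\<And>u. u \<in> {s..t} ==> U u ** V u = mat 1"
 shows "parallel_transport A ga s t = U t ** V s"
 unfolding parallel_transport_def
proof (rule the_equality)
 show "\<exists>Ph K. continuous_on {s..t} Ph \<and> Ph s = mat 1 \<and> Ph t = U t ** V s \<and> finite K \<and>
   (\<forall>u \<in> {s<..<t} - K. (Ph has_vector_derivative (vector_derivative ga (at u) *\<^sub>m (A (ga u) ** Ph u))) (at u))"
 proof (intro exI[of _ "%u. U u ** V s"] exI[of _ K] conjI ballI)
  show "continuous_on {s..t} (%u. U u ** V s)" by (intro mm.continuous_on cU continuous_intros)
  fix u assume "u \<in> {s<..<t} - K"
  from bounded_linear.has_vector_derivative[OF mm.bounded_linear_left dU[OF this], of "V s"]
  show "((%u. U u ** V s) has_vector_derivative (vector_derivative ga (at u) *\<^sub>m (A (ga u) ** (U u ** V s)))) (at u)"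
   by (simp add: mat_assoc)
 qed (use st inv fin in auto)
 fix M assume "\<exists>Ph K. continuous_on {s..t} Ph \<and> Ph s = mat 1 \<and> Ph t = M \<and> finite K \<and>
   (\<forall>u \<in> {s<..<t} - K. (Ph has_vector_derivative (vector_derivative ga (at u) *\<^sub>m (A (ga u) ** Ph u))) (at u))"
 then obtain Ph K' where Ph: "continuous_on {s..t} Ph" "Ph s = mat 1" "Ph t = M" "finite K'"
  "\<And>u. u \<in> {s<..<t} - K' ==> (Ph has_vector_derivative (vector_derivative ga (at u) *\<^sub>m (A (ga u) ** Ph u))) (at u)" by blast
 have "V t ** Ph t = V s ** Ph s"
 proof (rule vector_derivative_zero_const[where K = "K \<union> K'"])
  show "continuous_on {s..t} (%u. V u ** Ph u)" by (intro mm.continuous_on cV Ph)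
  fix u assume u: "u \<in> {s<..<t} - (K \<union> K')"
  have "((%u. V u ** Ph u) has_vector_derivative
    V u ** (vector_derivative ga (at u) *\<^sub>m (A (ga u) ** Ph u)) + (vector_derivative ga (at u) *\<^sub>m (- (V u ** A (ga u)))) ** Ph u) (at u)"
   by (rule mm.has_vector_derivative[OF dV Ph(5)]) (use u in auto)
  then show "((%u. V u ** Ph u) has_vector_derivative 0) (at u)"
   by (simp add: mat_assoc mat_distrib)
 qed (use fin Ph st in auto)
 then have "U t ** (V t ** M) = U t ** V s" using Ph by simp
 then show "M = U t ** V s" using inv[of t] st by (simp add: matrix_mul_assoc)
qed

text \<open>With G = 1 the product is 1 + (a + b) A, since A^2 = 0. The error is sandwiched between
  factors of size 1 + |l|, so G - 1 = O(w) and the vanishing of |w| (1 + |l|)^2 suffice.\<close>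

lemma regularised_limit:
 fixes A :: "complex^'n^'n" and w l a b :: "'b => complex"
 assumes AA: "A ** A = 0" and lim: "((%t. norm (w t) * (1 + norm (l t))\<^sup>2) \<longlongrightarrow> 0) Fl"
  and ev: "\<forall>\<^sub>F t in Fl. norm (a t) <= K * (1 + norm (l t)) \<and> norm (b t) <= K * (1 + norm (l t)) \<and> a t + b t = ka \<and>
   norm (G t - mat 1) <= B * norm (w t)" and K: "0 <= K" "0 <= B"
 shows "((%t. (mat 1 + a t *\<^sub>m A) ** G t ** (mat 1 + b t *\<^sub>m A)) \<longlongrightarrow> mat 1 + ka *\<^sub>m A) Fl"
proof -
 define Q where "Q = norm (mat 1 :: complex^'n^'n) + K * norm A"
 have Q: "norm (mat 1 + c *\<^sub>m A) <= Q * (1 + r)" if "norm c <= K * (1 + r)" "0 <= r" for c r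
 proof -
  have "norm (mat 1 + c *\<^sub>m A) <= norm (mat 1 :: complex^'n^'n) + norm c * norm A" by (rule norm_triangle_le) simp
  also have "\<dots> <= norm (mat 1 :: complex^'n^'n) * (1 + r) + (K * (1 + r)) * norm A"
   using that by (intro add_mono mult_right_mono) (auto simp: mult_le_cancel_left1)
  finally show ?thesis by (simp add: Q_def algebra_simps)
 qed
 have "((%t. (mat 1 + a t *\<^sub>m A) ** G t ** (mat 1 + b t *\<^sub>m A) - (mat 1 + ka *\<^sub>m A)) \<longlongrightarrow> 0) Fl"
 proof (rule Lim_null_comparison)
  show "\<forall>\<^sub>F t in Fl. norm ((mat 1 + a t *\<^sub>m A) ** G t ** (mat 1 + b t *\<^sub>m A) - (mat 1 + ka *\<^sub>m A))
    <= (Q\<^sup>2 * B) * (norm (w t) * (1 + norm (l t))\<^sup>2)"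
   using ev
  proof eventually_elim
   case (elim t)
   have "(mat 1 + a t *\<^sub>m A) ** (mat 1 + b t *\<^sub>m A) = mat 1 + (a t + b t) *\<^sub>m A"
    by (simp add: mat_distrib AA ms.zero_right add_ac)
   then have e: "(mat 1 + a t *\<^sub>m A) ** G t ** (mat 1 + b t *\<^sub>m A) - (mat 1 + ka *\<^sub>m A) =
     (mat 1 + a t *\<^sub>m A) ** (G t - mat 1) ** (mat 1 + b t *\<^sub>m A)"
    using elim by (simp add: mm.diff_right mm.diff_left)
   have "norm ((mat 1 + a t *\<^sub>m A) ** (G t - mat 1) ** (mat 1 + b t *\<^sub>m A)) <=
     (norm (mat 1 + a t *\<^sub>m A) * norm (G t - mat 1)) * norm (mat 1 + b t *\<^sub>m A)"
    by (intro order_trans[OF norm_matrix_mult_le] mult_right_mono norm_matrix_mult_le) auto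
   also have "\<dots> <= ((Q * (1 + norm (l t))) * (B * norm (w t))) * (Q * (1 + norm (l t)))"
    using elim K by (intro mult_mono Q mult_nonneg_nonneg) (auto simp: Q_def)
   finally show ?case unfolding e by (simp add: power2_eq_square mult_ac)
  qed
  show "((%t. (Q\<^sup>2 * B) * (norm (w t) * (1 + norm (l t))\<^sup>2)) \<longlongrightarrow> 0) Fl"
   using tendsto_mult[OF tendsto_const[of "Q\<^sup>2 * B"] lim] by simp
 qed
 then show ?thesis by (rule Lim_null[THEN iffD2])
qed

text \<open>Values of \<open>f\<close> differ by multiples of 2 pi i, and a continuous function with
  uniformly separated values is constant on a connected set.\<close>

lemma exp_const_imp_const:
 fixes f :: "real => complex"
 assumes "connected S" "continuous_on S f" "\<And>t. t \<in> S ==> exp (f t) = c"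
 shows "\<exists>ka. \<forall>t\<in>S. f t = ka"
proof -
 have "f constant_on S"
 proof (rule continuous_discrete_range_constant[OF assms(1,2)])
  fix x assume x: "x \<in> S"
  have "2 * pi <= norm (f y - f x)" if y: "y \<in> S" "f y ~= f x" for y
  proof -
   have "exp (f y) = exp (f x)" using assms(3) x y by simp
   then obtain n :: int where n: "f y = f x + (of_int (2 * n) * pi) * \<i>" unfolding exp_eq by (elim exE)
   then have "n ~= 0" using y by auto
   have "norm (f y - f x) = \<bar>of_int (2 * n) * pi\<bar>"
    unfolding n add_diff_cancel_left' by (simp only: norm_mult norm_ii norm_of_int norm_of_real abs_mult mult_1_right)
   also have "\<dots> = \<bar>of_int n\<bar> * (2 * pi)" by (simp add: abs_mult)
   also have "\<dots> \<ge> 1 * (2 * pi)" using \<open>n ~= 0\<close> by (intro mult_right_mono) (auto simp flip: of_int_abs)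
   finally show ?thesis by simp
  qed
  then show "\<exists>e>0. \<forall>y. y \<in> S \<and> f y ~= f x --> e <= norm (f y - f x)"
   by (intro exI[of _ "2 * pi"]) auto
 qed
 then show ?thesis by (auto simp: constant_on_def)
qed

abbreviation "at_ends \<equiv> at_right (0::real) \<times>\<^sub>F at_left (1::real)"

lemma eventually_prod_at_ends:
 assumes "\<forall>\<^sub>F s in at_right (0::real). P s" "\<forall>\<^sub>F t in at_left (1::real). Q t"
 shows "\<forall>\<^sub>F (s, t) in at_ends. P s \<and> Q t"
 using assms by (auto simp: eventually_prod_filter)

lemma eventually_ends: "\<forall>\<^sub>F (s, t) in at_ends. 0 < s \<and> s < (1/2::real) \<and> (1/2::real) < t \<and> t < 1"
proof -
 have "\<forall>\<^sub>F s in at_right (0::real). 0 < s \<and> s < 1/2" by (auto simp: eventually_at_right_field intro!: exI[of _ "1/2"])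
 moreover have "\<forall>\<^sub>F t in at_left (1::real). 1/2 < t \<and> t < 1" by (auto simp: eventually_at_left_field intro!: exI[of _ "1/2"])
 ultimately show ?thesis by (rule eventually_mono[OF eventually_prod_at_ends]) (auto simp: case_prod_beta)
qed

lemma (in pole_path) parallel_transport_fund:
 fixes X Y :: "complex => complex^'n^'n"
 assumes f: "fund B S X Y" and S: "\<And>t. t \<in> {0<..<1} ==> (C t - z i) / d \<in> S"
  and conn: "\<And>w. A w = (1 / d) *\<^sub>m B ((w - z i) / d)" and st: "0 < s" "s <= t" "t < 1"
 shows "parallel_transport A C s t = X ((C t - z i) / d) ** Y ((C s - z i) / d)"
proof -
 obtain L v M where L: "finite L" "\<And>t. t \<in> {0<..<1} - L ==> (C has_vector_derivative v t) (at t)"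
  "\<And>t. t \<in> {0<..<1} - L ==> vector_derivative C (at t) = v t" using velocity by metis
 have sub: "{s..t} \<subseteq> {0<..<1}" using st by auto
 have cg: "continuous_on {s..t} (%u. (C u - z i) / d)"
  using dnz sub by (intro continuous_intros continuous_on_subset[OF continuous_C]) auto
 have cX: "continuous_on S X" "continuous_on S Y"
  unfolding continuous_on_eq_continuous_within
  using has_mder_imp_continuous fundD(1,2)[OF f] continuous_at_imp_continuous_at_within by blast+
 have dg: "((%u. (C u - z i) / d) has_vector_derivative v u / d) (at u)" if "u \<in> {0<..<1} - L" for u
  using has_vector_derivative_divide[OF has_vector_derivative_diff[OF L(2)[OF that] has_vector_derivative_const], of "z i" d]
  by simp
 show ?thesis
 proof (rule parallel_transport_eq[where U = "%u. X ((C u - z i) / d)" and V = "%u. Y ((C u - z i) / d)" and K = L])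
  show "continuous_on {s..t} (%u. X ((C u - z i) / d))" "continuous_on {s..t} (%u. Y ((C u - z i) / d))"
   using S sub by (auto intro!: continuous_on_compose2[OF cX(1) cg] continuous_on_compose2[OF cX(2) cg])
  fix u assume "u \<in> {s<..<t} - L"
  then have u: "u \<in> {0<..<1} - L" using st by auto
  note Su = S[of u]
  show "((%u. X ((C u - z i) / d)) has_vector_derivative vector_derivative C (at u) *\<^sub>m (A (C u) ** X ((C u - z i) / d))) (at u)"
   using has_mder_path[OF fundD(1)[OF f Su] dg[OF u]] u by (simp add: L(3) conn)
  show "((%u. Y ((C u - z i) / d)) has_vector_derivative vector_derivative C (at u) *\<^sub>m - (Y ((C u - z i) / d) ** A (C u))) (at u)"
   using has_mder_path[OF fundD(2)[OF f Su] dg[OF u]] u by (simp add: L(3) conn ms.minus_right)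
 next
  fix u assume "u \<in> {s..t}"
  then show "X ((C u - z i) / d) ** Y ((C u - z i) / d) = mat 1"
   using fundD(3)[OF f S[of u]] sub by auto
 qed (use st L in auto)
qed

lemma tendsto_lg_sq:
 assumes "\<bar>si\<bar> = 1" "(w \<longlongrightarrow> 0) Fl" "\<forall>\<^sub>F t in Fl. w t ~= 0"
 shows "((%t. norm (w t) * (1 + norm (lg si (w t)))\<^sup>2) \<longlongrightarrow> 0) Fl"
proof -
 have f: "filterlim w (at 0) Fl" using assms(2,3) by (simp add: filterlim_at)
 have "((%t. norm (w t) + 2 * (norm (w t) * norm (lg si (w t))) + norm (w t) * (norm (lg si (w t)))\<^sup>2) \<longlongrightarrow> norm (0::complex) + 2 * 0 + 0) Fl"
  by (intro tendsto_intros assms(2) filterlim_compose[OF tendsto_lg(1)[OF assms(1)] f]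
    filterlim_compose[OF tendsto_lg(2)[OF assms(1)] f])
 then show ?thesis by (simp add: power2_eq_square algebra_simps)
qed

context fuchs_solutions
begin

text \<open>The inverse G of H satisfies G - 1 = - (H - 1) G, and its norm is at most twice that of
  the identity where H is within 1/2 of 1.\<close>

lemma near_lipschitz:
 assumes k: "k \<in> insert i0 K"
 shows "\<exists>B de. 0 < de \<and> 0 <= B \<and> (\<forall>w. norm w < de --> norm (H k (x k + w) - mat 1) <= B * norm w \<and>
   (\<forall>G. H k (x k + w) ** G = mat 1 --> norm (G - mat 1) <= B * norm w))"
proof -
 have n: "near_solution k (rh k) (H k)" using near k by blast
 then obtain E where "has_mder (H k) E (at (x k))" unfolding near_solution_def
  by (metis centre_in_ball)
 then obtain B de where B: "0 < de" "0 <= B" "\<And>y. norm (y - x k) < de ==> norm (H k y - H k (x k)) <= B * norm (y - x k)"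
  using has_mder_lipschitz by metis
 have H1: "H k (x k) = mat 1" using n by (simp add: near_solution_def)
 define Q where "Q = norm (mat 1 :: complex^'n^'n)"
 define de' where "de' = min de (1 / (2 * B + 1))"
 have B': "0 < de'" using B by (simp add: de'_def)
 have main: "norm (H k (x k + w) - mat 1) <= B * norm w" "B * norm w <= 1/2" if w: "norm w < de'" for w
 proof -
  show "norm (H k (x k + w) - mat 1) <= B * norm w" using B(3)[of "x k + w"] w H1 by (simp add: de'_def)
  have "norm w < 1 / (2 * B + 1)" using w by (simp add: de'_def)
  then have "norm w * (2 * B + 1) < 1" using B(2) by (simp add: pos_less_divide_eq)
  then have "2 * (B * norm w) < 1 - norm w" by (simp add: algebra_simps)
  then show "B * norm w <= 1/2" using norm_ge_zero[of w] by linarith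
 qed
 have inv: "norm (G - mat 1) <= (2 * Q * B) * norm w" if w: "norm w < de'" and G: "H k (x k + w) ** G = mat 1" for w G
 proof -
  define X where "X = H k (x k + w) - mat 1"
  have X: "norm X <= B * norm w" "norm X <= 1/2" using main[OF w] by (simp_all add: X_def)
  have e: "G - mat 1 = - (X ** G)" using G by (simp add: X_def mm.diff_left)
  then have "G = mat 1 - X ** G" by (simp add: algebra_simps)
  then have "norm G <= Q + norm (X ** G)" unfolding Q_def by (metis norm_triangle_ineq4)
  also have "norm (X ** G) <= 1/2 * norm G" using X by (intro order_trans[OF norm_matrix_mult_le] mult_right_mono) auto
  finally have G2: "norm G <= 2 * Q" by simp
  have "norm (X ** G) <= (B * norm w) * (2 * Q)"
   using X G2 B(2) by (intro order_trans[OF norm_matrix_mult_le] mult_mono) auto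
  then show ?thesis unfolding e by (simp add: mult_ac)
 qed
 have Q: "0 <= Q" by (simp add: Q_def)
 show ?thesis
 proof (rule exI[of _ "B + 2 * Q * B"], rule exI[of _ de'], intro conjI allI impI)
  fix w :: complex assume w: "norm w < de'"
  have "0 <= (2 * Q * B) * norm w" "0 <= B * norm w" using B Q by simp_all
  moreover have "(B + 2 * Q * B) * norm w = B * norm w + (2 * Q * B) * norm w" by (rule distrib_right)
  ultimately have le: "B * norm w <= (B + 2 * Q * B) * norm w" "(2 * Q * B) * norm w <= (B + 2 * Q * B) * norm w" by linarith+
  show "norm (H k (x k + w) - mat 1) <= (B + 2 * Q * B) * norm w" by (rule order_trans[OF main(1)[OF w] le(1)])
  show "norm (G - mat 1) <= (B + 2 * Q * B) * norm w" if "H k (x k + w) ** G = mat 1" for G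
   by (rule order_trans[OF inv[OF w that] le(2)])
 qed (use B Q B' in auto)
qed

lemma lg_product: "k \<in> {1..m} ==> (mat 1 - c *\<^sub>m res k) ** (mat 1 + c *\<^sub>m res k) = mat 1"
 "k \<in> {1..m} ==> (mat 1 + c *\<^sub>m res k) ** (mat 1 - c *\<^sub>m res k) = mat 1"
 by (simp_all add: mat_distrib res_res ms.zero_right)

text \<open>Near x_k, \<open>Ps\<close> is H (1 + lg res) C and \<open>Th\<close> is D (1 - lg res)
  H^(-1). The regularising factors cancel the logarithm up to the constant \<open>ka\<close>, which
  allows for arbitrary determinations of it.\<close>

lemma solution_limits:
 assumes k: "k \<in> insert i0 K" and w: "(w \<longlongrightarrow> 0) Fl" and ev: "\<forall>\<^sub>F t in Fl. x k + w t \<in> slit (-1) k (rh k) \<and> w t ~= 0"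
 shows "((%t. (mat 1 - (lg (-1) (w t) + ka) *\<^sub>m res k) ** Ps (-1) (x k + w t)) \<longlongrightarrow> (mat 1 - ka *\<^sub>m res k) ** C (-1) k) Fl"
  "((%t. Th (-1) (x k + w t) ** (mat 1 + (lg (-1) (w t) + ka) *\<^sub>m res k)) \<longlongrightarrow> D (-1) k ** (mat 1 + ka *\<^sub>m res k)) Fl"
proof -
 have km: "k \<in> {1..m}" using k ks by blast
 obtain B de where B: "0 < de" "0 <= B" "\<And>w. norm w < de ==> norm (H k (x k + w) - mat 1) <= B * norm w"
   "\<And>w G. norm w < de ==> H k (x k + w) ** G = mat 1 ==> norm (G - mat 1) <= B * norm w"
  using near_lipschitz[OF k] by metis
 have evde: "\<forall>\<^sub>F t in Fl. norm (w t) < de" using w B(1) by (metis order_tendstoD(2) tendsto_norm_zero)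
 have lim: "((%t. norm (w t) * (1 + norm (lg (-1) (w t)))\<^sup>2) \<longlongrightarrow> 0) Fl"
  by (rule tendsto_lg_sq[OF _ w]) (use ev in \<open>auto elim: eventually_mono\<close>)
 have ka: "norm (lg (-1) v + ka) <= (1 + norm ka) * (1 + norm (lg (-1) v))" for v
 proof -
  have "norm (lg (-1) v + ka) <= norm (lg (-1) v) + norm ka" by (rule norm_triangle_ineq)
  also have "\<dots> <= (1 + norm ka) * (1 + norm (lg (-1) v))" by (simp add: algebra_simps)
  finally show ?thesis .
 qed
 have l: "norm (lg (-1) v) <= (1 + norm ka) * (1 + norm (lg (-1) v))" for v
  by (simp add: algebra_simps add_nonneg_nonneg)
 have "((%t. (mat 1 + (- (lg (-1) (w t) + ka)) *\<^sub>m res k) ** H k (x k + w t) ** (mat 1 + lg (-1) (w t) *\<^sub>m res k))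
   \<longlongrightarrow> mat 1 + (- ka) *\<^sub>m res k) Fl"
 proof (rule regularised_limit[OF res_res[OF km] lim, where K = "1 + norm ka" and B = B])
  show "\<forall>\<^sub>F t in Fl. norm (- (lg (-1) (w t) + ka)) <= (1 + norm ka) * (1 + norm (lg (-1) (w t))) \<and>
    norm (lg (-1) (w t)) <= (1 + norm ka) * (1 + norm (lg (-1) (w t))) \<and>
    - (lg (-1) (w t) + ka) + lg (-1) (w t) = - ka \<and> norm (H k (x k + w t) - mat 1) <= B * norm (w t)"
   using evde by eventually_elim (use ka l B(3) in \<open>simp add: norm_minus_cancel[of "lg _ _ + _"] del: minus_add_distrib\<close>)
 qed (use B in auto)
 from mm.tendsto[OF this tendsto_const[of "C (-1) k"]]
 have 1: "((%t. (mat 1 + (- (lg (-1) (w t) + ka)) *\<^sub>m res k) ** H k (x k + w t) ** (mat 1 + lg (-1) (w t) *\<^sub>m res k) ** C (-1) k)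
   \<longlongrightarrow> (mat 1 - ka *\<^sub>m res k) ** C (-1) k) Fl"
  by (simp add: ms.minus_left)
 show "((%t. (mat 1 - (lg (-1) (w t) + ka) *\<^sub>m res k) ** Ps (-1) (x k + w t)) \<longlongrightarrow> (mat 1 - ka *\<^sub>m res k) ** C (-1) k) Fl"
 proof (rule Lim_transform_eventually[OF 1])
  show "\<forall>\<^sub>F t in Fl. (mat 1 + (- (lg (-1) (w t) + ka)) *\<^sub>m res k) ** H k (x k + w t) ** (mat 1 + lg (-1) (w t) *\<^sub>m res k) ** C (-1) k =
   (mat 1 - (lg (-1) (w t) + ka) *\<^sub>m res k) ** Ps (-1) (x k + w t)"
   using ev
  proof eventually_elim
   case (elim t)
   then show ?case using form[of "-1" k "x k + w t"] k
    by (simp add: mat_assoc ms.minus_left del: minus_add_distrib)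
  qed
 qed
 \<comment> \<open>The inverse of \<open>H k\<close>, written through \<open>Th\<close>, so that its
   estimate comes from \<open>near_lipschitz\<close>.\<close>
 define G where "G t = (mat 1 + lg (-1) (w t) *\<^sub>m res k) ** C (-1) k ** Th (-1) (x k + w t)" for t
 have evG: "\<forall>\<^sub>F t in Fl. H k (x k + w t) ** G t = mat 1 \<and> D (-1) k ** (mat 1 - lg (-1) (w t) *\<^sub>m res k) ** G t = Th (-1) (x k + w t)"
  using ev
 proof eventually_elim
  case (elim t)
  then have s: "x k + w t \<in> slit (-1) k (rh k)" by simp
  then have "x k + w t \<in> dom (-1)" using slit_in_dom adm k by blast
  then have "Ps (-1) (x k + w t) ** Th (-1) (x k + w t) = mat 1" using fundD(3)[OF fund] by simp
  then have "H k (x k + w t) ** G t = mat 1" using form[OF _ k s] by (simp add: G_def matrix_mul_assoc)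
  moreover have "D (-1) k ** (mat 1 - lg (-1) (w t) *\<^sub>m res k) ** G t =
    D (-1) k ** ((mat 1 - lg (-1) (w t) *\<^sub>m res k) ** (mat 1 + lg (-1) (w t) *\<^sub>m res k)) ** C (-1) k ** Th (-1) (x k + w t)"
   by (simp only: G_def matrix_mul_assoc)
  ultimately show ?case using DC[of "-1" k] k by (simp only: lg_product[OF km] matrix_mul_rid) simp
 qed
 have "((%t. (mat 1 + (- lg (-1) (w t)) *\<^sub>m res k) ** G t ** (mat 1 + (lg (-1) (w t) + ka) *\<^sub>m res k))
   \<longlongrightarrow> mat 1 + ka *\<^sub>m res k) Fl"
 proof (rule regularised_limit[OF res_res[OF km] lim, where K = "1 + norm ka" and B = B])
  show "\<forall>\<^sub>F t in Fl. norm (- lg (-1) (w t)) <= (1 + norm ka) * (1 + norm (lg (-1) (w t))) \<and>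
    norm (lg (-1) (w t) + ka) <= (1 + norm ka) * (1 + norm (lg (-1) (w t))) \<and>
    - lg (-1) (w t) + (lg (-1) (w t) + ka) = ka \<and> norm (G t - mat 1) <= B * norm (w t)"
   using evde evG by eventually_elim (use ka l B(4) in simp)
 qed (use B in auto)
 from mm.tendsto[OF tendsto_const[of "D (-1) k"] this]
 have 2: "((%t. D (-1) k ** ((mat 1 + (- lg (-1) (w t)) *\<^sub>m res k) ** G t ** (mat 1 + (lg (-1) (w t) + ka) *\<^sub>m res k)))
   \<longlongrightarrow> D (-1) k ** (mat 1 + ka *\<^sub>m res k)) Fl" .
 show "((%t. Th (-1) (x k + w t) ** (mat 1 + (lg (-1) (w t) + ka) *\<^sub>m res k)) \<longlongrightarrow> D (-1) k ** (mat 1 + ka *\<^sub>m res k)) Fl"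
 proof (rule Lim_transform_eventually[OF 2])
  show "\<forall>\<^sub>F t in Fl. D (-1) k ** ((mat 1 + (- lg (-1) (w t)) *\<^sub>m res k) ** G t ** (mat 1 + (lg (-1) (w t) + ka) *\<^sub>m res k)) =
    Th (-1) (x k + w t) ** (mat 1 + (lg (-1) (w t) + ka) *\<^sub>m res k)"
   using evG by eventually_elim (simp add: ms.minus_left matrix_mul_assoc)
 qed
qed

lemma segment_ends:
 fixes z :: "nat => complex"
 assumes pp: "pole_path m z i0 j Cp d" and d: "d = z j - z i0" and x: "\<And>k. x k = (z k - z i0) / d"
 defines "ga \<equiv> %t. (Cp t - z i0) / d"
 shows "\<exists>ta>0. ta < 1 \<and> (\<forall>t\<in>{0<..<ta}. ga t \<in> slit (-1) i0 (rh i0) \<and> ga t ~= x i0 \<and> Re (ga t - x i0) ~= 0)"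
  and "\<exists>ta>0. ta < 1 \<and> (\<forall>t\<in>{ta<..<1}. ga t \<in> slit (-1) j (rh j) \<and> ga t ~= x j \<and> Re (ga t - x j) ~= 0)"
  and "j \<in> insert i0 K"
proof -
 interpret pole_path m z i0 j Cp d by (rule pp)
 have xj: "x j = of_real 1" and xi: "x i0 = of_real 0" using x d dnz by auto
 have jK: "j \<in> K" using ij(2) xj W_of_real[of 1] by (simp add: K_def)
 then show jK': "j \<in> insert i0 K" by simp
 obtain ta c where ta: "0 < ta" "ta <= 1" "0 < c" "\<And>t. t\<in>{0..ta} ==> Cp t = z i0 + d * of_real (c * t)" using start by blast
 have r0: "0 < rh i0" "0 < rh j" using rho_pos jK' by auto
 define ta1 where "ta1 = min (ta / 2) (rh i0 / c)"
 have "ga t \<in> slit (-1) i0 (rh i0) \<and> ga t ~= x i0 \<and> Re (ga t - x i0) ~= 0" if t: "t \<in> {0<..<ta1}" for t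
 proof -
  have g: "ga t = of_real (c * t)" using ta(4)[of t] t dnz by (simp add: ga_def ta1_def)
  have "t < rh i0 / c" using t by (simp add: ta1_def)
  then have "c * t < rh i0" using ta(3) by (simp add: pos_less_divide_eq mult.commute)
  moreover have "0 < c * t" using t ta by simp
  ultimately have "of_real (c * t) \<in> slit (-1) i0 (rh i0)" by (intro real_in_slit) (auto simp: xi)
  then show ?thesis using g xi ta(3) t by simp
 qed
 moreover have "0 < ta1" "ta1 < 1" using ta r0 by (auto simp: ta1_def)
 ultimately show "\<exists>ta>0. ta < 1 \<and> (\<forall>t\<in>{0<..<ta}. ga t \<in> slit (-1) i0 (rh i0) \<and> ga t ~= x i0 \<and> Re (ga t - x i0) ~= 0)" by blast
 obtain ta' c' where ta': "0 <= ta'" "ta' < 1" "0 < c'" "\<And>t. t\<in>{ta'..1} ==> Cp t = z j - d * of_real (c' * (1 - t))" using finish by blast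
 define b where "b = min (rh j) 1 / (2 * c')"
 have b: "0 < b" using r0 ta' by (simp add: b_def)
 define ta2 where "ta2 = max (max ta' (1/2)) (1 - b)"
 have "ga t \<in> slit (-1) j (rh j) \<and> ga t ~= x j \<and> Re (ga t - x j) ~= 0" if t: "t \<in> {ta2<..<1}" for t
 proof -
  have "Cp t = z i0 + d * of_real (1 - c' * (1 - t))"
   using ta'(4)[of t] t by (simp add: ta2_def) (simp add: d algebra_simps)
  then have g: "ga t = of_real (1 - c' * (1 - t))" using dnz by (simp add: ga_def)
  have "1 - t < min (rh j) 1 / (2 * c')" using t by (simp add: ta2_def b_def)
  then have "(1 - t) * (2 * c') < min (rh j) 1" using ta' by (simp add: pos_less_divide_eq)
  moreover have "(1 - t) * (2 * c') = 2 * (c' * (1 - t))" by simp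
  moreover have "0 < c' * (1 - t)" using t ta' by simp
  ultimately have s: "c' * (1 - t) < rh j" "c' * (1 - t) < 1" "0 < c' * (1 - t)"
   unfolding min_less_iff_conj by linarith+
  then have "of_real (1 - c' * (1 - t)) \<in> slit (-1) j (rh j)" by (intro real_in_slit[OF jK']) (auto simp: xj)
  then show ?thesis using g xj ta'(3) t by simp
 qed
 moreover have "0 < ta2" "ta2 < 1" using ta' b by (auto simp: ta2_def)
 ultimately show "\<exists>ta>0. ta < 1 \<and> (\<forall>t\<in>{ta<..<1}. ga t \<in> slit (-1) j (rh j) \<and> ga t ~= x j \<and> Re (ga t - x j) ~= 0)" by blast
qed


text \<open>Both functions are logarithms of Cp - p up to the constant factor d. Off the imaginary
  axis \<open>lg\<close> is continuous, so their difference is constant near the end.\<close>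

lemma log_near_end:
 fixes Li :: "real => complex"
 assumes S: "S = {a<..<b}" "S \<subseteq> {0<..<1}" and L: "log_along Cp p Li" and k: "x k = (p - q) / d" and d: "d ~= 0"
  and cC: "continuous_on {0<..<1} Cp"
  and Re: "\<And>t. t \<in> S ==> Re ((Cp t - q) / d - x k) ~= 0"
 shows "\<exists>ka. \<forall>t\<in>S. Li t = lg (-1) ((Cp t - q) / d - x k) + ka"
proof -
 have cL: "continuous_on {0<..<1} Li" and eL: "\<And>s. s \<in> {0<..<1} ==> exp (Li s) = Cp s - p"
  using L by (auto simp: log_along_def)
 have "\<exists>ka. \<forall>t\<in>S. Li t - lg (-1) ((Cp t - q) / d - x k) = ka"
 proof (rule exp_const_imp_const)
  show "connected S" by (simp add: S(1))
  have "continuous_on {w. Re w ~= 0} (lg (-1))"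
   by (auto intro!: continuous_at_imp_continuous_on DERIV_isCont[OF lg_deriv])
  then have "continuous_on S (%t. lg (-1) ((Cp t - q) / d - x k))"
   by (rule continuous_on_compose2) (use Re S d in \<open>auto intro!: continuous_intros continuous_on_subset[OF cC]\<close>)
  then show "continuous_on S (%t. Li t - lg (-1) ((Cp t - q) / d - x k))"
   using S by (intro continuous_intros continuous_on_subset[OF cL])
  fix t assume t: "t \<in> S"
  have w: "(Cp t - q) / d - x k = (Cp t - p) / d" using k by (simp add: diff_divide_distrib)
  have n: "(Cp t - p) / d ~= 0"
  proof
   assume "(Cp t - p) / d = 0"
   then show False using Re[OF t] unfolding w by (metis zero_complex.simps(1))
  qed
  then have "exp (lg (-1) ((Cp t - p) / d)) = (Cp t - p) / d" by (intro exp_lg) auto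
  then show "exp (Li t - lg (-1) ((Cp t - q) / d - x k)) = d"
   using eL[of t] t S n d by (auto simp: exp_diff w)
 qed
 then show ?thesis by (simp add: diff_eq_eq add.commute)
qed

text \<open>Transport along the path is \<open>Ps\<close> at the end times \<open>Th\<close> at the
  start, so the limit splits into two local ones. Multiplication by \<open>res j\<close> on the left
  and \<open>P i0\<close> on the right removes the logarithms and the constants \<open>ka0\<close>
  and \<open>ka1\<close>: the sandwiched expression is independent of the determinations and
  converges even without regularisation.\<close>

lemma regularised_transport:
 fixes z :: "nat => complex"
 assumes pp: "pole_path m z i0 j Cp d" and d: "d = z j - z i0" and x: "\<And>k. x k = (z k - z i0) / d"
  and dm: "\<And>t. t \<in> {0<..<1} ==> (Cp t - z i0) / d \<in> dom (-1)"
 defines "PT \<equiv> parallel_transport (fl_connection m z P F) Cp"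
 shows "((%(s, t). res j ** PT s t ** P i0) \<longlongrightarrow> res j ** C (-1) j ** D (-1) i0 ** P i0) at_ends"
  and "log_along Cp (z i0) Li ==> log_along Cp (z j) Lj ==>
   \<exists>T. has_reg_transport (fl_connection m z P F) Cp (P i0 ** F) (P j ** F) Li Lj T \<and>
    P j ** F ** T ** P i0 = res j ** C (-1) j ** D (-1) i0 ** P i0"
proof -
 interpret p: pole_path m z i0 j Cp d by (rule pp)
 define ga where "ga t = (Cp t - z i0) / d" for t
 note ends = segment_ends[OF pp d x, folded ga_def]
 have jm: "j \<in> {1..m}" and im: "i0 \<in> {1..m}" by (rule p.ij)+
 have conn: "fl_connection m z P F w = (1 / d) *\<^sub>m A ((w - z i0) / d)" for w
 proof -
  have "1 / (w - z k) = (1 / d) * (1 / ((w - z i0) / d - x k))" for k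
   using p.dnz x[of k] by (simp add: diff_divide_distrib[symmetric])
  then have "(1 / (w - z k)) *\<^sub>m (P k ** F) = (1 / d) *\<^sub>m ((1 / ((w - z i0) / d - x k)) *\<^sub>m res k)" for k
   by (simp only: msmult_msmult res_def)
  then show ?thesis by (simp only: fl_connection_def A_def ms.sum_right)
 qed
 have PT: "PT s t = Ps (-1) (ga t) ** Th (-1) (ga s)" if "0 < s" "s < 1/2" "1/2 < t" "t < 1" for s t
  unfolding PT_def ga_def by (rule p.parallel_transport_fund[OF fund _ conn]) (use that dm in auto)
 obtain ta where ta: "0 < ta" "ta < 1" "\<And>t. t\<in>{0<..<ta} ==> ga t \<in> slit (-1) i0 (rh i0) \<and> ga t ~= x i0 \<and> Re (ga t - x i0) ~= 0"
  using ends(1) by blast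
 obtain ta' where ta': "0 < ta'" "ta' < 1" "\<And>t. t\<in>{ta'<..<1} ==> ga t \<in> slit (-1) j (rh j) \<and> ga t ~= x j \<and> Re (ga t - x j) ~= 0"
  using ends(2) by blast
 have ev0: "\<forall>\<^sub>F s in at_right 0. s \<in> {0<..<ta}" using ta by (auto simp: eventually_at_right_field intro!: exI[of _ ta])
 have ev1: "\<forall>\<^sub>F t in at_left 1. t \<in> {ta'<..<1}" using ta' by (auto simp: eventually_at_left_field intro!: exI[of _ ta'])
 have cg: "continuous_on {0..1} ga" unfolding ga_def by (intro continuous_intros p.continuous_C) (use p.dnz in auto)
 have "ga 0 = x i0" "ga 1 = x j" using x by (simp_all add: ga_def p.C0 p.C1)
 then have "(ga \<longlongrightarrow> x i0) (at_right 0)" "(ga \<longlongrightarrow> x j) (at_left 1)"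
  using continuous_on_Icc_at_rightD[OF cg] continuous_on_Icc_at_leftD[OF cg] by simp_all
 then have w0: "((%s. ga s - x i0) \<longlongrightarrow> 0) (at_right 0)" and w1: "((%t. ga t - x j) \<longlongrightarrow> 0) (at_left 1)"
  by (simp_all add: LIM_zero_iff)
 have s0: "\<forall>\<^sub>F s in at_right 0. x i0 + (ga s - x i0) \<in> slit (-1) i0 (rh i0) \<and> ga s - x i0 ~= 0"
  using ev0 by eventually_elim (use ta(3) in auto)
 have s1: "\<forall>\<^sub>F t in at_left 1. x j + (ga t - x j) \<in> slit (-1) j (rh j) \<and> ga t - x j ~= 0"
  using ev1 by eventually_elim (use ta'(3) in auto)
 have i0': "i0 \<in> insert i0 K" by simp
 note lim0 = solution_limits(2)[OF i0' w0 s0, simplified] and lim1 = solution_limits(1)[OF ends(3) w1 s1, simplified]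
 define l0 where "l0 s = lg (-1) (ga s - x i0)" for s
 define l1 where "l1 t = lg (-1) (ga t - x j)" for t
 have prod: "((%(s, t). ((mat 1 - (l1 t + ka1) *\<^sub>m res j) ** Ps (-1) (ga t)) ** (Th (-1) (ga s) ** (mat 1 + (l0 s + ka0) *\<^sub>m res i0)))
   \<longlongrightarrow> ((mat 1 - ka1 *\<^sub>m res j) ** C (-1) j) ** (D (-1) i0 ** (mat 1 + ka0 *\<^sub>m res i0))) at_ends" for ka0 ka1
  unfolding case_prod_beta l0_def l1_def
  by (intro mm.tendsto filterlim_compose[OF lim1 filterlim_snd] filterlim_compose[OF lim0 filterlim_fst])
 have res_one: "res j ** (mat 1 - c *\<^sub>m res j) = res j" "(mat 1 + c *\<^sub>m res i0) ** P i0 = P i0" for c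
  by (simp_all add: mat_distrib res_res[OF jm] res_P[OF im] ms.zero_right)
 have final: "res j ** (((mat 1 - c *\<^sub>m res j) ** M) ** (N ** (mat 1 + c' *\<^sub>m res i0))) ** P i0 = res j ** M ** N ** P i0" for c c' M N
 proof -
  have "res j ** (((mat 1 - c *\<^sub>m res j) ** M) ** (N ** (mat 1 + c' *\<^sub>m res i0))) ** P i0 =
    (res j ** (mat 1 - c *\<^sub>m res j)) ** M ** (N ** ((mat 1 + c' *\<^sub>m res i0) ** P i0))"
   by (simp only: matrix_mul_assoc)
  then show ?thesis by (simp only: res_one matrix_mul_assoc)
 qed
 have "((%p. res j ** (case p of (s, t) => ((mat 1 - (l1 t + 0) *\<^sub>m res j) ** Ps (-1) (ga t)) ** (Th (-1) (ga s) ** (mat 1 + (l0 s + 0) *\<^sub>m res i0))) ** P i0)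
   \<longlongrightarrow> res j ** (((mat 1 - 0 *\<^sub>m res j) ** C (-1) j) ** (D (-1) i0 ** (mat 1 + 0 *\<^sub>m res i0))) ** P i0) at_ends"
  by (intro mm.tendsto tendsto_const prod)
 then have "((%(s, t). res j ** Ps (-1) (ga t) ** Th (-1) (ga s) ** P i0) \<longlongrightarrow> res j ** C (-1) j ** D (-1) i0 ** P i0) at_ends"
  unfolding case_prod_beta final .
 then show "((%(s, t). res j ** PT s t ** P i0) \<longlongrightarrow> res j ** C (-1) j ** D (-1) i0 ** P i0) at_ends"
 proof (rule Lim_transform_eventually)
  show "\<forall>\<^sub>F p in at_ends. (case p of (s, t) => res j ** Ps (-1) (ga t) ** Th (-1) (ga s) ** P i0) =
    (case p of (s, t) => res j ** PT s t ** P i0)"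
   using eventually_ends by eventually_elim (auto simp: PT matrix_mul_assoc)
 qed
 assume Li: "log_along Cp (z i0) Li" and Lj: "log_along Cp (z j) Lj"
 have cC: "continuous_on {0<..<1} Cp" by (rule continuous_on_subset[OF p.continuous_C]) auto
 obtain ka0 where ka0: "\<And>t. t\<in>{0<..<ta} ==> Li t = l0 t + ka0"
 proof -
  have "\<exists>ka. \<forall>t\<in>{0<..<ta}. Li t = lg (-1) ((Cp t - z i0) / d - x i0) + ka"
   using ta by (intro log_near_end[OF refl _ Li x p.dnz cC]) (auto simp: ga_def)
  then show ?thesis using that unfolding l0_def ga_def by blast
 qed
 obtain ka1 where ka1: "\<And>t. t\<in>{ta'<..<1} ==> Lj t = l1 t + ka1"
 proof -
  have "\<exists>ka. \<forall>t\<in>{ta'<..<1}. Lj t = lg (-1) ((Cp t - z i0) / d - x j) + ka"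
   using ta' by (intro log_near_end[OF refl _ Lj x p.dnz cC]) (auto simp: ga_def)
  then show ?thesis using that unfolding l1_def ga_def by blast
 qed
 define T where "T = ((mat 1 - ka1 *\<^sub>m res j) ** C (-1) j) ** (D (-1) i0 ** (mat 1 + ka0 *\<^sub>m res i0))"
 have "has_reg_transport (fl_connection m z P F) Cp (P i0 ** F) (P j ** F) Li Lj T"
  unfolding has_reg_transport_def T_def
 proof (rule Lim_transform_eventually[OF prod])
  have "\<forall>\<^sub>F (s, t) in at_ends. s \<in> {0<..<ta} \<and> t \<in> {ta'<..<1}"
   by (rule eventually_prod_at_ends[OF ev0 ev1])
  then show "\<forall>\<^sub>F p in at_ends.
    (case p of (s, t) => ((mat 1 - (l1 t + ka1) *\<^sub>m res j) ** Ps (-1) (ga t)) ** (Th (-1) (ga s) ** (mat 1 + (l0 s + ka0) *\<^sub>m res i0))) =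
    (case p of (s, t) => mexp (- (Lj t *\<^sub>m (P j ** F))) ** parallel_transport (fl_connection m z P F) Cp s t ** mexp (Li s *\<^sub>m (P i0 ** F)))"
   using eventually_ends
  proof eventually_elim
   case (elim p)
   obtain s t where st: "p = (s, t)" by (cases p)
   have e1: "mexp (- (Lj t *\<^sub>m res j)) = mat 1 - (l1 t + ka1) *\<^sub>m res j"
    using mexp_nilpotent[OF res_res[OF jm], of "- Lj t"] ka1[of t] elim st by (simp add: ms.minus_left)
   have e0: "mexp (Li s *\<^sub>m res i0) = mat 1 + (l0 s + ka0) *\<^sub>m res i0"
    using mexp_nilpotent[OF res_res[OF im], of "Li s"] ka0[of s] elim st by simp
   show ?case using PT[of s t] elim unfolding st PT_def by (simp add: e0[unfolded res_def] e1[unfolded res_def] res_def matrix_mul_assoc)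
  qed
 qed
 moreover have "P j ** F ** T ** P i0 = res j ** C (-1) j ** D (-1) i0 ** P i0"
  unfolding T_def res_def[of j, symmetric] final ..
 ultimately show "\<exists>T. has_reg_transport (fl_connection m z P F) Cp (P i0 ** F) (P j ** F) Li Lj T \<and>
    P j ** F ** T ** P i0 = res j ** C (-1) j ** D (-1) i0 ** P i0" by blast
qed

end

section \<open>Iterated integrals as iterated Volterra operators\<close>

definition volterra :: "real => (real => complex) => (real => complex) => real => complex" where
 "volterra s f h x = (LINT y|lborel. (if s <= y \<and> y <= x then f y * h y else 0))"

lemma volterra_measurable:
 assumes [measurable]: "f \<in> borel_measurable borel" "h \<in> borel_measurable borel"
 shows "volterra s f h \<in> borel_measurable borel"
 unfolding volterra_def by measurable

lemma integrable_indicator_Icc: "integrable lborel (%y::real. B * indicat_real {a..b} y)"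
 by (rule integrable_mult_right) (simp add: emeasure_lborel_Icc_eq)

lemma integrable_bounded_Icc:
 fixes f :: "real => 'a :: {banach, second_countable_topology}"
 assumes "f \<in> borel_measurable borel" "\<And>y. norm (f y) <= B" "\<And>y. y \<notin> {a..b} ==> f y = 0"
 shows "integrable lborel f"
proof (rule Bochner_Integration.integrable_bound)
 show "integrable lborel (%y. B * indicator {a..b} y)" by (rule integrable_indicator_Icc)
 show "AE y in lborel. norm (f y) <= norm (B * indicator {a..b} y)"
 proof (rule AE_I2)
  fix y
  show "norm (f y) <= norm (B * indicator {a..b} y)"
   using assms(2)[of y] assms(3)[of y] by (cases "y \<in> {a..b}") auto
 qed
qed (use assms in simp)

lemma volterra_bounded:
 assumes "f \<in> borel_measurable borel" "h \<in> borel_measurable borel"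
  and "\<And>y. y \<in> {s..t} ==> norm (f y) <= B" "\<And>y. y \<in> {s..t} ==> norm (h y) <= B'" and x: "x \<in> {s..t}"
 shows "norm (volterra s f h x) <= B * B' * (t - s)"
proof -
 have B: "0 <= B" "0 <= B'" using assms(3,4)[OF x] by (auto intro: order_trans[OF norm_ge_zero])
 have "norm (volterra s f h x) <= (LINT y|lborel. B * B' * indicator {s..t} y)"
  unfolding volterra_def
 proof (rule Bochner_Integration.integral_norm_bound_integral)
  have b: "norm (if s <= y \<and> y <= x then f y * h y else 0) <= B * B' * indicator {s..t} y" for y
   using assms(3)[of y] assms(4)[of y] x B by (auto simp: norm_mult intro: mult_mono)
  then show "norm (if s <= y \<and> y <= x then f y * h y else 0) <= B * B' * indicator {s..t} y" for y .
  show "integrable lborel (%y. B * B' * indicator {s..t} y)" by (rule integrable_indicator_Icc)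
  show "integrable lborel (%y. if s <= y \<and> y <= x then f y * h y else 0)"
  proof (rule integrable_bounded_Icc[where B = "B * B'" and a = s and b = x])
   show "(%y. if s <= y \<and> y <= x then f y * h y else 0) \<in> borel_measurable borel"
    using assms(1,2) by measurable
   show "norm (if s <= y \<and> y <= x then f y * h y else 0) <= B * B'" for y
    using assms(3)[of y] assms(4)[of y] x B by (auto simp: norm_mult intro: mult_mono)
  qed auto
 qed
 also have "\<dots> = B * B' * (t - s)" using x by simp
 finally show ?thesis .
qed

definition in_simplex :: "nat => real => real => (nat => real) => bool" where
 "in_simplex n s t u \<longleftrightarrow> (\<forall>k<n. s <= u k \<and> u k <= t) \<and> (\<forall>k. Suc k < n --> u (Suc k) <= u k)"

text \<open>The upper limit left for the next, innermost variable.\<close>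

definition lowest :: "nat => real => (nat => real) => real" where
 "lowest n t u = (if n = 0 then t else u (n - 1))"

lemma in_simplex_Suc:
 assumes "s <= t"
 shows "in_simplex (Suc n) s t (u(n := y)) \<longleftrightarrow> in_simplex n s t u \<and> s <= y \<and> y <= lowest n t u"
proof (cases n)
 case (Suc n')
 then show ?thesis
  unfolding in_simplex_def lowest_def by (auto simp: less_Suc_eq)
qed (auto simp: in_simplex_def lowest_def)

lemma lowest_mem: "s <= t ==> in_simplex n s t u ==> lowest n t u \<in> {s..t}"
 by (auto simp: in_simplex_def lowest_def)

abbreviation "cube n \<equiv> \<Pi>\<^sub>M k\<in>{..<n}. (lborel :: real measure)"

text \<open>The weight \<open>h\<close> at the lowest coordinate makes the induction possible:
  integrating out the last variable replaces \<open>h\<close> by a Volterra integral.\<close>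

definition simplex_integrand where
 "simplex_integrand fs s t h u = (if in_simplex (length fs) s t u
   then (\<Prod>k<length fs. (fs ! k) (u k)) * h (lowest (length fs) t u) else (0::complex))"

lemma simplex_integrand_measurable:
 assumes "\<And>f. f \<in> set fs ==> f \<in> borel_measurable borel" "h \<in> borel_measurable borel"
 shows "simplex_integrand fs s t h \<in> borel_measurable (cube (length fs))"
proof -
 define n where "n = length fs"
 have c [measurable]: "(%u. u k) \<in> borel_measurable (cube n)" if "k < n" for k
  using measurable_component_singleton[of k "{..<n}" "%_. lborel"] that by simp
 have p1: "Measurable.pred (cube n) (%u. \<forall>k\<in>{..<n}. s <= u k \<and> u k <= t)"
 proof (rule pred_intros_finite)
  fix k assume "k \<in> {..<n}"
  then have [measurable]: "(%u. u k) \<in> borel_measurable (cube n)" using c by simp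
  show "Measurable.pred (cube n) (%u. s <= u k \<and> u k <= t)" by measurable
 qed simp
 have p2: "Measurable.pred (cube n) (%u. \<forall>k\<in>{..<n - 1}. u (Suc k) <= u k)"
 proof (rule pred_intros_finite)
  fix k assume "k \<in> {..<n - 1}"
  then have [measurable]: "(%u. u k) \<in> borel_measurable (cube n)" "(%u. u (Suc k)) \<in> borel_measurable (cube n)" using c by simp_all
  show "Measurable.pred (cube n) (%u. u (Suc k) <= u k)" unfolding pred_def by (rule borel_measurable_le) fact+
 qed simp
 have "in_simplex n s t = (%u. (\<forall>k\<in>{..<n}. s <= u k \<and> u k <= t) \<and> (\<forall>k\<in>{..<n - 1}. u (Suc k) <= u k))"
  by (auto simp: in_simplex_def fun_eq_iff)
 then have p [measurable]: "Measurable.pred (cube n) (in_simplex n s t)" using p1 p2 by simp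
 have "lowest n t \<in> borel_measurable (cube n)"
 proof (cases "n = 0")
  case False
  then show ?thesis unfolding lowest_def[abs_def] using c[of "n - 1"] by simp
 qed (simp add: lowest_def[abs_def])
 then have [measurable]: "(%u. h (lowest n t u)) \<in> borel_measurable (cube n)"
  using assms(2) by (rule measurable_compose)
 have [measurable]: "(%u. \<Prod>k<n. (fs ! k) (u k)) \<in> borel_measurable (cube n)"
 proof (rule borel_measurable_prod)
  fix k assume k: "k \<in> {..<n}"
  then have m: "fs ! k \<in> borel_measurable borel" using assms(1) by (simp add: n_def)
  show "(%u. (fs ! k) (u k)) \<in> borel_measurable (cube n)"
   by (rule measurable_compose[OF c m]) (use k in simp)
 qed
 show ?thesis unfolding simplex_integrand_def[abs_def] n_def[symmetric]
  by (intro measurable_If borel_measurable_times) (rule p[unfolded pred_def] | fact | simp)+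
qed

lemma simplex_integrand_integrable:
 assumes "\<And>f. f \<in> set fs ==> f \<in> borel_measurable borel" "h \<in> borel_measurable borel" and st: "s <= t"
  and B: "\<And>f y. f \<in> set fs ==> y \<in> {s..t} ==> norm (f y) <= B" and B': "\<And>y. y \<in> {s..t} ==> norm (h y) <= B'"
 shows "integrable (cube (length fs)) (simplex_integrand fs s t h)"
proof -
 interpret product_sigma_finite "%_::nat. lborel :: real measure" by standard
 have "integrable (cube (length fs)) (%u. (\<Prod>k<length fs. B * indicator {s..t} (u k)) * B')"
  by (intro integrable_mult_left product_integrable_prod integrable_indicator_Icc) auto
 then show ?thesis
 proof (rule Bochner_Integration.integrable_bound)
  show "AE u in cube (length fs). norm (simplex_integrand fs s t h u) <= norm ((\<Prod>k<length fs. B * indicator {s..t} (u k)) * B')"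
  proof (rule AE_I2)
   fix u
   show "norm (simplex_integrand fs s t h u) <= norm ((\<Prod>k<length fs. B * indicator {s..t} (u k)) * B')"
   proof (cases "in_simplex (length fs) s t u")
    case True
    then have u: "\<And>k. k < length fs ==> u k \<in> {s..t}" by (simp add: in_simplex_def)
    have "norm (\<Prod>k<length fs. (fs ! k) (u k)) <= (\<Prod>k<length fs. B * indicator {s..t} (u k))"
     unfolding prod_norm[symmetric] using u B by (intro prod_mono) auto
    moreover have "norm (h (lowest (length fs) t u)) <= B'" using B' lowest_mem[OF st True] by blast
    ultimately have "norm (\<Prod>k<length fs. (fs ! k) (u k)) * norm (h (lowest (length fs) t u)) <=
      \<bar>\<Prod>k<length fs. B * indicator {s..t} (u k)\<bar> * \<bar>B'\<bar>" by (intro mult_mono) auto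
    then show ?thesis using True by (simp add: simplex_integrand_def norm_mult abs_mult)
   qed (simp add: simplex_integrand_def)
  qed
 qed (rule simplex_integrand_measurable[OF assms(1,2)])
qed

text \<open>Fubini in the innermost variable, which belongs to the last entry of the list, matches
  one step of \<open>foldr\<close> on \<open>fs @ [f]\<close>; hence the induction from the right
  with \<open>h\<close> arbitrary.\<close>

lemma simplex_integral_foldr:
 assumes "\<And>f. f \<in> set fs ==> f \<in> borel_measurable borel" "h \<in> borel_measurable borel" and st: "s <= t"
  and "\<And>f y. f \<in> set fs ==> y \<in> {s..t} ==> norm (f y) <= B" and "\<And>y. y \<in> {s..t} ==> norm (h y) <= B'"
 shows "(LINT u|cube (length fs). simplex_integrand fs s t h u) = foldr (volterra s) fs h t"
 using assms(1,2,4,5)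
proof (induction fs arbitrary: h B' rule: rev_induct)
 case Nil
 show ?case by (simp add: PiM_empty simplex_integrand_def in_simplex_def lowest_def lebesgue_integral_count_space_finite)
next
 case (snoc f fs)
 interpret product_sigma_finite "%_::nat. lborel :: real measure" by standard
 define n where "n = length fs"
 have set: "{..<length (fs @ [f])} = insert n {..<n}" by (auto simp: n_def)
 have fm: "f \<in> borel_measurable borel" using snoc.prems(1) by simp
 have int: "integrable (Pi\<^sub>M (insert n {..<n}) (%_. lborel)) (simplex_integrand (fs @ [f]) s t h)"
  unfolding set[symmetric] by (rule simplex_integrand_integrable[where B = B and B' = B']) (use snoc.prems st in auto)
 have step: "simplex_integrand (fs @ [f]) s t h (u(n := y)) =
   (if in_simplex n s t u then (\<Prod>k<n. (fs ! k) (u k)) else 0) * (if s <= y \<and> y <= lowest n t u then f y * h y else 0)" for u y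
 proof -
  have "(\<Prod>k<Suc n. ((fs @ [f]) ! k) ((u(n := y)) k)) = (\<Prod>k<n. (fs ! k) (u k)) * f y"
   by (simp add: n_def nth_append)
  then show ?thesis using in_simplex_Suc[OF st, of n u y]
   by (simp add: simplex_integrand_def n_def[symmetric] lowest_def mult_ac del: prod.lessThan_Suc)
 qed
 have "(LINT u|cube (length (fs @ [f])). simplex_integrand (fs @ [f]) s t h u) =
   (LINT u|cube n. LINT y|lborel. simplex_integrand (fs @ [f]) s t h (u(n := y)))"
  unfolding set by (rule product_integral_insert[OF _ _ int]) auto
 also have "\<dots> = (LINT u|cube n. simplex_integrand fs s t (volterra s f h) u)"
  unfolding step integral_mult_right_zero volterra_def[symmetric]
  by (rule Bochner_Integration.integral_cong[OF refl]) (simp add: simplex_integrand_def n_def)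
 also have "\<dots> = foldr (volterra s) fs (volterra s f h) t"
  unfolding n_def using snoc.prems
  by (intro snoc.IH[where B' = "B * B' * (t - s)"] volterra_measurable volterra_bounded fm) auto
 finally show ?case by simp
qed

fun itint :: "(nat => real => complex) => nat list => real => real => complex" where
 "itint g [] s t = 1"
| "itint g (k # ks) s t = volterra s (g k) (itint g ks s) t"

lemma itint_foldr: "itint g ks s = foldr (volterra s) (map g ks) (%_. 1)"
 by (induction ks) (auto intro!: ext)

lemma itint_measurable:
 assumes "\<And>k. k \<in> set ks ==> g k \<in> borel_measurable borel"
 shows "itint g ks s \<in> borel_measurable borel"
 using assms
proof (induction ks)
 case (Cons k ks)
 have "itint g (k # ks) s = volterra s (g k) (itint g ks s)" by (simp add: fun_eq_iff)
 then show ?case using Cons by (simp only:) (intro volterra_measurable, auto)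
qed (simp add: fun_eq_iff[symmetric] itint_foldr)

lemma (in pole_path) iterated_integral_eq:
 assumes st: "0 < s" "s <= t" "t < 1" and ks: "set ks \<subseteq> {1..m}"
 shows "iterated_integral C (log_forms z ks) s t = itint letter ks s t"
proof -
 obtain c where c: "0 < c" "\<And>k t. k\<in>{1..m} ==> t\<in>{0<..<1} ==> norm (letter k t) <= c / end_weight i j k t"
  using letter_bound by blast
 define B where "B = c / min s (1 - t)"
 have B: "norm (letter k y) <= B" if "k \<in> {1..m}" "y \<in> {s..t}" for k y
 proof -
  have "min s (1 - t) <= end_weight i j k y" using that st by (auto simp: end_weight_def)
  then have "c / end_weight i j k y <= B" unfolding B_def using c st by (intro divide_left_mono) (auto simp: end_weight_def intro!: mult_pos_pos)
  then show ?thesis using c(2)[OF that(1), of y] that st by auto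
 qed
 have "iterated_integral C (log_forms z ks) s t = (LINT u|cube (length (map letter ks)). simplex_integrand (map letter ks) s t (%_. 1) u)"
  unfolding iterated_integral_def set_lebesgue_integral_def log_forms_def length_map
 proof (rule Bochner_Integration.integral_cong[OF refl])
  fix u :: "nat => real"
  have "(\<Prod>k<length ks. (map (%k w. 1 / (w - z k)) ks ! k) (C (u k)) * vector_derivative C (at (u k))) =
    (\<Prod>k<length ks. letter (ks ! k) (u k))" if "in_simplex (length ks) s t u"
   using that st by (intro prod.cong) (auto simp: letter_def in_simplex_def intro: less_le_trans le_less_trans)
  then show "indicat_real {u. (\<forall>k<length ks. s <= u k \<and> u k <= t) \<and> (\<forall>k. Suc k < length ks --> u (Suc k) <= u k)} u *\<^sub>R
    (\<Prod>k<length ks. (map (%k w. 1 / (w - z k)) ks ! k) (C (u k)) * vector_derivative C (at (u k))) =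
    simplex_integrand (map letter ks) s t (%_. 1) u"
   by (simp add: simplex_integrand_def in_simplex_def[symmetric] indicator_def)
 qed
 also have "\<dots> = foldr (volterra s) (map letter ks) (%_. 1) t"
 proof (rule simplex_integral_foldr[where B = B and B' = 1])
  show "f \<in> borel_measurable borel" if "f \<in> set (map letter ks)" for f using that letter_measurable by auto
  show "norm (f y) <= B" if "f \<in> set (map letter ks)" "y \<in> {s..t}" for f y using that B ks by auto
 qed (use st in auto)
 finally show ?thesis by (simp add: itint_foldr)
qed

lemma norm_lborel_integral_le:
 fixes f :: "real => 'a :: {banach, second_countable_topology}"
 assumes fm: "f \<in> borel_measurable borel"
  and d: "\<And>y. y \<in> {s..t} ==> (\<phi> has_real_derivative \<phi>' y) (at y)" and \<phi>m: "\<phi>' \<in> borel_measurable borel"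
  and pos: "\<And>y. y \<in> {s..t} ==> 0 <= \<phi>' y"
  and le: "\<And>y. y \<in> {s..t} ==> norm (f y) <= Q * \<phi>' y" and st: "s <= t"
 shows "norm (LINT y|lborel. (if s <= y \<and> y <= t then f y else 0)) <= Q * (\<phi> t - \<phi> s)"
proof -
 note FTC = integrable_FTC_Icc_nonneg[OF \<phi>m d pos st] integral_FTC_Icc_nonneg[OF \<phi>m d pos st]
 have int: "integrable lborel (%y. Q * (\<phi>' y * indicator {s..t} y))" using FTC(1) by (intro integrable_mult_right) auto
 have b: "norm (if s <= y \<and> y <= t then f y else 0) <= Q * (\<phi>' y * indicator {s..t} y)" for y
  using le[of y] by auto
 have "norm (LINT y|lborel. (if s <= y \<and> y <= t then f y else 0)) <= (LINT y|lborel. Q * (\<phi>' y * indicator {s..t} y))"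
 proof (rule Bochner_Integration.integral_norm_bound_integral[OF _ int])
  show "integrable lborel (%y. if s <= y \<and> y <= t then f y else 0)"
  proof (rule Bochner_Integration.integrable_bound[OF int])
   show "(%y. if s <= y \<and> y <= t then f y else 0) \<in> borel_measurable lborel"
    using fm by measurable
   show "AE y in lborel. norm (if s <= y \<and> y <= t then f y else 0) <= norm (Q * (\<phi>' y * indicator {s..t} y))"
    by (rule AE_I2, rule order_trans[OF b]) (simp add: abs_le_iff)
  qed
 qed (rule b)
 also have "\<dots> = Q * (\<phi> t - \<phi> s)" using FTC(2) by simp
 finally show ?thesis .
qed

section \<open>Majorants for iterated integrals of logarithmic forms\<close>

locale log_words =
 fixes m i j :: nat and g :: "nat => real => complex" and c :: real
 assumes ij: "i \<in> {1..m}" "j \<in> {1..m}" "i ~= j"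
  and meas: "\<And>k. g k \<in> borel_measurable borel"
  and zero: "\<And>k t. t \<notin> {0<..<1} ==> g k t = 0"
  and bound: "\<And>k t. k \<in> {1..m} ==> t \<in> {0<..<1} ==> norm (g k t) <= c / end_weight i j k t"
  and c: "0 < c"
begin

lemma itint_meas: "itint g ks s \<in> borel_measurable borel"
 by (rule itint_measurable) (rule meas)

text \<open>Majorants propagate along words if the derivative of the one for k dominates the letter
  k times the one for every admissible successor l. Each letter costs a factor \<open>q\<close>, and
  nonnegativity removes the contribution of the lower limit \<open>s\<close>.\<close>

lemma majorant:
 fixes \<phi> \<phi>' :: "nat => real => real"
 assumes q: "0 <= q"
  and d: "\<And>k x. k \<in> {1..m} ==> 0 < x ==> x < 1 ==> (\<phi> k has_real_derivative \<phi>' k x) (at x)"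
  and pos: "\<And>k x. k \<in> {1..m} ==> 0 < x ==> x < 1 ==> 0 <= \<phi> k x \<and> 0 <= \<phi>' k x"
  and \<phi>m: "\<And>k. \<phi>' k \<in> borel_measurable borel"
  and first: "\<And>k x. k \<in> {1..m} ==> k ~= i ==> 0 < x ==> x < 1 ==> c / end_weight i j k x <= q * \<phi>' k x"
  and step: "\<And>k l x. k \<in> {1..m} ==> l \<in> {1..m} ==> adj k l ==> 0 < x ==> x < 1 ==>
   c / end_weight i j k x * \<phi> l x <= q * \<phi>' k x"
  and "ks ~= []" "set ks \<subseteq> {1..m}" "last ks ~= i" "successively adj ks" and s: "0 < s" and "s <= t" "t < 1"
 shows "norm (itint g ks s t) <= q ^ length ks * \<phi> (hd ks) t"
 using assms(7-10,12,13)
proof (induction ks arbitrary: t)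
 case (Cons k ks)
 have k: "k \<in> {1..m}" using Cons.prems by simp
 have le: "norm (g k y * itint g ks s y) <= q ^ length (k # ks) * \<phi>' k y" if y: "y \<in> {s..t}" for y
 proof (cases "ks = []")
  case True
  have "k ~= i" "0 < y" "y < 1" using True Cons.prems y s by auto
  then have "norm (g k y) <= q * \<phi>' k y" using bound[OF k, of y] first[OF k, of y] by simp
  then show ?thesis using True by simp
 next
  case False
  have hk: "hd ks \<in> {1..m}" "adj k (hd ks)" "successively adj ks"
   using False Cons.prems hd_in_set[OF False] by (auto simp: successively_Cons simp del: atLeastAtMost_iff)
  have y1: "0 < y" "y < 1" using y s Cons.prems by auto
  have "norm (itint g ks s y) <= q ^ length ks * \<phi> (hd ks) y"
   using Cons.IH[of y] False Cons.prems y hk by auto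
  then have "norm (g k y * itint g ks s y) <= (c / end_weight i j k y) * (q ^ length ks * \<phi> (hd ks) y)"
   unfolding norm_mult using bound[OF k, of y] y1 by (intro mult_mono) (auto intro: order_trans[OF norm_ge_zero])
  also have "\<dots> = q ^ length ks * (c / end_weight i j k y * \<phi> (hd ks) y)" by simp
  also have "\<dots> <= q ^ length ks * (q * \<phi>' k y)"
   using step[OF k hk(1,2) y1] q by (intro mult_left_mono) auto
  finally show ?thesis by (simp add: mult_ac)
 qed
 have "norm (itint g (k # ks) s t) <= q ^ length (k # ks) * (\<phi> k t - \<phi> k s)"
  unfolding itint.simps volterra_def
 proof (rule norm_lborel_integral_le[OF _ _ \<phi>m _ le])
  fix y assume "y \<in> {s..t}"
  then have y1: "0 < y" "y < 1" using s Cons.prems by auto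
  show "(\<phi> k has_real_derivative \<phi>' k y) (at y)" "0 <= \<phi>' k y" using d[OF k y1] pos[OF k y1] by auto
 qed (use Cons.prems in \<open>auto intro!: borel_measurable_times meas itint_meas\<close>)
 also have "\<dots> <= q ^ length (k # ks) * \<phi> k t"
  using pos[OF k, of s] s Cons.prems q by (intro mult_left_mono) auto
 finally show ?case by simp
qed simp

lemma sqrt_deriv: "x < 1 ==> ((%x. sqrt (1 - x)) has_real_derivative - (1 / (2 * sqrt (1 - x)))) (at x)"
 by (auto intro!: derivative_eq_intros simp: field_simps)

lemma quotient_deriv:
 assumes "x < 1"
 shows "((%x. x / sqrt (1 - x)) has_real_derivative (2 - x) / (2 * (1 - x) * sqrt (1 - x))) (at x)"
proof -
 define r where "r = sqrt (1 - x)"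
 have r: "0 < r" "r * r = 1 - x" using assms by (auto simp: r_def)
 have "((%x. x / sqrt (1 - x)) has_real_derivative (1 * sqrt (1 - x) - x * (- (1 / (2 * sqrt (1 - x))))) / (sqrt (1 - x) * sqrt (1 - x))) (at x)"
  by (rule DERIV_divide[OF DERIV_ident sqrt_deriv]) (use assms in auto)
 also have "(1 * sqrt (1 - x) - x * (- (1 / (2 * sqrt (1 - x))))) / (sqrt (1 - x) * sqrt (1 - x)) = (r + x / (2 * r)) / (r * r)"
  by (simp add: r_def)
 also have "\<dots> = (2 * (r * r) + x) / (2 * (r * r) * r)" using r(1) by (simp add: field_simps)
 also have "\<dots> = (2 - x) / (2 * (1 - x) * sqrt (1 - x))" unfolding r(2) by (simp add: r_def)
 finally show ?thesis .
qed

lemma weight_ge: "0 < x ==> x < 1 ==> x * (1 - x) <= end_weight i j k x"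
 "0 < x ==> x < 1 ==> k ~= i ==> 1 - x <= end_weight i j k x"
 "0 < x ==> x < 1 ==> k ~= j ==> x <= end_weight i j k x"
 using ij by (auto simp: end_weight_def mult_le_one mult_left_le_one_le mult_left_le)

text \<open>One majorant x / sqrt (1 - x) for all letters: its derivative is at least 1 / (2 (1 -
  x)^(3/2)), and its zero at 0 compensates the pole of the letter i. The bound covers repeated
  letters too, but blows up at t = 1.\<close>

lemma word_bound:
 assumes "ks ~= []" "set ks \<subseteq> {1..m}" "last ks ~= i" "0 < s" "s <= t" "t < 1"
 shows "norm (itint g ks s t) <= (2 * c) ^ length ks * (t / sqrt (1 - t))"
proof (rule majorant[where \<phi> = "%k x. x / sqrt (1 - x)" and \<phi>' = "%k x. (2 - x) / (2 * (1 - x) * sqrt (1 - x))" and adj = "%k l. True"])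
 have key: "c / ((1 - x) * sqrt (1 - x)) <= 2 * c * ((2 - x) / (2 * (1 - x) * sqrt (1 - x)))" if x: "0 < x" "x < 1" for x
 proof -
  have p: "0 < (1 - x) * sqrt (1 - x)" using x by simp
  have "2 * c * ((2 - x) / (2 * ((1 - x) * sqrt (1 - x)))) = (c * (2 - x)) / ((1 - x) * sqrt (1 - x))"
   using p by (simp only: times_divide_eq_right mult.assoc mult_divide_mult_cancel_left_if) simp
  then have "2 * c * ((2 - x) / (2 * (1 - x) * sqrt (1 - x))) = (c * (2 - x)) / ((1 - x) * sqrt (1 - x))"
   by (simp only: mult.assoc)
  moreover have "c * 1 <= c * (2 - x)" using c x by (intro mult_left_mono) auto
  ultimately show ?thesis using p by (simp add: divide_right_mono)
 qed
 fix k l :: nat and x :: real assume x: "0 < x" "x < 1"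
 have r: "0 < sqrt (1 - x)" "sqrt (1 - x) <= 1" using x by auto
 show "((%x. x / sqrt (1 - x)) has_real_derivative (2 - x) / (2 * (1 - x) * sqrt (1 - x))) (at x)" by (rule quotient_deriv[OF x(2)])
 show "0 <= x / sqrt (1 - x) \<and> 0 <= (2 - x) / (2 * (1 - x) * sqrt (1 - x))" using x by simp
 show "c / end_weight i j k x <= 2 * c * ((2 - x) / (2 * (1 - x) * sqrt (1 - x)))" if "k ~= i"
 proof -
  have "(1 - x) * sqrt (1 - x) <= 1 - x" using r x by (intro mult_left_le) auto
  then have "(1 - x) * sqrt (1 - x) <= end_weight i j k x" using weight_ge(2)[OF x that] by linarith
  then have "c / end_weight i j k x <= c / ((1 - x) * sqrt (1 - x))" using c x by (intro divide_left_mono) (auto intro!: mult_pos_pos simp: end_weight_def)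
  then show ?thesis using key[OF x] by linarith
 qed
 show "c / end_weight i j k x * (x / sqrt (1 - x)) <= 2 * c * ((2 - x) / (2 * (1 - x) * sqrt (1 - x)))"
 proof -
  have "c / end_weight i j k x <= c / (x * (1 - x))" using c x weight_ge(1)[OF x] by (intro divide_left_mono) (auto intro!: mult_pos_pos simp: end_weight_def)
  then have "c / end_weight i j k x * (x / sqrt (1 - x)) <= c / (x * (1 - x)) * (x / sqrt (1 - x))" using x by (intro mult_right_mono) auto
  also have "\<dots> = c / ((1 - x) * sqrt (1 - x))" using x by simp
  finally show ?thesis using key[OF x] by linarith
 qed
next
 show "successively (%k l. True) ks" by (induction ks rule: induct_list012) auto
qed (use c assms in auto)


text \<open>Only the majorant of i is nonzero at 0 and only that of j is unbounded at 1; these would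
  be harmful in front of another letter i or j respectively, which happens only for repetitions. The
  exponential factor stays below exp (2 K^2).\<close>

definition majorant_fun :: "real => nat => real => real" where
 "majorant_fun K k x = (if k = i then 1 else if k = j then K * (x / sqrt (1 - x)) else K * x) *
   exp (2 * K\<^sup>2 * (1 - sqrt (1 - x)))"

definition majorant_deriv :: "real => nat => real => real" where
 "majorant_deriv K k x = ((if k = i then 0 else if k = j then K * ((2 - x) / (2 * (1 - x) * sqrt (1 - x))) else K) +
   (if k = i then 1 else if k = j then K * (x / sqrt (1 - x)) else K * x) * (K\<^sup>2 / sqrt (1 - x))) *
   exp (2 * K\<^sup>2 * (1 - sqrt (1 - x)))"

lemma majorant_fun_deriv:
 assumes "x < 1" shows "(majorant_fun K k has_real_derivative majorant_deriv K k x) (at x)"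
proof -
 have e: "((%x. exp (2 * K\<^sup>2 * (1 - sqrt (1 - x)))) has_real_derivative (K\<^sup>2 / sqrt (1 - x)) * exp (2 * K\<^sup>2 * (1 - sqrt (1 - x)))) (at x)"
  by (rule derivative_eq_intros sqrt_deriv[OF assms] refl)+ simp
 have p: "((%x. if k = i then 1 else if k = j then K * (x / sqrt (1 - x)) else K * x) has_real_derivative
   (if k = i then 0 else if k = j then K * ((2 - x) / (2 * (1 - x) * sqrt (1 - x))) else K)) (at x)"
  using DERIV_cmult[OF quotient_deriv[OF assms], of K] by (auto intro!: derivative_eq_intros)
 show ?thesis unfolding majorant_fun_def[abs_def]
  by (rule DERIV_cong[OF DERIV_mult[OF p e]]) (simp add: majorant_deriv_def algebra_simps)
qed

text \<open>If the successor is i, the derivative of the prefactor dominates; otherwise the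
  derivative of the exponential does, whose logarithmic derivative K^2 / sqrt (1 - x) is integrable
  up to 1.\<close>

lemma majorant_step:
 assumes K: "1 <= K" and kl: "k ~= l" and x: "0 < x" "x < 1"
 shows "K / end_weight i j k x * majorant_fun K l x <= majorant_deriv K k x"
proof -
 define r where "r = sqrt (1 - x)"
 define E where "E = exp (2 * K\<^sup>2 * (1 - r))"
 have r: "0 < r" "r <= 1" "r * r = 1 - x" using x by (auto simp: r_def)
 have E: "0 < E" by (simp add: E_def)
 define p where "p k = (if k = i then 1 else if k = j then K * (x / r) else K * x)" for k
 define p' where "p' k = (if k = i then 0 else if k = j then K * ((2 - x) / (2 * (1 - x) * r)) else K)" for k
 have KK: "K <= K\<^sup>2" using K by (simp add: power2_eq_square)
 have "K / end_weight i j k x * p l <= p' k + p k * (K\<^sup>2 / r)"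
 proof -
  have pl: "p l <= K * (x / r)" if "l ~= i"
  proof (cases "l = j")
   case False
   have "x <= x / r" using r x by (simp add: pos_le_divide_eq mult_left_le)
   then have "K * x <= K * (x / r)" using K by (intro mult_left_mono) auto
   then show ?thesis using False that by (simp add: p_def)
  qed (use that in \<open>simp add: p_def\<close>)
  consider "k = i" | "k = j" "l = i" | "k = j" "l ~= i" | "k ~= i" "k ~= j" "l = i" | "k ~= i" "k ~= j" "l ~= i" by blast
  then show ?thesis
  proof cases
   case 1
   have "K / x * p l <= K / x * (K * (x / r))" using pl kl 1 K x by (intro mult_left_mono) auto
   also have "\<dots> = K\<^sup>2 / r" using x by (simp add: power2_eq_square)
   finally show ?thesis using 1 by (simp add: end_weight_def p_def p'_def)
  next
   case 2
   \<comment> \<open>This is (1 - r)^2 >= 0 with r^2 = 1 - x.\<close>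
   have "2 * r <= 2 - x" using r(3) zero_le_square[of "1 - r"] by (simp add: algebra_simps)
   then have "(2 * r) / (2 * (1 - x) * r) <= (2 - x) / (2 * (1 - x) * r)" using r x by (intro divide_right_mono) auto
   moreover have "(2 * r) / (2 * (1 - x) * r) = 1 / (1 - x)" using r x by (simp add: field_simps)
   ultimately have "K * (1 / (1 - x)) <= K * ((2 - x) / (2 * (1 - x) * r))" using K by (intro mult_left_mono) auto
   moreover have "0 <= K * (x / r) * (K\<^sup>2 / r)" using K x r by simp
   ultimately show ?thesis using 2 ij by (simp add: end_weight_def p_def p'_def)
  next
   case 3
   then have lo: "l ~= j" using kl by auto
   have "K / (1 - x) * (K * x) = (K * x / (1 - x)) * K" by simp
   also have "\<dots> <= (K * x / (1 - x)) * K\<^sup>2" using KK K x by (intro mult_left_mono) auto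
   also have "\<dots> = K * (x / r) * (K\<^sup>2 / r)" unfolding r(3)[symmetric] by (simp add: mult_ac)
   finally have "K / (1 - x) * (K * x) <= K * (x / r) * (K\<^sup>2 / r)" .
   moreover have "0 <= K * ((2 - x) / (2 * (1 - x) * r))" using K x r by simp
   ultimately show ?thesis using 3 lo ij by (simp add: end_weight_def p_def p'_def)
  next
   case 4
   have "0 <= K * x * (K\<^sup>2 / r)" using K x r by simp
   then show ?thesis using 4 by (simp add: end_weight_def p_def p'_def)
  next
   case 5
   have "K * p l <= K * (K * (x / r))" using pl 5 K by (intro mult_left_mono) auto
   also have "\<dots> = (K * x / r) * K" by simp
   also have "\<dots> <= (K * x / r) * K\<^sup>2" using KK K x r by (intro mult_left_mono) auto
   finally have "K * p l <= K * x * (K\<^sup>2 / r)" by (simp add: mult_ac)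
   then show ?thesis using 5 K by (simp add: end_weight_def p_def p'_def)
  qed
 qed
 then have "K / end_weight i j k x * p l * E <= (p' k + p k * (K\<^sup>2 / r)) * E" using E by (intro mult_right_mono) auto
 moreover have "majorant_fun K l x = p l * E" "majorant_deriv K k x = (p' k + p k * (K\<^sup>2 / r)) * E"
  unfolding majorant_fun_def majorant_deriv_def p_def p'_def E_def r_def by (rule refl)+
 ultimately show ?thesis by (simp only: mult.assoc)
qed

lemma majorant_nonneg:
 assumes "1 <= K" "0 < x" "x < 1" shows "0 <= majorant_fun K k x" "0 <= majorant_deriv K k x"
 using assms by (auto simp: majorant_fun_def majorant_deriv_def)

text \<open>The cost c / K of a letter can be made as small as desired, at the price of a constant
  independent of the word and of the end points. Since the first letter differs from j, its majorant
  is bounded up to 1.\<close>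

lemma nonrepeating_word_bound:
 assumes K: "1 <= K"
  and ks: "ks ~= []" "set ks \<subseteq> {1..m}" "last ks ~= i" "successively (~=) ks" "hd ks ~= j" and st: "0 < s" "s <= t" "t < 1"
 shows "norm (itint g ks s t) <= (c / K) ^ length ks * (K * exp (2 * K\<^sup>2))"
proof -
 have mult: "c / w * a <= c / K * b" if "K / w * a <= b" for w a b :: real
 proof -
  have "c / K * (K / w * a) <= c / K * b" using that c K by (intro mult_left_mono) auto
  then show ?thesis using K by simp
 qed
 have "norm (itint g ks s t) <= (c / K) ^ length ks * majorant_fun K (hd ks) t"
 proof (rule majorant[where \<phi> = "majorant_fun K" and \<phi>' = "majorant_deriv K" and adj = "(~=)"])
  fix k l x assume x: "0 < x" "x < (1::real)"
  show "(majorant_fun K k has_real_derivative majorant_deriv K k x) (at x)" by (rule majorant_fun_deriv[OF x(2)])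
  show "0 <= majorant_fun K k x \<and> 0 <= majorant_deriv K k x" using majorant_nonneg[OF K x] by simp
  show "c / end_weight i j k x * majorant_fun K l x <= c / K * majorant_deriv K k x" if "k ~= l"
   by (rule mult[OF majorant_step[OF K that x]])
  show "c / end_weight i j k x <= c / K * majorant_deriv K k x" if "k ~= i"
  proof -
   have "1 <= majorant_fun K i x" using x by (simp add: majorant_fun_def)
   then have "K / end_weight i j k x * 1 <= K / end_weight i j k x * majorant_fun K i x"
    using K x by (intro mult_left_mono) (auto simp: end_weight_def)
   then show ?thesis using mult[of "end_weight i j k x" 1] majorant_step[OF K that x] by fastforce
  qed
 next
  show "majorant_deriv K k \<in> borel_measurable borel" for k unfolding majorant_deriv_def[abs_def] by measurable
 qed (use K c ks st in auto)
 also have "majorant_fun K (hd ks) t <= K * exp (2 * K\<^sup>2)"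
 proof -
  have "t \<in> {0..1}" using st by simp
  then have "(if hd ks = i then 1 else if hd ks = j then K * (t / sqrt (1 - t)) else K * t) <= K" using ks K by (auto simp: mult_left_le)
  moreover have "exp (2 * K\<^sup>2 * (1 - sqrt (1 - t))) <= exp (2 * K\<^sup>2)" using st by (auto intro!: mult_left_le)
  ultimately show ?thesis unfolding majorant_fun_def using K by (intro mult_mono) auto
 qed
 finally show ?thesis using c K by (simp add: mult_left_mono)
qed

end

section \<open>Convergence of the iterated integrals at both ends\<close>

text \<open>Reduces the joint limit of the two end points to sequences, to which dominated
  convergence applies. The distances 1 / (n + 2) <= 1/2 keep both sequences in their halves of the
  interval.\<close>

lemma tendsto_ends_sequentially:
 fixes f :: "real => real => 'a :: metric_space"
 assumes "\<And>s t. (\<And>n. 0 < s n \<and> s n < 1/2) ==> (\<And>n. 1/2 < t n \<and> t n < 1) ==> s \<longlonglongrightarrow> 0 ==> t \<longlonglongrightarrow> 1 ==>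
  (%n. f (s n) (t n)) \<longlonglongrightarrow> L"
 shows "((%(s, t). f s t) \<longlongrightarrow> L) at_ends"
proof (rule ccontr)
 assume "\<not> ?thesis"
 then obtain e where e: "0 < e" "\<not> (\<forall>\<^sub>F p in at_ends. dist (case p of (s, t) => f s t) L < e)"
  by (auto simp: tendsto_iff)
 have "\<exists>p. 0 < fst p \<and> fst p < 1 / real (n + 2) \<and> 1 - 1 / real (n + 2) < snd p \<and> snd p < 1 \<and> \<not> dist (f (fst p) (snd p)) L < e" for n
 proof (rule ccontr)
  assume no: "\<not> ?thesis"
  have "\<forall>\<^sub>F s in at_right 0. 0 < s \<and> s < 1 / real (n + 2)"
   by (auto simp: eventually_at_right_field intro!: exI[of _ "1 / real (n + 2)"])
  moreover have "\<forall>\<^sub>F t in at_left 1. 1 - 1 / real (n + 2) < t \<and> t < 1"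
   by (auto simp: eventually_at_left_field intro!: exI[of _ "1 - 1 / real (n + 2)"])
  ultimately have "\<forall>\<^sub>F p in at_ends. dist (case p of (s, t) => f s t) L < e"
   by (rule eventually_mono[OF eventually_prod_at_ends]) (use no in \<open>auto simp: case_prod_beta\<close>)
  then show False using e by simp
 qed
 then obtain p where p: "\<And>n. 0 < fst (p n) \<and> fst (p n) < 1 / real (n + 2) \<and> 1 - 1 / real (n + 2) < snd (p n) \<and> snd (p n) < 1 \<and>
   \<not> dist (f (fst (p n)) (snd (p n))) L < e" by metis
 have l0: "(%n. 1 / real (n + 2)) \<longlonglongrightarrow> 0" using LIMSEQ_ignore_initial_segment[OF lim_inverse_n, of 2] by (simp add: inverse_eq_divide)
 have small: "1 / real (n + 2) <= 1 / 2" for n by (simp add: field_simps)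
 have "(%n. f (fst (p n)) (snd (p n))) \<longlonglongrightarrow> L"
 proof (rule assms)
  show "(%n. fst (p n)) \<longlonglongrightarrow> 0"
   by (rule tendsto_sandwich[OF _ _ tendsto_const l0]) (use p in \<open>auto intro!: always_eventually less_imp_le\<close>)
  have l1: "(%n. 1 - 1 / real (n + 2)) \<longlonglongrightarrow> 1" using tendsto_diff[OF tendsto_const l0, of 1] by simp
  show "(%n. snd (p n)) \<longlonglongrightarrow> 1"
   by (rule tendsto_sandwich[OF _ _ l1 tendsto_const]) (use p in \<open>auto intro!: always_eventually less_imp_le\<close>)
  fix n show "0 < fst (p n) \<and> fst (p n) < 1/2" "1/2 < snd (p n) \<and> snd (p n) < 1"
   using p[of n] small[of n] by linarith+
 qed
 then have "\<forall>\<^sub>F n in sequentially. dist (f (fst (p n)) (snd (p n))) L < e" using e(1) by (rule tendstoD)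
 then show False using p by (auto simp: eventually_sequentially)
qed

lemma ends_nontrivial: "at_ends ~= bot"
 by (simp add: prod_filter_eq_bot)

lemma integrable_inverse_sqrt: "integrable lborel (%y::real. if 0 < y \<and> y < 1 then a * (1 / sqrt (1 - y)) else 0)"
proof -
 have "set_integrable lborel (einterval (ereal 0) (ereal 1)) (%y. 1 / sqrt (1 - y))"
 proof (rule interval_integral_FTC_nonneg(1)[where F = "%y. - 2 * sqrt (1 - y)" and A = "- 2" and B = 0])
  fix x :: real assume x: "ereal 0 < ereal x" "ereal x < ereal 1"
  show "((%y. - 2 * sqrt (1 - y)) has_real_derivative 1 / sqrt (1 - x)) (at x)"
   using x by (auto intro!: derivative_eq_intros simp: field_simps)
  show "isCont (%y. 1 / sqrt (1 - y)) x" using x by (intro continuous_intros) auto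
 next
  have c: "isCont (%y. - 2 * sqrt (1 - y)) x" for x :: real by (intro continuous_intros)
  have "((%y. - 2 * sqrt (1 - y)) \<longlongrightarrow> - 2 * sqrt (1 - 0)) (at_right 0)" "((%y. - 2 * sqrt (1 - y)) \<longlongrightarrow> - 2 * sqrt (1 - 1)) (at_left 1)"
   using continuous_at_imp_continuous_at_within[OF c[of 0], of "{0<..}"] continuous_at_imp_continuous_at_within[OF c[of 1], of "{..<1}"]
   unfolding continuous_within by (simp_all only:)
  then show "(((%y. - 2 * sqrt (1 - y)) \<circ> real_of_ereal) \<longlongrightarrow> - 2) (at_right (ereal 0))"
   "(((%y. - 2 * sqrt (1 - y)) \<circ> real_of_ereal) \<longlongrightarrow> 0) (at_left (ereal 1))"
   by (simp_all add: ereal_tendsto_simps1)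
 qed auto
 then have "integrable lborel (%y. a * (indicator {0<..<1} y *\<^sub>R (1 / sqrt (1 - y))))"
  unfolding set_integrable_def by (intro integrable_mult_right) (simp add: einterval_eq_Icc)
 moreover have "(%y. a * (indicator {0<..<1} y *\<^sub>R (1 / sqrt (1 - y)))) = (%y. if 0 < y \<and> y < 1 then a * (1 / sqrt (1 - y)) else 0)"
  by (auto simp: fun_eq_iff)
 ultimately show ?thesis by simp
qed

context log_words
begin

text \<open>The zero of the crude word bound at 0 absorbs the possible pole of the leading letter.
  Only for a leading letter j does the resulting bound fail to be integrable at 1.\<close>

lemma integrand_bound:
 assumes ks: "set (k # ks) \<subseteq> {1..m}" "last (k # ks) ~= i" and y: "0 < s" "s <= y" "y < 1"
 defines "a \<equiv> c * (2 * c) ^ length ks"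
 shows "norm (g k y * itint g ks s y) <= a * (1 / ((1 - y) * sqrt (1 - y)))"
  and "k ~= j ==> norm (g k y * itint g ks s y) <= a * (1 / sqrt (1 - y))"
proof -
 have y1: "0 < y" using y by simp
 have r: "0 < sqrt (1 - y)" "sqrt (1 - y) <= 1" using y y1 by auto
 have k: "k \<in> {1..m}" using ks by simp
 have gk: "norm (g k y) <= c / w" if "0 < w" "w <= end_weight i j k y" for w
 proof -
  have "c / end_weight i j k y <= c / w" using c that by (intro divide_left_mono) auto
  then show ?thesis using bound[OF k, of y] y y1 by auto
 qed
 have "norm (g k y * itint g ks s y) <= a * (1 / ((1 - y) * sqrt (1 - y))) \<and>
  (k ~= j --> norm (g k y * itint g ks s y) <= a * (1 / sqrt (1 - y)))"
 proof (cases "ks = []")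
  case True
  then have ki: "k ~= i" using ks by simp
  have "(1 - y) * sqrt (1 - y) <= 1 - y" using r y by (intro mult_left_le) auto
  then have "(1 - y) * sqrt (1 - y) <= end_weight i j k y" using weight_ge(2)[OF y1 y(3) ki] by (rule order_trans)
  then have "norm (g k y) <= c / ((1 - y) * sqrt (1 - y))" using y r by (intro gk) auto
  moreover have "norm (g k y) <= c / sqrt (1 - y)" if "k ~= j"
   using r ki that by (intro gk) (auto simp: end_weight_def)
  ultimately show ?thesis using True by (simp add: a_def)
 next
  case False
  have w: "norm (itint g ks s y) <= (2 * c) ^ length ks * (y / sqrt (1 - y))"
   using ks False y by (intro word_bound) auto
  have pr: "norm (g k y * itint g ks s y) <= c / v * ((2 * c) ^ length ks * (y / sqrt (1 - y)))"
   if "0 < v" "v <= end_weight i j k y" for v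
   unfolding norm_mult using gk[OF that] w c that by (intro mult_mono) auto
  have "c / (y * (1 - y)) * ((2 * c) ^ length ks * (y / sqrt (1 - y))) = a * (1 / ((1 - y) * sqrt (1 - y)))"
   using y1 by (simp add: a_def)
  moreover have "c / y * ((2 * c) ^ length ks * (y / sqrt (1 - y))) = a * (1 / sqrt (1 - y))"
   using y1 by (simp add: a_def)
  ultimately show ?thesis using pr[of "y * (1 - y)"] pr[of y] weight_ge[OF y1 y(3)] y y1 by auto
 qed
 then show "norm (g k y * itint g ks s y) <= a * (1 / ((1 - y) * sqrt (1 - y)))"
  "k ~= j ==> norm (g k y * itint g ks s y) <= a * (1 / sqrt (1 - y))" by auto
qed

lemma integrand_measurable: "(%y. if s <= y \<and> y <= t then g k y * itint g ks s' y else 0) \<in> borel_measurable lborel"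
proof -
 have [measurable]: "(%y. g k y * itint g ks s' y) \<in> borel_measurable borel"
  by (intro borel_measurable_times meas itint_meas)
 show ?thesis by measurable
qed

text \<open>The upper end is fixed below 1, so the integrand is bounded uniformly in the lower end,
  and dominated convergence applies letter by letter.\<close>

lemma lower_limit:
 assumes s: "\<And>n. 0 < s n" "s \<longlonglongrightarrow> 0" and t: "0 < t" "t < 1" and "set ks \<subseteq> {1..m}" "ks ~= [] ==> last ks ~= i"
 shows "(%n. itint g ks (s n) t) \<longlonglongrightarrow> itint g ks 0 t"
 using t assms(5,6)
proof (induction ks arbitrary: t)
 case (Cons k ks)
 define a where "a = c * (2 * c) ^ length ks"
 define B where "B = a * (1 / ((1 - t) * sqrt (1 - t)))"
 have a: "0 < a" using c by (simp add: a_def)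
 show ?case unfolding itint.simps volterra_def
 proof (rule integral_dominated_convergence[where w = "%y. B * indicator {0..t} y"])
  show "integrable lborel (%y. B * indicator {0..t} y)" by (rule integrable_indicator_Icc)
  show "AE y in lborel. (%n. if s n <= y \<and> y <= t then g k y * itint g ks (s n) y else 0) \<longlonglongrightarrow>
    (if 0 <= y \<and> y <= t then g k y * itint g ks 0 y else 0)"
  proof (rule AE_I2)
   fix y
   show "(%n. if s n <= y \<and> y <= t then g k y * itint g ks (s n) y else 0) \<longlonglongrightarrow> (if 0 <= y \<and> y <= t then g k y * itint g ks 0 y else 0)"
   proof (cases "0 < y \<and> y <= t")
    case True
    have "(%n. g k y * itint g ks (s n) y) \<longlonglongrightarrow> g k y * itint g ks 0 y"
     by (rule tendsto_mult[OF tendsto_const Cons.IH]) (use Cons.prems True in auto)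
    moreover have "\<forall>\<^sub>F n in sequentially. s n < y" using s(2) True by (auto dest: order_tendstoD)
    then have "\<forall>\<^sub>F n in sequentially. g k y * itint g ks (s n) y = (if s n <= y \<and> y <= t then g k y * itint g ks (s n) y else 0)"
     by eventually_elim (use True in auto)
    ultimately show ?thesis using True by (auto intro: Lim_transform_eventually)
   next
    case False
    have "\<not> (s n <= y \<and> y <= t)" for n using False s(1)[of n] by auto
    \<comment> \<open>The only point in question is y = 0, where the letter vanishes by the
      cut-off.\<close>
    moreover have "0 <= y \<and> y <= t ==> g k y = 0" using False zero[of y k] by (cases "y = 0") auto
    ultimately have "(%n. if s n <= y \<and> y <= t then g k y * itint g ks (s n) y else 0) = (%n. 0)"
     "(if 0 <= y \<and> y <= t then g k y * itint g ks 0 y else 0) = 0" by (auto simp: fun_eq_iff)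
    then show ?thesis by simp
   qed
  qed
  fix n
  show "AE y in lborel. norm (if s n <= y \<and> y <= t then g k y * itint g ks (s n) y else 0) <= B * indicator {0..t} y"
  proof (rule AE_I2)
   fix y
   show "norm (if s n <= y \<and> y <= t then g k y * itint g ks (s n) y else 0) <= B * indicator {0..t} y"
   proof (cases "s n <= y \<and> y <= t")
    case True
    have "norm (g k y * itint g ks (s n) y) <= a * (1 / ((1 - y) * sqrt (1 - y)))"
     unfolding a_def by (rule integrand_bound(1)) (use Cons.prems True s in auto)
    also have "\<dots> <= B" unfolding B_def using a True Cons.prems s(1)[of n]
     by (intro mult_left_mono divide_left_mono mult_mono mult_pos_pos) auto
    finally show ?thesis using True s(1)[of n] by auto
   next
    case False
    have "0 <= B" using a Cons.prems by (simp add: B_def)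
    then show ?thesis using False by auto
   qed
  qed
 qed (rule integrand_measurable)+
qed simp

text \<open>As the first letter is not j, the outermost integrand is dominated by a multiple of 1 /
  sqrt (1 - y); for fixed y the inner integrals converge by \<open>lower_limit\<close>.\<close>

lemma improper_limit:
 assumes "ks ~= []" "set ks \<subseteq> {1..m}" "last ks ~= i" "hd ks ~= j"
 shows "((%(s, t). itint g ks s t) \<longlongrightarrow> itint g ks 0 1) at_ends"
proof (rule tendsto_ends_sequentially)
 fix s t :: "nat => real"
 assume s: "\<And>n. 0 < s n \<and> s n < 1/2" and t: "\<And>n. 1/2 < t n \<and> t n < 1" and lim: "s \<longlonglongrightarrow> 0" "t \<longlonglongrightarrow> 1"
 obtain k ks' where ks: "ks = k # ks'" using assms(1) by (cases ks) auto
 define a where "a = c * (2 * c) ^ length ks'"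
 have a: "0 < a" using c by (simp add: a_def)
 show "(%n. itint g ks (s n) (t n)) \<longlonglongrightarrow> itint g ks 0 1"
  unfolding ks itint.simps volterra_def
 proof (rule integral_dominated_convergence[where w = "%y. if 0 < y \<and> y < 1 then a * (1 / sqrt (1 - y)) else 0"])
  show "integrable lborel (%y::real. if 0 < y \<and> y < 1 then a * (1 / sqrt (1 - y)) else 0)" by (rule integrable_inverse_sqrt)
  show "AE y in lborel. (%n. if s n <= y \<and> y <= t n then g k y * itint g ks' (s n) y else 0) \<longlonglongrightarrow>
    (if 0 <= y \<and> y <= 1 then g k y * itint g ks' 0 y else 0)"
  proof (rule AE_I2)
   fix y
   show "(%n. if s n <= y \<and> y <= t n then g k y * itint g ks' (s n) y else 0) \<longlonglongrightarrow> (if 0 <= y \<and> y <= 1 then g k y * itint g ks' 0 y else 0)"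
   proof (cases "0 < y \<and> y < 1")
    case True
    have "(%n. g k y * itint g ks' (s n) y) \<longlonglongrightarrow> g k y * itint g ks' 0 y"
     by (rule tendsto_mult[OF tendsto_const lower_limit]) (use s lim assms True ks in auto)
    moreover have "\<forall>\<^sub>F n in sequentially. s n < y" "\<forall>\<^sub>F n in sequentially. y < t n" using lim True by (auto dest: order_tendstoD)
    then have "\<forall>\<^sub>F n in sequentially. g k y * itint g ks' (s n) y = (if s n <= y \<and> y <= t n then g k y * itint g ks' (s n) y else 0)"
     by eventually_elim (use True in auto)
    ultimately show ?thesis using True by (auto intro: Lim_transform_eventually)
   next
    case False
    then have g0: "g k y = 0" using zero[of y k] by auto
    have "(%n. if s n <= y \<and> y <= t n then g k y * itint g ks' (s n) y else 0) = (%n. 0)" by (simp add: g0 fun_eq_iff)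
    then show ?thesis by (simp add: g0)
   qed
  qed
  fix n
  show "AE y in lborel. norm (if s n <= y \<and> y <= t n then g k y * itint g ks' (s n) y else 0) <= (if 0 < y \<and> y < 1 then a * (1 / sqrt (1 - y)) else 0)"
  proof (rule AE_I2)
   fix y
   show "norm (if s n <= y \<and> y <= t n then g k y * itint g ks' (s n) y else 0) <= (if 0 < y \<and> y < 1 then a * (1 / sqrt (1 - y)) else 0)"
   proof (cases "s n <= y \<and> y <= t n")
    case True
    then have y: "0 < y" "y < 1" using s[of n] t[of n] by auto
    have "norm (g k y * itint g ks' (s n) y) <= a * (1 / sqrt (1 - y))"
     unfolding a_def by (rule integrand_bound(2)) (use True y s[of n] assms ks in auto)
    then show ?thesis using True y by simp
   qed (use a in auto)
  qed
 qed (rule integrand_measurable)+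
qed

lemma nonrepeating_limit_bound:
 assumes K: "1 <= K" and ks: "ks ~= []" "set ks \<subseteq> {1..m}" "last ks ~= i" "hd ks ~= j" "successively (~=) ks"
 shows "norm (itint g ks 0 1) <= (c / K) ^ length ks * (K * exp (2 * K\<^sup>2))"
proof (rule tendsto_upperbound[OF tendsto_norm[OF improper_limit[OF ks(1-4)]] _ ends_nontrivial])
 show "\<forall>\<^sub>F p in at_ends. norm (case p of (s, t) => itint g ks s t) <= (c / K) ^ length ks * (K * exp (2 * K\<^sup>2))"
  using eventually_ends
 proof eventually_elim
  case (elim p)
  then show ?case using nonrepeating_word_bound[OF K ks(1,2,3,5,4), of "fst p" "snd p"] by (auto simp: case_prod_beta)
 qed
qed

end

lemma (in pole_path) log_words_letter: "\<exists>c. log_words m i j letter c"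
proof -
 obtain c where c: "0 < c" "\<forall>k\<in>{1..m}. \<forall>t\<in>{0<..<1}. norm (letter k t) <= c / end_weight i j k t"
  using letter_bound by blast
 have "log_words m i j letter c"
  by unfold_locales (use c ij neq letter_measurable in \<open>auto simp: letter_def\<close>)
 then show ?thesis by blast
qed

section \<open>Words and the Dyson series\<close>

definition words :: "nat => nat => nat list set" where
 "words m n = {ks. length ks = n \<and> set ks \<subseteq> {1..m}}"

lemma finite_words: "finite (words m n)"
 using finite_lists_length_eq[of "{1..m}" n] by (simp add: words_def conj_commute)

lemma words_Suc: "words m (Suc n) = (%(k, ks). k # ks) ` ({1..m} \<times> words m n)"
 by (auto simp: words_def length_Suc_conv image_iff)

lemma sum_words_Suc: "(\<Sum>ks\<in>words m (Suc n). f ks) = (\<Sum>k=1..m. \<Sum>ks\<in>words m n. f (k # ks))"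
proof -
 have "inj_on (%(k, ks). k # ks) ({1..m} \<times> words m n)" by (auto simp: inj_on_def)
 then have "(\<Sum>ks\<in>words m (Suc n). f ks) = sum (f \<circ> (%(k, ks). k # ks)) ({1..m} \<times> words m n)"
  unfolding words_Suc by (rule sum.reindex)
 then show ?thesis by (simp add: sum.cartesian_product case_prod_beta o_def)
qed

definition word_mat :: "(nat => complex^'n^'n) => nat list => complex^'n^'n" where
 "word_mat R ks = foldr (%k M. R k ** M) ks (mat 1)"

lemma word_mat_simps [simp]: "word_mat R [] = mat 1" "word_mat R (k # ks) = R k ** word_mat R ks"
 by (simp_all add: word_mat_def)

lemma word_product_eq: "word_product P F = word_mat (%k. P k ** F)"
 by (simp add: word_product_def word_mat_def fun_eq_iff)

locale dyson = log_words m i j g c for m i j g c +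
 fixes R :: "nat => complex^'n^'n" and U :: "real => complex^'n^'n" and s t :: real and L :: "real set"
 assumes st: "0 < s" "s <= t" "t < 1" and cU: "continuous_on {s..t} U" and Us: "U s = mat 1" and L: "finite L"
  and dU: "\<And>u. u \<in> {s<..<t} - L ==> (U has_vector_derivative (\<Sum>k=1..m. g k u *\<^sub>m (R k ** U u))) (at u)"
begin

definition T :: "(real => complex^'n^'n) => real => complex^'n^'n" where
 "T f x = (LINT y|lborel. (if s <= y \<and> y <= x then (\<Sum>k=1..m. g k y *\<^sub>m (R k ** f y)) else 0))"

definition layer :: "nat => real => complex^'n^'n" where
 "layer n x = (\<Sum>ks\<in>words m n. itint g ks s x *\<^sub>m word_mat R ks)"

text \<open>The cut-off outside [s, t] produces a Borel function on the whole line.\<close>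

definition U' :: "real => complex^'n^'n" where "U' y = indicator {s..t} y *\<^sub>R U y"

fun rem :: "nat => real => complex^'n^'n" where
 "rem 0 = U'"
| "rem (Suc n) = (%x. rem n x - layer n x)"

lemma letters_bounded: "\<exists>b>0. \<forall>k\<in>{1..m}. \<forall>y\<in>{s..t}. norm (g k y) <= b"
proof (intro exI[of _ "c / min s (1 - t)"] conjI ballI)
 show "0 < c / min s (1 - t)" using c st by simp
 fix k y assume k: "k \<in> {1..m}" and y: "y \<in> {s..t}"
 have "min s (1 - t) <= end_weight i j k y" using y st by (auto simp: end_weight_def)
 then have "c / end_weight i j k y <= c / min s (1 - t)"
  using c st y by (intro divide_left_mono) (auto simp: end_weight_def intro!: mult_pos_pos)
 then show "norm (g k y) <= c / min s (1 - t)" using bound[OF k, of y] y st by auto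
qed

lemma meas_op:
 fixes f :: "real => complex^'n^'n"
 assumes [measurable]: "f \<in> borel_measurable borel"
 shows "(%y. g k y *\<^sub>m (M ** f y)) \<in> borel_measurable borel"
proof -
 have 1: "(%y. M ** f y) \<in> borel_measurable borel"
  by (rule measurable_compose[OF assms]) (intro borel_measurable_continuous_onI linear_continuous_on mm.bounded_linear_right)
 show ?thesis
  by (rule borel_measurable_continuous_Pair[OF meas 1]) (intro ms.continuous_on continuous_intros)
qed

lemma meas_sum_op: "f \<in> borel_measurable borel ==> (%y. \<Sum>k=1..m. g k y *\<^sub>m (R k ** f y)) \<in> borel_measurable borel"
 by (intro borel_measurable_sum meas_op)

lemma T_integrable:
 assumes f: "f \<in> borel_measurable borel" and b: "\<And>y. y \<in> {s..t} ==> norm (f y) <= B" and x: "x \<in> {s..t}"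
 shows "integrable lborel (%y. if s <= y \<and> y <= x then (\<Sum>k=1..m. g k y *\<^sub>m (R k ** f y)) else 0)"
proof -
 obtain b' where b': "0 < b'" "\<And>k y. k \<in> {1..m} ==> y \<in> {s..t} ==> norm (g k y) <= b'" using letters_bounded by blast
 have B: "0 <= B" using b[OF x] by (rule order_trans[OF norm_ge_zero])
 show ?thesis
 proof (rule integrable_bounded_Icc[where a = s and b = x and B = "\<Sum>k=1..m. b' * (norm (R k) * B)"])
  show "(%y. if s <= y \<and> y <= x then \<Sum>k=1..m. g k y *\<^sub>m (R k ** f y) else 0) \<in> borel_measurable borel"
   using meas_sum_op[OF f] by measurable
  fix y
  show "norm (if s <= y \<and> y <= x then \<Sum>k=1..m. g k y *\<^sub>m (R k ** f y) else 0) <= (\<Sum>k=1..m. b' * (norm (R k) * B))"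
  proof (cases "s <= y \<and> y <= x")
   case True
   have "norm (\<Sum>k=1..m. g k y *\<^sub>m (R k ** f y)) <= (\<Sum>k=1..m. b' * (norm (R k) * B))"
   proof (rule sum_norm_le)
    fix k assume k: "k \<in> {1..m}"
    have "norm (R k ** f y) <= norm (R k) * B"
     using b[of y] True x by (intro order_trans[OF norm_matrix_mult_le] mult_left_mono) auto
    then show "norm (g k y *\<^sub>m (R k ** f y)) <= b' * (norm (R k) * B)"
     unfolding norm_msmult using b'(1) b'(2)[OF k, of y] True x by (intro mult_mono) auto
   qed
   then show ?thesis using True by simp
  qed (use B b' in \<open>auto intro!: sum_nonneg\<close>)
 qed auto
qed

lemma T_diff:
 assumes "f \<in> borel_measurable borel" "\<And>y. y \<in> {s..t} ==> norm (f y) <= B"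
  "h \<in> borel_measurable borel" "\<And>y. y \<in> {s..t} ==> norm (h y) <= B'" and x: "x \<in> {s..t}"
 shows "T (%y. f y - h y) x = T f x - T h x"
 unfolding T_def
 by (subst Bochner_Integration.integral_diff[symmetric, OF T_integrable[OF assms(1,2) x] T_integrable[OF assms(3,4) x]])
   (auto intro!: Bochner_Integration.integral_cong simp: mat_distrib sum_subtractf)

lemma itint_bound: "ks \<in> words m n ==> \<exists>B. \<forall>y\<in>{s..t}. norm (itint g ks s y) <= B"
proof (induction ks arbitrary: n)
 case (Cons k ks)
 obtain b where b: "0 < b" "\<And>k y. k \<in> {1..m} ==> y \<in> {s..t} ==> norm (g k y) <= b" using letters_bounded by blast
 obtain B where B: "\<And>y. y \<in> {s..t} ==> norm (itint g ks s y) <= B"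
 proof -
  have "ks \<in> words m (length ks)" using Cons.prems by (auto simp: words_def)
  then show ?thesis using Cons.IH that by blast
 qed
 have "norm (itint g (k # ks) s y) <= b * B * (t - s)" if "y \<in> {s..t}" for y
  unfolding itint.simps
  by (rule volterra_bounded[OF meas itint_meas _ _ that]) (use b B Cons.prems in \<open>auto simp: words_def\<close>)
 then show ?case by blast
qed (auto intro!: exI[of _ 1])

lemma layer_measurable: "layer n \<in> borel_measurable borel"
proof -
 have "(%x. itint g ks s x *\<^sub>m word_mat R ks) \<in> borel_measurable borel" for ks
  by (rule measurable_compose[OF itint_meas]) (intro borel_measurable_continuous_onI linear_continuous_on ms.bounded_linear_left)
 then show ?thesis unfolding layer_def[abs_def] by (intro borel_measurable_sum)
qed

lemma layer_bounded: "\<exists>B. \<forall>y\<in>{s..t}. norm (layer n y) <= B"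
proof -
 obtain B where B: "\<And>ks y. ks \<in> words m n ==> y \<in> {s..t} ==> norm (itint g ks s y) <= B ks"
  using bchoice[of "words m n" "%ks B. \<forall>y\<in>{s..t}. norm (itint g ks s y) <= B"] itint_bound by blast
 have "norm (layer n y) <= (\<Sum>ks\<in>words m n. B ks * norm (word_mat R ks))" if "y \<in> {s..t}" for y
  unfolding layer_def by (rule sum_norm_le) (use B that in \<open>auto intro!: mult_right_mono\<close>)
 then show ?thesis by blast
qed

lemma layer_Suc:
 assumes x: "x \<in> {s..t}" shows "layer (Suc n) x = T (layer n) x"
proof -
 have int: "integrable lborel (%y. if s <= y \<and> y <= x then g k y * itint g ks s y else 0)"
  if k: "k \<in> {1..m}" and ks: "ks \<in> words m n" for k ks
 proof -
  obtain b where b: "0 < b" "\<And>k y. k \<in> {1..m} ==> y \<in> {s..t} ==> norm (g k y) <= b" using letters_bounded by blast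
  obtain B where B: "\<And>y. y \<in> {s..t} ==> norm (itint g ks s y) <= B" using itint_bound[OF ks] by blast
  have "0 <= B" using B[OF x] by (rule order_trans[OF norm_ge_zero])
  then show ?thesis using b B x k
   by (intro integrable_bounded_Icc[where a = s and b = x and B = "b * B"])
     (use integrand_measurable in \<open>auto simp: norm_mult intro!: mult_mono\<close>)
 qed
 note i2 = integrable_bounded_linear[OF ms.bounded_linear_left int]
 have "T (layer n) x = (LINT y|lborel. (\<Sum>k=1..m. \<Sum>ks\<in>words m n.
   (if s <= y \<and> y <= x then g k y * itint g ks s y else 0) *\<^sub>m (R k ** word_mat R ks)))"
  unfolding T_def
 proof (rule Bochner_Integration.integral_cong[OF refl])
  fix y
  show "(if s <= y \<and> y <= x then \<Sum>k = 1..m. g k y *\<^sub>m (R k ** layer n y) else 0) =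
   (\<Sum>k=1..m. \<Sum>ks\<in>words m n. (if s <= y \<and> y <= x then g k y * itint g ks s y else 0) *\<^sub>m (R k ** word_mat R ks))"
  proof (cases "s <= y \<and> y <= x")
   case True
   then show ?thesis by (simp add: layer_def mm.sum_right ms.sum_right)
  next
   case False
   show ?thesis unfolding if_not_P[OF False] ms.zero_left by simp
  qed
 qed
 also have "\<dots> = (\<Sum>k=1..m. LINT y|lborel. (\<Sum>ks\<in>words m n.
   (if s <= y \<and> y <= x then g k y * itint g ks s y else 0) *\<^sub>m (R k ** word_mat R ks)))"
  by (rule Bochner_Integration.integral_sum) (rule Bochner_Integration.integrable_sum, rule i2)
 also have "\<dots> = (\<Sum>k=1..m. \<Sum>ks\<in>words m n. LINT y|lborel.
   (if s <= y \<and> y <= x then g k y * itint g ks s y else 0) *\<^sub>m (R k ** word_mat R ks))"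
  by (rule sum.cong[OF refl], rule Bochner_Integration.integral_sum, rule i2)
 also have "\<dots> = (\<Sum>k=1..m. \<Sum>ks\<in>words m n. volterra s (g k) (itint g ks s) x *\<^sub>m (R k ** word_mat R ks))"
  unfolding volterra_def
  by (rule sum.cong[OF refl], rule sum.cong[OF refl], rule integral_bounded_linear[OF ms.bounded_linear_left int])
 also have "\<dots> = layer (Suc n) x" by (simp add: layer_def sum_words_Suc)
 finally show ?thesis ..
qed


lemma U'_measurable: "U' \<in> borel_measurable borel"
 unfolding U'_def[abs_def] by (rule borel_measurable_continuous_on_indicator[OF _ cU]) auto

lemma U'_bounded: "\<exists>B. \<forall>y\<in>{s..t}. norm (U' y) <= B"
proof -
 have "bounded (U ` {s..t})" by (intro compact_imp_bounded compact_continuous_image cU) auto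
 then show ?thesis by (auto simp: bounded_iff U'_def)
qed

lemma U_integral:
 assumes x: "x \<in> {s..t}" shows "U' x - mat 1 = T U' x"
proof -
 define f where "f y = (\<Sum>k=1..m. g k y *\<^sub>m (R k ** U y))" for y
 have 1: "(f has_integral (U x - U s)) {s..x}"
  using x by (intro fundamental_theorem_of_calculus_interior_strong[OF L])
   (auto simp: f_def intro!: dU[simplified] continuous_on_subset[OF cU])
 obtain B where "\<And>y. y \<in> {s..t} ==> norm (U' y) <= B" using U'_bounded by blast
 then have "((%y. if s <= y \<and> y <= x then \<Sum>k = 1..m. g k y *\<^sub>m (R k ** U' y) else 0) has_integral T U' x) UNIV"
  unfolding T_def by (intro has_integral_integral_lborel T_integrable[OF U'_measurable _ x])
 moreover have "(%y. if s <= y \<and> y <= x then \<Sum>k = 1..m. g k y *\<^sub>m (R k ** U' y) else 0) = (%y. if y \<in> {s..x} then f y else 0)"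
  using x by (auto simp: fun_eq_iff f_def U'_def)
 ultimately have "(f has_integral T U' x) {s..x}" by (simp only: has_integral_restrict_UNIV)
 then have "T U' x = U x - U s" using 1 by (rule has_integral_unique)
 then show ?thesis using x Us by (simp add: U'_def)
qed

lemma rem_measurable: "rem n \<in> borel_measurable borel"
proof (induction n)
 case 0
 show ?case using U'_measurable by (simp add: fun_eq_iff[symmetric])
next
 case (Suc n)
 then show ?case unfolding rem.simps by (intro borel_measurable_diff layer_measurable)
qed

lemma rem_bounded: "\<exists>B. \<forall>y\<in>{s..t}. norm (rem n y) <= B"
proof (induction n)
 case (Suc n)
 then obtain B where B: "\<And>y. y \<in> {s..t} ==> norm (rem n y) <= B" by blast
 obtain B' where B': "\<And>y. y \<in> {s..t} ==> norm (layer n y) <= B'" using layer_bounded by blast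
 have "norm (rem (Suc n) y) <= B + B'" if "y \<in> {s..t}" for y
  using B[OF that] B'[OF that] norm_triangle_ineq4[of "rem n y" "layer n y"] by simp
 then show ?case by blast
qed (use U'_bounded in simp)

text \<open>In integral form the equation for U reads U - 1 = T U, and T maps each layer to the
  next; linearity propagates the relation to the remainders.\<close>

lemma rem_Suc: "x \<in> {s..t} ==> rem (Suc n) x = T (rem n) x"
proof (induction n)
 case 0
 have "words m 0 = {[]}" by (auto simp: words_def)
 then have "layer 0 x = mat 1" by (simp add: layer_def)
 then show ?case using U_integral[OF 0] by simp
next
 case (Suc n)
 obtain B where B: "\<And>y. y \<in> {s..t} ==> norm (rem n y) <= B" using rem_bounded by blast
 obtain B' where B': "\<And>y. y \<in> {s..t} ==> norm (layer n y) <= B'" using layer_bounded by blast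
 have "rem (Suc (Suc n)) x = T (rem n) x - T (layer n) x" using Suc layer_Suc[OF Suc.prems] by simp
 also have "\<dots> = T (%y. rem n y - layer n y) x"
  by (rule T_diff[symmetric, OF rem_measurable B layer_measurable B' Suc.prems])
 finally show ?case by simp
qed

text \<open>On [s, t] the letters are bounded, so n applications of T gain (x - s)^n / n!. The
  constants depend on s and t, so the limit at the ends of the path rests on the majorants
  instead.\<close>

lemma rem_decay: "\<exists>M B. \<forall>n. \<forall>x\<in>{s..t}. norm (rem n x) <= (M * B ^ n) * ((x - s) ^ n / fact n)"
proof -
 obtain b where b: "0 < b" "\<And>k y. k \<in> {1..m} ==> y \<in> {s..t} ==> norm (g k y) <= b" using letters_bounded by blast
 obtain M where M: "\<And>y. y \<in> {s..t} ==> norm (U' y) <= M" using U'_bounded by blast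
 define B where "B = (\<Sum>k=1..m. b * norm (R k))"
 have "norm (rem n x) <= (M * B ^ n) * ((x - s) ^ n / fact n)" if "x \<in> {s..t}" for n x
  using that
 proof (induction n arbitrary: x)
  case (Suc n)
  have le: "norm (\<Sum>k=1..m. g k y *\<^sub>m (R k ** rem n y)) <= (M * B ^ Suc n) * ((y - s) ^ n / fact n)" if y: "y \<in> {s..x}" for y
  proof -
   have yt: "y \<in> {s..t}" using y Suc.prems by auto
   have "norm (\<Sum>k=1..m. g k y *\<^sub>m (R k ** rem n y)) <= (\<Sum>k=1..m. b * norm (R k) * norm (rem n y))"
   proof (rule sum_norm_le)
    fix k assume "k \<in> {1..m}"
    then show "norm (g k y *\<^sub>m (R k ** rem n y)) <= b * norm (R k) * norm (rem n y)"
     unfolding norm_msmult mult.assoc using b yt by (intro mult_mono norm_matrix_mult_le) auto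
   qed
   also have "\<dots> = B * norm (rem n y)" by (simp only: B_def sum_distrib_right)
   also have "\<dots> <= B * ((M * B ^ n) * ((y - s) ^ n / fact n))"
    using Suc.IH[OF yt] b by (intro mult_left_mono) (auto simp: B_def intro!: sum_nonneg)
   finally show ?thesis by (simp add: mult_ac)
  qed
  have "norm (T (rem n) x) <= (M * B ^ Suc n) * ((x - s) ^ Suc n / fact (Suc n) - (s - s) ^ Suc n / fact (Suc n))"
   unfolding T_def
  proof (rule norm_lborel_integral_le[OF meas_sum_op[OF rem_measurable] _ _ _ le])
   fix y assume y: "y \<in> {s..x}"
   show "((%y. (y - s) ^ Suc n / fact (Suc n)) has_real_derivative (y - s) ^ n / fact n) (at y)"
    by (rule derivative_eq_intros refl | simp)+
   show "0 <= (y - s) ^ n / fact n" using y by simp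
  next
   show "(%y. (y - s) ^ n / fact n) \<in> borel_measurable borel" by measurable
  qed (use Suc.prems in auto)
  then show ?case unfolding rem_Suc[OF Suc.prems] by simp
 qed (use M in auto)
 then show ?thesis by blast
qed

lemma layers_sums: "(%n. layer n t) sums U t"
proof -
 have tt: "t \<in> {s..t}" using st by simp
 obtain M B where MB: "\<And>n. norm (rem n t) <= (M * B ^ n) * ((t - s) ^ n / fact n)" using rem_decay tt by blast
 have lim: "(%n. M * ((B * (t - s)) ^ n / fact n)) \<longlonglongrightarrow> 0"
  using tendsto_mult[OF tendsto_const[of M] summable_LIMSEQ_zero[OF summable_exp[of "B * (t - s)"]]]
  by (simp add: divide_inverse mult.commute)
 have "(%n. rem n t) \<longlonglongrightarrow> 0"
 proof (rule Lim_null_comparison[OF _ lim], intro always_eventually allI)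
  fix n
  have "(M * B ^ n) * ((t - s) ^ n / fact n) = M * ((B * (t - s)) ^ n / fact n)"
   unfolding power_mult_distrib by simp
  then show "norm (rem n t) <= M * ((B * (t - s)) ^ n / fact n)" using MB[of n] by linarith
 qed
 then have "(%n. U t - rem n t) \<longlonglongrightarrow> U t - 0" by (intro tendsto_diff tendsto_const)
 moreover have "(\<Sum>n<N. layer n t) = U t - rem N t" for N
  by (induction N) (use tt in \<open>auto simp: U'_def\<close>)
 ultimately show ?thesis by (simp add: sums_def)
qed

end

lemma (in pole_path) dyson_transport:
 fixes X Y :: "complex => complex^'n^'n" and R :: "nat => complex^'n^'n"
 assumes lw: "log_words m i j letter c" and f: "fund B S X Y" and S: "\<And>t. t \<in> {0<..<1} ==> (C t - z i) / d \<in> S"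
  and conn: "\<And>w. (\<Sum>k=1..m. (1 / (w - z k)) *\<^sub>m R k) = (1 / d) *\<^sub>m B ((w - z i) / d)" and st: "0 < s" "s <= t" "t < 1"
 shows "(%n. \<Sum>ks\<in>words m n. itint letter ks s t *\<^sub>m word_mat R ks) sums (X ((C t - z i) / d) ** Y ((C s - z i) / d))"
proof -
 obtain L v M where L: "finite L" "\<And>t. t \<in> {0<..<1} - L ==> (C has_vector_derivative v t) (at t)"
  "\<And>t. t \<in> {0<..<1} - L ==> vector_derivative C (at t) = v t" using velocity by metis
 interpret log_words m i j letter c by (rule lw)
 have sub: "{s..t} \<subseteq> {0<..<1}" using st by auto
 have cg: "continuous_on {s..t} (%u. (C u - z i) / d)"
  using dnz sub by (intro continuous_intros continuous_on_subset[OF continuous_C]) auto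
 have cX: "continuous_on S X"
  unfolding continuous_on_eq_continuous_within
  using has_mder_imp_continuous fundD(1)[OF f] continuous_at_imp_continuous_at_within by blast
 define U where "U u = X ((C u - z i) / d) ** Y ((C s - z i) / d)" for u
 interpret dyson m i j letter c R U s t L
 proof
  show "continuous_on {s..t} U"
   unfolding U_def using S sub by (intro mm.continuous_on continuous_on_const continuous_on_compose2[OF cX cg]) auto
  show "U s = mat 1" unfolding U_def using fundD(3)[OF f S[of s]] st by simp
  fix u assume "u \<in> {s<..<t} - L"
  then have u: "u \<in> {0<..<1} - L" using st by auto
  have "((%u. (C u - z i) / d) has_vector_derivative v u / d) (at u)"
   using has_vector_derivative_divide[OF has_vector_derivative_diff[OF L(2)[OF u] has_vector_derivative_const], of "z i" d] by simp
  from has_mder_path[OF has_mder_multc_right[OF fundD(1)[OF f S[of u]]] this, of "Y ((C s - z i) / d)"]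
  have "(U has_vector_derivative (v u / d) *\<^sub>m (B ((C u - z i) / d) ** X ((C u - z i) / d) ** Y ((C s - z i) / d))) (at u)"
   using u by (simp add: U_def[abs_def])
  moreover have "(\<Sum>k=1..m. letter k u *\<^sub>m (R k ** U u)) = v u *\<^sub>m ((\<Sum>k=1..m. (1 / (C u - z k)) *\<^sub>m R k) ** U u)"
   using u by (simp add: mm.sum_left ms.sum_right letter_def L(3))
  ultimately show "(U has_vector_derivative (\<Sum>k=1..m. letter k u *\<^sub>m (R k ** U u))) (at u)"
   unfolding conn by (simp add: U_def mat_assoc)
 qed (use st L in auto)
 show ?thesis using layers_sums by (simp add: layer_def U_def)
qed

lemma word_mat_append: "word_mat R (ks @ [k]) = word_mat R ks ** R k"
 by (induction ks) (simp_all add: matrix_mul_assoc)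

lemma norm_word_mat_le:
 fixes R :: "nat => complex^'n^'n"
 assumes "ks \<in> words m n"
 shows "norm (word_mat R ks) <= norm (mat 1 :: complex^'n^'n) * (\<Sum>k=1..m. norm (R k)) ^ n"
 using assms
proof (induction n arbitrary: ks)
 case (Suc n)
 then obtain k ks' where k: "ks = k # ks'" "k \<in> {1..m}" "ks' \<in> words m n" by (auto simp: words_Suc)
 have "norm (R k) <= (\<Sum>k=1..m. norm (R k))" using k by (intro member_le_sum) auto
 then have "norm (R k ** word_mat R ks') <= (\<Sum>k=1..m. norm (R k)) * (norm (mat 1 :: complex^'n^'n) * (\<Sum>k=1..m. norm (R k)) ^ n)"
  using Suc.IH[OF k(3)] by (intro order_trans[OF norm_matrix_mult_le] mult_mono) (auto intro!: sum_nonneg)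
 then show ?case by (simp add: k mult_ac)
qed (auto simp: words_def)

text \<open>Two equal neighbours produce the square of a residue.\<close>

lemma word_mat_repeating:
 assumes "\<And>k. k \<in> {1..m} ==> R k ** R k = 0" "set ks \<subseteq> {1..m}" "\<not> successively (~=) ks"
 shows "word_mat R ks = 0"
 using assms(2,3)
proof (induction ks rule: induct_list012)
 case (3 k l ks)
 show ?case
 proof (cases "k = l")
  case True
  then have "word_mat R (k # l # ks) = (R k ** R k) ** word_mat R ks" by (simp add: matrix_mul_assoc)
  then show ?thesis using assms(1)[of k] 3 by (simp add: mm.zero_left)
 next
  case False
  then have "word_mat R (l # ks) = 0" using 3 by (auto simp: successively_Cons)
  then show ?thesis by (simp add: mm.zero_right)
 qed
qed auto

section \<open>The series for the connection matrix\<close>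

text \<open>For fixed end points the transport is its Dyson series. Between \<open>res j\<close> and
  \<open>P i0\<close> only words that neither start with j nor end with \<open>i0\<close> survive;
  their terms are dominated by a geometric series uniformly in the end points, so Tannery's theorem
  exchanges the sum with the limit.\<close>

lemma (in fuchs_solutions) transport_series:
 fixes z :: "nat => complex"
 assumes pp: "pole_path m z i0 j Cp d" and d: "d = z j - z i0" and x: "\<And>k. x k = (z k - z i0) / d"
  and dm: "\<And>t. t \<in> {0<..<1} ==> (Cp t - z i0) / d \<in> dom (-1)"
 defines "Tm \<equiv> %n. \<Sum>ks \<in> index_words m j i0 (Suc n). improper_iterated_integral Cp (log_forms z ks) *\<^sub>m word_product P F ks"
 shows "n \<ge> 1 ==> ks \<in> index_words m j i0 n ==> \<exists>v. has_improper_iterated_integral Cp (log_forms z ks) v"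
  and "summable Tm"
  and "P j ** F ** (mat 1 + (\<Sum>n. Tm n)) ** P i0 = res j ** C (-1) j ** D (-1) i0 ** P i0"
proof -
 interpret p: pole_path m z i0 j Cp d by (rule pp)
 obtain c where lw: "log_words m i0 j p.letter c" using p.log_words_letter by blast
 interpret w: log_words m i0 j p.letter c by (rule lw)
 define V where "V ks = itint p.letter ks 0 1" for ks
 have jm: "j \<in> {1..m}" and im: "i0 \<in> {1..m}" by (rule p.ij)+
 have rr: "res k ** res k = 0" if "k \<in> {1..m}" for k by (rule res_res[OF that])
 have sub: "index_words m j i0 n \<subseteq> words m n" for n by (auto simp: index_words_def words_def)
 have iw: "ks ~= [] \<and> set ks \<subseteq> {1..m} \<and> last ks ~= i0 \<and> hd ks ~= j" if "ks \<in> index_words m j i0 n" "n \<ge> 1" for ks n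
  using that by (auto simp: index_words_def)
 have imp: "has_improper_iterated_integral Cp (log_forms z ks) (V ks)" if ks: "ks \<in> index_words m j i0 n" "n \<ge> 1" for ks n
  unfolding has_improper_iterated_integral_def V_def
 proof (rule Lim_transform_eventually)
  note iw = iw[OF ks]
  show "((%(s, t). itint p.letter ks s t) \<longlongrightarrow> itint p.letter ks 0 1) at_ends"
   using iw by (intro w.improper_limit) auto
  show "\<forall>\<^sub>F p in at_ends. (case p of (s, t) => itint p.letter ks s t) = (case p of (s, t) => iterated_integral Cp (log_forms z ks) s t)"
   using eventually_ends by eventually_elim (use iw in \<open>auto simp: p.iterated_integral_eq\<close>)
 qed
 then show "n \<ge> 1 ==> ks \<in> index_words m j i0 n ==> \<exists>v. has_improper_iterated_integral Cp (log_forms z ks) v" by blast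
 have imp_eq: "improper_iterated_integral Cp (log_forms z ks) = V ks" if ks: "ks \<in> index_words m j i0 n" "n \<ge> 1" for ks n
  unfolding improper_iterated_integral_def
 proof (rule the_equality[where P = "has_improper_iterated_integral Cp (log_forms z ks)", OF imp[OF ks]])
  fix v assume "has_improper_iterated_integral Cp (log_forms z ks) v"
  then show "v = V ks" using imp[OF ks] unfolding has_improper_iterated_integral_def
   by (rule tendsto_unique[OF ends_nontrivial])
 qed
 \<comment> \<open>The empty word is treated separately: membership in \<open>index_words\<close>
   for n = 0 would refer to the unspecified \<open>hd []\<close> and \<open>last []\<close>.\<close>
 define S where "S a n = (if n = 0 then mat 1 else \<Sum>ks\<in>index_words m j i0 n. a ks *\<^sub>m word_mat res ks)" for a :: "nat list => complex" and n
 have Tm: "Tm n = S V (Suc n)" for n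
  unfolding Tm_def S_def by (simp add: imp_eq word_product_eq res_def[abs_def] cong: sum.cong)
 define r where "r = (\<Sum>k=1..m. norm (res k))"
 have r: "0 <= r" by (simp add: r_def sum_nonneg)
 \<comment> \<open>There are at most m^n words of length n, with matrix factors at most a constant
   times r^n. The choice of K makes m c r / K <= 1/2, so the terms decay like (1/2)^n.\<close>
 define K where "K = 1 + 2 * (m * c * r)"
 have K: "1 <= K" "m * c * r / K <= 1 / 2"
 proof -
  have "0 <= m * c * r" using w.c r by simp
  then show "1 <= K" "m * c * r / K <= 1 / 2" by (simp_all add: K_def pos_divide_le_eq)
 qed
 define Q where "Q = norm (mat 1 :: complex^'n^'n) * (1 + K * exp (2 * K\<^sup>2))"
 have S_bound: "norm (S a n) <= Q * (1 / 2) ^ n"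
  if a: "\<And>ks. ks \<in> index_words m j i0 n ==> n \<ge> 1 ==> successively (~=) ks ==> norm (a ks) <= (c / K) ^ n * (K * exp (2 * K\<^sup>2))" for a n
 proof (cases "n = 0")
  case False
  define E where "E = (c / K) ^ n * (K * exp (2 * K\<^sup>2)) * (norm (mat 1 :: complex^'n^'n) * r ^ n)"
  have E: "0 <= E" using w.c K r by (simp add: E_def)
  have t: "norm (a ks *\<^sub>m word_mat res ks) <= E" if ks: "ks \<in> index_words m j i0 n" for ks
  proof (cases "successively (~=) ks")
   case True
   have "norm (word_mat res ks) <= norm (mat 1 :: complex^'n^'n) * r ^ n"
    unfolding r_def using ks sub by (intro norm_word_mat_le) blast
   then show ?thesis unfolding E_def norm_msmult using a[OF ks] True False w.c K by (intro mult_mono) auto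
  next
   case nr: False
   have "word_mat res ks = 0" using iw[OF ks] False by (intro word_mat_repeating[OF rr _ nr]) auto
   then show ?thesis using E by simp
  qed
  have "S a n = (\<Sum>ks\<in>index_words m j i0 n. a ks *\<^sub>m word_mat res ks)" using False by (simp add: S_def)
  then have "norm (S a n) <= (\<Sum>ks\<in>index_words m j i0 n. E)" by (simp only:) (rule sum_norm_le, rule t)
  also have "\<dots> <= (\<Sum>ks\<in>words m n. E)" by (rule sum_mono2[OF finite_words sub E])
  also have "\<dots> = real m ^ n * E"
   using card_lists_length_eq[of "{1..m}" n] by (simp add: words_def conj_commute)
  also have "\<dots> = (m * c * r / K) ^ n * (K * exp (2 * K\<^sup>2) * norm (mat 1 :: complex^'n^'n))"
   by (simp add: E_def power_mult_distrib power_divide)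
  also have "\<dots> <= (1 / 2) ^ n * Q"
  proof (rule mult_mono)
   show "(m * c * r / K) ^ n <= (1 / 2) ^ n" using K w.c r by (intro power_mono) auto
   show "K * exp (2 * K\<^sup>2) * norm (mat 1 :: complex^'n^'n) <= Q" by (simp add: Q_def algebra_simps)
  qed (use K in auto)
  finally show ?thesis by (simp add: mult.commute)
 qed (use K in \<open>simp add: S_def Q_def mult_le_cancel_left1\<close>)
 have SV: "norm (S V n) <= Q * (1 / 2) ^ n" for n
 proof (rule S_bound)
  fix ks assume ks: "ks \<in> index_words m j i0 n" "n \<ge> 1" "successively (~=) ks"
  then have "length ks = n" by (simp add: index_words_def)
  then show "norm (V ks) <= (c / K) ^ n * (K * exp (2 * K\<^sup>2))"
   using w.nonrepeating_limit_bound[OF K(1), of ks] iw[OF ks(1,2)] ks(3) by (simp add: V_def)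
 qed
 have geo: "summable (%n. Q' * (1 / 2 :: real) ^ n)" for Q' by (intro summable_mult summable_geometric) simp
 have sumS: "summable (S V)" by (rule summable_comparison_test'[OF geo SV])
 then show "summable Tm" unfolding Tm[abs_def] by (simp add: summable_Suc_iff)
 define B where "B M = res j ** M ** P i0" for M :: "complex^'n^'n"
 have blB: "bounded_linear B" unfolding B_def
  by (rule bounded_linear_compose[OF mm.bounded_linear_left mm.bounded_linear_right])
 have B_words: "B (\<Sum>ks\<in>words m n. a ks *\<^sub>m word_mat res ks) = B (S a n)" if a0: "a [] = 1" for a n
 proof (cases "n = 0")
  case True
  have "words m 0 = {[]}" by (auto simp: words_def)
  then show ?thesis by (simp add: S_def True a0)
 next
  case False
  \<comment> \<open>A word starting with j contributes the square of \<open>res j\<close>, one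
    ending with \<open>i0\<close> the product \<open>res i0 ** P i0\<close>; both vanish.\<close>
  have z: "B (a ks *\<^sub>m word_mat res ks) = 0" if ks: "ks \<in> words m n - index_words m j i0 n" for ks
  proof -
   have ne: "ks ~= []" "set ks \<subseteq> {1..m}" using ks False by (auto simp: words_def)
   from ks ne consider "hd ks = j" | "last ks = i0" by (auto simp: words_def index_words_def)
   then have "B (word_mat res ks) = 0"
   proof cases
    case 1
    then have e: "ks = j # tl ks" using ne by (metis list.collapse)
    have "B (word_mat res ks) = (res j ** res j) ** word_mat res (tl ks) ** P i0"
     by (subst e) (simp only: B_def word_mat_simps matrix_mul_assoc)
    then show ?thesis by (simp add: rr[OF jm] mm.zero_left)
   next
    case 2
    then have e: "ks = butlast ks @ [i0]" using ne by (metis append_butlast_last_id)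
    have "B (word_mat res ks) = res j ** word_mat res (butlast ks) ** (res i0 ** P i0)"
     by (subst e) (simp only: B_def word_mat_append matrix_mul_assoc)
    then show ?thesis by (simp add: res_P[OF im] mm.zero_right)
   qed
   then show ?thesis by (simp add: B_def ms.zero_right)
  qed
  have "B (\<Sum>ks\<in>words m n. a ks *\<^sub>m word_mat res ks) = (\<Sum>ks\<in>words m n. B (a ks *\<^sub>m word_mat res ks))"
   by (rule linear_sum[OF bounded_linear.linear[OF blB]])
  also have "\<dots> = (\<Sum>ks\<in>index_words m j i0 n. B (a ks *\<^sub>m word_mat res ks))"
   by (rule sum.mono_neutral_right[OF finite_words sub]) (use z in blast)
  also have "\<dots> = B (S a n)" using False by (simp add: S_def linear_sum[OF bounded_linear.linear[OF blB]])
  finally show ?thesis .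
 qed
 have conn: "(\<Sum>k=1..m. (1 / (v - z k)) *\<^sub>m res k) = (1 / d) *\<^sub>m A ((v - z i0) / d)" for v
 proof -
  have "1 / (v - z k) = (1 / d) * (1 / ((v - z i0) / d - x k))" for k
   using p.dnz x[of k] by (simp add: diff_divide_distrib[symmetric])
  then show ?thesis by (simp only: A_def ms.sum_right msmult_msmult)
 qed
 define G where "G s t = B (parallel_transport (fl_connection m z P F) Cp s t)" for s t
 have G: "(%n. B (S (%ks. itint p.letter ks s t) n)) sums G s t" if st: "0 < s" "s <= t" "t < 1" for s t
 proof -
  have "(%n. \<Sum>ks\<in>words m n. itint p.letter ks s t *\<^sub>m word_mat res ks) sums (Ps (-1) ((Cp t - z i0) / d) ** Th (-1) ((Cp s - z i0) / d))"
   by (rule p.dyson_transport[OF lw fund _ conn st]) (use dm in auto)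
  moreover have "parallel_transport (fl_connection m z P F) Cp s t = Ps (-1) ((Cp t - z i0) / d) ** Th (-1) ((Cp s - z i0) / d)"
   by (rule p.parallel_transport_fund[OF fund _ _ st]) (use dm conn in \<open>auto simp: fl_connection_def res_def\<close>)
  ultimately have "(%n. B (\<Sum>ks\<in>words m n. itint p.letter ks s t *\<^sub>m word_mat res ks)) sums G s t"
   unfolding G_def using bounded_linear.sums[OF blB] by simp
  then show ?thesis by (simp add: B_words)
 qed
 have limG: "((%(s, t). G s t) \<longlongrightarrow> res j ** C (-1) j ** D (-1) i0 ** P i0) at_ends"
  using regularised_transport(1)[OF pp d x dm] by (simp add: G_def B_def)
 have entry: "(\<Sum>n. B (S V n) $ a $ b) = (res j ** C (-1) j ** D (-1) i0 ** P i0) $ a $ b" for a b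
 proof -
  define Q' where "Q' = norm (res j) * Q * norm (P i0)"
  have Bn: "norm (B M $ a $ b) <= Q' * (1 / 2) ^ n" if "norm M <= Q * (1 / 2) ^ n" for M n
  proof -
   have "norm (B M $ a $ b) <= norm (res j ** M) * norm (P i0)"
    unfolding B_def by (rule order_trans[OF norm_entry_le norm_matrix_mult_le])
   also have "\<dots> <= (norm (res j) * (Q * (1 / 2) ^ n)) * norm (P i0)"
    using that by (intro mult_right_mono order_trans[OF norm_matrix_mult_le] mult_left_mono) auto
   finally show ?thesis by (simp add: Q'_def mult_ac)
  qed
  have "((%p. \<Sum>n. B (S (%ks. itint p.letter ks (fst p) (snd p)) n) $ a $ b) \<longlongrightarrow> (\<Sum>n. B (S V n) $ a $ b)) at_ends"
  proof (rule conjunct2[OF conjunct2[OF tannerys_theorem[where M = "%n. Q' * (1 / 2) ^ n", OF _ _ geo ends_nontrivial]]])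
   fix n
   have "((%p. S (%ks. itint p.letter ks (fst p) (snd p)) n) \<longlongrightarrow> S V n) at_ends"
   proof (cases "n = 0")
    case False
    have "((%p. itint p.letter ks (fst p) (snd p) *\<^sub>m word_mat res ks) \<longlongrightarrow> V ks *\<^sub>m word_mat res ks) at_ends"
     if ks: "ks \<in> index_words m j i0 n" for ks
     unfolding V_def using w.improper_limit[of ks] iw[OF ks] False
     by (intro ms.tendsto tendsto_const) (auto simp: case_prod_unfold)
    then show ?thesis unfolding S_def using False by (auto intro!: tendsto_sum)
   qed (simp add: S_def)
   from bounded_linear.tendsto[OF blB this]
   show "((%p. B (S (%ks. itint p.letter ks (fst p) (snd p)) n) $ a $ b) \<longlongrightarrow> B (S V n) $ a $ b) at_ends"
    by (intro tendsto_vec_nth)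
  next
   have "\<forall>\<^sub>F q in at_top \<times>\<^sub>F at_ends. (case snd q of (s, t) => 0 < s \<and> s < (1/2::real) \<and> (1/2::real) < t \<and> t < 1)"
    by (rule eventually_compose_filterlim[OF eventually_ends filterlim_snd])
   then show "\<forall>\<^sub>F (n, p) in at_top \<times>\<^sub>F at_ends.
     norm (B (S (%ks. itint p.letter ks (fst p) (snd p)) n) $ a $ b) <= Q' * (1 / 2) ^ n"
   proof eventually_elim
    case (elim q)
    obtain n s t where q: "q = (n, (s, t))" by (metis prod.collapse)
    have st: "0 < s" "s <= t" "t < 1" using elim by (auto simp: q)
    have "norm (S (%ks. itint p.letter ks s t) n) <= Q * (1 / 2) ^ n"
    proof (rule S_bound)
     fix ks assume ks: "ks \<in> index_words m j i0 n" "n \<ge> 1" "successively (~=) ks"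
     then have "length ks = n" by (simp add: index_words_def)
     then show "norm (itint p.letter ks s t) <= (c / K) ^ n * (K * exp (2 * K\<^sup>2))"
      using w.nonrepeating_word_bound[OF K(1) _ _ _ ks(3) _ st] iw[OF ks(1,2)] by simp
    qed
    then show ?case by (simp add: q Bn)
   qed
  qed
  moreover have "((%p. \<Sum>n. B (S (%ks. itint p.letter ks (fst p) (snd p)) n) $ a $ b) \<longlongrightarrow> (res j ** C (-1) j ** D (-1) i0 ** P i0) $ a $ b) at_ends"
  proof (rule Lim_transform_eventually)
   show "((%p. (case p of (s, t) => G s t) $ a $ b) \<longlongrightarrow> (res j ** C (-1) j ** D (-1) i0 ** P i0) $ a $ b) at_ends"
    by (intro tendsto_vec_nth limG)
   show "\<forall>\<^sub>F p in at_ends. (case p of (s, t) => G s t) $ a $ b = (\<Sum>n. B (S (%ks. itint p.letter ks (fst p) (snd p)) n) $ a $ b)"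
    using eventually_ends
   proof eventually_elim
    case (elim p)
    then have "(%n. B (S (%ks. itint p.letter ks (fst p) (snd p)) n)) sums G (fst p) (snd p)" by (intro G) (auto simp: case_prod_unfold)
    from bounded_linear.sums[OF bounded_linear_vec_nth bounded_linear.sums[OF bounded_linear_vec_nth this]]
    show ?case by (simp add: sums_iff case_prod_beta)
   qed
  qed
  ultimately show ?thesis by (rule tendsto_unique[OF ends_nontrivial])
 qed
 have "(%n. B (S V n)) sums B (\<Sum>n. S V n)" by (rule bounded_linear.sums[OF blB summable_sums[OF sumS]])
 then have "B (\<Sum>n. S V n) $ a $ b = (\<Sum>n. B (S V n) $ a $ b)" for a b
  using bounded_linear.sums[OF bounded_linear_vec_nth bounded_linear.sums[OF bounded_linear_vec_nth]] by (metis sums_unique)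
 then have "B (\<Sum>n. S V n) = res j ** C (-1) j ** D (-1) i0 ** P i0" by (simp add: mat_eq_iff entry)
 moreover have "(\<Sum>n. S V n) = mat 1 + (\<Sum>n. Tm n)" using suminf_split_head[OF sumS] by (simp add: Tm[abs_def] S_def[of V 0] algebra_simps)
 ultimately show "P j ** F ** (mat 1 + (\<Sum>n. Tm n)) ** P i0 = res j ** C (-1) j ** D (-1) i0 ** P i0"
  by (simp add: B_def res_def)
qed

section \<open>The three cases of the Stokes factor\<close>

text \<open>For z_j on z_i + l the block is 2 pi i P_j F times the connection matrix between the two
  poles, and both the regularised transport and the series evaluate that same sandwiched matrix. The
  other cases come from the conjugation limit alone.\<close>

theorem theorem9p2:
  fixes Z F S :: "complex^'n^'n"
    and m :: nat
    and z :: "nat \<Rightarrow> complex"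
    and P :: "nat \<Rightarrow> complex^'n^'n"
    and l :: "complex set"
    and i j :: nat
  assumes "diagonalisable Z"
    and "bij_betw z {1..m} (eigenvalues Z)"
    and "\<forall>k \<in> {1..m}. is_eigenprojection Z (z k) (P k)"
    and "\<forall>k \<in> {1..m}. P k ** F ** P k = 0"
    and "l \<in> stokes_rays Z"
    and "is_stokes_factor Z F l S"
    and "i \<in> {1..m}" and "j \<in> {1..m}"
  shows "(z j \<noteq> z i \<and> \<not> ray_less l (z i) (z j) \<longrightarrow> P j ** S ** P i = 0) \<and>
    (z j = z i \<longrightarrow> P j ** S ** P i = P i) \<and>
    (ray_less l (z i) (z j) \<longrightarrow>
      (\<forall>e. small_radius m z e \<longrightarrow>
        (let C = perturbed_segment m z e j i in
          (\<forall>Li Lj. log_along C (z i) Li \<and> log_along C (z j) Lj \<longrightarrow>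
            (\<exists>T. has_reg_transport (fl_connection m z P F) C (P i ** F) (P j ** F) Li Lj T \<and>
                 P j ** S ** P i = (2 * of_real pi * \<i>) *\<^sub>m (P j ** F ** T ** P i))) \<and>
          (\<forall>n \<ge> 1. \<forall>ks \<in> index_words m j i n.
            \<exists>v. has_improper_iterated_integral C (log_forms z ks) v) \<and>
          summable (\<lambda>n. \<Sum>ks \<in> index_words m j i (Suc n).
            improper_iterated_integral C (log_forms z ks) *\<^sub>m word_product P F ks) \<and>
          P j ** S ** P i = (2 * of_real pi * \<i>) *\<^sub>m (P j ** F **
            (mat 1 + (\<Sum>n. \<Sum>ks \<in> index_words m j i (Suc n).
              improper_iterated_integral C (log_forms z ks) *\<^sub>m word_product P F ks)) ** P i))))"
  proof -
  note dp = diagonalisable_projections[OF assms(1-3)]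
  interpret projections m P by unfold_locales (use dp(1,2) in auto)
  have Z: "Z = diag z" using dp(3) by (simp add: diag_def)
  have inj: "inj_on z {1..m}" and ev: "eigenvalues (diag z) = z ` {1..m}"
    using assms(2) unfolding Z by (auto simp: bij_betw_def)
  have PFP: "P k ** F ** P k = 0" if "k \<in> {1..m}" for k using assms(4) that by blast
  have sr: "l \<in> stokes_rays (diag z)" and sf: "is_stokes_factor (diag z) F l S"
    using assms(5,6) unfolding Z by blast+
  note entries = stokes_factor_entries[OF sf sr ev assms(7,8)]
  have diagonal: "P j ** S ** P i = P i" if eq: "z j = z i"
  proof -
    have "j = i" using inj eq assms(7,8) by (auto dest: inj_onD)
    then show ?thesis using entries(2) by simp
  qed
  have above: "let C = perturbed_segment m z e j i in
          (\<forall>Li Lj. log_along C (z i) Li \<and> log_along C (z j) Lj \<longrightarrow>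
            (\<exists>T. has_reg_transport (fl_connection m z P F) C (P i ** F) (P j ** F) Li Lj T \<and>
                 P j ** S ** P i = (2 * of_real pi * \<i>) *\<^sub>m (P j ** F ** T ** P i))) \<and>
          (\<forall>n \<ge> 1. \<forall>ks \<in> index_words m j i n.
            \<exists>v. has_improper_iterated_integral C (log_forms z ks) v) \<and>
          summable (\<lambda>n. \<Sum>ks \<in> index_words m j i (Suc n).
            improper_iterated_integral C (log_forms z ks) *\<^sub>m word_product P F ks) \<and>
          P j ** S ** P i = (2 * of_real pi * \<i>) *\<^sub>m (P j ** F **
            (mat 1 + (\<Sum>n. \<Sum>ks \<in> index_words m j i (Suc n).
              improper_iterated_integral C (log_forms z ks) *\<^sub>m word_product P F ks)) ** P i)"
    if less: "ray_less l (z i) (z j)" and small: "small_radius m z e" for e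
  proof -
    \<comment> \<open>The ray l is given through some difference of eigenvalues; since it also
      passes through z_j - z_i, the normalisation can be based on this difference.\<close>
    obtain p q where pq: "p \<noteq> q" "l = ray_through (p - q)" using sr by (auto simp: stokes_rays_def)
    obtain u where u: "u \<in> l" "z j = z i + u" using less by (auto simp: ray_less_def)
    then obtain y where y: "0 < y" "u = of_real y * (p - q)" using pq by (auto simp: ray_through_def)
    have zij: "z j \<noteq> z i" using u y pq by simp
    have l: "l = ray_through (z j - z i)" using u y pq ray_through_mult[OF y(1), of "p - q"] by simp
    obtain \<mu> \<Psi> \<Theta> H \<rho> C D where fs: "fuchs_solutions m P F (\<lambda>k. (z k - z i) / (z j - z i)) \<mu> i \<Psi> \<Theta> H \<rho> C D"
      and S: "P j ** S ** P i = (2 * of_real pi * \<i>) *\<^sub>m (P j ** F ** C (-1) j ** D (-1) i ** P i)"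
      using stokes_normalised[OF PFP inj ev sf assms(7,8) zij l] by blast
    interpret fs: fuchs_solutions m P F "\<lambda>k. (z k - z i) / (z j - z i)" \<mu> i \<Psi> \<Theta> H \<rho> C D by (rule fs)
    note path = fs.perturbed_segment_path[OF small assms(8) zij inj refl refl]
    note series = fs.transport_series[OF path(1) refl refl path(2)]
    note transport = fs.regularised_transport(2)[OF path(1) refl refl path(2)]
    show ?thesis
      unfolding Let_def
    proof (intro conjI allI impI ballI)
      fix Li Lj assume "log_along (perturbed_segment m z e j i) (z i) Li \<and> log_along (perturbed_segment m z e j i) (z j) Lj"
      then show "\<exists>T. has_reg_transport (fl_connection m z P F) (perturbed_segment m z e j i) (P i ** F) (P j ** F) Li Lj T \<and>
          P j ** S ** P i = (2 * of_real pi * \<i>) *\<^sub>m (P j ** F ** T ** P i)"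
        using transport[of Li Lj] S by (auto simp: fs.res_def)
    next
      fix n :: nat and ks assume "1 \<le> n" "ks \<in> index_words m j i n"
      then show "\<exists>v. has_improper_iterated_integral (perturbed_segment m z e j i) (log_forms z ks) v"
        using series(1)[of n ks] by simp
    qed (use series(2,3) S in \<open>simp_all add: fs.res_def\<close>)
  qed
  show ?thesis using entries(1) diagonal above by blast
qed


end
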